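(* Let $u$ be a subsonic variational solution (as defined in the context) in $\Omega$, let $x^\circ=(0,x_2^\circ)\in\Omega$ with $x_2^\circ\ne0$, and let $\delta=\frac12\operatorname{dist}(x^\circ,\partial\Omega)$. Write $t(x)=\frac{|\nabla u(x)|^2}{x_1^2}$ and $H=H(t(x);x_2)$. For $r\in(0,\delta)$ define $$I(r)=\int_{B_r^+(x^\circ)}x_1\big[F(t;x_2)+\lambda(x_2)\chi_{\{u>0\}}\big]dx,\qquad J(r)=\int_{\partial B_r^+(x^\circ)}\frac{u^2}{x_1\bar\rho_0}\,d\mathcal{H}^1,$$ $$M^{x_1}(r)=r^{-3}I(r)-2r^{-4}J(r).$$ Then for a.e. $r\in(0,\delta)$, $$(M^{x_1})'(r)=2r^{-3}\int_{\partial B_r^+(x^\circ)}\frac1{x_1H}\Big(\nabla u\cdot\nu-2\frac ur\Big)^2d\mathcal{H}^1+\sum_{i=1}^3r^{-4}K_i^{x_1}(r),$$ where $$K_1^{x_1}(r)=\int_{B_r^+(x^\circ)}x_1(x_2-x_2^\circ)\big[\partial_2F(t;x_2)+\lambda'(x_2)\chi_{\{u>0\}}\big]dx,$$ $$K_2^{x_1}(r)=4\int_{\partial B_r^+(x^\circ)}\Big(\frac1{x_1H}-\frac1{x_1\bar\rho_0}\Big)u\nabla u\cdot\nu\,d\mathcal{H}^1,\qquad K_3^{x_1}(r)=\frac8r\int_{\partial B_r^+(x^\circ)}\Big(\frac1{x_1\bar\rho_0}-\frac1{x_1H}\Big)u^2\,d\mathcal{H}^1.$$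
   Context: Notation. $x=(x_1,x_2)$; $B_r(x^\circ)$ is the open disc in $\mathbb{R}^2$; $B_r^+(x^\circ)=B_r(x^\circ)\cap\{x_1>0\}$; $\partial B_r^+(x^\circ)=\{x_1>0,|x-x^\circ|=r\}$; $\nu=(x-x^\circ)/r$ on it; $\chi_A$ is the characteristic function of $A$; $\mathcal{H}^1$ is one-dimensional Hausdorff measure; $\partial\Omega$ is the boundary of $\Omega$ relative to $\{x_1\ge0\}$. $W^{1,2}_{w,loc}(\Omega)$ is the space of $v$ with $\int_K\frac1{x_1}(|v|^2+|\nabla v|^2)dx<\infty$ for all compact $K\subset\Omega$. "Locally" means on each compact subset. Equation of state. $g>0$ and $\bar\rho_0>0$ are constants; $p\in C^{1,\alpha}([0,\infty))$, twice differentiable on $(0,\infty)$, with $p'(\rho)>0$ and $2p'(\rho)+\rho p''(\rho)>0$ for $\rho>0$; $h(\rho)=\int_{\bar\rho_0}^{\rho}\frac{p'(s)}{s}ds$; $s_*:=\frac{p'(\bar\rho_0)}{2g}$. For $0\le s<s_*$ let $\rho_{cr}(s)$ be the unique number with $\frac{p'(\rho_{cr}(s))}{2}+h(\rho_{cr}(s))=gs$. For $t\ge0$ let $H(t;s)$ be the unique solution $H>\rho_{cr}(s)$ of $\frac{g\bar\rho_0^2t}{H^2}+h(H)=gs$, whenever it exists; in particular $H(s;s)=\bar\rho_0$. Set $F(t;s)=\int_0^t\frac{d\tau}{H(\tau;s)}$, $\partial_1F=\partial F/\partial t=1/H$, $\partial_2F=\partial F/\partial s$, and $\lambda(s)=\frac{2s}{\bar\rho_0}-F(s;s)$.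 Free boundary problem: $\operatorname{div}\Big(\frac{\nabla u}{x_1H(|\nabla u|^2/x_1^2;x_2)}\Big)=0$ in $\Omega\cap\{u>0\}$, $\frac{|\nabla u|^2}{x_1^2}=x_2$ on $\Omega\cap\partial\{u>0\}$, where $\Omega$ is connected and relatively open in $\{x_1\ge0\}$, contained in $\{x_2<s_*\}$. Subsonic variational solution: $u\in W^{1,2}_{w,loc}(\Omega)$ such that (1) $u\ge0$ in $\Omega$, $u=0$ on $\{x_1=0\}$; (2) $u\in C^0(\Omega)\cap C^2(\Omega\cap\{u>0\})$; (3) for every $x^\circ\in\Omega\cap\{x_1=0\}$, as $x\to x^\circ$ with $x\in\Omega\cap\{u>0\}$, $\frac1{x_1}\partial_{x_2}u\to0$ and $\frac1{x_1}\partial_{x_1}u$ has a limit; (4) there is $\varepsilon_0>0$ such that $H(\frac{|\nabla u|^2}{x_1^2};x_2)-\rho_{cr}(x_2)\ge\varepsilon_0$ locally in $\Omega\cap\{x_2\ge0\}$; (5) $\{u>0\}$, hence the free surface $\partial\{u>0\}$, is contained in $\{x_1\ge0,x_2\ge0\}$ (all integrands involving $H,F,\lambda$ are read as $0$ where $x_2<0$); (6) for every $\phi=(\phi_1,\phi_2)\in C^1_0(\Omega;\mathbb{R}^2)$ with $\phi_1=0$ on $\{x_1=0\}$, writing $t=|\nabla u|^2/x_1^2$, $$0=\int_\Omega x_1[F(t;x_2)+\lambda(x_2)\chi_{\{u>0\}}]\operatorname{div}\phi-2\int_\Omega\partial_1F(t;x_2)\tfrac1{x_1}\nabla u\,D\phi\,\nabla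 u+\int_\Omega\big(F(t;x_2)-2\partial_1F(t;x_2)t+\lambda(x_2)\chi_{\{u>0\}}\big)\phi_1+\int_\Omega x_1\big(\partial_2F(t;x_2)+\lambda'(x_2)\chi_{\{u>0\}}\big)\phi_2 .$$ *)

theory Defs
  imports "HOL-Analysis.Analysis"
begin

section \<open>One-dimensional Hausdorff measure\<close>

text \<open>Boundedness of the covering sets is required because \<^const>\<open>diameter\<close> is a junk value on
  unbounded sets.  In dimension one the usual normalising constant is 1.\<close>

definition hausdorff1_pre :: "real \<Rightarrow> 'a::metric_space set \<Rightarrow> ennreal" where
  "hausdorff1_pre \<delta> A =
     (INF C \<in> {C :: nat \<Rightarrow> 'a set. A \<subseteq> (\<Union>i. C i) \<and> (\<forall>i. bounded (C i) \<and> diameter (C i) \<le> \<delta>)}.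
        \<Sum>i. ennreal (diameter (C i)))"

definition hausdorff1_outer :: "'a::metric_space set \<Rightarrow> ennreal" where
  "hausdorff1_outer A = (SUP \<delta>\<in>{0<..}. hausdorff1_pre \<delta> A)"

text \<open>The measure lives on the Caratheodory-measurable sets, so that it is complete.\<close>

definition hausdorff1 :: "'a::metric_space measure" where
  "hausdorff1 = measure_of UNIV (lambda_system UNIV (Pow UNIV) hausdorff1_outer) hausdorff1_outer"

lemma hausdorff1_pre_le:
  assumes "A \<subseteq> (\<Union>i. C i)" "\<And>i::nat. bounded (C i)" "\<And>i. diameter (C i) \<le> \<delta>"
  shows "hausdorff1_pre \<delta> A \<le> (\<Sum>i. ennreal (diameter (C i)))"
  unfolding hausdorff1_pre_def using assms by (intro INF_lower) auto

lemma hausdorff1_pre_mono: "A \<subseteq> B \<Longrightarrow> hausdorff1_pre \<delta> A \<le> hausdorff1_pre \<delta> B"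
  unfolding hausdorff1_pre_def by (intro INF_superset_mono) auto

lemma hausdorff1_pre_empty: "0 \<le> \<delta> \<Longrightarrow> hausdorff1_pre \<delta> {} = 0"
  using hausdorff1_pre_le[of "{}" "\<lambda>_. {}" \<delta>] by simp

lemma hausdorff1_pre_subadditive:
  "hausdorff1_pre \<delta> (\<Union>i. A i) \<le> (\<Sum>i::nat. hausdorff1_pre \<delta> (A i))"
proof (rule ennreal_le_epsilon)
  fix e :: real
  assume "0 < e" and fin: "(\<Sum>n. hausdorff1_pre \<delta> (A n)) < top"
  then have *: "hausdorff1_pre \<delta> (A n) < hausdorff1_pre \<delta> (A n) + e * (1/2)^Suc n" for n
    by (auto simp add: less_top dest!: ennreal_suminf_lessD)
  have "\<exists>C. A n \<subseteq> (\<Union>i::nat. C i) \<and> (\<forall>i. bounded (C i) \<and> diameter (C i) \<le> \<delta>) \<and>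
      (\<Sum>i. ennreal (diameter (C i))) \<le> hausdorff1_pre \<delta> (A n) + e * (1/2)^Suc n" for n
    using *[of n] unfolding hausdorff1_pre_def[of \<delta> "A n"] INF_less_iff
    by (auto intro: less_imp_le)
  then obtain B where sub: "\<And>n. A n \<subseteq> (\<Union>i::nat. B n i)"
    and bd: "\<And>n i. bounded (B n i)" "\<And>n i. diameter (B n i) \<le> \<delta>"
    and le: "\<And>n. (\<Sum>i. ennreal (diameter (B n i))) \<le> hausdorff1_pre \<delta> (A n) + e * (1/2)^Suc n"
    by metis
  define C where "C = case_prod B \<circ> prod_decode"
  have "hausdorff1_pre \<delta> (\<Union>i. A i) \<le> (\<Sum>i. ennreal (diameter (C i)))"
  proof (rule hausdorff1_pre_le)
    show "(\<Union>i. A i) \<subseteq> (\<Union>i. C i)"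
      using sub by (auto simp add: C_def subset_eq) (metis prod.case prod_encode_inverse)
  qed (auto simp: C_def bd split: prod.splits)
  also have "\<dots> = (\<Sum>n. \<Sum>i. ennreal (diameter (B n i)))"
    unfolding C_def comp_def
    by (subst suminf_ennreal_2dimen[where f = "\<lambda>(n,i). ennreal (diameter (B n i))", symmetric])
       (auto simp: split_def comp_def)
  also have "\<dots> \<le> (\<Sum>n. hausdorff1_pre \<delta> (A n) + e * (1/2)^Suc n)"
    using le by (intro suminf_le) auto
  also have "\<dots> = (\<Sum>n. hausdorff1_pre \<delta> (A n)) + (\<Sum>n. ennreal e * ennreal ((1/2)^Suc n))"
    using \<open>0 < e\<close> by (subst suminf_add[symmetric]) (auto simp flip: ennreal_mult')
  also have "(\<Sum>n. ennreal e * ennreal ((1/2)^Suc n)) = e"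
    unfolding ennreal_suminf_cmult
    by (subst suminf_ennreal_eq[OF zero_le_power power_half_series]) auto
  finally show "hausdorff1_pre \<delta> (\<Union>i. A i) \<le> (\<Sum>n. hausdorff1_pre \<delta> (A n)) + e" .
qed

lemma hausdorff1_outer_measure_space: "outer_measure_space (Pow UNIV) hausdorff1_outer"
  unfolding outer_measure_space_def positive_def increasing_def countably_subadditive_def
proof (intro conjI allI impI ballI)
  show "hausdorff1_outer {} = 0"
    by (auto simp: hausdorff1_outer_def hausdorff1_pre_empty intro!: antisym SUP_least)
next
  fix A B :: "'a set" assume "A \<subseteq> B"
  then show "hausdorff1_outer A \<le> hausdorff1_outer B"
    unfolding hausdorff1_outer_def by (intro SUP_mono) (auto intro: hausdorff1_pre_mono)
next
  fix A :: "nat \<Rightarrow> 'a set"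
  show "hausdorff1_outer (\<Union>i. A i) \<le> (\<Sum>i. hausdorff1_outer (A i))"
    unfolding hausdorff1_outer_def[of "\<Union>i. A i"]
  proof (rule SUP_least)
    fix \<delta> :: real assume "\<delta> \<in> {0<..}"
    then have "(\<Sum>i. hausdorff1_pre \<delta> (A i)) \<le> (\<Sum>i. hausdorff1_outer (A i))"
      unfolding hausdorff1_outer_def by (intro suminf_le SUP_upper) auto
    then show "hausdorff1_pre \<delta> (\<Union>i. A i) \<le> (\<Sum>i. hausdorff1_outer (A i))"
      using hausdorff1_pre_subadditive order_trans by blast
  qed
qed

lemma space_hausdorff1 [simp]: "space hausdorff1 = UNIV"
  by (simp add: hausdorff1_def space_measure_of_conv)

lemma
  fixes A :: "'a::metric_space set"
  shows sets_hausdorff1: "sets (hausdorff1 :: 'a measure) = lambda_system UNIV (Pow UNIV) hausdorff1_outer"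
    and emeasure_hausdorff1: "A \<in> sets hausdorff1 \<Longrightarrow> emeasure hausdorff1 A = hausdorff1_outer A"
proof -
  have ms: "measure_space UNIV (lambda_system UNIV (Pow UNIV) hausdorff1_outer)
              (hausdorff1_outer :: 'a set \<Rightarrow> ennreal)"
    by (rule sigma_algebra.caratheodory_lemma[OF sigma_algebra_Pow hausdorff1_outer_measure_space])
  then show sets: "sets (hausdorff1 :: 'a measure) = lambda_system UNIV (Pow UNIV) hausdorff1_outer"
    unfolding hausdorff1_def by (intro sigma_algebra.sets_measure_of_eq) (simp add: measure_space_def)
  show "A \<in> sets hausdorff1 \<Longrightarrow> emeasure hausdorff1 A = hausdorff1_outer A"
    using ms unfolding sets unfolding hausdorff1_def
    by (intro emeasure_measure_of_sigma) (auto simp: measure_space_def)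
qed

section \<open>Function spaces\<close>

text \<open>\<open>D\<phi>\<close> is the derivative of \<open>\<phi>\<close>.  Derivatives are taken within \<open>S\<close>: for \<open>S\<close> relatively open
  in a closed half-plane, \<open>\<phi>\<close> is \<open>C\<^sup>1\<close> up to the part of the boundary line contained in \<open>S\<close>
  and its support may meet that part.\<close>

definition C1_0 :: "'a::real_normed_vector set \<Rightarrow> ('a \<Rightarrow> 'b::real_normed_vector) \<Rightarrow>
    ('a \<Rightarrow> 'a \<Rightarrow>\<^sub>L 'b) \<Rightarrow> bool" where
  "C1_0 S \<phi> D\<phi> \<longleftrightarrow>
     (\<forall>x\<in>S. (\<phi> has_derivative blinfun_apply (D\<phi> x)) (at x within S)) \<and>
     continuous_on S D\<phi> \<and>
     (\<exists>K. compact K \<and> K \<subseteq> S \<and> (\<forall>x\<in>S - K. \<phi> x = 0))"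

text \<open>Only used for open \<open>S\<close>.\<close>

definition C2_on :: "'a::real_normed_vector set \<Rightarrow> ('a \<Rightarrow> 'b::real_normed_vector) \<Rightarrow> bool" where
  "C2_on S f \<longleftrightarrow> (\<exists>(Df :: 'a \<Rightarrow> 'a \<Rightarrow>\<^sub>L 'b) (D2f :: 'a \<Rightarrow> 'a \<Rightarrow>\<^sub>L ('a \<Rightarrow>\<^sub>L 'b)).
     (\<forall>x\<in>S. (f has_derivative blinfun_apply (Df x)) (at x)) \<and>
     (\<forall>x\<in>S. (Df has_derivative blinfun_apply (D2f x)) (at x)) \<and>
     continuous_on S D2f)"

definition has_weak_gradient ::
  "('a::euclidean_space \<Rightarrow> real) \<Rightarrow> ('a \<Rightarrow> 'a) \<Rightarrow> 'a set \<Rightarrow> bool" where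
  "has_weak_gradient v Dv U \<longleftrightarrow>
     (\<forall>K. compact K \<and> K \<subseteq> U \<longrightarrow> set_integrable lebesgue K v \<and> set_integrable lebesgue K Dv) \<and>
     (\<forall>\<phi> D\<phi>. C1_0 U \<phi> D\<phi> \<longrightarrow> (\<forall>b\<in>Basis.
        (LINT x:U|lebesgue. v x * D\<phi> x b) = - (LINT x:U|lebesgue. (Dv x \<bullet> b) * \<phi> x)))"

text \<open>Membership in the weighted space, with \<open>Dv\<close> a representative of the weak gradient.  The
  compact sets may touch the axis \<open>x\<^sub>1 = 0\<close>, which is a null set.\<close>

definition W12_w_loc ::
  "(real \<times> real) set \<Rightarrow> (real \<times> real \<Rightarrow> real) \<Rightarrow> (real \<times> real \<Rightarrow> real \<times> real) \<Rightarrow> bool" where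
  "W12_w_loc \<Omega> v Dv \<longleftrightarrow>
     has_weak_gradient v Dv (\<Omega> \<inter> {x. fst x > 0}) \<and>
     (\<forall>K. compact K \<and> K \<subseteq> \<Omega> \<longrightarrow>
        set_integrable lebesgue K (\<lambda>x. 1 / fst x * (\<bar>v x\<bar>\<^sup>2 + (norm (Dv x))\<^sup>2)))"

section \<open>Equation of state\<close>

text \<open>Throughout, \<open>g\<close> is the gravity constant, \<open>\<rho>0\<close> the constant density \<open>\<rho>\<close>-bar-zero and \<open>p\<close> the
  pressure law.  The Hoelder condition on \<open>p'\<close> is local in \<open>[0,\<infinity>)\<close>, which includes
  the polytropic laws.\<close>

definition equation_of_state :: "real \<Rightarrow> real \<Rightarrow> (real \<Rightarrow> real) \<Rightarrow> real \<Rightarrow> bool" where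
  "equation_of_state g \<rho>0 p \<alpha> \<longleftrightarrow>
     g > 0 \<and> \<rho>0 > 0 \<and> 0 < \<alpha> \<and> \<alpha> < 1 \<and>
     (\<exists>p'. (\<forall>\<rho>\<ge>0. (p has_real_derivative p' \<rho>) (at \<rho> within {0..})) \<and>
        (\<forall>R. \<exists>C. \<forall>a\<in>{0..R}. \<forall>b\<in>{0..R}. \<bar>p' a - p' b\<bar> \<le> C * \<bar>a - b\<bar> powr \<alpha>)) \<and>
     (\<forall>\<rho>>0. deriv p differentiable at \<rho>) \<and>
     (\<forall>\<rho>>0. deriv p \<rho> > 0 \<and> 2 * deriv p \<rho> + \<rho> * deriv (deriv p) \<rho> > 0)"

definition enthalpy :: "real \<Rightarrow> (real \<Rightarrow> real) \<Rightarrow> real \<Rightarrow> real" where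
  "enthalpy \<rho>0 p \<rho> = (LBINT s=\<rho>0..\<rho>. deriv p s / s)"

definition s_star :: "real \<Rightarrow> real \<Rightarrow> (real \<Rightarrow> real) \<Rightarrow> real" where
  "s_star g \<rho>0 p = deriv p \<rho>0 / (2 * g)"

definition rho_cr :: "real \<Rightarrow> real \<Rightarrow> (real \<Rightarrow> real) \<Rightarrow> real \<Rightarrow> real" where
  "rho_cr g \<rho>0 p s = (THE \<rho>. \<rho> > 0 \<and> deriv p \<rho> / 2 + enthalpy \<rho>0 p \<rho> = g * s)"

definition is_H :: "real \<Rightarrow> real \<Rightarrow> (real \<Rightarrow> real) \<Rightarrow> real \<Rightarrow> real \<Rightarrow> real \<Rightarrow> bool" where
  "is_H g \<rho>0 p t s h \<longleftrightarrow>
     h > rho_cr g \<rho>0 p s \<and> g * \<rho>0\<^sup>2 * t / h\<^sup>2 + enthalpy \<rho>0 p h = g * s"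

definition H_eos :: "real \<Rightarrow> real \<Rightarrow> (real \<Rightarrow> real) \<Rightarrow> real \<Rightarrow> real \<Rightarrow> real" where
  "H_eos g \<rho>0 p t s = (THE h. is_H g \<rho>0 p t s h)"

definition F_eos :: "real \<Rightarrow> real \<Rightarrow> (real \<Rightarrow> real) \<Rightarrow> real \<Rightarrow> real \<Rightarrow> real" where
  "F_eos g \<rho>0 p t s = (LBINT \<tau>=0..t. 1 / H_eos g \<rho>0 p \<tau> s)"

text \<open>\<open>1/H\<close> is the \<open>t\<close>-derivative of \<open>F\<close>, one-sided at \<open>t = 0\<close>.\<close>

definition d1F_eos :: "real \<Rightarrow> real \<Rightarrow> (real \<Rightarrow> real) \<Rightarrow> real \<Rightarrow> real \<Rightarrow> real" where
  "d1F_eos g \<rho>0 p t s = 1 / H_eos g \<rho>0 p t s"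

definition d2F_eos :: "real \<Rightarrow> real \<Rightarrow> (real \<Rightarrow> real) \<Rightarrow> real \<Rightarrow> real \<Rightarrow> real" where
  "d2F_eos g \<rho>0 p t s = deriv (\<lambda>\<sigma>. F_eos g \<rho>0 p t \<sigma>) s"

definition lambda_eos :: "real \<Rightarrow> real \<Rightarrow> (real \<Rightarrow> real) \<Rightarrow> real \<Rightarrow> real" where
  "lambda_eos g \<rho>0 p s = 2 * s / \<rho>0 - F_eos g \<rho>0 p s s"

section \<open>Subsonic variational solutions\<close>

definition half_plane :: "(real \<times> real) set" where
  "half_plane = {x. 0 \<le> fst x}"

text \<open>The part of the plane over which integrands involving \<open>H\<close>, \<open>F\<close> or \<open>\<lambda>\<close> are integrated; they
  are read as 0 where \<open>x\<^sub>2 < 0\<close>.\<close>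

definition fluid_side :: "(real \<times> real) set" where
  "fluid_side = {x. 0 \<le> snd x}"

definition flow_domain :: "real \<Rightarrow> real \<Rightarrow> (real \<Rightarrow> real) \<Rightarrow> (real \<times> real) set \<Rightarrow> bool" where
  "flow_domain g \<rho>0 p \<Omega> \<longleftrightarrow>
     openin (top_of_set half_plane) \<Omega> \<and> connected \<Omega> \<and> \<Omega> \<subseteq> {x. snd x < s_star g \<rho>0 p}"

definition tq :: "(real \<times> real \<Rightarrow> real \<times> real) \<Rightarrow> real \<times> real \<Rightarrow> real" where
  "tq Du x = (norm (Du x))\<^sup>2 / (fst x)\<^sup>2"

text \<open>The domain variation identity, tested with \<open>\<phi>\<close>; the sum over \<^const>\<open>Basis\<close> is the divergence.\<close>

definition variation_identity ::
  "real \<Rightarrow> real \<Rightarrow> (real \<Rightarrow> real) \<Rightarrow> (real \<times> real) set \<Rightarrow> (real \<times> real \<Rightarrow> real) \<Rightarrow>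
   (real \<times> real \<Rightarrow> real \<times> real) \<Rightarrow> (real \<times> real \<Rightarrow> real \<times> real) \<Rightarrow>
   (real \<times> real \<Rightarrow> (real \<times> real) \<Rightarrow>\<^sub>L (real \<times> real)) \<Rightarrow> bool" where
  "variation_identity g \<rho>0 p \<Omega> u Du \<phi> D\<phi> \<longleftrightarrow>
     0 = (LINT x:(\<Omega> \<inter> fluid_side)|lebesgue.
            fst x * (F_eos g \<rho>0 p (tq Du x) (snd x) + lambda_eos g \<rho>0 p (snd x) * indicator {y. u y > 0} x)
              * (\<Sum>b\<in>Basis. D\<phi> x b \<bullet> b))
       - 2 * (LINT x:(\<Omega> \<inter> fluid_side)|lebesgue.
            d1F_eos g \<rho>0 p (tq Du x) (snd x) * (1 / fst x) * (Du x \<bullet> D\<phi> x (Du x)))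
       + (LINT x:(\<Omega> \<inter> fluid_side)|lebesgue.
            (F_eos g \<rho>0 p (tq Du x) (snd x) - 2 * d1F_eos g \<rho>0 p (tq Du x) (snd x) * tq Du x
               + lambda_eos g \<rho>0 p (snd x) * indicator {y. u y > 0} x) * fst (\<phi> x))
       + (LINT x:(\<Omega> \<inter> fluid_side)|lebesgue.
            fst x * (d2F_eos g \<rho>0 p (tq Du x) (snd x)
               + deriv (lambda_eos g \<rho>0 p) (snd x) * indicator {y. u y > 0} x) * snd (\<phi> x))"

text \<open>\<open>Du\<close> is an arbitrary representative of the weak gradient of \<open>u\<close>; classical derivatives
  (\<^const>\<open>frechet_derivative\<close>) are used where \<open>u\<close> is \<open>C\<^sup>2\<close>.  In the subsonicity condition,
  existence of \<open>H\<close> at the given argument is part of the requirement, and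
  ``locally'' means on each compact subset, with \<open>\<epsilon>0\<close> allowed to depend on it.\<close>

definition subsonic_variational_solution ::
  "real \<Rightarrow> real \<Rightarrow> (real \<Rightarrow> real) \<Rightarrow> (real \<times> real) set \<Rightarrow> (real \<times> real \<Rightarrow> real) \<Rightarrow>
   (real \<times> real \<Rightarrow> real \<times> real) \<Rightarrow> bool" where
  "subsonic_variational_solution g \<rho>0 p \<Omega> u Du \<longleftrightarrow>
     W12_w_loc \<Omega> u Du \<and>
     (\<forall>x\<in>\<Omega>. u x \<ge> 0) \<and> (\<forall>x\<in>\<Omega>. fst x = 0 \<longrightarrow> u x = 0) \<and>
     continuous_on \<Omega> u \<and> C2_on (\<Omega> \<inter> {x. u x > 0}) u \<and>
     (\<forall>x0\<in>\<Omega>. fst x0 = 0 \<longrightarrow>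
        ((\<lambda>x. 1 / fst x * frechet_derivative u (at x) (0, 1)) \<longlongrightarrow> 0)
          (at x0 within \<Omega> \<inter> {x. u x > 0}) \<and>
        (\<exists>l. ((\<lambda>x. 1 / fst x * frechet_derivative u (at x) (1, 0)) \<longlongrightarrow> l)
          (at x0 within \<Omega> \<inter> {x. u x > 0}))) \<and>
     (\<forall>K. compact K \<and> K \<subseteq> \<Omega> \<inter> {x. snd x \<ge> 0} \<longrightarrow>
        (\<exists>\<epsilon>0>0. AE x in lebesgue. x \<in> K \<longrightarrow>
           (\<exists>h. is_H g \<rho>0 p (tq Du x) (snd x) h) \<and>
           H_eos g \<rho>0 p (tq Du x) (snd x) - rho_cr g \<rho>0 p (snd x) \<ge> \<epsilon>0)) \<and>
     \<Omega> \<inter> {x. u x > 0} \<subseteq> {x. fst x \<ge> 0 \<and> snd x \<ge> 0} \<and>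
     (\<forall>\<phi> D\<phi>. C1_0 \<Omega> \<phi> D\<phi> \<and> (\<forall>x\<in>\<Omega>. fst x = 0 \<longrightarrow> fst (\<phi> x) = 0) \<longrightarrow>
        variation_identity g \<rho>0 p \<Omega> u Du \<phi> D\<phi>)"

section \<open>Half discs\<close>

definition half_disc :: "real \<times> real \<Rightarrow> real \<Rightarrow> (real \<times> real) set" where
  "half_disc x0 r = ball x0 r \<inter> {x. fst x > 0}"

definition half_circle :: "real \<times> real \<Rightarrow> real \<Rightarrow> (real \<times> real) set" where
  "half_circle x0 r = {x. fst x > 0 \<and> norm (x - x0) = r}"

end

theory Submission
  imports Defs
begin

text \<open>Subsonicity keeps \<open>t\<close> locally bounded, so \<open>\<bar>\<nabla>u\<bar>\<close> is of order \<open>x\<^sub>1\<close> and \<open>u\<close> of order \<open>x\<^sub>1\<^sup>2\<close>, and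
  \<open>u\<^sup>2\<close> is \<open>C\<^sup>1\<close> near the centre \<open>c\<close>; hence the weak gradient is the classical one on \<open>W = {u > 0}\<close> and
  vanishes almost everywhere else.  On \<open>W\<close> the variational identity for inner variations supported
  there implies \<open>div (\<nabla>u / (x\<^sub>1 H)) = 0\<close>.

  Testing this equation with \<open>u \<eta>\<close> and the variational identity with \<open>\<eta> (x - c)\<close>, for a radial cutoff
  \<open>\<eta>\<close> of the disc of radius \<open>r\<close>, and letting \<open>\<eta>\<close> tend to the characteristic function gives, at the
  Lebesgue points \<open>r\<close> of the circle integrals, an energy identity and a Pohozaev identity
  \<open>3 I - 4 T + K\<^sub>1 = r (I' - 2 N)\<close>, where \<open>T\<close> is the integral of \<open>x\<^sub>1 t / H\<close> over the half disc, equal to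
  that of \<open>u \<nabla>u \<cdot> \<nu> / (x\<^sub>1 H)\<close> over the half circle, and \<open>N\<close> is the circle integral of
  \<open>(\<nabla>u \<cdot> \<nu>)\<^sup>2 / (x\<^sub>1 H)\<close>.  In polar coordinates \<open>J\<close> is an integral over a fixed interval of angles, which is
  differentiated under the integral sign.  The formula for \<open>M'\<close> follows by algebra.\<close>

section \<open>Lebesgue points\<close>

text \<open>Nothing is known about the regularity of the free boundary, so the divergence theorem
  cannot be applied to {u > 0} inside a disc. Boundary terms on the circle arise only from the
  gradient of the radial cutoff, whose kernel concentrates at the radius r. This is why Lebesgue
  points enter: I is only the primitive of an integrable function of the radius, whereas J is
  differentiable at every r.

  The powers in M match the growth u = O(x_1^2), under which I is of order r^3 and J of order r^4.
  The square in M' is completed with the weight 1/(x_1 H), but J carries 1/(x_1 \<rho>0); K_2 and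
  K_3 record this mismatch.

  The equation of state enters through an explicit primitive \<Phi> of 1/H in t: F + \<lambda> is
  \<Phi> up to a constant, and its derivative in s is H/\<rho>0^2, so derivatives of H drop out of
  the energy density. Since \<open>Du\<close> is an arbitrary representative, every integrand is
  replaced by a Borel function vanishing off {u > 0}; polar coordinates carry the almost everywhere
  equality to almost every circle.\<close>

lemma emeasure_UN_countable_le:
  assumes X: "\<And>i. i \<in> I \<Longrightarrow> X i \<in> sets M" and I: "countable I"
  shows "emeasure M (\<Union>i\<in>I. X i) \<le> (\<integral>\<^sup>+i. emeasure M (X i) \<partial>count_space I)"
proof -
  let ?n = "to_nat_on I"
  \<comment> \<open>Each point is given to the member of smallest number in the enumeration of
    \<open>I\<close>, which reduces the claim to disjoint families.\<close>
  define D where "D i = X i - (\<Union>j\<in>{j\<in>I. ?n j < ?n i}. X j)" for i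
  have D: "D i \<in> sets M" if "i \<in> I" for i
    unfolding D_def using X I that by (intro sets.Diff sets.countable_UN') auto
  have "disjoint_family_on D I"
    unfolding disjoint_family_on_def
  proof (intro ballI impI)
    fix i j assume ij: "i \<in> I" "j \<in> I" "i \<noteq> j"
    then have "?n i \<noteq> ?n j" using inj_on_to_nat_on[OF I] by (auto dest: inj_onD)
    then show "D i \<inter> D j = {}" using ij unfolding D_def by (cases "?n i" "?n j" rule: linorder_cases) auto
  qed
  moreover have "(\<Union>i\<in>I. X i) \<subseteq> (\<Union>i\<in>I. D i)"
  proof
    fix x assume "x \<in> (\<Union>i\<in>I. X i)"
    then obtain k where "k \<in> I \<and> x \<in> X k" by blast
    from ex_has_least_nat[of "\<lambda>i. i \<in> I \<and> x \<in> X i", OF this, of ?n]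
    obtain i where "i \<in> I" "x \<in> X i" "\<forall>j. j \<in> I \<and> x \<in> X j \<longrightarrow> ?n i \<le> ?n j" by blast
    then show "x \<in> (\<Union>i\<in>I. D i)" unfolding D_def by (force simp: not_le[symmetric])
  qed
  ultimately have "emeasure M (\<Union>i\<in>I. X i) \<le> (\<integral>\<^sup>+i. emeasure M (D i) \<partial>count_space I)"
    using D I by (subst emeasure_UN_countable[symmetric]) (auto intro!: emeasure_mono sets.countable_UN')
  also have "\<dots> \<le> (\<integral>\<^sup>+i. emeasure M (X i) \<partial>count_space I)"
    using X by (intro nn_integral_mono emeasure_mono) (auto simp: D_def)
  finally show ?thesis .
qed

text \<open>The Hardy-Littlewood weak type estimate. The 5 comes from Vitali's covering lemma, which
  asks for bounded radii, hence \<open>r\<close> at most 1. A Borel superset \<open>T\<close> stands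
  in for the exceptional set, whose own measurability is left open.\<close>

lemma maximal_weak_type:
  fixes h :: "'a::euclidean_space \<Rightarrow> ennreal" and \<alpha> :: real
  assumes h[measurable]: "h \<in> borel_measurable borel" and \<alpha>: "\<alpha> > 0"
  obtains T where "T \<in> sets borel"
    "{x. \<exists>r\<in>{0<..1}. \<alpha> * emeasure lborel (ball x r) < (\<integral>\<^sup>+y\<in>ball x r. h y \<partial>lborel)} \<subseteq> T"
    "\<alpha> * emeasure lborel T \<le> 5 ^ DIM('a) * (\<integral>\<^sup>+y. h y \<partial>lborel)"
proof -
  define N where "N = density lborel h"
  have N: "emeasure N (ball x r) = (\<integral>\<^sup>+y\<in>ball x r. h y \<partial>lborel)" for x r
    unfolding N_def by (subst emeasure_density) auto
  have Nsets [simp, measurable_cong]: "sets N = sets borel" by (simp add: N_def)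
  define S where "S = {x::'a. \<exists>r\<in>{0<..1::real}. \<alpha> * emeasure lborel (ball x r) < emeasure N (ball x r)}"
  have "\<forall>x\<in>S. \<exists>r::real. (0 < r \<and> r \<le> 1) \<and> \<alpha> * emeasure lborel (ball x r) < emeasure N (ball x r)"
    unfolding S_def by auto
  then obtain r where r: "\<And>x. x \<in> S \<Longrightarrow> 0 < r x \<and> r x \<le> (1::real)"
    "\<And>x. x \<in> S \<Longrightarrow> \<alpha> * emeasure lborel (ball x (r x)) < emeasure N (ball x (r x))"
    by metis
  have "S \<subseteq> (\<Union>i\<in>S. ball i (r i))"
    using r by force
  then have sub: "S \<subseteq> (\<Union>i\<in>S. ball (id i) (r i))" by simp
  obtain C where C: "countable C" "C \<subseteq> S" "pairwise (\<lambda>i j. disjnt (ball i (r i)) (ball j (r j))) C"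
      "S \<subseteq> (\<Union>i\<in>C. ball i (5 * r i))"
    by (rule Vitali_covering_lemma_balls[OF sub r(1)]) (auto simp only: id_def)
  have dis: "disjoint_family_on (\<lambda>i. ball i (r i)) C"
    using C(3) unfolding pairwise_def disjoint_family_on_def disjnt_def by blast
  let ?T = "\<Union>i\<in>C. ball i (5 * r i)"
  have five: "emeasure lborel (ball i (5 * r i)) = 5 ^ DIM('a) * emeasure lborel (ball i (r i))" if "i \<in> C" for i
    using r(1)[of i] C(2) that
    by (subst (1 2) emeasure_ball) (auto simp: power_mult_distrib ennreal_mult' mult_ac simp flip: ennreal_power)
  show thesis
  proof
    show "?T \<in> sets borel" using C(1) by auto
    show "{x. \<exists>r\<in>{0<..1}. \<alpha> * emeasure lborel (ball x r) < (\<integral>\<^sup>+y\<in>ball x r. h y \<partial>lborel)} \<subseteq> ?T"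
      using C(4) unfolding S_def N .
    have "emeasure lborel ?T \<le> (\<integral>\<^sup>+i. emeasure lborel (ball i (5 * r i)) \<partial>count_space C)"
      by (rule emeasure_UN_countable_le) (use C in auto)
    also have "\<dots> = 5 ^ DIM('a) * (\<integral>\<^sup>+i. emeasure lborel (ball i (r i)) \<partial>count_space C)"
      by (subst nn_integral_cmult[symmetric]) (auto intro!: nn_integral_cong simp: five)
    finally have "\<alpha> * emeasure lborel ?T \<le> 5 ^ DIM('a) * (\<integral>\<^sup>+i. \<alpha> * emeasure lborel (ball i (r i)) \<partial>count_space C)"
      by (subst nn_integral_cmult) (auto simp: mult_left_mono mult_ac)
    also have "\<dots> \<le> 5 ^ DIM('a) * (\<integral>\<^sup>+i. emeasure N (ball i (r i)) \<partial>count_space C)"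
      by (intro mult_left_mono nn_integral_mono) (use r(2) C(2) in \<open>auto intro!: less_imp_le\<close>)
    also have "(\<integral>\<^sup>+i. emeasure N (ball i (r i)) \<partial>count_space C) = emeasure N (\<Union>i\<in>C. ball i (r i))"
      by (rule emeasure_UN_countable[symmetric]) (use C dis in auto)
    also have "\<dots> \<le> emeasure N UNIV"
      by (rule emeasure_mono) auto
    also have "\<dots> = (\<integral>\<^sup>+y. h y \<partial>lborel)"
      unfolding N_def by (subst emeasure_density) auto
    finally show "\<alpha> * emeasure lborel ?T \<le> 5 ^ DIM('a) * (\<integral>\<^sup>+y. h y \<partial>lborel)"
      by (simp add: mult_left_mono)
  qed
qed

definition lebesgue_point :: "('a::euclidean_space \<Rightarrow> real) \<Rightarrow> 'a \<Rightarrow> bool" where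
  "lebesgue_point f x \<longleftrightarrow> (\<forall>\<alpha>::real. \<alpha> > 0 \<longrightarrow> (\<forall>\<^sub>F r in at_right 0.
     (\<integral>\<^sup>+y\<in>ball x r. ennreal \<bar>f y - f x\<bar> \<partial>lborel) \<le> ennreal \<alpha> * emeasure lborel (ball x r)))"

text \<open>This is what the triangle inequality gives at a Lebesgue point \<open>x\<close> of an
  approximation \<open>k\<close> of \<open>f\<close>, with \<open>h = |f - k|\<close>: the integral
  of \<open>h\<close> is the error near \<open>x\<close>, \<open>h x\<close> the error at the
  centre, and \<alpha> bounds the oscillation of \<open>k\<close>.\<close>

definition avg_dominated :: "('a::euclidean_space \<Rightarrow> real) \<Rightarrow> ('a \<Rightarrow> real) \<Rightarrow> 'a \<Rightarrow> bool" where
  "avg_dominated f h x \<longleftrightarrow> (\<forall>\<alpha>::real. \<alpha> > 0 \<longrightarrow> (\<forall>\<^sub>F r in at_right 0.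
     (\<integral>\<^sup>+y\<in>ball x r. ennreal \<bar>f y - f x\<bar> \<partial>lborel) \<le>
      (\<integral>\<^sup>+y\<in>ball x r. ennreal (h y) \<partial>lborel) + ennreal (h x + \<alpha>) * emeasure lborel (ball x r)))"

text \<open>Off a null set, if the mean oscillation of \<open>f\<close> exceeds 3 \<alpha> at
  arbitrarily small radii, then the maximal function of \<open>h\<close> or \<open>h\<close> itself
  exceeds \<alpha>. The weak type estimate and Markov's inequality bound both sets by the integral
  of \<open>h\<close>, which is as small as desired.\<close>

lemma AE_lebesgue_point_approx:
  fixes f :: "'a::euclidean_space \<Rightarrow> real"
  assumes approx: "\<And>e::real. e > 0 \<Longrightarrow> \<exists>h\<in>borel_measurable borel. (\<integral>\<^sup>+y. ennreal (h y) \<partial>lborel) \<le> ennreal e \<and>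
     (\<forall>y. h y \<ge> 0) \<and> (AE x in lborel. avg_dominated f h x)"
  shows "AE x in lborel. lebesgue_point f x"
proof -
  have main: "AE x in lborel. \<forall>\<^sub>F r in at_right 0.
      (\<integral>\<^sup>+y\<in>ball x r. ennreal \<bar>f y - f x\<bar> \<partial>lborel) \<le> ennreal (3 * \<alpha>) * emeasure lborel (ball x r)"
    (is "AE x in lborel. ?P x") if \<alpha>: "\<alpha> > 0" for \<alpha>
  proof -
    have "\<exists>T\<in>sets borel. {x. \<not> ?P x} \<subseteq> T \<and> emeasure lborel T \<le> ennreal e" if e: "e > 0" for e
    proof -
      \<comment> \<open>The exceptional set gets measure at most
        \<open>(5 ^ DIM('a) + 1) * e' / \<alpha>\<close>, which this choice makes equal to
        \<open>e\<close>.\<close>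
      define e' where "e' = \<alpha> * e / (5 ^ DIM('a) + 1)"
      have "e' > 0" using \<alpha> e by (simp add: e'_def add_pos_pos)
      obtain h where h[measurable]: "h \<in> borel_measurable borel" and hi: "(\<integral>\<^sup>+y. ennreal (h y) \<partial>lborel) \<le> ennreal e'"
        and h0: "\<And>y. h y \<ge> 0" and ae: "AE x in lborel. avg_dominated f h x"
        using approx[OF \<open>e' > 0\<close>] by (elim bexE conjE) auto
      obtain Z where Z: "Z \<in> null_sets lborel" and aeZ: "\<And>x. x \<notin> Z \<Longrightarrow> avg_dominated f h x"
        by (rule AE_E3[OF ae]) auto
      obtain T where T: "T \<in> sets borel"
        "{x. \<exists>r\<in>{0<..1}. \<alpha> * emeasure lborel (ball x r) < (\<integral>\<^sup>+y\<in>ball x r. h y \<partial>lborel)} \<subseteq> T"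
        "\<alpha> * emeasure lborel T \<le> 5 ^ DIM('a) * (\<integral>\<^sup>+y. h y \<partial>lborel)"
        by (rule maximal_weak_type[of "\<lambda>y. ennreal (h y)" \<alpha>]) (use \<alpha> in auto)
      define L where "L = {x. h x > \<alpha>}"
      have L[measurable]: "L \<in> sets borel" unfolding L_def by measurable
      have Le: "\<alpha> * emeasure lborel L \<le> (\<integral>\<^sup>+y. h y \<partial>lborel)"
      proof -
        have "\<alpha> * emeasure lborel L = (\<integral>\<^sup>+y. ennreal \<alpha> * indicator L y \<partial>lborel)"
          by (simp add: nn_integral_cmult)
        also have "\<dots> \<le> (\<integral>\<^sup>+y. h y \<partial>lborel)"
          using h0 \<alpha> by (intro nn_integral_mono) (auto simp: L_def indicator_def intro!: ennreal_leI)
        finally show ?thesis .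
      qed
      have sub: "{x. \<not> ?P x} \<subseteq> T \<union> L \<union> Z"
      proof (rule ccontr)
        assume "\<not> ?thesis"
        then obtain x where x: "\<not> ?P x" "x \<notin> T" "x \<notin> L" "x \<notin> Z" by blast
        have *: "\<forall>\<^sub>F r in at_right 0.
          (\<integral>\<^sup>+y\<in>ball x r. ennreal \<bar>f y - f x\<bar> \<partial>lborel) \<le>
           (\<integral>\<^sup>+y\<in>ball x r. ennreal (h y) \<partial>lborel) + ennreal (h x + \<alpha>) * emeasure lborel (ball x r)"
          using aeZ[OF x(4)] \<alpha> unfolding avg_dominated_def by (elim allE impE) auto
        have "\<forall>\<^sub>F r::real in at_right 0. r \<in> {0<..1}"
          unfolding eventually_at_right[OF zero_less_one] by (auto intro!: exI[of _ 1])
        with * have "?P x"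
        proof eventually_elim
          case (elim r)
          have 1: "(\<integral>\<^sup>+y\<in>ball x r. ennreal (h y) \<partial>lborel) \<le> \<alpha> * emeasure lborel (ball x r)"
            using x(2) T(2) elim(2) by (force simp: not_less)
          have 2: "h x + \<alpha> \<le> 2 * \<alpha>" using x(3) by (simp add: L_def)
          have "(\<integral>\<^sup>+y\<in>ball x r. ennreal \<bar>f y - f x\<bar> \<partial>lborel) \<le>
            \<alpha> * emeasure lborel (ball x r) + ennreal (2 * \<alpha>) * emeasure lborel (ball x r)"
            using 1 2 by (intro order_trans[OF elim(1)] add_mono mult_right_mono ennreal_leI) auto
          also have "\<dots> = ennreal (3 * \<alpha>) * emeasure lborel (ball x r)"
            using \<alpha> by (subst distrib_right[symmetric]) (simp flip: ennreal_plus)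
          finally show ?case .
        qed
        with x(1) show False by blast
      qed
      have "\<alpha> * emeasure lborel (T \<union> L \<union> Z) \<le> \<alpha> * (emeasure lborel T + emeasure lborel L)"
        using Z T(1) by (subst emeasure_Un_null_set) (auto intro!: mult_left_mono emeasure_subadditive)
      also have "\<dots> \<le> (5 ^ DIM('a) + 1) * ennreal e'"
        unfolding distrib_left distrib_right mult_1
        by (intro add_mono order_trans[OF T(3) mult_left_mono[OF hi]] order_trans[OF Le hi]) simp
      also have "\<dots> = \<alpha> * ennreal e"
      proof -
        have *: "(5 ^ DIM('a) + 1) * e' = \<alpha> * e"
          by (simp add: e'_def add_pos_pos less_imp_neq[symmetric])
        have "(5 ^ DIM('a) + 1) * ennreal e' = ennreal (5 ^ DIM('a) + 1) * ennreal e'"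
          by (subst ennreal_plus) (auto simp flip: ennreal_power)
        also have "\<dots> = ennreal ((5 ^ DIM('a) + 1) * e')"
          by (rule ennreal_mult[symmetric]) (use \<open>e' > 0\<close> in auto)
        also have "\<dots> = \<alpha> * ennreal e"
          unfolding * using \<alpha> e by (intro ennreal_mult) auto
        finally show ?thesis .
      qed
      finally have "emeasure lborel (T \<union> L \<union> Z) \<le> e"
        using \<alpha> by (subst (asm) ennreal_mult_le_mult_iff) auto
      with sub Z T(1) show ?thesis by (intro bexI[of _ "T \<union> L \<union> Z"]) (auto simp: null_sets_def)
    qed
    then have "\<forall>n. \<exists>T\<in>sets borel. {x. \<not> ?P x} \<subseteq> T \<and> emeasure lborel T \<le> ennreal (1 / Suc n)"
      by simp
    then have "\<exists>T. \<forall>n. T n \<in> sets borel \<and> {x. \<not> ?P x} \<subseteq> T n \<and> emeasure lborel (T n) \<le> ennreal (1 / Suc n)"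
      unfolding Bex_def by (rule choice)
    then obtain T where T: "\<And>n::nat. T n \<in> sets borel" "\<And>n. {x. \<not> ?P x} \<subseteq> T n"
        "\<And>n. emeasure lborel (T n) \<le> ennreal (1 / Suc n)" by blast
    have Tm: "(\<Inter>n. T n) \<in> sets lborel" using T(1) by auto
    have "emeasure lborel (\<Inter>n. T n) \<le> ennreal e" if e: "0 < (e::real)" for e
    proof -
      obtain n where n: "1 / Suc n < e" using reals_Archimedean[OF e] by (auto simp: inverse_eq_divide)
      have "emeasure lborel (\<Inter>n. T n) \<le> emeasure lborel (T n)"
        using T(1) by (intro emeasure_mono) auto
      also note T(3)[of n]
      also have "ennreal (1 / Suc n) \<le> ennreal e" using n by (intro ennreal_leI) simp
      finally show ?thesis .
    qed
    then have "emeasure lborel (\<Inter>n. T n) \<le> 0"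
      by - (rule ennreal_le_epsilon, simp)
    then have "(\<Inter>n. T n) \<in> null_sets lborel"
      using Tm by auto
    then show ?thesis
      by (rule AE_I') (use T(2) in auto)
  qed
  have "AE x in lborel. \<forall>n. \<forall>\<^sub>F r in at_right 0.
      (\<integral>\<^sup>+y\<in>ball x r. ennreal \<bar>f y - f x\<bar> \<partial>lborel) \<le> ennreal (3 * (1 / Suc n)) * emeasure lborel (ball x r)"
    unfolding AE_all_countable by (intro allI main) simp
  then show ?thesis
  proof eventually_elim
    case (elim x)
    show ?case unfolding lebesgue_point_def
    proof (intro allI impI)
      fix \<alpha> :: real assume "\<alpha> > 0"
      then obtain n where n: "1 / Suc n < \<alpha> / 3"
        using reals_Archimedean[of "\<alpha> / 3"] by (auto simp: inverse_eq_divide)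
      show "\<forall>\<^sub>F r in at_right 0. (\<integral>\<^sup>+y\<in>ball x r. ennreal \<bar>f y - f x\<bar> \<partial>lborel) \<le> \<alpha> * emeasure lborel (ball x r)"
        using elim[rule_format, of n]
      proof eventually_elim
        case (elim r)
        also have "ennreal (3 * (1 / Suc n)) * emeasure lborel (ball x r) \<le> \<alpha> * emeasure lborel (ball x r)"
          using n by (intro mult_right_mono ennreal_leI) auto
        finally show ?case .
      qed
    qed
  qed
qed


text \<open>For an indicator, outer regularity of \<open>A\<close> and of its complement gives open
  sets \<open>U\<close> and \<open>V\<close> with small intersection. At a point outside the
  intersection the indicator is constant nearby, up to errors inside the intersection, so a multiple
  of the indicator of \<open>U \<inter> V\<close> serves as \<open>h\<close>. Integrable functions
  follow by approximation in L1.\<close>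

lemma AE_lebesgue_point:
  fixes f :: "'a::euclidean_space \<Rightarrow> real"
  assumes "integrable lborel f"
  shows "AE x in lborel. lebesgue_point f x"
  using assms
proof (induction rule: integrable_induct)
  case (base A c)
  then have A[measurable]: "A \<in> sets borel" by simp
  show ?case
  proof (rule AE_lebesgue_point_approx)
    fix e :: real assume "e > 0"
    define e' where "e' = (e / (\<bar>c\<bar> + 1)) / 2"
    have e': "e' > 0" using \<open>e > 0\<close> by (simp add: e'_def add_nonneg_pos)
    have e'c: "\<bar>c\<bar> * (e' + e') \<le> e"
    proof -
      have "e' + e' = e / (\<bar>c\<bar> + 1)" unfolding e'_def by (rule field_sum_of_halves)
      then have "\<bar>c\<bar> * (e' + e') = (\<bar>c\<bar> / (\<bar>c\<bar> + 1)) * e" by simp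
      also have "\<dots> \<le> 1 * e" using \<open>e > 0\<close> by (intro mult_right_mono) auto
      finally show ?thesis by simp
    qed
    obtain U where U: "open U" "A \<subseteq> U" "emeasure lborel (U - A) < ennreal e'"
      using outer_regular_lborel[OF A e'] by metis
    obtain V where V: "open V" "- A \<subseteq> V" "emeasure lborel (V - (- A)) < ennreal e'"
      using outer_regular_lborel[OF _ e', of "- A"] by auto
    have [measurable]: "U \<in> sets borel" "V \<in> sets borel" using U V by auto
    define h :: "'a \<Rightarrow> real" where "h = (\<lambda>x. \<bar>c\<bar> * indicator (U \<inter> V) x)"
    have "(\<integral>\<^sup>+y. ennreal (h y) \<partial>lborel) = (\<integral>\<^sup>+y. ennreal \<bar>c\<bar> * indicator (U \<inter> V) y \<partial>lborel)"
      by (intro nn_integral_cong) (simp add: h_def indicator_def)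
    also have "\<dots> = \<bar>c\<bar> * emeasure lborel (U \<inter> V)" by (subst nn_integral_cmult) auto
    finally have hi1: "(\<integral>\<^sup>+y. ennreal (h y) \<partial>lborel) = \<bar>c\<bar> * emeasure lborel (U \<inter> V)" .
    have "emeasure lborel (U \<inter> V) \<le> emeasure lborel ((U - A) \<union> (V - (- A)))"
      by (intro emeasure_mono) auto
    also have "\<dots> \<le> emeasure lborel (U - A) + emeasure lborel (V - (- A))"
      by (rule emeasure_subadditive) auto
    also have "\<dots> \<le> ennreal e' + ennreal e'" using U V by (intro add_mono) auto
    also have "\<dots> = ennreal (e' + e')" using e' by (subst ennreal_plus) auto
    finally have "\<bar>c\<bar> * emeasure lborel (U \<inter> V) \<le> ennreal \<bar>c\<bar> * ennreal (e' + e')"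
      by (rule mult_left_mono) simp
    also have "\<dots> = ennreal (\<bar>c\<bar> * (e' + e'))" using e' by (intro ennreal_mult[symmetric]) auto
    also have "\<dots> \<le> ennreal e" by (rule ennreal_leI[OF e'c])
    finally have hi: "(\<integral>\<^sup>+y. ennreal (h y) \<partial>lborel) \<le> ennreal e" unfolding hi1 .
    have dom: "avg_dominated (\<lambda>x. indicator A x *\<^sub>R c) h x" for x
    proof -
      have near: "\<forall>\<^sub>F r::real in at_right 0. ball x r \<subseteq> S" if S: "open S" "x \<in> S" for S
      proof -
        obtain d where "d > 0" "ball x d \<subseteq> S" using S open_contains_ball by blast
        then show ?thesis unfolding eventually_at_right[OF zero_less_one]
          by (intro exI[of _ d]) auto
      qed
      have *: "\<forall>\<^sub>F r in at_right 0. \<forall>y\<in>ball x r. \<bar>indicator A y *\<^sub>R c - indicator A x *\<^sub>R c\<bar> \<le> h y"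
        if "x \<notin> U \<inter> V"
      proof (cases "x \<in> U")
        case True
        show ?thesis using near[OF U(1) True]
        proof eventually_elim
          case (elim r)
          have "x \<in> A" using True that V(2) by auto
          with elim V(2) show ?case by (auto simp: h_def indicator_def)
        qed
      next
        case False
        then have "x \<in> V" using U V by auto
        show ?thesis using near[OF V(1) \<open>x \<in> V\<close>]
        proof eventually_elim
          case (elim r)
          have "x \<notin> A" using False U by auto
          with elim U(2) show ?case by (auto simp: h_def indicator_def)
        qed
      qed
      show ?thesis unfolding avg_dominated_def
      proof (intro allI impI)
        fix \<alpha> :: real assume \<alpha>: "\<alpha> > 0"
        show "\<forall>\<^sub>F r in at_right 0.
          (\<integral>\<^sup>+y\<in>ball x r. ennreal \<bar>indicator A y *\<^sub>R c - indicator A x *\<^sub>R c\<bar> \<partial>lborel) \<le>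
           (\<integral>\<^sup>+y\<in>ball x r. ennreal (h y) \<partial>lborel) + ennreal (h x + \<alpha>) * emeasure lborel (ball x r)"
        proof (cases "x \<in> U \<inter> V")
          case True
          have "(\<integral>\<^sup>+y\<in>ball x r. ennreal \<bar>indicator A y *\<^sub>R c - indicator A x *\<^sub>R c\<bar> \<partial>lborel) \<le>
             ennreal (h x + \<alpha>) * emeasure lborel (ball x r)" for r
            unfolding nn_integral_cmult_indicator[of "ball x r" lborel, simplified, symmetric]
            using True \<alpha> by (intro nn_integral_mono mult_right_mono ennreal_leI) (auto simp: h_def indicator_def)
          then show ?thesis
            using add_increasing[OF zero_le] by (intro always_eventually allI) blast
        next
          case False
          show ?thesis using *[OF False]
          proof eventually_elim
            case (elim r)
            then have "(\<integral>\<^sup>+y\<in>ball x r. ennreal \<bar>indicator A y *\<^sub>R c - indicator A x *\<^sub>R c\<bar> \<partial>lborel) \<le>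
               (\<integral>\<^sup>+y\<in>ball x r. ennreal (h y) \<partial>lborel)"
              by (intro nn_integral_mono) (simp add: indicator_def ennreal_leI)
            then show ?case by (rule add_increasing2[OF zero_le])
          qed
        qed
      qed
    qed
    show "\<exists>h\<in>borel_measurable borel. (\<integral>\<^sup>+y. ennreal (h y) \<partial>lborel) \<le> ennreal e \<and>
     (\<forall>y. h y \<ge> 0) \<and> (AE x in lborel. avg_dominated (\<lambda>x. indicator A x *\<^sub>R c) h x)"
      using hi dom by (intro bexI[of _ h]) (auto simp: h_def)
  qed
next
  case (add f g)
  have [measurable]: "f \<in> borel_measurable borel" "g \<in> borel_measurable borel"
    using add by auto
  from add(3,4) show ?case
  proof eventually_elim
    case (elim x)
    show ?case unfolding lebesgue_point_def
    proof (intro allI impI)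
      fix \<alpha> :: real assume \<alpha>: "\<alpha> > 0"
      then have \<alpha>2: "\<alpha> / 2 > 0" by simp
      from elim(1)[unfolded lebesgue_point_def, rule_format, OF \<alpha>2]
           elim(2)[unfolded lebesgue_point_def, rule_format, OF \<alpha>2]
      show "\<forall>\<^sub>F r in at_right 0. (\<integral>\<^sup>+y\<in>ball x r. ennreal \<bar>f y + g y - (f x + g x)\<bar> \<partial>lborel) \<le> \<alpha> * emeasure lborel (ball x r)"
      proof eventually_elim
        case (elim r)
        have "(\<integral>\<^sup>+y\<in>ball x r. ennreal \<bar>f y + g y - (f x + g x)\<bar> \<partial>lborel) \<le>
          (\<integral>\<^sup>+y. ennreal \<bar>f y - f x\<bar> * indicator (ball x r) y + ennreal \<bar>g y - g x\<bar> * indicator (ball x r) y \<partial>lborel)"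
          by (intro nn_integral_mono) (auto simp: indicator_def simp flip: ennreal_plus intro!: ennreal_leI)
        also have "\<dots> = (\<integral>\<^sup>+y\<in>ball x r. ennreal \<bar>f y - f x\<bar> \<partial>lborel) + (\<integral>\<^sup>+y\<in>ball x r. ennreal \<bar>g y - g x\<bar> \<partial>lborel)"
          by (rule nn_integral_add) (auto intro!: borel_measurable_times_ennreal borel_measurable_indicator)
        also have "\<dots> \<le> ennreal (\<alpha> / 2) * emeasure lborel (ball x r) + ennreal (\<alpha> / 2) * emeasure lborel (ball x r)"
          using elim by (rule add_mono)
        also have "\<dots> = \<alpha> * emeasure lborel (ball x r)"
          using \<alpha> by (subst distrib_right[symmetric]) (simp flip: ennreal_plus)
        finally show ?case .
      qed
    qed
  qed
next
  case (lim f s)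
  have m[measurable]: "f \<in> borel_measurable borel" "\<And>i. s i \<in> borel_measurable borel"
    using lim by auto
  show ?case
  proof (rule AE_lebesgue_point_approx)
    fix e :: real assume "e > 0"
    have "(\<lambda>i. \<integral>\<^sup>+x. norm (f x - s i x) \<partial>lborel) \<longlonglongrightarrow> 0"
    proof (rule nn_integral_dominated_convergence_norm[where w="\<lambda>x. 2 * norm (f x)"])
      show "(\<integral>\<^sup>+x. ennreal (2 * norm (f x)) \<partial>lborel) < \<infinity>"
        using lim.hyps(4) by (simp add: integrable_iff_bounded ennreal_mult nn_integral_cmult ennreal_mult_less_top)
    qed (use lim in auto)
    from order_tendstoD(2)[OF this, of "ennreal e"] \<open>e > 0\<close>
    obtain i where i: "(\<integral>\<^sup>+x. norm (f x - s i x) \<partial>lborel) < ennreal e"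
      by (auto simp: eventually_sequentially)
    define h where "h = (\<lambda>x. \<bar>f x - s i x\<bar>)"
    have [measurable]: "h \<in> borel_measurable borel" unfolding h_def by measurable
    have "AE x in lborel. avg_dominated f h x"
      using lim.IH[of i]
    proof eventually_elim
      case (elim x)
      show ?case unfolding avg_dominated_def
      proof (intro allI impI)
        fix \<alpha> :: real assume \<alpha>: "\<alpha> > 0"
        from elim[unfolded lebesgue_point_def, rule_format, OF \<alpha>]
        show "\<forall>\<^sub>F r in at_right 0. (\<integral>\<^sup>+y\<in>ball x r. ennreal \<bar>f y - f x\<bar> \<partial>lborel) \<le>
            (\<integral>\<^sup>+y\<in>ball x r. ennreal (h y) \<partial>lborel) + ennreal (h x + \<alpha>) * emeasure lborel (ball x r)"
        proof eventually_elim
          case (elim r)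
          have "(\<integral>\<^sup>+y\<in>ball x r. ennreal \<bar>f y - f x\<bar> \<partial>lborel) \<le>
            (\<integral>\<^sup>+y. (ennreal (h y) * indicator (ball x r) y + ennreal \<bar>s i y - s i x\<bar> * indicator (ball x r) y)
               + ennreal (h x) * indicator (ball x r) y \<partial>lborel)"
            by (intro nn_integral_mono) (auto simp: h_def indicator_def simp flip: ennreal_plus intro!: ennreal_leI)
          also have "\<dots> = ((\<integral>\<^sup>+y\<in>ball x r. ennreal (h y) \<partial>lborel) + (\<integral>\<^sup>+y\<in>ball x r. ennreal \<bar>s i y - s i x\<bar> \<partial>lborel))
              + ennreal (h x) * emeasure lborel (ball x r)"
          proof -
            have [measurable]: "ball x r \<in> sets borel" by simp
            show ?thesis by (simp add: nn_integral_add nn_integral_cmult_indicator)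
          qed
          also have "\<dots> \<le> ((\<integral>\<^sup>+y\<in>ball x r. ennreal (h y) \<partial>lborel) + ennreal \<alpha> * emeasure lborel (ball x r))
              + ennreal (h x) * emeasure lborel (ball x r)"
            by (intro add_mono order_refl elim)
          also have "\<dots> = (\<integral>\<^sup>+y\<in>ball x r. ennreal (h y) \<partial>lborel) + ennreal (h x + \<alpha>) * emeasure lborel (ball x r)"
            using \<alpha> by (simp add: h_def add.assoc distrib_right add.commute)
          finally show ?case .
        qed
      qed
    qed
    then show "\<exists>h\<in>borel_measurable borel. (\<integral>\<^sup>+y. ennreal (h y) \<partial>lborel) \<le> ennreal e \<and>
     (\<forall>y. h y \<ge> 0) \<and> (AE x in lborel. avg_dominated f h x)"
      using i by (intro bexI[of _ h]) (auto simp: h_def)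
  qed
qed


section \<open>Test functions\<close>

text \<open>All cutoffs and truncations below are built from this C^1 function:
  \<open>radial_bump\<close>, \<open>smooth_step\<close>, and the truncation of \<open>u\<close> in
  the energy identity.\<close>

lemma has_real_derivative_pos_part_square:
  "((\<lambda>x. (max 0 x)\<^sup>2) has_real_derivative 2 * max 0 x) (at (x::real))"
proof (cases "x = 0")
  case True
  have "((\<lambda>h::real. (max 0 h)\<^sup>2 / h) \<longlongrightarrow> 0) (at 0)"
  proof (rule Lim_null_comparison)
    show "\<forall>\<^sub>F h::real in at 0. norm ((max 0 h)\<^sup>2 / h) \<le> \<bar>h\<bar>"
      by (intro always_eventually allI) (auto simp: max_def power2_eq_square)
    show "((\<lambda>h::real. \<bar>h\<bar>) \<longlongrightarrow> 0) (at 0)"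
      by (rule tendsto_eq_intros refl)+ auto
  qed
  then show ?thesis using True by (simp add: DERIV_def)
next
  case False
  show ?thesis
  proof (cases "x > 0")
    case True
    have "((\<lambda>x. x\<^sup>2) has_real_derivative 2 * x) (at x)"
      by (auto intro!: derivative_eq_intros)
    then have "((\<lambda>x. (max 0 x)\<^sup>2) has_real_derivative 2 * x) (at x)"
      by (rule has_field_derivative_transform_within_open[of _ _ _ "{0<..}"]) (use True in auto)
    with True show ?thesis by simp
  next
    case neg: False
    have "((\<lambda>x. 0::real) has_real_derivative 0) (at x)" by simp
    then have "((\<lambda>x. (max 0 x)\<^sup>2) has_real_derivative 0) (at x)"
      by (rule has_field_derivative_transform_within_open[of _ _ _ "{..<0}"]) (use neg False in auto)
    with neg show ?thesis by simp
  qed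
qed

text \<open>With \<open>s\<close> the squared positive part, \<open>s / (s + 1 / Suc n)\<close>
  tends to 1 where \<open>s > 0\<close> and stays 0 where \<open>s = 0\<close>. The result is C^1
  and tends to the indicator of the open ball.\<close>

definition radial_bump :: "'a::real_inner \<Rightarrow> real \<Rightarrow> nat \<Rightarrow> 'a \<Rightarrow> real" where
  "radial_bump c r n y = (max 0 (r\<^sup>2 - (norm (y - c))\<^sup>2))\<^sup>2 / ((max 0 (r\<^sup>2 - (norm (y - c))\<^sup>2))\<^sup>2 + 1 / Suc n)"

lemma radial_bump_nonneg_le_1: "0 \<le> radial_bump c r n y" "radial_bump c r n y \<le> 1"
  unfolding radial_bump_def by (auto simp: divide_simps add_nonneg_pos intro!: divide_nonneg_pos add_nonneg_pos)

lemma radial_bump_eq_0: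
  assumes "r > 0" "y \<notin> ball c r" shows "radial_bump c r n y = 0"
proof -
  have "r \<le> norm (y - c)" using assms(2) by (simp add: dist_norm norm_minus_commute)
  then have "r\<^sup>2 \<le> (norm (y - c))\<^sup>2" using assms(1) by (intro power_mono) auto
  then show ?thesis by (simp add: radial_bump_def)
qed

lemma radial_bump_tendsto:
  assumes "r > 0"
  shows "(\<lambda>n. radial_bump c r n y) \<longlonglongrightarrow> indicator (ball c r) y"
proof (cases "y \<in> ball c r")
  case True
  define q where "q = r\<^sup>2 - (norm (y - c))\<^sup>2"
  have "q > 0" using True assms unfolding q_def
    by (simp add: dist_norm norm_minus_commute power_strict_mono)
  have "(\<lambda>n. q\<^sup>2 / (q\<^sup>2 + 1 / Suc n)) \<longlonglongrightarrow> q\<^sup>2 / (q\<^sup>2 + 0)"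
    using \<open>q > 0\<close> by (intro tendsto_intros LIMSEQ_Suc[OF lim_1_over_n]) auto
  with \<open>q > 0\<close> True show ?thesis by (simp add: radial_bump_def flip: q_def)
next
  case False
  then have "radial_bump c r n y = 0" for n using radial_bump_eq_0[OF assms] by blast
  with False show ?thesis by simp
qed

lemma C1_0_radial_bump:
  fixes c :: "'a::euclidean_space"
  assumes "r > 0" "cball c r \<subseteq> U" "open U"
  shows "\<exists>D. C1_0 U (radial_bump c r n) D"
proof -
  define k where "k = (\<lambda>z::real. (max 0 z)\<^sup>2 / ((max 0 z)\<^sup>2 + 1 / Suc n))"
  define k' where "k' = (\<lambda>z::real. (2 * max 0 z * ((max 0 z)\<^sup>2 + 1 / Suc n) - (max 0 z)\<^sup>2 * (2 * max 0 z)) /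
     (((max 0 z)\<^sup>2 + 1 / Suc n) * ((max 0 z)\<^sup>2 + 1 / Suc n)))"
  have pos: "(max 0 z)\<^sup>2 + 1 / Suc n \<noteq> 0" for z :: real
    using zero_le_power2[of "max 0 z"] by (smt (verit) divide_pos_pos of_nat_0_less_iff zero_less_Suc)
  have k: "(k has_real_derivative k' z) (at z)" for z
    unfolding k_def k'_def
    using DERIV_divide[OF has_real_derivative_pos_part_square[of z]
        DERIV_add[OF has_real_derivative_pos_part_square[of z] DERIV_const[of "1 / Suc n"]] pos[of z]]
    by simp
  have contk: "continuous_on UNIV k'"
    unfolding k'_def by (intro continuous_intros) (use pos in auto)
  define D where "D = (\<lambda>y. (k' (r\<^sup>2 - (norm (y - c))\<^sup>2) * (-2)) *\<^sub>R blinfun_inner_left (y - c))"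
  have eq: "radial_bump c r n y = k (r\<^sup>2 - (norm (y - c))\<^sup>2)" for y
    by (simp add: radial_bump_def k_def)
  have "(radial_bump c r n has_derivative blinfun_apply (D y)) (at y within S)" for y S
  proof -
    have 1: "((\<lambda>y. r\<^sup>2 - (y - c) \<bullet> (y - c)) has_derivative (\<lambda>h. - 2 * ((y - c) \<bullet> h))) (at y within S)"
      by (auto intro!: derivative_eq_intros simp: inner_commute)
    have "((\<lambda>y. k (r\<^sup>2 - (y - c) \<bullet> (y - c))) has_derivative
        (\<lambda>h. k' (r\<^sup>2 - (y - c) \<bullet> (y - c)) * (- 2 * ((y - c) \<bullet> h)))) (at y within S)"
      using has_derivative_compose[OF 1 k[unfolded has_field_derivative_def]] by simp
    then show ?thesis
      unfolding eq[abs_def] D_def power2_norm_eq_inner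
      by (rule has_derivative_eq_rhs) (simp add: fun_eq_iff blinfun.scaleR_left blinfun.minus_left inner_commute)
  qed
  moreover have "continuous_on U D"
    unfolding D_def
    by (intro continuous_intros continuous_on_compose2[OF contk] bounded_linear.continuous_on[OF bounded_linear_blinfun_inner_left]) auto
  moreover have "\<forall>x\<in>U - cball c r. radial_bump c r n x = 0"
    using radial_bump_eq_0[OF assms(1), of _ c n] by auto
  ultimately show ?thesis
    unfolding C1_0_def using assms(2) by (intro exI[of _ D]) (auto intro!: exI[of _ "cball c r"])
qed

text \<open>At a Lebesgue point with \<open>f x\<close> nonzero, the constant \<open>f x\<close>
  differs from \<open>f\<close> on a small ball by at most half of \<open>|f x|\<close> on average,
  although the integral of \<open>f\<close> over the ball is 0.\<close>

lemma AE_zero_if_ball_integrals_zero: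
  fixes f :: "'a::euclidean_space \<Rightarrow> real"
  assumes f: "integrable lborel f"
    and z: "\<And>x r. r > 0 \<Longrightarrow> cball x r \<subseteq> U \<Longrightarrow> (LINT y:ball x r|lborel. f y) = 0" and U: "open U"
  shows "AE x in lborel. x \<in> U \<longrightarrow> f x = 0"
  using AE_lebesgue_point[OF f]
proof eventually_elim
  case (elim x)
  show ?case
  proof (rule impI, rule ccontr)
    assume x: "x \<in> U" and nz: "f x \<noteq> 0"
    define \<alpha> where "\<alpha> = \<bar>f x\<bar> / 2"
    have \<alpha>: "\<alpha> > 0" using nz by (simp add: \<alpha>_def)
    obtain d where d: "d > 0" "cball x d \<subseteq> U" using U x open_contains_cball by blast
    have "\<forall>\<^sub>F r::real in at_right 0. r \<in> {0<..<d}"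
      unfolding eventually_at_right[OF d(1)] using d by (intro exI[of _ d]) auto
    with elim[unfolded lebesgue_point_def, rule_format, OF \<alpha>]
    have "\<forall>\<^sub>F r::real in at_right 0. False"
    proof eventually_elim
      case (elim r)
      have int0: "(LINT y:ball x r|lborel. f y) = 0"
        using elim(2) d subset_cball[of r d x] by (intro z) auto
      have fi: "set_integrable lborel (ball x r) f"
        unfolding set_integrable_def using f by (intro integrable_mult_indicator) auto
      have ci: "set_integrable lborel (ball x r) (\<lambda>y. f x)"
        unfolding set_integrable_def real_scaleR_def by (intro integrable_mult_left integrable_real_indicator) (auto simp: emeasure_lborel_ball_finite simp flip: infinity_ennreal_def)
      have di: "set_integrable lborel (ball x r) (\<lambda>y. f y - f x)"
        by (rule set_integral_diff(1)[OF fi ci])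
      have "\<bar>f x\<bar> * measure lborel (ball x r) = \<bar>LINT y:ball x r|lborel. f y - f x\<bar>"
      proof -
        have "(LINT y:ball x r|lborel. f x) = measure lborel (ball x r) * f x"
          by (simp add: set_lebesgue_integral_def)
        then show ?thesis
          by (subst set_integral_diff(2)[OF fi ci]) (simp add: int0 abs_mult)
      qed
      also have "\<dots> \<le> (LINT y:ball x r|lborel. \<bar>f y - f x\<bar>)"
        using set_integral_norm_bound[OF di] by simp
      finally have "ennreal (\<bar>f x\<bar> * measure lborel (ball x r)) \<le> ennreal (LINT y:ball x r|lborel. \<bar>f y - f x\<bar>)"
        by (rule ennreal_leI)
      also have "\<dots> = (\<integral>\<^sup>+y. ennreal (indicator (ball x r) y * \<bar>f y - f x\<bar>) \<partial>lborel)"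
        unfolding set_lebesgue_integral_def real_scaleR_def
        using set_integrable_abs[OF di] unfolding set_integrable_def real_scaleR_def
        by (subst nn_integral_eq_integral) auto
      also have "\<dots> = (\<integral>\<^sup>+y\<in>ball x r. ennreal \<bar>f y - f x\<bar> \<partial>lborel)"
        by (intro nn_integral_cong) (auto simp: indicator_def)
      also have "\<dots> \<le> \<alpha> * emeasure lborel (ball x r)" by (rule elim(1))
      also have "\<dots> = ennreal (\<alpha> * measure lborel (ball x r))"
        using \<alpha> emeasure_lborel_ball_finite[of x r] by (subst emeasure_eq_ennreal_measure) (auto simp: ennreal_mult)
      finally have "\<bar>f x\<bar> * measure lborel (ball x r) \<le> \<alpha> * measure lborel (ball x r)"
        using \<alpha> by (subst (asm) ennreal_le_iff) auto
      moreover have "measure lborel (ball x r) > 0" using elim(2) by (auto simp: content_ball_pos)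
      ultimately show False using nz by (simp add: \<alpha>_def)
    qed
    then show False by simp
  qed
qed

text \<open>The fundamental lemma of the calculus of variations. The bumps converge boundedly to
  indicators of balls, so \<open>f\<close> has integral 0 over small balls, and Lebesgue points
  finish the argument.\<close>

lemma test_integrals_zero_imp_AE_zero:
  fixes f :: "'a::euclidean_space \<Rightarrow> real"
  assumes U: "open U" and f: "\<And>K. compact K \<Longrightarrow> K \<subseteq> U \<Longrightarrow> set_integrable lebesgue K f"
    and z: "\<And>\<phi> D. C1_0 U \<phi> D \<Longrightarrow> (LINT x:U|lebesgue. f x * \<phi> x) = 0"
  shows "AE x in lebesgue. x \<in> U \<longrightarrow> f x = 0"
proof -
  have ball0: "(LINT y:ball x r|lebesgue. f y) = 0" if r: "r > 0" "cball x r \<subseteq> U" for x r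
  proof -
    have int: "integrable lebesgue (\<lambda>y. indicator (cball x r) y *\<^sub>R f y)"
      using f[of "cball x r"] r by (simp add: set_integrable_def)
    have "(\<lambda>n. LINT y|lebesgue. indicator (cball x r) y *\<^sub>R f y * radial_bump x r n y)
       \<longlonglongrightarrow> (LINT y|lebesgue. indicator (cball x r) y *\<^sub>R f y * indicator (ball x r) y)"
    proof (rule integral_dominated_convergence[where w="\<lambda>y. norm (indicator (cball x r) y *\<^sub>R f y)"])
      show "AE y in lebesgue. (\<lambda>n. indicator (cball x r) y *\<^sub>R f y * radial_bump x r n y) \<longlonglongrightarrow> indicator (cball x r) y *\<^sub>R f y * indicator (ball x r) y"
        by (intro always_eventually allI tendsto_intros radial_bump_tendsto r)
      show "(\<lambda>y. indicator (cball x r) y *\<^sub>R f y * radial_bump x r n y) \<in> borel_measurable lebesgue" for n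
      proof (intro borel_measurable_times borel_measurable_integrable[OF int])
        have "continuous_on UNIV (radial_bump x r n)"
          unfolding radial_bump_def
          by (intro continuous_intros) (smt (verit) divide_pos_pos of_nat_0_less_iff zero_less_Suc zero_le_power2)
        then have "radial_bump x r n \<in> borel_measurable borel" by (rule borel_measurable_continuous_onI)
        then show "radial_bump x r n \<in> borel_measurable lebesgue" by (intro measurable_completion) simp
      qed
      show "AE y in lebesgue. norm (indicator (cball x r) y *\<^sub>R f y * radial_bump x r n y) \<le> norm (indicator (cball x r) y *\<^sub>R f y)" for n
      proof (intro always_eventually allI)
        fix y
        have "\<bar>radial_bump x r n y\<bar> \<le> 1" using radial_bump_nonneg_le_1[where c=x and r=r and n=n and y=y] by simp
        then show "norm (indicator (cball x r) y *\<^sub>R f y * radial_bump x r n y) \<le> norm (indicator (cball x r) y *\<^sub>R f y)"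
          unfolding norm_mult by (intro mult_left_le) simp_all
      qed
      show "integrable lebesgue (\<lambda>y. norm (indicator (cball x r) y *\<^sub>R f y))" by (rule integrable_norm[OF int])
      show "(\<lambda>y. indicator (cball x r) y *\<^sub>R f y * indicator (ball x r) y) \<in> borel_measurable lebesgue"
        by (intro borel_measurable_times borel_measurable_integrable[OF int] measurable_completion borel_measurable_indicator) simp
    qed
    moreover have "(LINT y|lebesgue. indicator (cball x r) y *\<^sub>R f y * radial_bump x r n y) = 0" for n
    proof -
      obtain D where D: "C1_0 U (radial_bump x r n) D" using C1_0_radial_bump[OF r U] by blast
      have "(LINT y|lebesgue. indicator (cball x r) y *\<^sub>R f y * radial_bump x r n y) = (LINT y:U|lebesgue. f y * radial_bump x r n y)"
        unfolding set_lebesgue_integral_def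
      proof (intro Bochner_Integration.integral_cong refl)
        fix y
        show "indicator (cball x r) y *\<^sub>R f y * radial_bump x r n y = indicator U y *\<^sub>R (f y * radial_bump x r n y)"
          using radial_bump_eq_0[OF r(1), of y x n] subsetD[OF r(2), of y] ball_subset_cball[of x r]
          by (cases "y \<in> ball x r") (auto simp: indicator_def)
      qed
      with z[OF D] show ?thesis by simp
    qed
    ultimately have "(LINT y|lebesgue. indicator (cball x r) y *\<^sub>R f y * indicator (ball x r) y) = 0"
      by (simp add: LIMSEQ_const_iff)
    then show ?thesis unfolding set_lebesgue_integral_def
      by (rule trans[rotated]) (intro Bochner_Integration.integral_cong, auto simp: indicator_def)
  qed
  have loc: "AE x in lebesgue. x \<in> ball c R \<longrightarrow> f x = 0" if R: "cball c R \<subseteq> U" for c R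
  proof -
    define F where "F = (\<lambda>y. indicator (cball c R) y *\<^sub>R f y)"
    have int: "integrable lebesgue F"
      using f[of "cball c R"] R by (simp add: set_integrable_def F_def)
    \<comment> \<open>The Lebesgue point theorem is stated for \<open>lborel\<close>, so the
      localised function is replaced by a Borel representative.\<close>
    obtain G where G[measurable]: "G \<in> borel_measurable lborel" and FG: "AE x in lborel. F x = G x"
      using completion_ex_borel_measurable_real[OF borel_measurable_integrable[OF int]] by blast
    have FG': "AE x in lebesgue. F x = G x" using FG by (rule AE_completion)
    have "integrable lebesgue G"
      using int by (subst integrable_cong_AE[where g=F]) (use FG' measurable_completion[OF G] borel_measurable_integrable[OF int] in \<open>auto elim: eventually_mono\<close>)
    then have Gi: "integrable lborel G" by (simp add: integrable_completion)
    have "AE x in lborel. x \<in> ball c R \<longrightarrow> G x = 0"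
    proof (rule AE_zero_if_ball_integrals_zero[OF Gi])
      fix x r assume r: "r > 0" "cball x r \<subseteq> ball c R"
      have "(LINT y:ball x r|lborel. G y) = (LINT y:ball x r|lebesgue. G y)"
        unfolding set_lebesgue_integral_def using G by (intro integral_completion[symmetric] borel_measurable_scaleR borel_measurable_indicator) auto
      also have "\<dots> = (LINT y:ball x r|lebesgue. F y)"
        unfolding set_lebesgue_integral_def
        using FG' borel_measurable_integrable[OF int] measurable_completion[OF G]
        by (intro integral_cong_AE borel_measurable_scaleR borel_measurable_indicator) (auto elim: eventually_mono)
      also have "\<dots> = (LINT y:ball x r|lebesgue. f y)"
        unfolding set_lebesgue_integral_def F_def
        using order_trans[OF ball_subset_cball order_trans[OF r(2) ball_subset_cball]]
        by (intro Bochner_Integration.integral_cong refl) (auto simp: indicator_def subset_eq)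
      also have "\<dots> = 0"
        by (intro ball0 r(1) order_trans[OF r(2) order_trans[OF ball_subset_cball R]])
      finally show "(LINT y:ball x r|lborel. G y) = 0" .
    qed auto
    then have "AE x in lebesgue. x \<in> ball c R \<longrightarrow> G x = 0" by (rule AE_completion)
    with FG' show ?thesis
      by eventually_elim (use ball_subset_cball[of c R] in \<open>auto simp: F_def\<close>)
  qed
  \<comment> \<open>By Lindelof countably many of the balls cover \<open>U\<close>, so the local
    null sets have a null union.\<close>
  define \<F> where "\<F> = {ball c R | c R. cball c R \<subseteq> U}"
  have "\<Union>\<F> = U"
  proof
    show "\<Union>\<F> \<subseteq> U" unfolding \<F>_def using ball_subset_cball by blast
    show "U \<subseteq> \<Union>\<F>"
    proof
      fix x assume "x \<in> U"
      then obtain e where "e > 0" "cball x e \<subseteq> U" using U open_contains_cball by blast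
      then show "x \<in> \<Union>\<F>" unfolding \<F>_def by (intro UnionI[of "ball x e"]) auto
    qed
  qed
  moreover obtain \<G> where \<G>: "\<G> \<subseteq> \<F>" "countable \<G>" "\<Union>\<G> = \<Union>\<F>"
    using Lindelof[of \<F>] unfolding \<F>_def by blast
  ultimately have "\<Union>\<G> = U" by simp
  have "AE x in lebesgue. \<forall>B\<in>\<G>. x \<in> B \<longrightarrow> f x = 0"
    unfolding AE_ball_countable[OF \<G>(2)]
  proof
    fix B assume "B \<in> \<G>"
    then obtain c R where "B = ball c R" "cball c R \<subseteq> U" using \<G>(1) unfolding \<F>_def by blast
    then show "AE x in lebesgue. x \<in> B \<longrightarrow> f x = 0" using loc by simp
  qed
  then show ?thesis
    by eventually_elim (use \<open>\<Union>\<G> = U\<close> in blast)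
qed

section \<open>Borel sets are Hausdorff measurable\<close>

lemma hausdorff1_pre_antimono: "\<delta> \<le> \<delta>' \<Longrightarrow> hausdorff1_pre \<delta>' A \<le> hausdorff1_pre \<delta> A"
  unfolding hausdorff1_pre_def by (intro INF_superset_mono) (auto intro: order_trans)

lemma hausdorff1_pre_le_outer: "0 < \<delta> \<Longrightarrow> hausdorff1_pre \<delta> A \<le> hausdorff1_outer A"
  unfolding hausdorff1_outer_def by (intro SUP_upper) auto

lemma hausdorff1_outer_mono: "A \<subseteq> B \<Longrightarrow> hausdorff1_outer A \<le> hausdorff1_outer B"
  unfolding hausdorff1_outer_def by (intro SUP_mono) (auto intro: hausdorff1_pre_mono)

lemma hausdorff1_outer_empty: "hausdorff1_outer {} = 0"
  using hausdorff1_outer_measure_space unfolding outer_measure_space_def positive_def by blast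

lemma hausdorff1_outer_UN: "hausdorff1_outer (\<Union>i. A i) \<le> (\<Sum>i::nat. hausdorff1_outer (A i))"
  unfolding hausdorff1_outer_def[of "\<Union>i. A i"]
proof (rule SUP_least)
  fix \<delta> :: real assume "\<delta> \<in> {0<..}"
  then have "(\<Sum>i. hausdorff1_pre \<delta> (A i)) \<le> (\<Sum>i. hausdorff1_outer (A i))"
    by (intro suminf_le hausdorff1_pre_le_outer) auto
  then show "hausdorff1_pre \<delta> (\<Union>i. A i) \<le> (\<Sum>i. hausdorff1_outer (A i))"
    using hausdorff1_pre_subadditive order_trans by blast
qed

lemma hausdorff1_outer_Un: "hausdorff1_outer (A \<union> B) \<le> hausdorff1_outer A + hausdorff1_outer B"
proof -
  have "hausdorff1_outer (\<Union>i::nat. if i = 0 then A else if i = 1 then B else {})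
    \<le> (\<Sum>i::nat. hausdorff1_outer (if i = 0 then A else if i = 1 then B else {}))"
    by (rule hausdorff1_outer_UN)
  also have "(\<Sum>i::nat. hausdorff1_outer (if i = 0 then A else if i = 1 then B else {})) =
     (\<Sum>i\<in>{0,1::nat}. hausdorff1_outer (if i = 0 then A else if i = 1 then B else {}))"
    by (rule suminf_finite) (auto simp: hausdorff1_outer_empty)
  also have "\<dots> = hausdorff1_outer A + hausdorff1_outer B" by simp
  also have "(\<Union>i::nat. if i = 0 then A else if i = 1 then B else {}) = A \<union> B"
    by (auto split: if_splits intro: exI[of _ "0::nat"] exI[of _ "1::nat"])
  finally show ?thesis .
qed

text \<open>A covering set of diameter below \<open>e\<close> cannot meet both \<open>A\<close> and
  \<open>B\<close>, so a fine cover of the union splits into a cover of each.\<close>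

lemma hausdorff1_outer_separated:
  assumes e: "e > 0" and sep: "\<And>x y. x \<in> A \<Longrightarrow> y \<in> B \<Longrightarrow> e \<le> dist x y"
  shows "hausdorff1_outer A + hausdorff1_outer B \<le> hausdorff1_outer (A \<union> B)"
proof -
  have pre: "hausdorff1_pre \<delta> A + hausdorff1_pre \<delta> B \<le> hausdorff1_pre \<delta> (A \<union> B)" if \<delta>: "0 < \<delta>" "\<delta> < e" for \<delta>
    unfolding hausdorff1_pre_def[of \<delta> "A \<union> B"]
  proof (rule INF_greatest)
    fix C :: "nat \<Rightarrow> 'a set"
    assume "C \<in> {C. A \<union> B \<subseteq> (\<Union>i. C i) \<and> (\<forall>i. bounded (C i) \<and> diameter (C i) \<le> \<delta>)}"
    then have C: "A \<union> B \<subseteq> (\<Union>i. C i)" "\<And>i. bounded (C i)" "\<And>i. diameter (C i) \<le> \<delta>" by auto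
    define D where "D S i = (if C i \<inter> S = {} then {} else C i)" for S i
    have D: "hausdorff1_pre \<delta> S \<le> (\<Sum>i. ennreal (diameter (D S i)))" if S: "S \<subseteq> A \<union> B" for S
    proof (rule hausdorff1_pre_le)
      show "S \<subseteq> (\<Union>i. D S i)"
      proof
        fix x assume x: "x \<in> S"
        then obtain i where "x \<in> C i" using C(1) S by blast
        with x have "x \<in> D S i" by (auto simp: D_def)
        then show "x \<in> (\<Union>i. D S i)" by blast
      qed
    qed (use C \<delta> in \<open>auto simp: D_def\<close>)
    have "hausdorff1_pre \<delta> A + hausdorff1_pre \<delta> B \<le>
      (\<Sum>i. ennreal (diameter (D A i))) + (\<Sum>i. ennreal (diameter (D B i)))"
      by (intro add_mono D) auto
    also have "\<dots> = (\<Sum>i. ennreal (diameter (D A i)) + ennreal (diameter (D B i)))"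
      by (rule suminf_add) auto
    also have "\<dots> \<le> (\<Sum>i. ennreal (diameter (C i)))"
    proof (intro suminf_le)
      fix i
      have "C i \<inter> A = {} \<or> C i \<inter> B = {}"
      proof (rule ccontr)
        assume "\<not> ?thesis"
        then obtain x y where xy: "x \<in> C i" "x \<in> A" "y \<in> C i" "y \<in> B" by blast
        have "dist x y \<le> diameter (C i)" using xy C(2) by (intro diameter_bounded_bound) auto
        with C(3)[of i] sep[OF xy(2,4)] \<delta> show False by linarith
      qed
      then show "ennreal (diameter (D A i)) + ennreal (diameter (D B i)) \<le> ennreal (diameter (C i))"
        by (auto simp: D_def)
    qed auto
    finally show "hausdorff1_pre \<delta> A + hausdorff1_pre \<delta> B \<le> (\<Sum>i. ennreal (diameter (C i)))" .
  qed
  have "hausdorff1_pre \<delta>1 A + hausdorff1_pre \<delta>2 B \<le> hausdorff1_outer (A \<union> B)" if "0 < \<delta>1" "0 < \<delta>2" for \<delta>1 \<delta>2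
  proof -
    \<comment> \<open>Refining the scale only increases the premeasure, so both terms may be
      compared at one scale that also lies below the separation \<open>e\<close>.\<close>
    define d where "d = min (min \<delta>1 \<delta>2) (e/2)"
    have d: "0 < d" "d < e" "d \<le> \<delta>1" "d \<le> \<delta>2" using that e by (auto simp: d_def)
    have "hausdorff1_pre \<delta>1 A + hausdorff1_pre \<delta>2 B \<le> hausdorff1_pre d A + hausdorff1_pre d B"
      by (intro add_mono hausdorff1_pre_antimono d)
    also have "\<dots> \<le> hausdorff1_pre d (A \<union> B)" by (rule pre[OF d(1,2)])
    also have "\<dots> \<le> hausdorff1_outer (A \<union> B)" by (rule hausdorff1_pre_le_outer[OF d(1)])
    finally show ?thesis .
  qed
  then have "(SUP \<delta>1\<in>{0<..}. hausdorff1_pre \<delta>1 A + hausdorff1_pre \<delta>2 B) \<le> hausdorff1_outer (A \<union> B)" if "0 < \<delta>2" for \<delta>2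
    using that by (intro SUP_least) auto
  then have "hausdorff1_outer A + hausdorff1_pre \<delta>2 B \<le> hausdorff1_outer (A \<union> B)" if "0 < \<delta>2" for \<delta>2
    using that by (subst (asm) ennreal_SUP_add_left) (auto simp: hausdorff1_outer_def[of A])
  then have "(SUP \<delta>2\<in>{0<..}. hausdorff1_outer A + hausdorff1_pre \<delta>2 B) \<le> hausdorff1_outer (A \<union> B)"
    by (intro SUP_least) auto
  then show ?thesis
    by (subst (asm) add.commute, subst (asm) ennreal_SUP_add_left) (auto simp: hausdorff1_outer_def[of B] add.commute)
qed

text \<open>Caratheodory's criterion: the layers \<open>R k\<close> of points at distance about \<open>1/k\<close> from \<open>S\<close> are
  separated from each other for indices of equal parity, so their measures are summable.\<close>

lemma closed_in_sets_hausdorff1: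
  fixes S :: "'a::metric_space set"
  assumes S: "closed S"
  shows "S \<in> sets hausdorff1"
proof (cases "S = {}")
  case False
  have le: "hausdorff1_outer (S \<inter> X) + hausdorff1_outer (X - S) \<le> hausdorff1_outer X" for X
  proof (cases "hausdorff1_outer X = \<infinity>")
    case fin: False
    define A where "A n = {x\<in>X. 1 / real (Suc n) \<le> infdist x S}" for n :: nat
    define R where "R k = {x\<in>X. 1 / real (k + 2) \<le> infdist x S \<and> infdist x S < 1 / real (k + 1)}" for k :: nat
    have sepS: "hausdorff1_outer (S \<inter> X) + hausdorff1_outer (A n) \<le> hausdorff1_outer X" for n
    proof -
      have "hausdorff1_outer (S \<inter> X) + hausdorff1_outer (A n) \<le> hausdorff1_outer ((S \<inter> X) \<union> A n)"
      proof (rule hausdorff1_outer_separated[of "1 / real (Suc n)"])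
        fix x y assume "x \<in> S \<inter> X" "y \<in> A n"
        then show "1 / real (Suc n) \<le> dist x y"
          using infdist_le[of x S y] by (auto simp: A_def dist_commute)
      qed simp
      also have "\<dots> \<le> hausdorff1_outer X" by (rule hausdorff1_outer_mono) (auto simp: A_def)
      finally show ?thesis .
    qed
    have par: "(\<Sum>j<N. hausdorff1_outer (R (2 * j + c))) \<le> hausdorff1_outer (\<Union>j<N. R (2 * j + c))" for c N
    proof (induction N)
      case 0 show ?case by (simp add: hausdorff1_outer_empty)
    next
      case (Suc N)
      have "(\<Sum>j<Suc N. hausdorff1_outer (R (2 * j + c))) \<le>
          hausdorff1_outer (\<Union>j<N. R (2 * j + c)) + hausdorff1_outer (R (2 * N + c))"
        using Suc by (simp add: add_right_mono)
      also have "\<dots> \<le> hausdorff1_outer ((\<Union>j<N. R (2 * j + c)) \<union> R (2 * N + c))"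
      \<comment> \<open>For \<open>N = 0\<close> the union is empty, and with \<open>c = 0\<close>
        the gap below would involve 1/0. Otherwise the earlier layers have distance at least
        \<open>1 / (2 * N + c)\<close> from \<open>S\<close>, and the new layer less than
        \<open>1 / (2 * N + c + 1)\<close>.\<close>
      proof (cases "N = 0")
        case True then show ?thesis by (simp add: hausdorff1_outer_empty)
      next
        case False
        show ?thesis
        proof (rule hausdorff1_outer_separated)
          show "0 < 1 / real (2 * N + c) - 1 / real (2 * N + c + 1)"
            using False divide_strict_left_mono[of "real (2 * N + c)" "real (2 * N + c + 1)" 1] by simp
          fix x y assume x: "x \<in> (\<Union>j<N. R (2 * j + c))" and y: "y \<in> R (2 * N + c)"
          then obtain j where j: "j < N" "x \<in> R (2 * j + c)" by auto
          have "1 / real (2 * N + c) \<le> 1 / real (2 * j + c + 2)"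
            using j(1) by (intro divide_left_mono) auto
          also have "\<dots> \<le> infdist x S" using j(2) by (simp add: R_def)
          also have "\<dots> \<le> infdist y S + dist x y" by (rule infdist_triangle)
          also have "infdist y S \<le> 1 / real (2 * N + c + 1)" using y by (simp add: R_def)
          finally show "1 / real (2 * N + c) - 1 / real (2 * N + c + 1) \<le> dist x y" by simp
        qed
      qed
      also have "(\<Union>j<N. R (2 * j + c)) \<union> R (2 * N + c) = (\<Union>j<Suc N. R (2 * j + c))"
        by (auto simp: less_Suc_eq)
      finally show ?case .
    qed
    have par': "(\<Sum>j<N. hausdorff1_outer (R (2 * j + c))) \<le> hausdorff1_outer X" for c N
      using par[of c N] by (rule order_trans) (intro hausdorff1_outer_mono, auto simp: R_def)
    have bd: "(\<Sum>k<n. hausdorff1_outer (R k)) \<le> 2 * hausdorff1_outer X" for n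
    proof -
      have "(\<Sum>k<n. hausdorff1_outer (R k)) \<le> (\<Sum>k<2*n. hausdorff1_outer (R k))"
        by (intro sum_mono2) auto
      also have "\<dots> = (\<Sum>j<n. hausdorff1_outer (R (2 * j + 0))) + (\<Sum>j<n. hausdorff1_outer (R (2 * j + 1)))"
        by (induction n) (auto simp: algebra_simps)
      also have "\<dots> \<le> hausdorff1_outer X + hausdorff1_outer X" by (intro add_mono par')
      finally show ?thesis by (simp add: mult_2)
    qed
    define a where "a k = enn2real (hausdorff1_outer (R k))" for k
    have fin': "hausdorff1_outer X < top" using fin by (simp add: less_top)
    have Rfin: "hausdorff1_outer (R k) = ennreal (a k)" for k
    proof -
      have "hausdorff1_outer (R k) \<le> hausdorff1_outer X" by (rule hausdorff1_outer_mono) (auto simp: R_def)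
      with fin' show ?thesis unfolding a_def by (simp add: ennreal_enn2real_if top_unique less_top)
    qed
    have a0: "0 \<le> a k" for k by (simp add: a_def)
    have "summable a"
    proof (rule summableI_nonneg_bounded[OF a0])
      fix n
      have "ennreal (\<Sum>k<n. a k) \<le> 2 * hausdorff1_outer X"
        using bd[of n] by (simp add: Rfin sum_ennreal a0)
      then show "(\<Sum>k<n. a k) \<le> enn2real (2 * hausdorff1_outer X)"
        using fin' by (metis enn2real_mono enn2real_ennreal a0 sum_nonneg ennreal_mult_less_top ennreal_numeral ennreal_less_top)
    qed
    have "hausdorff1_outer (S \<inter> X) + hausdorff1_outer (X - S) \<le> hausdorff1_outer X + ennreal e" if e: "e > 0" for e :: real
    proof -
      \<comment> \<open>What separates \<open>X - S\<close> from \<open>A N\<close> consists of the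
        layers from \<open>N\<close> on, and their measures form a tail of a convergent
        series.\<close>
      obtain N where N: "\<And>n. n \<ge> N \<Longrightarrow> norm (\<Sum>i. a (i + n)) < e"
        using suminf_exist_split[OF e \<open>summable a\<close>] by blast
      have cov: "X - S \<subseteq> A N \<union> (\<Union>i. R (i + N))"
      proof
        fix x assume x: "x \<in> X - S"
        have pos: "infdist x S > 0" using x S False infdist_pos_not_in_closed by blast
        show "x \<in> A N \<union> (\<Union>i. R (i + N))"
        proof (cases "1 / real (Suc N) \<le> infdist x S")
          case True then show ?thesis using x by (auto simp: A_def)
        next
          case nle: False
          define k where "k = (LEAST k. 1 / real (Suc k) \<le> infdist x S)"
          obtain m where m: "1 / real (Suc m) \<le> infdist x S"
            using reals_Archimedean[OF pos] by (auto simp: inverse_eq_divide intro: less_imp_le)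
          have k: "1 / real (Suc k) \<le> infdist x S" unfolding k_def by (rule LeastI[of "\<lambda>k. 1 / real (Suc k) \<le> infdist x S", OF m])
          have "k > N"
          proof (rule ccontr)
            assume "\<not> k > N"
            then have "1 / real (Suc N) \<le> 1 / real (Suc k)" by (intro divide_left_mono) auto
            with k nle show False by linarith
          qed
          then obtain i where i: "k = Suc (i + N)" by (metis add.commute less_imp_Suc_add)
          have "\<not> 1 / real (Suc (i + N)) \<le> infdist x S"
            using not_less_Least[of "i + N" "\<lambda>k. 1 / real (Suc k) \<le> infdist x S"] i by (simp add: k_def)
          then have "x \<in> R (i + N)" using k x by (simp add: R_def i)
          then show ?thesis by blast
        qed
      qed
      have "hausdorff1_outer (X - S) \<le> hausdorff1_outer (A N \<union> (\<Union>i. R (i + N)))"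
        by (rule hausdorff1_outer_mono[OF cov])
      also have "\<dots> \<le> hausdorff1_outer (A N) + hausdorff1_outer (\<Union>i. R (i + N))"
        by (rule hausdorff1_outer_Un)
      also have "\<dots> \<le> hausdorff1_outer (A N) + ennreal e"
      proof (rule add_left_mono)
        have "hausdorff1_outer (\<Union>i. R (i + N)) \<le> (\<Sum>i. hausdorff1_outer (R (i + N)))"
          by (rule hausdorff1_outer_UN)
        also have "\<dots> = ennreal (\<Sum>i. a (i + N))"
          unfolding Rfin using \<open>summable a\<close> a0 by (intro suminf_ennreal2) auto
        also have "\<dots> \<le> ennreal e" using N[of N] by (intro ennreal_leI) auto
        finally show "hausdorff1_outer (\<Union>i. R (i + N)) \<le> ennreal e" .
      qed
      finally have "hausdorff1_outer (S \<inter> X) + hausdorff1_outer (X - S) \<le>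
          hausdorff1_outer (S \<inter> X) + hausdorff1_outer (A N) + ennreal e"
        by (simp add: add.assoc add_left_mono)
      also have "\<dots> \<le> hausdorff1_outer X + ennreal e" by (intro add_right_mono sepS)
      finally show ?thesis .
    qed
    then show ?thesis by - (rule ennreal_le_epsilon, simp)
  qed simp
  have "hausdorff1_outer (S \<inter> X) + hausdorff1_outer ((UNIV - S) \<inter> X) = hausdorff1_outer X" for X
  proof (rule antisym)
    have "(UNIV - S) \<inter> X = X - S" by auto
    with le[of X] show "hausdorff1_outer (S \<inter> X) + hausdorff1_outer ((UNIV - S) \<inter> X) \<le> hausdorff1_outer X" by simp
    have "hausdorff1_outer X = hausdorff1_outer ((S \<inter> X) \<union> ((UNIV - S) \<inter> X))"
      by (rule arg_cong[of _ _ hausdorff1_outer]) auto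
    also have "\<dots> \<le> hausdorff1_outer (S \<inter> X) + hausdorff1_outer ((UNIV - S) \<inter> X)"
      by (rule hausdorff1_outer_Un)
    finally show "hausdorff1_outer X \<le> hausdorff1_outer (S \<inter> X) + hausdorff1_outer ((UNIV - S) \<inter> X)" .
  qed
  then show ?thesis
    unfolding sets_hausdorff1 lambda_system_def by simp
qed simp

lemma sets_borel_subset_hausdorff1: "sets borel \<subseteq> sets (hausdorff1 :: 'a::metric_space measure)"
  unfolding borel_eq_closed
  by (subst sets_measure_of, simp) (rule sets.sigma_sets_subset'[where M=hausdorff1], use closed_in_sets_hausdorff1 in auto)

lemma measurable_hausdorff1_borel: "f \<in> borel_measurable borel \<Longrightarrow> f \<in> borel_measurable hausdorff1"
  using sets_borel_subset_hausdorff1 by (auto simp: measurable_def)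

text \<open>A subset of a null set satisfies Caratheodory's condition by subadditivity. Completeness
  allows circle integrals of expressions in the arbitrary representative \<open>Du\<close> to be
  evaluated through Borel functions equal to them almost everywhere.\<close>

lemma complete_measure_hausdorff1: "complete_measure (hausdorff1 :: 'a::metric_space measure)"
proof
  fix A B :: "'a set" assume "B \<subseteq> A" "A \<in> null_sets hausdorff1"
  then have "hausdorff1_outer A = 0" by (metis emeasure_hausdorff1 null_setsD1 null_setsD2)
  then have B0: "hausdorff1_outer (B \<inter> X) = 0" for X
    using hausdorff1_outer_mono[of "B \<inter> X" A] \<open>B \<subseteq> A\<close> by auto
  have "hausdorff1_outer ((UNIV - B) \<inter> X) = hausdorff1_outer X" for X
  proof (rule antisym)
    show "hausdorff1_outer ((UNIV - B) \<inter> X) \<le> hausdorff1_outer X" by (rule hausdorff1_outer_mono) auto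
    have "hausdorff1_outer X \<le> hausdorff1_outer ((B \<inter> X) \<union> ((UNIV - B) \<inter> X))"
      by (rule hausdorff1_outer_mono) auto
    also have "\<dots> \<le> hausdorff1_outer (B \<inter> X) + hausdorff1_outer ((UNIV - B) \<inter> X)"
      by (rule hausdorff1_outer_Un)
    finally show "hausdorff1_outer X \<le> hausdorff1_outer ((UNIV - B) \<inter> X)" by (simp add: B0)
  qed
  then show "B \<in> sets hausdorff1"
    unfolding sets_hausdorff1 lambda_system_def by (simp add: B0)
qed

lemma (in complete_measure) borel_measurable_AE_eq:
  assumes g: "g \<in> borel_measurable M" and ae: "AE x in M. f x = g x"
  shows "f \<in> borel_measurable M"
proof (rule measurableI)
  fix S assume S: "S \<in> sets (borel :: 'b measure)"
  have "g -` S \<inter> space M \<in> sets M" by (rule measurable_sets[OF g S])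
  moreover have "AE x in M. x \<in> g -` S \<inter> space M \<longleftrightarrow> x \<in> f -` S \<inter> space M"
    using ae by eventually_elim auto
  ultimately show "f -` S \<inter> space M \<in> sets M"
    using in_sets_AE[of "g -` S \<inter> space M" "f -` S \<inter> space M"] by blast
qed simp

lemma (in complete_measure) integral_AE_eq:
  fixes f :: "'a \<Rightarrow> 'b::{banach, second_countable_topology}"
  assumes g: "g \<in> borel_measurable M" and ae: "AE x in M. f x = g x"
  shows "integral\<^sup>L M f = integral\<^sup>L M g"
  by (rule integral_cong_AE[OF borel_measurable_AE_eq[OF g ae] g ae])

section \<open>Half circles and polar coordinates\<close>

definition polar :: "real \<times> real \<Rightarrow> real \<Rightarrow> real \<Rightarrow> real \<times> real" where
  "polar c r \<theta> = c + (r * cos \<theta>, r * sin \<theta>)"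

lemma dist_polar:
  assumes "r \<ge> 0"
  shows "dist (polar c r \<theta>) (polar c r \<theta>') = 2 * r * \<bar>sin ((\<theta> - \<theta>') / 2)\<bar>"
proof -
  have "(dist (polar c r \<theta>) (polar c r \<theta>'))\<^sup>2 = (r * cos \<theta> - r * cos \<theta>')\<^sup>2 + (r * sin \<theta> - r * sin \<theta>')\<^sup>2"
    by (simp add: polar_def dist_norm norm_prod_def)
  also have "\<dots> = r\<^sup>2 * ((cos \<theta>)\<^sup>2 + (sin \<theta>)\<^sup>2) + r\<^sup>2 * ((cos \<theta>')\<^sup>2 + (sin \<theta>')\<^sup>2) - 2 * r\<^sup>2 * (cos \<theta> * cos \<theta>' + sin \<theta> * sin \<theta>')"
    by algebra
  also have "\<dots> = 2 * r\<^sup>2 - 2 * r\<^sup>2 * cos (2 * ((\<theta> - \<theta>') / 2))"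
  proof -
    have h: "2 * ((\<theta> - \<theta>') / 2) = \<theta> - \<theta>'" by simp
    show ?thesis unfolding h cos_diff by (simp add: algebra_simps)
  qed
  also have "\<dots> = (2 * r * sin ((\<theta> - \<theta>') / 2))\<^sup>2"
    unfolding cos_double_sin by (simp add: algebra_simps power2_eq_square)
  finally have "sqrt ((dist (polar c r \<theta>) (polar c r \<theta>'))\<^sup>2) = sqrt ((2 * r * sin ((\<theta> - \<theta>') / 2))\<^sup>2)"
    by simp
  then show ?thesis using assms by (simp add: abs_mult)
qed

text \<open>The arc is cut into \<open>n\<close> pieces of equal angle. A chord is no longer than
  its arc, so the diameters add up to at most \<open>r * (b - a)\<close>, and \<open>n\<close> is
  taken large enough for the scale \<delta>.\<close>

lemma hausdorff1_outer_arc_le: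
  assumes r: "r > 0" and ab: "a < b"
  shows "hausdorff1_outer (polar c r ` {a<..<b}) \<le> ennreal (r * (b - a))"
  unfolding hausdorff1_outer_def
proof (rule SUP_least)
  fix \<delta> :: real assume "\<delta> \<in> {0<..}"
  then have \<delta>: "\<delta> > 0" by simp
  obtain n where n: "r * (b - a) / \<delta> < real n" using reals_Archimedean2 by blast
  have "r * (b - a) / \<delta> > 0" using r ab \<delta> by simp
  with n have n0: "n > 0" by (intro gr0I) auto
  define h where "h = (b - a) / n"
  have h: "h > 0" "r * h \<le> \<delta>" using n n0 ab \<delta> unfolding h_def by (auto simp: field_simps)
  define C where "C i = (if i < n then polar c r ` {a + i * h .. a + (i + 1) * h} else {})" for i :: nat
  have bd: "bounded (C i)" for i
  proof -
    have "continuous_on {a + i * h .. a + (i + 1) * h} (polar c r)"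
      unfolding polar_def by (intro continuous_intros)
    then show ?thesis
      by (auto simp: C_def intro!: compact_imp_bounded compact_continuous_image)
  qed
  have dm: "diameter (C i) \<le> (if i < n then r * h else 0)" for i
  proof (cases "i < n")
    case True
    have "diameter (polar c r ` {a + i * h .. a + (i + 1) * h}) \<le> r * h"
    proof (rule diameter_le)
      show "polar c r ` {a + i * h .. a + (i + 1) * h} \<noteq> {} \<or> 0 \<le> r * h" using r h by simp
      fix x y assume "x \<in> polar c r ` {a + i * h .. a + (i + 1) * h}" "y \<in> polar c r ` {a + i * h .. a + (i + 1) * h}"
      then obtain s t where st: "x = polar c r s" "y = polar c r t" "\<bar>s - t\<bar> \<le> h"
        by (auto simp: algebra_simps abs_le_iff)
      have "dist x y \<le> 2 * r * \<bar>(s - t) / 2\<bar>"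
        unfolding st dist_polar[OF less_imp_le[OF r]] using r abs_sin_x_le_abs_x[of "(s - t)/2"] by (intro mult_left_mono) auto
      also have "\<dots> \<le> r * h" using st(3) r by simp
      finally show "norm (x - y) \<le> r * h" by (simp add: dist_norm)
    qed
    with True show ?thesis by (simp add: C_def)
  qed (simp add: C_def)
  have cov: "polar c r ` {a<..<b} \<subseteq> (\<Union>i. C i)"
  proof
    fix x assume "x \<in> polar c r ` {a<..<b}"
    then obtain t where t: "a < t" "t < b" "x = polar c r t" by auto
    define i where "i = nat \<lfloor>(t - a) / h\<rfloor>"
    have "(t - a) / h \<ge> 0" using t h by simp
    then have i: "real i \<le> (t - a) / h" "(t - a) / h < real i + 1" unfolding i_def by linarith+
    have "(t - a) / h < n" using t h n0 unfolding h_def by (simp add: field_simps)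
    with i have "i < n" by linarith
    moreover have "t \<in> {a + i * h .. a + (i + 1) * h}"
      using i h by (simp add: field_simps)
    ultimately have "x \<in> C i" using t(3) by (simp add: C_def)
    then show "x \<in> (\<Union>i. C i)" by blast
  qed
  have "hausdorff1_pre \<delta> (polar c r ` {a<..<b}) \<le> (\<Sum>i. ennreal (diameter (C i)))"
    by (rule hausdorff1_pre_le[OF cov bd]) (use dm h \<delta> in \<open>smt (verit)\<close>)
  also have "\<dots> \<le> (\<Sum>i. ennreal (if i < n then r * h else 0))"
    by (intro suminf_le ennreal_leI dm) auto
  also have "\<dots> = (\<Sum>i<n. ennreal (r * h))"
    by (subst suminf_finite[of "{..<n}"]) auto
  also have "\<dots> = ennreal (real n * (r * h))"
    by (simp add: ennreal_mult' ennreal_of_nat_eq_real_of_nat)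
  also have "real n * (r * h) = r * (b - a)" using n0 by (simp add: h_def)
  finally show "hausdorff1_pre \<delta> (polar c r ` {a<..<b}) \<le> ennreal (r * (b - a))" .
qed

text \<open>For \<open>q < 1\<close> a short chord is at least \<open>q\<close> times its arc, so
  each set of a fine cover pulls back to a parameter set of length at most its diameter divided by
  \<open>q r\<close>; countable subadditivity of Lebesgue measure then bounds \<open>b - a\<close>.
  The restriction of the angle to \<pi> ensures that a short chord means close parameters.\<close>

lemma hausdorff1_outer_arc_ge:
  assumes r: "r > 0" and ab: "a < b" "b - a \<le> pi"
  shows "ennreal (r * (b - a)) \<le> hausdorff1_outer (polar c r ` {a<..<b})"
proof -
  have main: "ennreal (q * (r * (b - a))) \<le> hausdorff1_outer (polar c r ` {a<..<b})" if q: "0 < q" "q < 1" for q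
  proof -
    have "((\<lambda>h. sin h / h) \<longlongrightarrow> (1::real)) (at 0)"
      using DERIV_sin[of "0::real"] by (simp add: DERIV_def)
    from order_tendstoD(1)[OF this q(2)] obtain d where d: "d > 0" "\<And>h. h \<noteq> 0 \<Longrightarrow> \<bar>h\<bar> < d \<Longrightarrow> q < sin h / h"
      by (auto simp: eventually_at dist_real_def)
    \<comment> \<open>Half-angles below \<eta> satisfy \<open>sin y > q y\<close>. The scale
      \<open>r * sin \<eta>\<close> chosen next forces half-angles below \<eta>, because sine is
      increasing up to \<open>pi / 2\<close>.\<close>
    define \<eta> where "\<eta> = min (d/2) (pi/4)"
    have \<eta>: "0 < \<eta>" "\<eta> < d" "\<eta> < pi/2" using d(1) pi_gt_zero by (auto simp: \<eta>_def min_def)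
    have s0: "sin \<eta> > 0" using \<eta> pi_gt_zero by (intro sin_gt_zero) auto
    define \<delta> where "\<delta> = r * sin \<eta>"
    have \<delta>: "\<delta> > 0" using r s0 by (simp add: \<delta>_def)
    have key: "q * r * \<bar>s - t\<bar> \<le> dist (polar c r s) (polar c r t)"
      if st: "s \<in> {a<..<b}" "t \<in> {a<..<b}" and le: "dist (polar c r s) (polar c r t) \<le> \<delta>" for s t
    proof (cases "s = t")
      case False
      define y where "y = \<bar>s - t\<bar> / 2"
      have y: "0 < y" "y < pi/2" using st ab(2) False by (auto simp: y_def)
      have dst: "dist (polar c r s) (polar c r t) = 2 * r * sin y"
      proof -
        have "\<bar>sin ((s - t) / 2)\<bar> = \<bar>sin y\<bar>" 
        proof (cases "s \<ge> t")
          case True then show ?thesis by (simp add: y_def)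
        next
          case f: False
          then have "(s - t) / 2 = - y" by (simp add: y_def field_simps)
          then show ?thesis by simp
        qed
        also have "\<dots> = sin y" using y sin_gt_zero[of y] by simp
        finally show ?thesis unfolding dist_polar[OF less_imp_le[OF r]] by simp
      qed
      have "y < \<eta>"
      proof (rule ccontr)
        assume "\<not> y < \<eta>"
        then have "sin \<eta> \<le> sin y" using y \<eta> by (intro sin_monotone_2pi_le) auto
        have "2 * r * sin y \<le> r * sin \<eta>" using le unfolding dst \<delta>_def .
        then have "r * (2 * sin y) \<le> r * sin \<eta>" by (simp add: mult_ac)
        then have "2 * sin y \<le> sin \<eta>" using r by simp
        with \<open>sin \<eta> \<le> sin y\<close> show False using s0 by linarith
      qed
      then have "q < sin y / y" using d(2)[of y] y \<eta> by auto
      then have "q * y \<le> sin y" using y by (simp add: field_simps)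
      then have "2 * r * (q * y) \<le> 2 * r * sin y" using r by (intro mult_left_mono) auto
      then show ?thesis unfolding dst by (simp add: y_def mult_ac)
    qed simp
    have "ennreal (q * (r * (b - a))) \<le> hausdorff1_pre \<delta> (polar c r ` {a<..<b})"
      unfolding hausdorff1_pre_def
    proof (rule INF_greatest)
      fix C :: "nat \<Rightarrow> (real \<times> real) set"
      assume "C \<in> {C. polar c r ` {a<..<b} \<subseteq> (\<Union>i. C i) \<and> (\<forall>i. bounded (C i) \<and> diameter (C i) \<le> \<delta>)}"
      then have C: "polar c r ` {a<..<b} \<subseteq> (\<Union>i. C i)" "\<And>i. bounded (C i)" "\<And>i. diameter (C i) \<le> \<delta>" by auto
      define T where "T i = {t\<in>{a<..<b}. polar c r t \<in> C i}" for i
      \<comment> \<open>The covering sets are arbitrary and \<open>T i\<close> may fail to be Borel;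
        its interval hull has the same diameter and is Borel.\<close>
      have "\<exists>J\<in>sets borel. T i \<subseteq> J \<and> ennreal (q * r) * emeasure lborel J \<le> ennreal (diameter (C i))" for i
      proof (cases "T i = {}")
        case True then show ?thesis by (intro bexI[of _ "{}"]) auto
      next
        case False
        have bdT: "bdd_above (T i)" "bdd_below (T i)"
          by (auto simp: T_def intro!: bdd_aboveI[of _ b] bdd_belowI[of _ a] less_imp_le)
        have dT: "q * r * (s - t) \<le> diameter (C i)" if "s \<in> T i" "t \<in> T i" for s t
        proof -
          have 1: "dist (polar c r s) (polar c r t) \<le> diameter (C i)"
            using that C(2) by (intro diameter_bounded_bound) (auto simp: T_def)
          have "q * r * \<bar>s - t\<bar> \<le> dist (polar c r s) (polar c r t)"
            using that 1 C(3)[of i] by (intro key) (auto simp: T_def)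
          moreover have "q * r * (s - t) \<le> q * r * \<bar>s - t\<bar>" using q r by (intro mult_left_mono) auto
          ultimately show ?thesis using 1 by linarith
        qed
        have "Sup (T i) \<le> t + diameter (C i) / (q * r)" if "t \<in> T i" for t
          using dT[OF _ that] False q r by (intro cSup_least) (auto simp: field_simps)
        then have "Sup (T i) - diameter (C i) / (q * r) \<le> Inf (T i)"
          using False by (intro cInf_greatest) (auto simp: algebra_simps)
        then have 2: "q * r * (Sup (T i) - Inf (T i)) \<le> diameter (C i)"
          using q r by (simp add: field_simps)
        have "Inf (T i) \<le> Sup (T i)" using False bdT by (intro cInf_le_cSup) auto
        then have "ennreal (q * r) * emeasure lborel {Inf (T i)..Sup (T i)} = ennreal (q * r * (Sup (T i) - Inf (T i)))"
          using q r by (simp add: ennreal_mult)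
        also have "\<dots> \<le> ennreal (diameter (C i))" by (rule ennreal_leI[OF 2])
        finally show ?thesis
          using bdT by (intro bexI[of _ "{Inf (T i)..Sup (T i)}"]) (auto intro: cInf_lower cSup_upper)
      qed
      then have "\<exists>J. \<forall>i. J i \<in> sets borel \<and> T i \<subseteq> J i \<and> ennreal (q * r) * emeasure lborel (J i) \<le> ennreal (diameter (C i))"
        unfolding Bex_def by (intro choice) blast
      then obtain J where J: "\<And>i. J i \<in> sets borel" "\<And>i. T i \<subseteq> J i" "\<And>i. ennreal (q * r) * emeasure lborel (J i) \<le> ennreal (diameter (C i))"
        by blast
      have cov: "{a<..<b} \<subseteq> (\<Union>i. J i)"
      proof
        fix t assume t: "t \<in> {a<..<b}"
        then obtain i where "polar c r t \<in> C i" using C(1) by blast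
        with t have "t \<in> T i" by (simp add: T_def)
        with J(2) show "t \<in> (\<Union>i. J i)" by blast
      qed
      have "ennreal (q * (r * (b - a))) = ennreal (q * r) * emeasure lborel {a<..<b}"
        using ab q r by (simp add: mult.assoc flip: ennreal_mult)
      also have "\<dots> \<le> ennreal (q * r) * emeasure lborel (\<Union>i. J i)"
        using J(1) cov by (intro mult_left_mono emeasure_mono) auto
      also have "\<dots> \<le> ennreal (q * r) * (\<Sum>i. emeasure lborel (J i))"
        using J(1) by (intro mult_left_mono emeasure_subadditive_countably) auto
      also have "\<dots> = (\<Sum>i. ennreal (q * r) * emeasure lborel (J i))"
        by (rule ennreal_suminf_cmult[symmetric])
      also have "\<dots> \<le> (\<Sum>i. ennreal (diameter (C i)))"
        by (intro suminf_le J) auto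
      finally show "ennreal (q * (r * (b - a))) \<le> (\<Sum>i. ennreal (diameter (C i)))" .
    qed
    also have "\<dots> \<le> hausdorff1_outer (polar c r ` {a<..<b})" by (rule hausdorff1_pre_le_outer[OF \<delta>])
    finally show ?thesis .
  qed
  \<comment> \<open>The double successor keeps \<open>q\<close> positive already at
    \<open>n = 0\<close>.\<close>
  have "((\<lambda>n. ennreal ((1 - 1 / real (Suc (Suc n))) * (r * (b - a)))) \<longlongrightarrow> ennreal ((1 - 0) * (r * (b - a)))) sequentially"
    by (intro tendsto_intros tendsto_ennrealI LIMSEQ_Suc[OF LIMSEQ_Suc[OF lim_1_over_n]])
  then have "ennreal ((1 - 0) * (r * (b - a))) \<le> hausdorff1_outer (polar c r ` {a<..<b})"
    by (rule LIMSEQ_le_const2) (intro exI[of _ 0] allI impI main, auto)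
  then show ?thesis by simp
qed

lemma hausdorff1_outer_arc:
  assumes "r > 0" "a \<le> b" "b - a \<le> pi"
  shows "hausdorff1_outer (polar c r ` {a<..<b}) = ennreal (r * (b - a))"
proof (cases "a < b")
  case True
  then show ?thesis using hausdorff1_outer_arc_le[OF assms(1) True] hausdorff1_outer_arc_ge[OF assms(1) True assms(3)]
    by (intro antisym) auto
next
  case False
  with assms show ?thesis by (simp add: hausdorff1_outer_empty)
qed

section \<open>Arc length on a half circle as a measure on angles\<close>

definition semi :: "real set" where "semi = {- (pi/2)<..<pi/2}"

lemma semi_borel [measurable]: "semi \<in> sets borel"
  by (simp add: semi_def)

lemma cos_pos_semi: "\<theta> \<in> semi \<Longrightarrow> cos \<theta> > 0"
  using cos_gt_zero_pi[of \<theta>] by (auto simp: semi_def)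

lemma emeasure_semi: "emeasure lborel semi = ennreal pi"
  by (simp add: semi_def)

lemma fst_snd_borel [measurable]:
  "(fst :: real \<times> real \<Rightarrow> real) \<in> borel_measurable borel" "(snd :: real \<times> real \<Rightarrow> real) \<in> borel_measurable borel"
  by (intro borel_measurable_continuous_onI continuous_intros)+

lemma tan_borel [measurable]: "(tan :: real \<Rightarrow> real) \<in> borel_measurable borel"
  unfolding tan_def[abs_def]
  by (rule borel_measurable_divide) (intro borel_measurable_continuous_onI continuous_intros)+

text \<open>The arctangent already covers all angles of the right half plane, and it gives a Borel
  function defined everywhere.\<close>

definition ang :: "real \<Rightarrow> real \<times> real \<Rightarrow> real" where
  "ang b x = arctan ((snd x - b) / fst x)"

lemma ang_borel [measurable]: "ang b \<in> borel_measurable borel"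
  unfolding ang_def by measurable

lemma ang_in_semi: "ang b x \<in> semi"
  using arctan_bounded by (auto simp: ang_def semi_def)

lemma ang_polar:
  assumes "r > 0" "\<theta> \<in> semi" shows "ang b (polar (0, b) r \<theta>) = \<theta>"
proof -
  have "ang b (polar (0, b) r \<theta>) = arctan (tan \<theta>)"
    using assms(1) by (simp add: ang_def polar_def tan_def)
  then show ?thesis using assms(2) by (simp add: arctan_tan semi_def)
qed

lemma polar_ang:
  assumes "fst x > 0" "r = norm (x - (0, b))" shows "polar (0, b) r (ang b x) = x"
proof -
  obtain p q where x: "x = (p, q)" by (cases x)
  have p: "p > 0" using assms x by simp
  define s where "s = sqrt (1 + ((q - b) / p)\<^sup>2)"
  have s: "s > 0" unfolding s_def by (simp add: add_pos_nonneg)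
  have "r = sqrt (p\<^sup>2 + (q - b)\<^sup>2)" using assms x by (simp add: norm_prod_def)
  also have "p\<^sup>2 + (q - b)\<^sup>2 = p\<^sup>2 * (1 + ((q - b) / p)\<^sup>2)" using p by (simp add: field_simps)
  also have "sqrt \<dots> = p * s" unfolding s_def real_sqrt_mult using p by simp
  finally have r: "r = p * s" .
  show ?thesis
    unfolding polar_def ang_def x using r s p
    by (simp add: cos_arctan sin_arctan flip: s_def)
qed

lemma norm_polar: "r \<ge> 0 \<Longrightarrow> norm (polar c r \<theta> - c) = r"
  by (simp add: polar_def norm_prod_def power_mult_distrib flip: distrib_left)

lemma fst_polar: "fst (polar (0, b) r \<theta>) = r * cos \<theta>" and snd_polar: "snd (polar (0, b) r \<theta>) = b + r * sin \<theta>"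
  by (simp_all add: polar_def)

lemma half_circle_eq_polar:
  assumes "r > 0" shows "half_circle (0, b) r = polar (0, b) r ` semi"
proof
  show "half_circle (0, b) r \<subseteq> polar (0, b) r ` semi"
  proof
    fix x assume "x \<in> half_circle (0, b) r"
    then have "x = polar (0, b) r (ang b x)" using polar_ang[of x r b] by (auto simp: half_circle_def)
    then show "x \<in> polar (0, b) r ` semi" using ang_in_semi by blast
  qed
  show "polar (0, b) r ` semi \<subseteq> half_circle (0, b) r"
    using assms norm_polar[of r "(0, b)"] cos_pos_semi by (auto simp: half_circle_def fst_polar)
qed

lemma half_circle_borel [measurable]: "half_circle c r \<in> sets borel"
proof -
  have "half_circle c r = {x. fst x > 0} \<inter> {x. norm (x - c) = r}" by (auto simp: half_circle_def)
  moreover have "open {x::real \<times> real. fst x > 0}" by (intro open_Collect_less continuous_intros)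
  moreover have "closed {x. norm (x - c) = r}" by (intro closed_Collect_eq continuous_intros)
  ultimately show ?thesis by (simp add: borel_open borel_closed)
qed

lemma polar_borel [measurable]: "polar c r \<in> borel_measurable borel"
  unfolding polar_def by (intro borel_measurable_continuous_onI continuous_intros)

lemma polar2_borel [measurable]: "(\<lambda>(\<rho>, \<theta>). polar c \<rho> \<theta>) \<in> borel_measurable (lborel \<Otimes>\<^sub>M lborel)"
proof -
  have "(\<lambda>z::real \<times> real. polar c (fst z) (snd z)) \<in> borel_measurable borel"
    unfolding polar_def by (intro borel_measurable_continuous_onI continuous_intros)
  then show ?thesis by (simp add: case_prod_beta lborel_prod)
qed

text \<open>Two measures on the line with finite and equal values on all half lines
  \<open>{x<..}\<close> coincide, and on half lines the claim is the arc length formula. Integrals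
  of all Borel functions over the half circle can then be transported at once.\<close>

lemma distr_half_circle:
  assumes r: "r > 0"
  shows "distr (density hausdorff1 (indicator (half_circle (0, b) r))) borel (ang b) =
    density lborel (\<lambda>\<theta>. ennreal r * indicator semi \<theta>)"
proof (rule measure_eqI_lessThan)
  let ?HC = "half_circle (0, b) r"
  have HC: "?HC \<in> sets hausdorff1" using sets_borel_subset_hausdorff1 half_circle_borel by blast
  have am: "ang b \<in> borel_measurable hausdorff1" by (rule measurable_hausdorff1_borel) simp
  have L: "emeasure (distr (density hausdorff1 (indicator ?HC)) borel (ang b)) {x<..} =
      ennreal (r * (pi/2 - max x (- (pi/2))))" and
     R: "emeasure (density lborel (\<lambda>\<theta>. ennreal r * indicator semi \<theta>)) {x<..} = ennreal (r * (pi/2 - max x (- (pi/2))))"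
    if x: "x \<le> pi/2" for x
  proof -
    let ?a = "max x (- (pi/2))"
    have eq: "?HC \<inter> ang b -` {x<..} = polar (0, b) r ` {?a<..<pi/2}"
    proof -
      have "?HC \<inter> ang b -` {x<..} = polar (0, b) r ` {\<theta>\<in>semi. x < \<theta>}"
        unfolding half_circle_eq_polar[OF r] using ang_polar[OF r] by auto
      also have "{\<theta>\<in>semi. x < \<theta>} = {?a<..<pi/2}" by (auto simp: semi_def)
      finally show ?thesis .
    qed
    have m: "ang b -` {x<..} \<in> sets hausdorff1" using measurable_sets[OF am, of "{x<..}"] by simp
    have "emeasure (distr (density hausdorff1 (indicator ?HC)) borel (ang b)) {x<..} = emeasure (density hausdorff1 (indicator ?HC)) (ang b -` {x<..})"
      using am by (subst emeasure_distr) auto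
    also have "\<dots> = (\<integral>\<^sup>+y. indicator ?HC y * indicator (ang b -` {x<..}) y \<partial>hausdorff1)"
      using HC m by (subst emeasure_density) auto
    also have "\<dots> = (\<integral>\<^sup>+y. indicator (?HC \<inter> ang b -` {x<..}) y \<partial>hausdorff1)"
      by (simp add: indicator_inter_arith)
    also have "\<dots> = emeasure hausdorff1 (?HC \<inter> ang b -` {x<..})" using HC m by (intro nn_integral_indicator) auto
    also have "\<dots> = hausdorff1_outer (?HC \<inter> ang b -` {x<..})" using HC m by (intro emeasure_hausdorff1) auto
    also have "\<dots> = ennreal (r * (pi/2 - ?a))" unfolding eq
      using x pi_gt_zero by (intro hausdorff1_outer_arc[OF r]) (auto simp: max_def)
    finally show "emeasure (distr (density hausdorff1 (indicator ?HC)) borel (ang b)) {x<..} = ennreal (r * (pi/2 - ?a))" .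
    have "emeasure (density lborel (\<lambda>\<theta>. ennreal r * indicator semi \<theta>)) {x<..} = (\<integral>\<^sup>+\<theta>. ennreal r * indicator semi \<theta> * indicator {x<..} \<theta> \<partial>lborel)"
      by (subst emeasure_density) auto
    also have "\<dots> = (\<integral>\<^sup>+\<theta>. ennreal r * indicator {?a<..<pi/2} \<theta> \<partial>lborel)"
      by (intro nn_integral_cong) (auto simp: indicator_def semi_def)
    also have "\<dots> = ennreal r * ennreal (pi/2 - ?a)"
      using x pi_gt_zero by (subst nn_integral_cmult_indicator) (auto simp: max_def)
    also have "\<dots> = ennreal (r * (pi/2 - ?a))" using r x pi_gt_zero by (intro ennreal_mult[symmetric]) (auto simp: max_def)
    finally show "emeasure (density lborel (\<lambda>\<theta>. ennreal r * indicator semi \<theta>)) {x<..} = ennreal (r * (pi/2 - ?a))" .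
  qed
  \<comment> \<open>Beyond \<open>pi / 2\<close> both measures vanish, by comparison with the half
    line starting at \<open>pi / 2\<close>.\<close>
  have mono: "emeasure (distr (density hausdorff1 (indicator ?HC)) borel (ang b)) {x<..} \<le>
      emeasure (distr (density hausdorff1 (indicator ?HC)) borel (ang b)) {pi/2<..}"
     "emeasure (density lborel (\<lambda>\<theta>. ennreal r * indicator semi \<theta>)) {x<..} \<le>
       emeasure (density lborel (\<lambda>\<theta>. ennreal r * indicator semi \<theta>)) {pi/2<..}" if "x > pi/2" for x
    using that by (intro emeasure_mono; auto)+
  have LR: "emeasure (distr (density hausdorff1 (indicator ?HC)) borel (ang b)) {x<..} = emeasure (density lborel (\<lambda>\<theta>. ennreal r * indicator semi \<theta>)) {x<..}
     \<and> emeasure (distr (density hausdorff1 (indicator ?HC)) borel (ang b)) {x<..} < \<infinity>" for x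
  proof (cases "x \<le> pi/2")
    case True then show ?thesis using L R by simp
  next
    case False
    then show ?thesis using mono[of x] L[of "pi/2"] R[of "pi/2"] by simp
  qed
  show "emeasure (distr (density hausdorff1 (indicator ?HC)) borel (ang b)) {x<..} = emeasure (density lborel (\<lambda>\<theta>. ennreal r * indicator semi \<theta>)) {x<..}" for x
    using LR by blast
  show "emeasure (distr (density hausdorff1 (indicator ?HC)) borel (ang b)) {x<..} < \<infinity>" for x
    using LR by blast
qed simp_all

lemma nn_integral_half_circle:
  assumes r: "r > 0" and f[measurable]: "f \<in> borel_measurable borel"
  shows "(\<integral>\<^sup>+x\<in>half_circle (0, b) r. f x \<partial>hausdorff1) = (\<integral>\<^sup>+\<theta>\<in>semi. ennreal r * f (polar (0, b) r \<theta>) \<partial>lborel)"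
proof -
  let ?HC = "half_circle (0, b) r" and ?f = "\<lambda>\<theta>. f (polar (0, b) r \<theta>)"
  have HC: "?HC \<in> sets hausdorff1" using sets_borel_subset_hausdorff1 half_circle_borel by blast
  have am: "ang b \<in> borel_measurable hausdorff1" by (rule measurable_hausdorff1_borel) simp
  have fm: "(\<lambda>x. ?f (ang b x)) \<in> borel_measurable hausdorff1" by (rule measurable_hausdorff1_borel) simp
  have "(\<integral>\<^sup>+x\<in>?HC. f x \<partial>hausdorff1) = (\<integral>\<^sup>+x. indicator ?HC x * ?f (ang b x) \<partial>hausdorff1)"
    using polar_ang[of _ r b] by (intro nn_integral_cong) (auto simp: indicator_def half_circle_def)
  also have "\<dots> = (\<integral>\<^sup>+x. ?f (ang b x) \<partial>density hausdorff1 (indicator ?HC))"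
    using HC fm by (subst nn_integral_density) auto
  also have "\<dots> = (\<integral>\<^sup>+\<theta>. ?f \<theta> \<partial>distr (density hausdorff1 (indicator ?HC)) borel (ang b))"
    using am by (subst nn_integral_distr) auto
  also have "\<dots> = (\<integral>\<^sup>+\<theta>. ennreal r * indicator semi \<theta> * ?f \<theta> \<partial>lborel)"
    unfolding distr_half_circle[OF r] by (subst nn_integral_density) auto
  finally show ?thesis by (simp add: mult_ac)
qed

text \<open>The integral over the half circle in angular form. The set of angles does not depend on
  \<open>r\<close>, so the integral can be differentiated in \<open>r\<close> under the integral
  sign.\<close>

definition circ_int :: "real \<times> real \<Rightarrow> (real \<times> real \<Rightarrow> real) \<Rightarrow> real \<Rightarrow> real" where
  "circ_int c f r = (LINT \<theta>:semi|lborel. r * f (polar c r \<theta>))"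

lemma integral_half_circle:
  fixes f :: "real \<times> real \<Rightarrow> real"
  assumes r: "r > 0" and f[measurable]: "f \<in> borel_measurable borel"
  shows "(LINT x:half_circle (0, b) r|hausdorff1. f x) = circ_int (0, b) f r"
proof -
  let ?HC = "half_circle (0, b) r" and ?f = "\<lambda>\<theta>. f (polar (0, b) r \<theta>)"
  have HC: "?HC \<in> sets hausdorff1" using sets_borel_subset_hausdorff1 half_circle_borel by blast
  have am: "ang b \<in> borel_measurable hausdorff1" by (rule measurable_hausdorff1_borel) simp
  have fm: "(\<lambda>x. ?f (ang b x)) \<in> borel_measurable hausdorff1" by (rule measurable_hausdorff1_borel) simp
  have ei: "(indicator ?HC :: _ \<Rightarrow> ennreal) = (\<lambda>x. ennreal (indicator ?HC x))" by (auto simp: indicator_def)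
  have "(LINT x:?HC|hausdorff1. f x) = (LINT x|hausdorff1. indicator ?HC x *\<^sub>R ?f (ang b x))"
    unfolding set_lebesgue_integral_def
    using polar_ang[of _ r b] by (intro Bochner_Integration.integral_cong) (auto simp: indicator_def half_circle_def)
  also have "\<dots> = (LINT x|density hausdorff1 (indicator ?HC). ?f (ang b x))"
    unfolding ei using HC fm by (subst integral_density) auto
  also have "\<dots> = (LINT \<theta>|distr (density hausdorff1 (indicator ?HC)) borel (ang b). ?f \<theta>)"
    using am by (subst integral_distr) auto
  also have "distr (density hausdorff1 (indicator ?HC)) borel (ang b) = density lborel (\<lambda>\<theta>. ennreal (r * indicator semi \<theta>))"
    unfolding distr_half_circle[OF r] using r by (intro density_cong) (auto simp: indicator_def)
  also have "(LINT \<theta>|density lborel (\<lambda>\<theta>. ennreal (r * indicator semi \<theta>)). ?f \<theta>) = (LINT \<theta>|lborel. (r * indicator semi \<theta>) *\<^sub>R ?f \<theta>)"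
    using r by (subst integral_density) auto
  also have "\<dots> = circ_int (0, b) f r"
    unfolding circ_int_def set_lebesgue_integral_def by (simp add: mult_ac)
  finally show ?thesis .
qed

text \<open>It is enough to compare the two measures on intervals, where the claim is the
  fundamental theorem of calculus for tan. The angles \<open>arctan l\<close> and
  \<open>arctan u\<close> lie strictly inside \<open>semi\<close>, so the poles of tan are
  avoided.\<close>

lemma nn_integral_tan:
  assumes [measurable]: "f \<in> borel_measurable borel"
  shows "(\<integral>\<^sup>+z. f z \<partial>lborel) = (\<integral>\<^sup>+\<theta>\<in>semi. ennreal (inverse ((cos \<theta>)\<^sup>2)) * f (tan \<theta>) \<partial>lborel)"
proof -
  define D where "D = density lborel (\<lambda>\<theta>. ennreal (inverse ((cos \<theta>)\<^sup>2)) * indicator semi \<theta>)"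
  have "lborel = distr D borel tan"
  proof (rule lborel_eqI)
    fix l u :: real assume "\<And>b. b \<in> Basis \<Longrightarrow> l \<bullet> b \<le> u \<bullet> b"
    then have lu: "l \<le> u" by simp
    have mono: "arctan l \<le> arctan u" using lu by (simp add: arctan_le_iff)
    have eq: "indicator semi \<theta> * indicator (tan -` box l u) \<theta> = (indicator {arctan l<..<arctan u} \<theta> :: ennreal)" for \<theta>
    proof (cases "\<theta> \<in> semi")
      case True
      then have at: "arctan (tan \<theta>) = \<theta>" by (simp add: arctan_tan semi_def)
      have "l < tan \<theta> \<longleftrightarrow> arctan l < \<theta>" "tan \<theta> < u \<longleftrightarrow> \<theta> < arctan u"
        using arctan_less_iff[of l "tan \<theta>"] arctan_less_iff[of "tan \<theta>" u] by (simp_all add: at)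
      with True show ?thesis by (auto simp: indicator_def)
    next
      case False
      then show ?thesis using arctan_bounded[of l] arctan_bounded[of u] by (auto simp: indicator_def semi_def)
    qed
    have "emeasure (distr D borel tan) (box l u) = emeasure D (tan -` box l u)"
      unfolding D_def by (subst emeasure_distr) auto
    also have "\<dots> = (\<integral>\<^sup>+\<theta>. ennreal (inverse ((cos \<theta>)\<^sup>2)) * indicator semi \<theta> * indicator (tan -` box l u) \<theta> \<partial>lborel)"
      unfolding D_def using measurable_sets[of tan borel borel "box l u"] by (subst emeasure_density) auto
    also have "\<dots> = (\<integral>\<^sup>+\<theta>. ennreal (inverse ((cos \<theta>)\<^sup>2)) * indicator {arctan l<..<arctan u} \<theta> \<partial>lborel)"
      by (simp only: mult.assoc eq)
    also have "\<dots> = (\<integral>\<^sup>+\<theta>. ennreal (inverse ((cos \<theta>)\<^sup>2)) * indicator {arctan l..arctan u} \<theta> \<partial>lborel)"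
    proof (rule nn_integral_cong_AE)
      have "AE \<theta> in lborel. \<theta> \<notin> {arctan l, arctan u}"
        by (rule AE_not_in) (simp add: finite_imp_null_set_lborel)
      then show "AE \<theta> in lborel. ennreal (inverse ((cos \<theta>)\<^sup>2)) * indicator {arctan l<..<arctan u} \<theta> =
        ennreal (inverse ((cos \<theta>)\<^sup>2)) * indicator {arctan l..arctan u} \<theta>"
        by eventually_elim (auto simp: indicator_def)
    qed
    also have "\<dots> = ennreal (tan (arctan u) - tan (arctan l))"
    proof (rule nn_integral_FTC_Icc[OF _ _ _ mono])
      show "(\<lambda>\<theta>::real. inverse ((cos \<theta>)\<^sup>2)) \<in> borel_measurable borel"
        by (intro borel_measurable_inverse borel_measurable_power borel_measurable_continuous_onI continuous_intros)
      fix \<theta> assume "\<theta> \<in> {arctan l..arctan u}"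
      then have "cos \<theta> \<noteq> 0" using cos_pos_semi[of \<theta>] arctan_bounded[of l] arctan_bounded[of u] by (auto simp: semi_def)
      then show "(tan has_real_derivative inverse ((cos \<theta>)\<^sup>2)) (at \<theta>)" by (rule DERIV_tan)
    qed auto
    finally show "emeasure (distr D borel tan) (box l u) = ennreal (\<Prod>b\<in>Basis. (u - l) \<bullet> b)" by (simp add: tan_arctan)
  qed (simp add: D_def)
  then have "(\<integral>\<^sup>+z. f z \<partial>lborel) = (\<integral>\<^sup>+z. f z \<partial>distr D borel tan)" by simp
  also have "\<dots> = (\<integral>\<^sup>+\<theta>. f (tan \<theta>) \<partial>D)" by (rule nn_integral_distr) (simp_all add: D_def)
  also have "\<dots> = (\<integral>\<^sup>+\<theta>. ennreal (inverse ((cos \<theta>)\<^sup>2)) * indicator semi \<theta> * f (tan \<theta>) \<partial>lborel)"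
    unfolding D_def by (rule nn_integral_density) auto
  finally show ?thesis by (simp add: mult_ac)
qed

text \<open>Polar coordinates on a half plane reduce to one-dimensional substitutions: \<open>y = b + x z\<close>,
  \<open>z = tan \<theta>\<close> for fixed \<open>x\<close>, then \<open>x = \<rho> cos \<theta>\<close> for fixed \<open>\<theta>\<close>.\<close>

lemma nn_integral_polar:
  fixes f :: "real \<times> real \<Rightarrow> ennreal"
  assumes f[measurable]: "f \<in> borel_measurable borel"
  shows "(\<integral>\<^sup>+x\<in>{x. fst x > 0}. f x \<partial>lborel) =
    (\<integral>\<^sup>+\<rho>\<in>{0<..}. (\<integral>\<^sup>+\<theta>\<in>semi. ennreal \<rho> * f (polar (0, b) \<rho> \<theta>) \<partial>lborel) \<partial>lborel)"
proof -
  have f2[measurable]: "(\<lambda>(x, y). f (g x y, h x y)) \<in> borel_measurable (lborel \<Otimes>\<^sub>M lborel)"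
    if "(\<lambda>(x, y). g x y) \<in> borel_measurable (lborel \<Otimes>\<^sub>M lborel)" "(\<lambda>(x, y). h x y) \<in> borel_measurable (lborel \<Otimes>\<^sub>M lborel)"
    for g h :: "real \<Rightarrow> real \<Rightarrow> real"
    using measurable_compose[OF borel_measurable_Pair[OF that] f] by (simp add: case_prod_beta)
  have op: "{x::real \<times> real. fst x > 0} \<in> sets borel"
    by (intro borel_open open_Collect_less continuous_intros)
  have f1[measurable]: "(\<lambda>y. f (x, h y)) \<in> borel_measurable borel" if "h \<in> borel_measurable borel" for x h
    using measurable_compose[OF borel_measurable_Pair[OF borel_measurable_const that] f] .
  have "(\<integral>\<^sup>+x\<in>{x. fst x > 0}. f x \<partial>lborel) = (\<integral>\<^sup>+x. f x * indicator {x. fst x > 0} x \<partial>(lborel \<Otimes>\<^sub>M lborel))"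
    by (simp add: lborel_prod)
  also have "\<dots> = (\<integral>\<^sup>+x. \<integral>\<^sup>+y. f (x, y) * indicator {x. fst x > 0} (x, y) \<partial>lborel \<partial>lborel)"
    by (rule lborel.nn_integral_fst[symmetric]) (use op in \<open>simp add: lborel_prod\<close>)
  also have "\<dots> = (\<integral>\<^sup>+x\<in>{0<..}. (\<integral>\<^sup>+y. f (x, y) \<partial>lborel) \<partial>lborel)"
    by (intro nn_integral_cong) (auto simp: indicator_def)
  also have "\<dots> = (\<integral>\<^sup>+x\<in>{0<..}. (\<integral>\<^sup>+\<theta>. ennreal x * (ennreal (inverse ((cos \<theta>)\<^sup>2)) * f (x, b + x * tan \<theta>) * indicator semi \<theta>) \<partial>lborel) \<partial>lborel)"
  proof (intro nn_integral_cong)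
    fix x :: real
    show "(\<integral>\<^sup>+y. f (x, y) \<partial>lborel) * indicator {0<..} x =
      (\<integral>\<^sup>+\<theta>. ennreal x * (ennreal (inverse ((cos \<theta>)\<^sup>2)) * f (x, b + x * tan \<theta>) * indicator semi \<theta>) \<partial>lborel) * indicator {0<..} x"
    proof (cases "x > 0")
      case True
      have "(\<integral>\<^sup>+y. f (x, y) \<partial>lborel) = ennreal x * (\<integral>\<^sup>+z. f (x, b + x * z) \<partial>lborel)"
        using True by (subst nn_integral_real_affine[where c=x and t=b]) auto
      also have "(\<integral>\<^sup>+z. f (x, b + x * z) \<partial>lborel) = (\<integral>\<^sup>+\<theta>\<in>semi. ennreal (inverse ((cos \<theta>)\<^sup>2)) * f (x, b + x * tan \<theta>) \<partial>lborel)"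
        by (rule nn_integral_tan) simp
      also have "ennreal x * \<dots> = (\<integral>\<^sup>+\<theta>. ennreal x * (ennreal (inverse ((cos \<theta>)\<^sup>2)) * f (x, b + x * tan \<theta>) * indicator semi \<theta>) \<partial>lborel)"
        by (rule nn_integral_cmult[symmetric]) simp
      finally show ?thesis using True by simp
    qed simp
  qed
  also have "\<dots> = (\<integral>\<^sup>+x. (\<integral>\<^sup>+\<theta>. ennreal x * (ennreal (inverse ((cos \<theta>)\<^sup>2)) * f (x, b + x * tan \<theta>) * indicator semi \<theta>) * indicator {0<..} x \<partial>lborel) \<partial>lborel)"
    by (intro nn_integral_cong) (auto simp: indicator_def)
  also have "\<dots> = (\<integral>\<^sup>+\<theta>. (\<integral>\<^sup>+x. ennreal x * (ennreal (inverse ((cos \<theta>)\<^sup>2)) * f (x, b + x * tan \<theta>) * indicator semi \<theta>) * indicator {0<..} x \<partial>lborel) \<partial>lborel)"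
    by (rule lborel_pair.Fubini') measurable
  also have "\<dots> = (\<integral>\<^sup>+\<theta>. (\<integral>\<^sup>+\<rho>. ennreal \<rho> * f (polar (0, b) \<rho> \<theta>) * indicator semi \<theta> * indicator {0<..} \<rho> \<partial>lborel) \<partial>lborel)"
  proof (rule nn_integral_cong)
    fix \<theta> :: real
    show "(\<integral>\<^sup>+x. ennreal x * (ennreal (inverse ((cos \<theta>)\<^sup>2)) * f (x, b + x * tan \<theta>) * indicator semi \<theta>) * indicator {0<..} x \<partial>lborel) =
       (\<integral>\<^sup>+\<rho>. ennreal \<rho> * f (polar (0, b) \<rho> \<theta>) * indicator semi \<theta> * indicator {0<..} \<rho> \<partial>lborel)"
    proof (cases "\<theta> \<in> semi")
      case True
      then have c: "cos \<theta> > 0" by (rule cos_pos_semi)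
      have [measurable]: "(\<lambda>x. f (x, b + x * tan \<theta>)) \<in> borel_measurable borel"
        using measurable_compose[OF borel_measurable_Pair[of "\<lambda>x. x" _ "\<lambda>x. b + x * tan \<theta>"] f] by simp
      have [measurable]: "(\<lambda>x. f (polar (0, b) x \<theta>)) \<in> borel_measurable borel"
        unfolding polar_def by (rule measurable_compose[OF _ f]) (intro borel_measurable_continuous_onI continuous_intros)
      have "(\<integral>\<^sup>+x. ennreal x * (ennreal (inverse ((cos \<theta>)\<^sup>2)) * f (x, b + x * tan \<theta>) * indicator semi \<theta>) * indicator {0<..} x \<partial>lborel) =
        ennreal (cos \<theta>) * (\<integral>\<^sup>+\<rho>. ennreal (cos \<theta> * \<rho>) * (ennreal (inverse ((cos \<theta>)\<^sup>2)) * f (cos \<theta> * \<rho>, b + cos \<theta> * \<rho> * tan \<theta>)) * indicator {0<..} (cos \<theta> * \<rho>) \<partial>lborel)"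
        using True c by (subst nn_integral_real_affine[where c="cos \<theta>" and t=0]) (auto simp: mult_ac)
      also have "\<dots> = (\<integral>\<^sup>+\<rho>. ennreal (cos \<theta>) * (ennreal (cos \<theta> * \<rho>) * (ennreal (inverse ((cos \<theta>)\<^sup>2)) * f (cos \<theta> * \<rho>, b + cos \<theta> * \<rho> * tan \<theta>)) * indicator {0<..} (cos \<theta> * \<rho>)) \<partial>lborel)"
        by (rule nn_integral_cmult[symmetric]) (rule measurable_compose[of "\<lambda>\<rho>. cos \<theta> * \<rho>" _ borel "\<lambda>y. ennreal y * (ennreal (inverse ((cos \<theta>)\<^sup>2)) * f (y, b + y * tan \<theta>)) * indicator {0<..} y"], auto)
      also have "\<dots> = (\<integral>\<^sup>+\<rho>. ennreal \<rho> * f (polar (0, b) \<rho> \<theta>) * indicator semi \<theta> * indicator {0<..} \<rho> \<partial>lborel)"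
      proof (intro nn_integral_cong)
        fix \<rho> :: real
        show "ennreal (cos \<theta>) * (ennreal (cos \<theta> * \<rho>) * (ennreal (inverse ((cos \<theta>)\<^sup>2)) * f (cos \<theta> * \<rho>, b + cos \<theta> * \<rho> * tan \<theta>)) * indicator {0<..} (cos \<theta> * \<rho>)) =
          ennreal \<rho> * f (polar (0, b) \<rho> \<theta>) * indicator semi \<theta> * indicator {0<..} \<rho>"
        proof (cases "\<rho> > 0")
          case pos: True
          have p: "(cos \<theta> * \<rho>, b + cos \<theta> * \<rho> * tan \<theta>) = polar (0, b) \<rho> \<theta>"
            using c by (simp add: polar_def tan_def)
          have "ennreal (cos \<theta>) * ennreal (cos \<theta> * \<rho>) * ennreal (inverse ((cos \<theta>)\<^sup>2)) = ennreal (cos \<theta> * (cos \<theta> * \<rho>) * inverse ((cos \<theta>)\<^sup>2))"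
            using c pos by (simp add: ennreal_mult)
          also have "cos \<theta> * (cos \<theta> * \<rho>) * inverse ((cos \<theta>)\<^sup>2) = \<rho>"
            using c by (simp add: power2_eq_square field_simps)
          finally show ?thesis using pos c True unfolding p by (simp add: mult.assoc[symmetric])
        next
          case False
          then have "\<not> 0 < cos \<theta> * \<rho>" using c by (simp add: zero_less_mult_iff)
          with False show ?thesis by simp
        qed
      qed
      finally show ?thesis .
    qed simp
  qed
  also have "\<dots> = (\<integral>\<^sup>+\<rho>. (\<integral>\<^sup>+\<theta>. ennreal \<rho> * f (polar (0, b) \<rho> \<theta>) * indicator semi \<theta> * indicator {0<..} \<rho> \<partial>lborel) \<partial>lborel)"
  proof -
    have "(\<lambda>(x, y). f (polar (0, b) x y)) \<in> borel_measurable (lborel \<Otimes>\<^sub>M lborel)"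
      using measurable_compose[OF polar2_borel f] by (simp add: case_prod_beta)
    then have "(\<lambda>(\<rho>, \<theta>). ennreal \<rho> * f (polar (0, b) \<rho> \<theta>) * indicator semi \<theta> * indicator {0<..} \<rho>) \<in> borel_measurable (lborel \<Otimes>\<^sub>M lborel)"
      by measurable
    from lborel_pair.Fubini'[OF this] show ?thesis by simp
  qed
  also have "\<dots> = (\<integral>\<^sup>+\<rho>\<in>{0<..}. (\<integral>\<^sup>+\<theta>\<in>semi. ennreal \<rho> * f (polar (0, b) \<rho> \<theta>) \<partial>lborel) \<partial>lborel)"
    by (intro nn_integral_cong) (auto simp: indicator_def)
  finally show ?thesis .
qed

text \<open>Polar coordinates applied to a Borel null set: its slices have measure zero for almost
  every radius. This is how the almost everywhere equality of \<open>Du\<close> with the classical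
  gradient reaches the circle integrals.\<close>

lemma AE_half_circle:
  fixes P :: "real \<times> real \<Rightarrow> bool"
  assumes "AE x in lebesgue. P x"
  shows "AE r in lborel. r > 0 \<longrightarrow> (AE x in hausdorff1. x \<in> half_circle (0, b) r \<longrightarrow> P x)"
proof -
  have "AE x in lborel. P x" using assms AE_completion_iff by blast
  then obtain N where N: "\<And>x. x \<notin> N \<Longrightarrow> P x" "N \<in> null_sets lborel" by (rule AE_E3) auto
  then have Nb[measurable]: "N \<in> sets borel" by auto
  have iN: "(indicator N :: _ \<Rightarrow> ennreal) \<in> borel_measurable borel" by simp
  have m: "(\<lambda>\<rho>. (\<integral>\<^sup>+\<theta>\<in>semi. ennreal \<rho> * indicator N (polar (0, b) \<rho> \<theta>) \<partial>lborel)) \<in> borel_measurable lborel"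
  proof -
    have "(\<lambda>(x, y). indicator N (polar (0, b) x y) :: ennreal) \<in> borel_measurable (lborel \<Otimes>\<^sub>M lborel)"
      using measurable_compose[OF polar2_borel iN] by (simp add: case_prod_beta)
    then have "(\<lambda>(\<rho>, \<theta>). ennreal \<rho> * indicator N (polar (0, b) \<rho> \<theta>) * indicator semi \<theta>) \<in> borel_measurable (lborel \<Otimes>\<^sub>M lborel)"
      by measurable
    then show ?thesis by (intro lborel.borel_measurable_nn_integral) auto
  qed
  have "(\<integral>\<^sup>+\<rho>\<in>{0<..}. (\<integral>\<^sup>+\<theta>\<in>semi. ennreal \<rho> * indicator N (polar (0, b) \<rho> \<theta>) \<partial>lborel) \<partial>lborel) = (\<integral>\<^sup>+x\<in>{x. fst x > 0}. indicator N x \<partial>lborel)"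
    by (rule nn_integral_polar[OF iN, symmetric])
  also have "\<dots> \<le> (\<integral>\<^sup>+x. indicator N x \<partial>lborel)" by (intro nn_integral_mono) (auto simp: indicator_def)
  also have "\<dots> = 0" using N(2) by auto
  finally have "AE \<rho> in lborel. (\<integral>\<^sup>+\<theta>\<in>semi. ennreal \<rho> * indicator N (polar (0, b) \<rho> \<theta>) \<partial>lborel) * indicator {0<..} \<rho> = 0"
    using m by (subst (asm) le_zero_eq, subst (asm) nn_integral_0_iff_AE) auto
  then show ?thesis
  proof eventually_elim
    case (elim r)
    show ?case
    proof
      assume r: "r > 0"
      let ?HC = "half_circle (0, b) r"
      have s: "?HC \<in> sets hausdorff1" "N \<in> sets hausdorff1" using sets_borel_subset_hausdorff1 half_circle_borel Nb by blast+
      have "emeasure hausdorff1 (N \<inter> ?HC) = (\<integral>\<^sup>+x\<in>?HC. indicator N x \<partial>hausdorff1)"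
        using s by (simp add: indicator_inter_arith[symmetric])
      also have "\<dots> = 0"
        using elim r by (subst nn_integral_half_circle[OF r iN]) simp
      finally have "N \<inter> ?HC \<in> null_sets hausdorff1" using s by auto
      then show "AE x in hausdorff1. x \<in> half_circle (0, b) r \<longrightarrow> P x"
        by (rule AE_I') (use N(1) in auto)
    qed
  qed
qed

lemma integral_half_circle_AE:
  fixes f g :: "real \<times> real \<Rightarrow> real"
  assumes r: "r > 0" and g: "g \<in> borel_measurable borel"
    and ae: "AE x in hausdorff1. x \<in> half_circle (0, b) r \<longrightarrow> indicator S x * f x = g x"
  shows "(LINT x:(half_circle (0, b) r \<inter> S)|hausdorff1. f x) = circ_int (0, b) g r"
proof -
  interpret complete_measure "hausdorff1 :: (real \<times> real) measure" by (rule complete_measure_hausdorff1)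
  have "(LINT x:(half_circle (0, b) r \<inter> S)|hausdorff1. f x) = (LINT x:half_circle (0, b) r|hausdorff1. g x)"
    unfolding set_lebesgue_integral_def
  proof (rule integral_AE_eq)
    show "(\<lambda>x. indicat_real (half_circle (0, b) r) x *\<^sub>R g x) \<in> borel_measurable hausdorff1"
      using g by (intro measurable_hausdorff1_borel) simp
    show "AE x in hausdorff1. indicat_real (half_circle (0, b) r \<inter> S) x *\<^sub>R f x = indicat_real (half_circle (0, b) r) x *\<^sub>R g x"
      using ae by eventually_elim (auto simp: indicator_def split: if_splits)
  qed
  then show ?thesis using integral_half_circle[OF r g] by simp
qed

text \<open>The nonnegative formula, applied to indicators, identifies the image measure under polar
  coordinates. The signed formula follows by transport to this measure and Fubini.\<close>

lemma integral_polar: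
  fixes g :: "real \<times> real \<Rightarrow> real"
  assumes g[measurable]: "g \<in> borel_measurable borel" and gi: "set_integrable lborel {x. fst x > 0} g"
  shows "set_integrable lborel {0<..} (circ_int (0, b) g)"
    "(LINT x:{x. fst x > 0}|lborel. g x) = (LINT \<rho>:{0<..}|lborel. circ_int (0, b) g \<rho>)"
proof -
  let ?P = "\<lambda>(\<rho>, \<theta>). polar (0, b) \<rho> \<theta>" and ?U = "{x::real \<times> real. fst x > 0}"
  let ?w = "\<lambda>(\<rho>, \<theta>). \<rho> * (indicator {0<..} \<rho> * indicator semi \<theta>) :: real"
  define D where "D = density (lborel \<Otimes>\<^sub>M lborel) (\<lambda>z. ennreal (?w z))"
  have op[measurable]: "?U \<in> sets borel" by (intro borel_open open_Collect_less continuous_intros)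
  have w[measurable]: "?w \<in> borel_measurable (lborel \<Otimes>\<^sub>M lborel)" by measurable
  have P[measurable]: "?P \<in> D \<rightarrow>\<^sub>M borel" unfolding D_def using polar2_borel by simp
  have eqm: "distr D borel ?P = density lborel (\<lambda>x. ennreal (indicator ?U x))"
  proof (rule measure_eqI)
    fix A assume "A \<in> sets (distr D borel ?P)"
    then have A[measurable]: "A \<in> sets borel" by simp
    have iA: "(indicator A :: _ \<Rightarrow> ennreal) \<in> borel_measurable borel" by simp
    have m: "(\<lambda>z. indicator A (?P z) :: ennreal) \<in> borel_measurable (lborel \<Otimes>\<^sub>M lborel)"
      using measurable_compose[OF polar2_borel iA] .
    have "emeasure (distr D borel ?P) A = (\<integral>\<^sup>+x. indicator A x \<partial>distr D borel ?P)" by simp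
    also have "\<dots> = (\<integral>\<^sup>+z. indicator A (?P z) \<partial>D)" by (rule nn_integral_distr) auto
    also have "\<dots> = (\<integral>\<^sup>+z. ennreal (?w z) * indicator A (?P z) \<partial>(lborel \<Otimes>\<^sub>M lborel))"
      unfolding D_def using w m by (intro nn_integral_density) auto
    also have "\<dots> = (\<integral>\<^sup>+\<rho>. \<integral>\<^sup>+\<theta>. ennreal (?w (\<rho>, \<theta>)) * indicator A (?P (\<rho>, \<theta>)) \<partial>lborel \<partial>lborel)"
      using w m by (intro lborel.nn_integral_fst[symmetric]) auto
    also have "\<dots> = (\<integral>\<^sup>+\<rho>\<in>{0<..}. (\<integral>\<^sup>+\<theta>\<in>semi. ennreal \<rho> * indicator A (polar (0, b) \<rho> \<theta>) \<partial>lborel) \<partial>lborel)"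
    proof (intro nn_integral_cong)
      fix \<rho> :: real
      show "(\<integral>\<^sup>+\<theta>. ennreal (?w (\<rho>, \<theta>)) * indicator A (?P (\<rho>, \<theta>)) \<partial>lborel) =
        (\<integral>\<^sup>+\<theta>\<in>semi. ennreal \<rho> * indicator A (polar (0, b) \<rho> \<theta>) \<partial>lborel) * indicator {0<..} \<rho>"
        by (cases "\<rho> > 0") (auto intro!: nn_integral_cong simp: indicator_def)
    qed
    also have "\<dots> = (\<integral>\<^sup>+x\<in>?U. indicator A x \<partial>lborel)" by (rule nn_integral_polar[OF iA, symmetric])
    also have "\<dots> = emeasure (density lborel (\<lambda>x. ennreal (indicator ?U x))) A"
      by (subst emeasure_density) (auto intro!: nn_integral_cong simp: indicator_def)
    finally show "emeasure (distr D borel ?P) A = emeasure (density lborel (\<lambda>x. ennreal (indicator ?U x))) A" .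
  qed simp
  have i1: "integrable (density lborel (\<lambda>x. ennreal (indicator ?U x))) g"
    using gi unfolding set_integrable_def by (subst integrable_density) auto
  have "(LINT x:?U|lborel. g x) = (LINT x|density lborel (\<lambda>x. ennreal (indicator ?U x)). g x)"
    unfolding set_lebesgue_integral_def by (subst integral_density) auto
  also have "\<dots> = (LINT z|D. g (?P z))"
    unfolding eqm[symmetric] by (rule integral_distr) auto
  also have "\<dots> = (LINT z|(lborel \<Otimes>\<^sub>M lborel). ?w z *\<^sub>R g (?P z))"
    unfolding D_def using polar2_borel by (intro integral_density) (auto simp: case_prod_beta indicator_def)
  finally have e1: "(LINT x:?U|lborel. g x) = (LINT z|(lborel \<Otimes>\<^sub>M lborel). ?w z *\<^sub>R g (?P z))" .
  have "integrable D (\<lambda>z. g (?P z))"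
    using i1 unfolding eqm[symmetric] by (subst (asm) integrable_distr_eq) auto
  then have i2: "integrable (lborel \<Otimes>\<^sub>M lborel) (\<lambda>z. ?w z *\<^sub>R g (?P z))"
    unfolding D_def using polar2_borel by (subst (asm) integrable_density) (auto simp: case_prod_beta indicator_def)
  have inner: "(LINT \<theta>|lborel. ?w (\<rho>, \<theta>) *\<^sub>R g (?P (\<rho>, \<theta>))) = indicator {0<..} \<rho> *\<^sub>R circ_int (0, b) g \<rho>" for \<rho>
    unfolding circ_int_def set_lebesgue_integral_def
    by (cases "\<rho> > 0") (auto simp: mult_ac)
  show "set_integrable lborel {0<..} (circ_int (0, b) g)"
    using lborel_pair.integrable_fst'[OF i2] unfolding set_integrable_def inner .
  show "(LINT x:?U|lborel. g x) = (LINT \<rho>:{0<..}|lborel. circ_int (0, b) g \<rho>)"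
    unfolding e1 using lborel_pair.integral_fst'[OF i2] unfolding inner set_lebesgue_integral_def by simp
qed

lemma circ_int_radial:
  assumes "r \<ge> 0"
  shows "circ_int c (\<lambda>x. k (norm (x - c)) * g x) r = k r * circ_int c g r"
  unfolding circ_int_def set_lebesgue_integral_def
  by (subst integral_mult_right_zero[symmetric]) (simp add: norm_polar[OF assms] mult_ac)

section \<open>Radial cutoffs\<close>

text \<open>The kernels have mass 1 and height at most \<open>C / h n\<close> on a ball of length
  \<open>2 * h n\<close>, so the error is at most \<open>2 * C\<close> times the mean oscillation of
  \<open>f\<close>, which tends to 0 at a Lebesgue point.\<close>

lemma lebesgue_point_average:
  fixes f :: "real \<Rightarrow> real" and k :: "nat \<Rightarrow> real \<Rightarrow> real"
  assumes lp: "lebesgue_point f r" and f: "integrable lborel f"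
    and k[measurable]: "\<And>n. k n \<in> borel_measurable borel"
    and kb: "\<And>n y. \<bar>k n y\<bar> \<le> C / h n * indicator (ball r (h n)) y"
    and h: "h \<longlonglongrightarrow> 0" "\<And>n. h n > 0" and k1: "\<And>n. (LINT y|lborel. k n y) = 1"
  shows "(\<lambda>n. LINT y|lborel. k n y * f y) \<longlonglongrightarrow> f r"
proof (rule LIMSEQ_I)
  fix e :: real assume e: "e > 0"
  have C: "C \<ge> 0"
  proof -
    have "0 \<le> C / h 0 * indicator (ball r (h 0)) r" using kb[of 0 r] by (rule order_trans[OF abs_ge_zero])
    then show ?thesis using h(2)[of 0] by (simp add: zero_le_divide_iff)
  qed
  \<comment> \<open>With \<open>C + 1\<close> instead of \<open>C\<close> the denominator is
    positive, and the final error \<open>2 * C * \<alpha>\<close> stays below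
    \<open>e / 2\<close>.\<close>
  define \<alpha> where "\<alpha> = e / (4 * (C + 1))"
  have \<alpha>: "\<alpha> > 0" using e C by (simp add: \<alpha>_def)
  have "filterlim h (at_right 0) sequentially"
    using h by (intro tendsto_imp_filterlim_at_right) auto
  with lp \<alpha> have "\<forall>\<^sub>F n in sequentially. (\<integral>\<^sup>+y\<in>ball r (h n). ennreal \<bar>f y - f r\<bar> \<partial>lborel) \<le> ennreal \<alpha> * emeasure lborel (ball r (h n))"
    unfolding lebesgue_point_def by (auto dest: eventually_compose_filterlim)
  then obtain N where N: "\<And>n. n \<ge> N \<Longrightarrow> (\<integral>\<^sup>+y\<in>ball r (h n). ennreal \<bar>f y - f r\<bar> \<partial>lborel) \<le> ennreal \<alpha> * emeasure lborel (ball r (h n))"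
    by (auto simp: eventually_sequentially)
  have fm[measurable]: "f \<in> borel_measurable borel" using f by auto
  have ki: "integrable lborel (k n)" for n
    by (rule Bochner_Integration.integrable_bound[where f="\<lambda>y. C / h n * indicator (ball r (h n)) y"])
      (use order_trans[OF kb abs_ge_self] emeasure_lborel_ball_finite[of r "h n"] in \<open>auto intro!: integrable_mult_right integrable_real_indicator simp del: times_divide_eq_left\<close>)
  have kfi: "integrable lborel (\<lambda>y. k n y * f y)" for n
  proof (rule Bochner_Integration.integrable_bound[where f="\<lambda>y. C / h n * f y"])
    show "integrable lborel (\<lambda>y. C / h n * f y)" using f by simp
    have "\<bar>k n y\<bar> \<le> C / h n" for y
      using C h(2)[of n] by (intro order_trans[OF kb]) (simp add: indicator_def less_imp_le)
    then show "AE y in lborel. norm (k n y * f y) \<le> norm (C / h n * f y)"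
      using C h(2)[of n] mult_right_mono[of _ "C / h n" "\<bar>f _\<bar>"] by (simp add: abs_mult)
  qed simp
  show "\<exists>no. \<forall>n\<ge>no. norm ((LINT y|lborel. k n y * f y) - f r) < e"
  proof (intro exI allI impI)
    fix n assume n: "n \<ge> N"
    have m: "measure lborel (ball r (h n)) = 2 * h n"
      using h(2)[of n] by (simp add: ball_eq_greaterThanLessThan)
    have "(LINT y|lborel. k n y * f y) - f r = (LINT y|lborel. k n y * f y) - (LINT y|lborel. k n y * f r)"
      using k1[of n] by simp
    also have "\<dots> = (LINT y|lborel. k n y * (f y - f r))"
      using kfi[of n] ki[of n] by (simp add: right_diff_distrib Bochner_Integration.integral_diff)
    finally have eq: "(LINT y|lborel. k n y * f y) - f r = (LINT y|lborel. k n y * (f y - f r))" .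
    have "ennreal (norm ((LINT y|lborel. k n y * f y) - f r)) \<le> (\<integral>\<^sup>+y. norm (k n y * (f y - f r)) \<partial>lborel)"
      unfolding eq using kfi[of n] ki[of n] by (intro integral_norm_bound_ennreal) (simp add: right_diff_distrib)
    also have "\<dots> \<le> (\<integral>\<^sup>+y. ennreal (C / h n) * (ennreal \<bar>f y - f r\<bar> * indicator (ball r (h n)) y) \<partial>lborel)"
    proof (intro nn_integral_mono)
      fix y
      have "\<bar>k n y\<bar> * \<bar>f y - f r\<bar> \<le> C / h n * indicator (ball r (h n)) y * \<bar>f y - f r\<bar>"
        by (rule mult_right_mono[OF kb]) simp
      then show "ennreal (norm (k n y * (f y - f r))) \<le> ennreal (C / h n) * (ennreal \<bar>f y - f r\<bar> * indicator (ball r (h n)) y)"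
        using C h(2)[of n] kb[of n y] by (auto simp: abs_mult indicator_def ennreal_leI simp flip: ennreal_mult split: if_splits)
    qed
    also have "\<dots> = ennreal (C / h n) * (\<integral>\<^sup>+y\<in>ball r (h n). ennreal \<bar>f y - f r\<bar> \<partial>lborel)"
    proof -
      have [measurable]: "ball r (h n) \<in> sets borel" by simp
      show ?thesis by (rule nn_integral_cmult) measurable
    qed
    also have "\<dots> \<le> ennreal (C / h n) * (ennreal \<alpha> * emeasure lborel (ball r (h n)))"
      by (intro mult_left_mono N n) simp
    also have "emeasure lborel (ball r (h n)) = ennreal (2 * h n)"
      using m emeasure_lborel_ball_finite[of r "h n"] by (subst emeasure_eq_ennreal_measure) auto
    also have "ennreal (C / h n) * (ennreal \<alpha> * ennreal (2 * h n)) = ennreal (C / h n * (\<alpha> * (2 * h n)))"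
    proof -
      have "ennreal \<alpha> * ennreal (2 * h n) = ennreal (\<alpha> * (2 * h n))"
        using \<alpha> h(2)[of n] by (intro ennreal_mult[symmetric]) auto
      then show ?thesis using C \<alpha> h(2)[of n] by (simp only:) (intro ennreal_mult[symmetric], auto)
    qed
    also have "C / h n * (\<alpha> * (2 * h n)) = 2 * C * \<alpha>" using h(2)[of n] by simp
    finally have "norm ((LINT y|lborel. k n y * f y) - f r) \<le> 2 * C * \<alpha>"
      using C \<alpha> by (subst (asm) ennreal_le_iff) auto
    also have "\<dots> \<le> 2 * (C + 1) * \<alpha>" using \<alpha> by (intro mult_right_mono) auto
    also have "\<dots> < e"
    proof -
      have "(C + 1) * \<alpha> = e / 4" using C by (simp add: \<alpha>_def divide_simps)
      then have "2 * ((C + 1) * \<alpha>) < e" using e by simp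
      then show ?thesis by (simp only: mult.assoc)
    qed
    finally show "norm ((LINT y|lborel. k n y * f y) - f r) < e" .
  qed
qed

text \<open>A difference quotient of the primitive is an average of \<open>f\<close> against the
  normalised indicator of the interval between \<open>r\<close> and \<open>X n\<close>, so the
  averaging lemma applies.\<close>

lemma lebesgue_point_DERIV:
  fixes f :: "real \<Rightarrow> real"
  assumes lp: "lebesgue_point f r" and f: "integrable lborel f" and d: "c < r"
    and F: "\<And>s. s > c \<Longrightarrow> F s = (LINT y:{c<..<s}|lborel. f y)"
  shows "(F has_real_derivative f r) (at r)"
  unfolding has_field_derivative_iff tendsto_at_iff_sequentially comp_def
proof (intro allI impI)
  fix X :: "nat \<Rightarrow> real" assume X: "\<forall>i. X i \<in> UNIV - {r}" and lim: "X \<longlonglongrightarrow> r"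
  define k where "k = (\<lambda>n y. (indicator {min r (X n)..<max r (X n)} y) / \<bar>X n - r\<bar> :: real)"
  have ne: "X n \<noteq> r" for n using X by auto
  have "(\<lambda>n. LINT y|lborel. k n y * f y) \<longlonglongrightarrow> f r"
  \<comment> \<open>Balls are open and the interval may contain its end point \<open>X n\<close>, so
    the radius is twice the distance; \<open>C = 2\<close> compensates.\<close>
  proof (rule lebesgue_point_average[OF lp f, where C=2 and h="\<lambda>n. 2 * \<bar>X n - r\<bar>"])
    show "\<bar>k n y\<bar> \<le> 2 / (2 * \<bar>X n - r\<bar>) * indicator (ball r (2 * \<bar>X n - r\<bar>)) y" for n y
      using ne[of n] by (auto simp: k_def indicator_def dist_real_def min_def max_def split: if_splits)
    show "(\<lambda>n. 2 * \<bar>X n - r\<bar>) \<longlonglongrightarrow> 0"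
      using lim by (auto intro!: tendsto_eq_intros)
    show "(LINT y|lborel. k n y) = 1" for n
      using ne[of n] by (simp add: k_def)
  qed (use ne in \<open>auto simp: k_def\<close>)
  moreover have "\<forall>\<^sub>F n in sequentially. (LINT y|lborel. k n y * f y) = (F (X n) - F r) / (X n - r)"
    using order_tendstoD(1)[OF lim d]
  proof eventually_elim
    case (elim n)
    have si: "set_integrable lborel A f" if "A \<in> sets borel" for A
      unfolding set_integrable_def using f that by (intro integrable_mult_indicator) auto
    have split: "(LINT y:{c<..<v}|lborel. f y) - (LINT y:{c<..<u}|lborel. f y) = (LINT y:{u..<v}|lborel. f y)"
      if "c < u" "u \<le> v" for u v
    proof -
      have "{c<..<v} = {c<..<u} \<union> {u..<v}" using that by auto
      moreover have "(LINT y:({c<..<u} \<union> {u..<v})|lborel. f y) = (LINT y:{c<..<u}|lborel. f y) + (LINT y:{u..<v}|lborel. f y)"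
        by (rule set_integral_Un) (auto intro: si)
      ultimately show ?thesis by simp
    qed
    have "(LINT y|lborel. k n y * f y) = (LINT y:{min r (X n)..<max r (X n)}|lborel. f y) / \<bar>X n - r\<bar>"
      unfolding k_def set_lebesgue_integral_def by (subst integral_divide_zero[symmetric]) simp
    also have "\<dots> = (F (X n) - F r) / (X n - r)"
    proof (cases "r < X n")
      case True
      then show ?thesis using split[of r "X n"] d elim by (simp add: F min_def max_def)
    next
      case False
      then have "X n < r" using ne[of n] by simp
      then show ?thesis using split[of "X n" r] d elim by (simp add: F min_def max_def) (simp add: field_simps)
    qed
    finally show ?case .
  qed
  ultimately show "(\<lambda>n. (F (X n) - F r) / (X n - r)) \<longlonglongrightarrow> f r"
    by (rule Lim_transform_eventually)
qed

text \<open>The piecewise quadratic C^1 step from 0 to 1: its derivative is the tent of height 2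
  over the unit interval.\<close>

definition smooth_step :: "real \<Rightarrow> real" where
  "smooth_step y = 2 * (max 0 y)\<^sup>2 - 4 * (max 0 (y - 1/2))\<^sup>2 + 2 * (max 0 (y - 1))\<^sup>2"

definition smooth_step' :: "real \<Rightarrow> real" where
  "smooth_step' y = 4 * max 0 y - 8 * max 0 (y - 1/2) + 4 * max 0 (y - 1)"

lemma smooth_step_deriv: "(smooth_step has_real_derivative smooth_step' y) (at y)"
proof -
  have d: "((\<lambda>y. (max 0 (y - a))\<^sup>2) has_real_derivative 2 * max 0 (y - a)) (at y)" for a
    using DERIV_chain2[OF has_real_derivative_pos_part_square DERIV_diff[OF DERIV_ident DERIV_const[of a]], of y] by simp
  show ?thesis
    unfolding smooth_step_def[abs_def] smooth_step'_def
    using DERIV_add[OF DERIV_diff[OF DERIV_cmult[OF d[of 0], of 2] DERIV_cmult[OF d[of "1/2"], of 4]] DERIV_cmult[OF d[of 1], of 2]]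
    by simp
qed

lemma smooth_step_simps: "y \<le> 0 \<Longrightarrow> smooth_step y = 0" "y \<ge> 1 \<Longrightarrow> smooth_step y = 1"
  by (auto simp: smooth_step_def max_def power2_eq_square algebra_simps)

lemma smooth_step'_bounds: "0 \<le> smooth_step' y" "smooth_step' y \<le> 2 * indicator {0..1} y"
  by (auto simp: smooth_step'_def max_def indicator_def)

lemma smooth_step_bounds: "0 \<le> smooth_step y" "smooth_step y \<le> 1"
proof -
  have mono: "x \<le> y \<Longrightarrow> smooth_step x \<le> smooth_step y" for x y
    by (rule DERIV_nonneg_imp_nondecreasing) (use smooth_step_deriv smooth_step'_bounds in blast)+
  show "0 \<le> smooth_step y" using mono[of "min 0 y" y] smooth_step_simps(1)[of "min 0 y"] by simp
  show "smooth_step y \<le> 1" using mono[of y "max 1 y"] smooth_step_simps(2)[of "max 1 y"] by simp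
qed

lemma continuous_smooth_step': "continuous_on S smooth_step'"
  unfolding smooth_step'_def by (intro continuous_intros)

text \<open>\<open>\<rho> \<mapsto> cut r n \<rho>\<close> decreases from 1 to 0 for \<open>\<rho>\<close> between \<open>r\<close> and \<open>r + 1 / Suc n\<close>; it is a function of
  \<open>\<rho>\<^sup>2\<close>, so that \<open>cut r n (norm x)\<close> is \<open>C\<^sup>1\<close> at 0.\<close>

definition cut_width :: "real \<Rightarrow> nat \<Rightarrow> real" where
  "cut_width r n = (r + 1 / Suc n)\<^sup>2 - r\<^sup>2"

definition cut :: "real \<Rightarrow> nat \<Rightarrow> real \<Rightarrow> real" where
  "cut r n \<rho> = 1 - smooth_step ((\<rho>\<^sup>2 - r\<^sup>2) / cut_width r n)"

definition cut_kernel :: "real \<Rightarrow> nat \<Rightarrow> real \<Rightarrow> real" where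
  "cut_kernel r n \<rho> = smooth_step' ((\<rho>\<^sup>2 - r\<^sup>2) / cut_width r n) * (2 * \<rho> / cut_width r n)"

lemma cut_width_pos: "r > 0 \<Longrightarrow> cut_width r n > 0"
  by (simp add: cut_width_def power_strict_mono)

lemma cut_deriv: "(cut r n has_real_derivative - cut_kernel r n \<rho>) (at \<rho>)"
proof -
  have "((\<lambda>\<rho>. (\<rho>\<^sup>2 - r\<^sup>2) / cut_width r n) has_real_derivative 2 * \<rho> / cut_width r n) (at \<rho>)"
    by (rule DERIV_cdivide) (auto intro!: derivative_eq_intros)
  from DERIV_diff[OF DERIV_const DERIV_chain2[OF smooth_step_deriv this]] show ?thesis
    unfolding cut_def[abs_def] cut_kernel_def by simp
qed

lemma cut_bounds: "0 \<le> cut r n \<rho>" "cut r n \<rho> \<le> 1"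
  using smooth_step_bounds by (auto simp: cut_def)

lemma cut_eq_1: "r > 0 \<Longrightarrow> 0 \<le> \<rho> \<Longrightarrow> \<rho> \<le> r \<Longrightarrow> cut r n \<rho> = 1"
  unfolding cut_def using cut_width_pos[of r n]
  by (subst smooth_step_simps(1)) (auto simp: divide_le_0_iff power_mono)

lemma cut_eq_0:
  assumes "r > 0" "r + 1 / Suc n \<le> \<rho>" shows "cut r n \<rho> = 0"
proof -
  have "(r + 1 / Suc n)\<^sup>2 \<le> \<rho>\<^sup>2" using assms by (intro power_mono) auto
  then have "cut_width r n \<le> \<rho>\<^sup>2 - r\<^sup>2" by (simp add: cut_width_def)
  then have "1 \<le> (\<rho>\<^sup>2 - r\<^sup>2) / cut_width r n" using cut_width_pos[OF assms(1), of n] by (simp add: le_divide_eq)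
  then show ?thesis by (simp add: cut_def smooth_step_simps)
qed

lemma cut_tendsto:
  assumes "r > 0" "\<rho> \<ge> 0"
  shows "(\<lambda>n. cut r n \<rho>) \<longlonglongrightarrow> indicator {..r} \<rho>"
proof (cases "\<rho> \<le> r")
  case True then show ?thesis using cut_eq_1[OF assms True] by simp
next
  case False
  then have "\<forall>\<^sub>F n in sequentially. 1 / real (Suc n) < \<rho> - r"
    using order_tendstoD(2)[OF LIMSEQ_Suc[OF lim_1_over_n], of "\<rho> - r"] by simp
  then have "\<forall>\<^sub>F n in sequentially. 0 = cut r n \<rho>"
    by eventually_elim (use cut_eq_0[OF assms(1)] in force)
  then show ?thesis using False by (auto intro: Lim_transform_eventually[OF tendsto_const])
qed

text \<open>With \<open>s = 1 / Suc n\<close> the width is \<open>s * (2 * r + s)\<close>, so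
  \<open>2 * \<rho> / width\<close> is at most \<open>2 / s\<close>, and the tent doubles this. The
  result is written as \<open>C / h\<close> with \<open>C = 8\<close> and \<open>h = 2 * s\<close>;
  the open ball of radius \<open>h\<close> contains the end point \<open>r + s\<close>.\<close>

lemma cut_kernel_bound:
  assumes r: "r > 0" and \<rho>: "\<rho> > 0"
  shows "\<bar>cut_kernel r n \<rho>\<bar> \<le> 8 / (2 / Suc n) * indicator (ball r (2 / Suc n)) \<rho>"
proof -
  let ?w = "cut_width r n" and ?s = "1 / real (Suc n)"
  have w: "?w > 0" by (rule cut_width_pos[OF r])
  have s: "?s > 0" by simp
  show ?thesis
  proof (cases "(\<rho>\<^sup>2 - r\<^sup>2) / ?w \<in> {0..1}")
    case True
    then have "r\<^sup>2 \<le> \<rho>\<^sup>2" "\<rho>\<^sup>2 \<le> (r + ?s)\<^sup>2" using w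
      by (auto simp: zero_le_divide_iff divide_le_eq cut_width_def)
    then have b: "r \<le> \<rho>" "\<rho> \<le> r + ?s"
      using r \<rho> s by (auto intro: power2_le_imp_le)
    have "\<bar>cut_kernel r n \<rho>\<bar> \<le> 2 * (2 * \<rho> / ?w)"
      using smooth_step'_bounds[of "(\<rho>\<^sup>2 - r\<^sup>2) / ?w"] w \<rho> True
      unfolding cut_kernel_def abs_mult by (intro mult_mono) (auto simp: abs_of_nonneg)
    also have "2 * \<rho> / ?w \<le> 2 * (r + ?s) / ?w" using b w by (intro divide_right_mono) auto
    also have "\<dots> \<le> 2 * Suc n"
    proof -
      have weq: "?w = ?s * (2 * r + ?s)" unfolding cut_width_def by (simp add: power2_eq_square algebra_simps)
      have "2 * real (Suc n) * ?s = 2" by (simp add: field_simps)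
      moreover have "2 * Suc n * ?w = 2 * real (Suc n) * ?s * (2 * r + ?s)" by (simp only: weq mult.assoc)
      ultimately have "2 * Suc n * ?w = 2 * (2 * r + ?s)" by simp
      moreover have "2 * (r + ?s) \<le> 2 * (2 * r + ?s)" using r by simp
      ultimately have "2 * (r + ?s) \<le> 2 * Suc n * ?w" by simp
      then show ?thesis using w by (simp add: divide_le_eq)
    qed
    finally have "\<bar>cut_kernel r n \<rho>\<bar> \<le> 8 / (2 / Suc n)" by simp
    moreover have "\<rho> \<in> ball r (2 / Suc n)" 
    proof -
      have "2 / real (Suc n) = 2 * ?s" by simp
      then have "\<bar>r - \<rho>\<bar> < 2 / real (Suc n)" using b s by linarith
      then show ?thesis by (simp add: dist_real_def)
    qed
    ultimately show ?thesis by simp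
  next
    case False
    then have "cut_kernel r n \<rho> = 0"
      using smooth_step'_bounds[of "(\<rho>\<^sup>2 - r\<^sup>2) / ?w"] by (simp add: cut_kernel_def)
    then show ?thesis by simp
  qed
qed

lemma continuous_cut_kernel: "r > 0 \<Longrightarrow> continuous_on S (cut_kernel r n)"
  unfolding cut_kernel_def[abs_def] using cut_width_pos[of r n]
  by (intro continuous_intros continuous_on_compose2[OF continuous_smooth_step']) auto

lemma cut_kernel_eq_0: "r > 0 \<Longrightarrow> 0 < \<rho> \<Longrightarrow> \<rho> < r \<or> r + 1 / Suc n < \<rho> \<Longrightarrow> cut_kernel r n \<rho> = 0"
proof -
  assume r: "r > 0" and \<rho>: "0 < \<rho>" and "\<rho> < r \<or> r + 1 / Suc n < \<rho>"
  then have "(\<rho>\<^sup>2 - r\<^sup>2) / cut_width r n \<notin> {0..1}"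
  proof (elim disjE)
    assume "\<rho> < r"
    then have "\<rho>\<^sup>2 < r\<^sup>2" using \<rho> by (intro power_strict_mono) auto
    then show ?thesis using cut_width_pos[OF r, of n] by (auto simp: zero_le_divide_iff)
  next
    assume "r + 1 / Suc n < \<rho>"
    then have "(r + 1 / Suc n)\<^sup>2 < \<rho>\<^sup>2" using r by (intro power_strict_mono) auto
    then show ?thesis using cut_width_pos[OF r, of n] by (auto simp: divide_le_eq cut_width_def)
  qed
  then show ?thesis
    using smooth_step'_bounds[of "(\<rho>\<^sup>2 - r\<^sup>2) / cut_width r n"] by (simp add: cut_kernel_def)
qed

lemma integral_cut_kernel:
  assumes r: "r > 0"
  shows "(LINT \<rho>|lborel. indicator {0<..} \<rho> * cut_kernel r n \<rho>) = 1"
proof -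
  let ?b = "r + 1 / Suc n"
  have "(LINT \<rho>|lborel. indicator {0<..} \<rho> * cut_kernel r n \<rho>) = (LINT \<rho>|lborel. cut_kernel r n \<rho> * indicator {r..?b} \<rho>)"
  proof (intro Bochner_Integration.integral_cong refl)
    fix \<rho> :: real
    show "indicator {0<..} \<rho> * cut_kernel r n \<rho> = cut_kernel r n \<rho> * indicator {r..?b} \<rho>"
      using cut_kernel_eq_0[OF r, of \<rho> n] r by (auto simp: indicator_def)
  qed
  also have "\<dots> = (- cut r n ?b) - (- cut r n r)"
  proof (rule integral_FTC_Icc_nonneg)
    show "cut_kernel r n \<in> borel_measurable borel"
      by (rule borel_measurable_continuous_onI[OF continuous_cut_kernel[OF r]])
    show "((\<lambda>x. - cut r n x) has_real_derivative cut_kernel r n \<rho>) (at \<rho>)" for \<rho>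
      using DERIV_minus[OF cut_deriv[of r n \<rho>]] by simp
    show "0 \<le> cut_kernel r n \<rho>" if "\<rho> \<in> {r..?b}" for \<rho>
      using smooth_step'_bounds(1) cut_width_pos[OF r, of n] that r by (auto simp: cut_kernel_def)
    show "r \<le> ?b" by simp
  qed
  also have "\<dots> = 1" using cut_eq_1[OF r, of r n] cut_eq_0[OF r, of n ?b] r by simp
  finally show ?thesis .
qed

text \<open>In polar coordinates both claims concern the single function \<open>f\<close> of the
  radius given by the circle integrals of \<open>g\<close>: one is the derivative of its primitive,
  the other its average against the cutoff kernel. Both hold at every Lebesgue point of
  \<open>f\<close>.\<close>

lemma AE_radial_limits:
  fixes g :: "real \<times> real \<Rightarrow> real"
  assumes g[measurable]: "g \<in> borel_measurable borel"
    and gb: "\<And>x. \<bar>g x\<bar> \<le> B * indicator {x. fst x > 0 \<and> norm (x - (0, b)) < R} x"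
  shows "AE r in lborel. r \<in> {0<..<R} \<longrightarrow>
    ((\<lambda>r. LINT x:half_disc (0, b) r|lborel. g x) has_real_derivative circ_int (0, b) g r) (at r) \<and>
    (\<lambda>n. LINT x:{x. fst x > 0}|lborel. cut_kernel r n (norm (x - (0, b))) * g x) \<longlonglongrightarrow> circ_int (0, b) g r"
proof -
  let ?U = "{x::real \<times> real. fst x > 0}" and ?c = "(0::real, b)"
  define f where "f \<rho> = indicator {0<..} \<rho> *\<^sub>R circ_int ?c g \<rho>" for \<rho>
  have HD: "half_disc ?c s = ?U \<inter> {x. norm (x - ?c) < s}" for s
    unfolding half_disc_def ball_def dist_norm by (subst norm_minus_commute) blast
  have open_HD: "open (half_disc ?c s)" for s
    unfolding half_disc_def by (intro open_Int open_ball open_Collect_less continuous_intros)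
  have opU: "open ?U" by (intro open_Collect_less continuous_intros)
  have [measurable]: "?U \<in> sets borel" "half_disc ?c s \<in> sets borel" for s
    using opU open_HD by auto
  have nm[measurable]: "(\<lambda>x. norm (x - ?c)) \<in> borel_measurable borel"
    by (intro borel_measurable_continuous_onI continuous_intros)
  have fin: "emeasure lborel (half_disc ?c s) < \<infinity>" for s
    using emeasure_mono[of "half_disc ?c s" "ball ?c s" lborel] emeasure_lborel_ball_finite[of ?c s]
    by (auto simp: half_disc_def)
  have dom: "set_integrable lborel ?U h" if "h \<in> borel_measurable borel" "\<And>x. \<bar>h x\<bar> \<le> B' * indicator (half_disc ?c R) x" for h :: "real \<times> real \<Rightarrow> real" and B'
    unfolding set_integrable_def
  proof (rule Bochner_Integration.integrable_bound[where f="\<lambda>x. B' * indicator (half_disc ?c R) x"])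
    show "integrable lborel (\<lambda>x. B' * indicator (half_disc ?c R) x)"
      using fin by (intro integrable_mult_right integrable_real_indicator) auto
    show "AE x in lborel. norm (indicat_real ?U x *\<^sub>R h x) \<le> norm (B' * indicat_real (half_disc ?c R) x)"
    proof (intro always_eventually allI)
      fix x
      show "norm (indicat_real ?U x *\<^sub>R h x) \<le> norm (B' * indicat_real (half_disc ?c R) x)"
        using order_trans[OF that(2)[of x] abs_ge_self] by (cases "x \<in> ?U") auto
    qed
  qed (use that in simp)
  have gb': "\<bar>g x\<bar> \<le> B * indicator (half_disc ?c R) x" for x
    using gb[of x] by (simp add: HD indicator_def)
  have gi: "set_integrable lborel ?U g" by (rule dom[OF g gb'])
  have fi: "integrable lborel f"
    using integral_polar(1)[OF g gi] by (simp add: set_integrable_def f_def[abs_def])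
  have "AE r in lborel. lebesgue_point f r" by (rule AE_lebesgue_point[OF fi])
  then show ?thesis
  proof eventually_elim
    case (elim r)
    show ?case
    proof
      assume r: "r \<in> {0<..<R}"
      have fr: "f r = circ_int ?c g r" using r by (simp add: f_def)
      have B: "B \<ge> 0"
      proof -
        have "(r * cos 0, b) \<in> half_disc ?c R" using r by (simp add: HD norm_prod_def)
        then show ?thesis using gb'[of "(r * cos 0, b)"] by simp
      qed
      have 1: "((\<lambda>r. LINT x:half_disc ?c r|lborel. g x) has_real_derivative f r) (at r)"
      proof (rule lebesgue_point_DERIV[OF elim fi, of 0])
        fix s :: real assume s: "s > 0"
        let ?h = "\<lambda>x. indicator {..<s} (norm (x - ?c)) * g x"
        have hm: "?h \<in> borel_measurable borel" by measurable
        have hi: "set_integrable lborel ?U ?h"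
        proof (rule dom[OF hm, of B])
          fix x
          have "\<bar>indicator {..<s} (norm (x - ?c)) * g x\<bar> \<le> \<bar>g x\<bar>" by (simp add: indicator_def)
          also note gb'[of x]
          finally show "\<bar>indicator {..<s} (norm (x - ?c)) * g x\<bar> \<le> B * indicator (half_disc ?c R) x" .
        qed
        have "(LINT x:half_disc ?c s|lborel. g x) = (LINT x:?U|lborel. ?h x)"
          unfolding set_lebesgue_integral_def HD
          by (intro Bochner_Integration.integral_cong) (auto simp: indicator_def)
        also have "\<dots> = (LINT \<rho>:{0<..}|lborel. circ_int ?c ?h \<rho>)" by (rule integral_polar(2)[OF hm hi])
        also have "\<dots> = (LINT \<rho>:{0<..<s}|lborel. f \<rho>)"
          unfolding set_lebesgue_integral_def
        proof (intro Bochner_Integration.integral_cong refl)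
          fix \<rho> :: real
          show "indicator {0<..} \<rho> *\<^sub>R circ_int ?c ?h \<rho> = indicator {0<..<s} \<rho> *\<^sub>R f \<rho>"
            using circ_int_radial[of \<rho> ?c "indicator {..<s}" g] by (cases "\<rho> > 0") (auto simp: indicator_def f_def)
        qed
        finally show "(LINT x:half_disc ?c s|lborel. g x) = (LINT \<rho>:{0<..<s}|lborel. f \<rho>)" .
      qed (use r in auto)
      have 2: "(\<lambda>n. LINT x:?U|lborel. cut_kernel r n (norm (x - ?c)) * g x) \<longlonglongrightarrow> f r"
      proof -
        have r0: "r > 0" using r by simp
        have ckm[measurable]: "cut_kernel r n \<in> borel_measurable borel" for n
          by (rule borel_measurable_continuous_onI[OF continuous_cut_kernel[OF r0]])
        have "(\<lambda>n. LINT \<rho>|lborel. (indicator {0<..} \<rho> * cut_kernel r n \<rho>) * f \<rho>) \<longlonglongrightarrow> f r"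
        proof (rule lebesgue_point_average[OF elim fi, where C=8 and h="\<lambda>n. 2 / Suc n"])
          show "\<bar>indicator {0<..} y * cut_kernel r n y\<bar> \<le> 8 / (2 / Suc n) * indicator (ball r (2 / Suc n)) y" for n y
            using cut_kernel_bound[OF r0, of y n] by (cases "y > 0") auto
          show "(\<lambda>n. 2 / real (Suc n)) \<longlonglongrightarrow> 0"
            using tendsto_mult_right_zero[OF LIMSEQ_Suc[OF lim_1_over_n], of 2] by simp
          show "(LINT y|lborel. indicator {0<..} y * cut_kernel r n y) = 1" for n
            by (rule integral_cut_kernel[OF r0])
        qed auto
        moreover have "(LINT x:?U|lborel. cut_kernel r n (norm (x - ?c)) * g x) = (LINT \<rho>|lborel. (indicator {0<..} \<rho> * cut_kernel r n \<rho>) * f \<rho>)" for n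
        proof -
          let ?h = "\<lambda>x. cut_kernel r n (norm (x - ?c)) * g x"
          have hm: "?h \<in> borel_measurable borel" by measurable
          have hi: "set_integrable lborel ?U ?h"
          proof (rule dom[OF hm, of "(8 / (2 / Suc n)) * B"])
            fix x
            show "\<bar>cut_kernel r n (norm (x - ?c)) * g x\<bar> \<le> 8 / (2 / Suc n) * B * indicator (half_disc ?c R) x"
            proof (cases "x \<in> half_disc ?c R")
              case True
              have "norm (x - ?c) > 0" using True by (auto simp: HD)
              then have "\<bar>cut_kernel r n (norm (x - ?c))\<bar> \<le> 8 / (2 / Suc n)"
                by (intro order_trans[OF cut_kernel_bound[OF r0]]) (auto simp: indicator_def)
              moreover have "\<bar>g x\<bar> \<le> B" using gb'[of x] True by simp
              ultimately have "\<bar>cut_kernel r n (norm (x - ?c))\<bar> * \<bar>g x\<bar> \<le> 8 / (2 / Suc n) * B"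
                by (intro mult_mono) auto
              with True show ?thesis by (simp add: abs_mult)
            next
              case False
              then have "g x = 0" using gb'[of x] by simp
              with False show ?thesis by simp
            qed
          qed
          have "(LINT x:?U|lborel. ?h x) = (LINT \<rho>:{0<..}|lborel. circ_int ?c ?h \<rho>)" by (rule integral_polar(2)[OF hm hi])
          also have "\<dots> = (LINT \<rho>|lborel. (indicator {0<..} \<rho> * cut_kernel r n \<rho>) * f \<rho>)"
            unfolding set_lebesgue_integral_def
          proof (intro Bochner_Integration.integral_cong refl)
            fix \<rho> :: real
            show "indicator {0<..} \<rho> *\<^sub>R circ_int ?c ?h \<rho> = (indicator {0<..} \<rho> * cut_kernel r n \<rho>) * f \<rho>"
              using circ_int_radial[of \<rho> ?c "cut_kernel r n" g] by (cases "\<rho> > 0") (auto simp: f_def)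
          qed
          finally show ?thesis .
        qed
        ultimately show ?thesis by simp
      qed
      show "((\<lambda>r. LINT x:half_disc (0, b) r|lborel. g x) has_real_derivative circ_int (0, b) g r) (at r) \<and>
         (\<lambda>n. LINT x:{x. fst x > 0}|lborel. cut_kernel r n (norm (x - (0, b))) * g x) \<longlonglongrightarrow> circ_int (0, b) g r"
        using 1 2 unfolding fr by blast
    qed
  qed
qed

section \<open>The equation of state\<close>

locale eos =
  fixes g \<rho>0 :: real and p :: "real \<Rightarrow> real" and \<alpha> :: real
  assumes eos: "equation_of_state g \<rho>0 p \<alpha>"
begin

lemma g_pos: "g > 0" and r0_pos: "\<rho>0 > 0"
  using eos by (auto simp: equation_of_state_def)

lemma p_deriv: "\<rho> > 0 \<Longrightarrow> (p has_real_derivative deriv p \<rho>) (at \<rho>)"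
proof -
  assume \<rho>: "\<rho> > 0"
  obtain p' where "\<And>\<rho>. \<rho> \<ge> 0 \<Longrightarrow> (p has_real_derivative p' \<rho>) (at \<rho> within {0..})"
    using eos by (auto simp: equation_of_state_def)
  then have "(p has_real_derivative p' \<rho>) (at \<rho> within {0..})" using \<rho> by simp
  moreover have "at \<rho> within {0..} = at \<rho>" using \<rho> by (intro at_within_interior) simp
  ultimately have "(p has_real_derivative p' \<rho>) (at \<rho>)" by simp
  then show ?thesis by (simp add: DERIV_imp_deriv)
qed

lemma dp_deriv: "\<rho> > 0 \<Longrightarrow> (deriv p has_real_derivative deriv (deriv p) \<rho>) (at \<rho>)"
  using eos by (auto simp: equation_of_state_def intro!: DERIV_deriv_iff_real_differentiable[THEN iffD2])

lemma dp_pos: "\<rho> > 0 \<Longrightarrow> deriv p \<rho> > 0" and ddp_pos: "\<rho> > 0 \<Longrightarrow> 2 * deriv p \<rho> + \<rho> * deriv (deriv p) \<rho> > 0"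
  using eos by (auto simp: equation_of_state_def)

lemma dp_cont: "S \<subseteq> {0<..} \<Longrightarrow> continuous_on S (deriv p)"
  using dp_deriv by (intro continuous_at_imp_continuous_on) (auto intro: DERIV_isCont)

abbreviation "h \<equiv> enthalpy \<rho>0 p"

lemma h_r0: "h \<rho>0 = 0" by (simp add: enthalpy_def)

lemma h_deriv: assumes \<rho>: "\<rho> > 0" shows "(h has_real_derivative deriv p \<rho> / \<rho>) (at \<rho>)"
proof -
  define a where "a = min \<rho> \<rho>0 / 2"
  define b where "b = max \<rho> \<rho>0 + 1"
  have a: "0 < a" "a < \<rho>" "a < \<rho>0" and b: "\<rho> < b" "\<rho>0 < b"
    using \<rho> r0_pos by (auto simp: a_def b_def)
  have "((\<lambda>u. LBINT y=\<rho>0..u. deriv p y / y) has_vector_derivative (deriv p \<rho> / \<rho>)) (at \<rho> within {a..b})"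
    by (rule interval_integral_FTC2) (use a b in \<open>auto intro!: continuous_intros dp_cont\<close>)
  moreover have "at \<rho> within {a..b} = at \<rho>" using a b by (intro at_within_interior) simp
  ultimately show ?thesis
    by (simp add: has_real_derivative_iff_has_vector_derivative enthalpy_def[abs_def])
qed

lemma h_cont: "S \<subseteq> {0<..} \<Longrightarrow> continuous_on S h"
  using h_deriv by (intro continuous_at_imp_continuous_on) (auto intro: DERIV_isCont)

lemma h_strict_mono: "0 < x \<Longrightarrow> x < y \<Longrightarrow> h x < h y"
proof (rule DERIV_pos_imp_increasing[of x y h])
  fix z assume "0 < x" "x \<le> z" "z \<le> y"
  then have "z > 0" by simp
  then show "\<exists>y. (h has_real_derivative y) (at z) \<and> 0 < y"
    using h_deriv[of z] dp_pos[of z] by (intro exI[of _ "deriv p z / z"]) simp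
qed

text \<open>The left side of the equation for the critical density. It is increasing because of the
  second condition on the pressure law, so a density \<open>y\<close> is subsonic at
  \<open>s\<close> exactly when \<open>g * s < Q y\<close>.\<close>

definition "Q \<rho> = deriv p \<rho> / 2 + h \<rho>"

lemma Q_deriv: "\<rho> > 0 \<Longrightarrow> (Q has_real_derivative (2 * deriv p \<rho> + \<rho> * deriv (deriv p) \<rho>) / (2 * \<rho>)) (at \<rho>)"
  unfolding Q_def[abs_def]
  using DERIV_add[OF DERIV_cdivide[OF dp_deriv, of \<rho> 2] h_deriv[of \<rho>]] by (simp add: field_simps)

lemma Q_cont: "S \<subseteq> {0<..} \<Longrightarrow> continuous_on S Q"
  using Q_deriv by (intro continuous_at_imp_continuous_on) (auto intro: DERIV_isCont)

lemma Q_strict_mono: "0 < x \<Longrightarrow> x < y \<Longrightarrow> Q x < Q y"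
proof (rule DERIV_pos_imp_increasing[of x y Q])
  fix z assume "0 < x" "x \<le> z" "z \<le> y"
  then have "z > 0" by simp
  then show "\<exists>y. (Q has_real_derivative y) (at z) \<and> 0 < y"
    using Q_deriv[of z] ddp_pos[of z] by (intro exI[of _ "(2 * deriv p z + z * deriv (deriv p) z) / (2 * z)"]) simp
qed

text \<open>As \<open>\<rho> \<rightarrow> 0\<close>, either \<open>p' (0) = 0\<close>, and then \<open>Q\<close> tends to the negative number \<open>h (0)\<close>,
  or \<open>p' (0) > 0\<close>, and then \<open>h\<close> tends to \<open>-\<infinity>\<close>.\<close>

lemma Q_neg: "\<exists>\<rho>>0. \<rho> < \<rho>0 \<and> Q \<rho> < 0"
proof -
  obtain p' where p': "\<And>\<rho>. \<rho> \<ge> 0 \<Longrightarrow> (p has_real_derivative p' \<rho>) (at \<rho> within {0..})"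
     "\<forall>R. \<exists>C. \<forall>a\<in>{0..R}. \<forall>b\<in>{0..R}. \<bar>p' a - p' b\<bar> \<le> C * \<bar>a - b\<bar> powr \<alpha>" and al: "\<alpha> > 0"
    using eos by (auto simp: equation_of_state_def)
  have pe: "p' \<rho> = deriv p \<rho>" if "\<rho> > 0" for \<rho>
  proof -
    have "(p has_real_derivative p' \<rho>) (at \<rho> within {0..})" using p'(1) that by simp
    moreover have "at \<rho> within {0..} = at \<rho>" using that by (intro at_within_interior) simp
    ultimately show ?thesis by (simp add: DERIV_imp_deriv)
  qed
  obtain C where C: "\<And>a b. a \<in> {0..1} \<Longrightarrow> b \<in> {0..1} \<Longrightarrow> \<bar>p' a - p' b\<bar> \<le> C * \<bar>a - b\<bar> powr \<alpha>"
    using p'(2) by meson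
  have lim: "(p' \<longlongrightarrow> p' 0) (at_right 0)"
  proof (rule LIM_zero_cancel, rule Lim_null_comparison)
    show "\<forall>\<^sub>F x in at_right 0. norm (p' x - p' 0) \<le> C * x powr \<alpha>"
      unfolding eventually_at_right[OF zero_less_one] using C[of _ 0] by (intro exI[of _ 1]) auto
    have "((\<lambda>x::real. x powr \<alpha>) \<longlongrightarrow> 0) (at_right 0)"
      using al by (intro tendsto_zero_powrI[OF tendsto_ident_at tendsto_const]) (auto simp: eventually_at_filter)
    then show "((\<lambda>x. C * x powr \<alpha>) \<longlongrightarrow> 0) (at_right 0)" by (rule tendsto_mult_right_zero)
  qed
  have pnn: "0 \<le> p' 0"
  proof (rule tendsto_lowerbound[OF lim])
    show "\<forall>\<^sub>F x in at_right 0. 0 \<le> p' x"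
      unfolding eventually_at_right[OF zero_less_one] using pe dp_pos by (intro exI[of _ 1]) (auto intro: less_imp_le)
  qed simp
  show ?thesis
  proof (cases "p' 0 = 0")
    case True
    define m where "m = h (\<rho>0 / 2)"
    have m: "m < 0" using h_strict_mono[of "\<rho>0/2" \<rho>0] r0_pos h_r0 by (simp add: m_def)
    have "\<forall>\<^sub>F x in at_right 0. p' x < - m"
      using order_tendstoD(2)[OF lim, of "- m"] m True by simp
    moreover have "\<forall>\<^sub>F x in at_right 0. x < \<rho>0 / 2"
      using r0_pos by (intro eventually_at_right_less[THEN eventually_mono] order_tendstoD(2)[OF tendsto_ident_at]) auto
    moreover have "\<forall>\<^sub>F x::real in at_right 0. x > 0" by (rule eventually_at_right_less)
    ultimately have "\<forall>\<^sub>F x in at_right 0. 0 < x \<and> x < \<rho>0 \<and> Q x < 0"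
    proof eventually_elim
      case (elim x)
      have "h x < m" using h_strict_mono[of x "\<rho>0/2"] elim by (simp add: m_def)
      then show ?case using elim pe[of x] m r0_pos by (simp add: Q_def)
    qed
    then obtain x where "0 < x \<and> x < \<rho>0 \<and> Q x < 0"
      using eventually_happens'[OF trivial_limit_at_right_real] by blast
    then show ?thesis by blast
  next
    case False
    define m where "m = p' 0 / 2"
    have m: "m > 0" "m < p' 0" using pnn False by (auto simp: m_def)
    have "\<forall>\<^sub>F x in at_right 0. m < p' x \<and> p' x < 2 * p' 0"
      using order_tendstoD[OF lim] m by (auto intro!: eventually_conj)
    then obtain d where d: "d > 0" "\<And>x. 0 < x \<Longrightarrow> x < d \<Longrightarrow> m < p' x \<and> p' x < 2 * p' 0"
      unfolding eventually_at_right[OF zero_less_one] by auto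
    define e where "e = min d \<rho>0 / 2"
    have e: "0 < e" "e < d" "e < \<rho>0" using d r0_pos by (auto simp: e_def)
    \<comment> \<open>Since \<open>h - m ln\<close> is increasing, passing from \<open>e\<close> to
      \<open>x\<close> lowers \<open>h\<close> by at least \<open>m * ln (e / x) = p' 0 + 1\<close>,
      which outweighs \<open>p' x / 2 < p' 0\<close>.\<close>
    define x where "x = e * exp (- ((p' 0 + 1) / m))"
    have x: "0 < x" "x < e" using e m by (auto simp: x_def mult_less_cancel_left1 divide_neg_pos)
    have "h e - m * ln e - (h x - m * ln x) \<ge> 0"
    proof -
      have "h x - m * ln x \<le> h e - m * ln e"
      proof (rule DERIV_nonneg_imp_nondecreasing[where f="\<lambda>x. h x - m * ln x"])
        show "x \<le> e" using x by simp
        fix y assume y: "x \<le> y" "y \<le> e"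
        then have y0: "y > 0" "y < d" using x e by auto
        have "((\<lambda>x. h x - m * ln x) has_real_derivative deriv p y / y - m * (1 / y)) (at y)"
          by (rule DERIV_diff[OF h_deriv[OF y0(1)] DERIV_cmult[OF DERIV_ln_divide[OF y0(1)]]])
        moreover have "deriv p y / y - m * (1 / y) \<ge> 0"
          using d(2)[OF y0] pe[OF y0(1)] y0 by (simp add: diff_divide_distrib[symmetric])
        ultimately show "\<exists>z. ((\<lambda>x. h x - m * ln x) has_real_derivative z) (at y) \<and> z \<ge> 0" by blast
      qed
      then show ?thesis by simp
    qed
    moreover have "ln x = ln e - (p' 0 + 1) / m" using e by (simp add: x_def ln_mult)
    then have "m * ln x = m * ln e - (p' 0 + 1)" using m by (simp add: right_diff_distrib)
    ultimately have "h x \<le> h e - (p' 0 + 1)" by simp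
    also have "h e < 0" using h_strict_mono[of e \<rho>0] e h_r0 by simp
    finally have "h x < - (p' 0 + 1)" by simp
    moreover have "deriv p x / 2 < p' 0" using d(2)[of x] pe[of x] x e by simp
    ultimately have "Q x < 0" by (simp add: Q_def)
    then show ?thesis using x e by (intro exI[of _ x]) auto
  qed
qed

lemma Q_r0: "Q \<rho>0 = g * s_star g \<rho>0 p"
  using g_pos by (simp add: Q_def h_r0 s_star_def)

definition "rcr s = rho_cr g \<rho>0 p s"

text \<open>Intermediate values between a density with negative \<open>Q\<close> and \<rho>0, where
  \<open>Q\<close> equals \<open>g * s_star\<close>. The latter is the role of the bound
  \<open>s < s_star\<close>.\<close>

lemma rcr:
  assumes s: "0 \<le> s" "s < s_star g \<rho>0 p"
  shows "0 < rcr s" "rcr s < \<rho>0" "Q (rcr s) = g * s"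
proof -
  obtain a where a: "0 < a" "a < \<rho>0" "Q a < 0" using Q_neg by blast
  have 1: "Q a \<le> g * s" "g * s \<le> Q \<rho>0"
    using a s g_pos mult_left_mono[of s "s_star g \<rho>0 p" g] by (auto simp: Q_r0 intro: order_trans[OF less_imp_le])
  obtain x where x: "a \<le> x" "x \<le> \<rho>0" "Q x = g * s"
    using IVT'[of Q a "g * s" \<rho>0, OF 1] Q_cont[of "{a..\<rho>0}"] a by (auto simp: subset_eq)
  have x0: "x > 0" using x a by simp
  have "Q x < Q \<rho>0" using x(3) s g_pos by (simp add: Q_r0)
  then have "x \<noteq> \<rho>0" by auto
  have "rho_cr g \<rho>0 p s = x"
    unfolding rho_cr_def Q_def[symmetric]
  proof (rule the_equality)
    show "0 < x \<and> Q x = g * s" using x x0 by simp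
    fix y assume "0 < y \<and> Q y = g * s"
    then show "y = x" using Q_strict_mono[of x y] Q_strict_mono[of y x] x x0 by (metis less_irrefl linorder_neqE_linordered_idom)
  qed
  then show "0 < rcr s" "rcr s < \<rho>0" "Q (rcr s) = g * s"
    using x x0 \<open>x \<noteq> \<rho>0\<close> by (auto simp: rcr_def)
qed

lemma rcr_less_iff:
  assumes s: "0 \<le> s" "s < s_star g \<rho>0 p" and y: "y > 0"
  shows "rcr s < y \<longleftrightarrow> g * s < Q y"
  using rcr[OF s] Q_strict_mono[of "rcr s" y] Q_strict_mono[of y "rcr s"] y
  by (metis less_asym linorder_neqE_linordered_idom)

text \<open>The Bernoulli equation for \<open>y\<close> solved for \<open>t\<close>.\<close>

definition "T y s = y\<^sup>2 * (g * s - h y) / (g * \<rho>0\<^sup>2)"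

lemma is_H_iff:
  assumes s: "0 \<le> s" "s < s_star g \<rho>0 p"
  shows "is_H g \<rho>0 p t s y \<longleftrightarrow> y > 0 \<and> g * s < Q y \<and> T y s = t"
proof -
  have "g * \<rho>0\<^sup>2 * t / y\<^sup>2 + h y = g * s \<longleftrightarrow> T y s = t" if "y > 0"
    using that g_pos r0_pos by (auto simp: T_def field_simps)
  moreover have "rcr s < y \<Longrightarrow> y > 0" using rcr(1)[OF s] by simp
  ultimately show ?thesis
    unfolding is_H_def rcr_def[symmetric] using rcr_less_iff[OF s, of y] by auto
qed

text \<open>The derivative carries the factor \<open>g * s - Q y\<close>: in the variable
  \<open>y\<close>, \<open>T\<close> decreases exactly on the subsonic branch. Uniqueness of
  \<open>H\<close> and its differentiability both rest on this sign.\<close>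

lemma T_deriv1:
  assumes "y > 0"
  shows "((\<lambda>y. T y s) has_real_derivative 2 * y * (g * s - Q y) / (g * \<rho>0\<^sup>2)) (at y)"
proof -
  have "((\<lambda>y. y\<^sup>2 * (g * s - h y)) has_real_derivative 2 * y * (g * s - h y) + y\<^sup>2 * (- (deriv p y / y))) (at y)"
    using assms by (auto intro!: derivative_eq_intros h_deriv simp: power2_eq_square)
  from DERIV_cdivide[OF this, of "g * \<rho>0\<^sup>2"] show ?thesis
    unfolding T_def[abs_def] Q_def using assms by (simp add: power2_eq_square algebra_simps)
qed

lemma T_strict_antimono:
  assumes "0 < x" "x < y" "g * s < Q x"
  shows "T y s < T x s"
proof (rule DERIV_neg_imp_decreasing[OF assms(2), of "\<lambda>y. T y s"])
  fix z assume z: "x \<le> z" "z \<le> y"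
  then have "Q x \<le> Q z" using Q_strict_mono[of x z] assms by (cases "x = z") auto
  then have "2 * z * (g * s - Q z) / (g * \<rho>0\<^sup>2) < 0"
    using assms z g_pos r0_pos by (intro divide_neg_pos mult_pos_neg) auto
  then show "\<exists>w. ((\<lambda>y. T y s) has_real_derivative w) (at z) \<and> w < 0"
    using T_deriv1[of z s] assms z by auto
qed

lemma is_H_unique:
  assumes s: "0 \<le> s" "s < s_star g \<rho>0 p" and "is_H g \<rho>0 p t s x" "is_H g \<rho>0 p t s y"
  shows "x = y"
  using assms(3,4) T_strict_antimono[of x y s] T_strict_antimono[of y x s] unfolding is_H_iff[OF s]
  by (metis less_irrefl linorder_neqE_linordered_idom)

abbreviation "H \<equiv> H_eos g \<rho>0 p"

lemma H_eqI:
  assumes "0 \<le> s" "s < s_star g \<rho>0 p" and "is_H g \<rho>0 p t s y"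
  shows "H t s = y"
  unfolding H_eos_def using assms is_H_unique[OF assms(1,2)] by (intro the_equality) auto

lemma is_H_r0:
  assumes "0 \<le> s" "s < s_star g \<rho>0 p" shows "is_H g \<rho>0 p s s \<rho>0"
  unfolding is_H_iff[OF assms] using assms r0_pos g_pos
  by (auto simp: Q_r0 T_def h_r0 mult_strict_left_mono)

text \<open>The second condition on the pressure law says that \<open>z^2 p'(z)\<close> increases,
  hence \<open>p'(z) / z\<close> is at least \<open>k / z^3\<close> with
  \<open>k = \<rho>0^2 p'(\<rho>0)\<close>. Integration gives the bound, and
  \<open>k / (2 \<rho>0^2) = g * s_star\<close>. So \<open>h\<close> exceeds \<open>g * s\<close>
  somewhere for every \<open>s\<close> below \<open>s_star\<close>.\<close>

lemma h_lower: assumes "y \<ge> \<rho>0" shows "h y \<ge> g * s_star g \<rho>0 p * (1 - \<rho>0\<^sup>2 / y\<^sup>2)"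
proof -
  have mono: "\<rho>0\<^sup>2 * deriv p \<rho>0 \<le> z\<^sup>2 * deriv p z" if z: "z \<ge> \<rho>0" for z
  proof (rule DERIV_nonneg_imp_nondecreasing[OF z, where f="\<lambda>z. z\<^sup>2 * deriv p z"])
    fix x assume "\<rho>0 \<le> x" "x \<le> z"
    then have x: "x > 0" using r0_pos by simp
    have "((\<lambda>z. z\<^sup>2 * deriv p z) has_real_derivative x * (2 * deriv p x + x * deriv (deriv p) x)) (at x)"
      using x by (auto intro!: derivative_eq_intros dp_deriv simp: power2_eq_square algebra_simps)
    moreover have "x * (2 * deriv p x + x * deriv (deriv p) x) \<ge> 0" using x ddp_pos[OF x] by simp
    ultimately show "\<exists>w. ((\<lambda>z. z\<^sup>2 * deriv p z) has_real_derivative w) (at x) \<and> w \<ge> 0" by blast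
  qed
  let ?k = "\<rho>0\<^sup>2 * deriv p \<rho>0"
  have "h \<rho>0 + ?k / 2 / \<rho>0\<^sup>2 \<le> h y + ?k / 2 / y\<^sup>2"
  proof (rule DERIV_nonneg_imp_nondecreasing[OF assms, where f="\<lambda>y. h y + ?k / 2 / y\<^sup>2"])
    fix x assume "\<rho>0 \<le> x" "x \<le> y"
    then have x: "x > 0" "x \<ge> \<rho>0" using r0_pos by auto
    have "((\<lambda>y. ?k / 2 / y\<^sup>2) has_real_derivative - ?k / x ^ 3) (at x)"
      using x by (auto intro!: derivative_eq_intros simp: power2_eq_square power3_eq_cube)
    from DERIV_add[OF h_deriv[OF x(1)] this]
    have "((\<lambda>y. h y + ?k / 2 / y\<^sup>2) has_real_derivative deriv p x / x + - ?k / x ^ 3) (at x)" .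
    moreover have "deriv p x / x + - ?k / x ^ 3 = (x\<^sup>2 * deriv p x - ?k) / x ^ 3"
      using x by (simp add: field_simps power2_eq_square power3_eq_cube)
    moreover have "(x\<^sup>2 * deriv p x - ?k) / x ^ 3 \<ge> 0" using mono[OF x(2)] x by simp
    ultimately show "\<exists>w. ((\<lambda>y. h y + ?k / 2 / y\<^sup>2) has_real_derivative w) (at x) \<and> w \<ge> 0" by metis
  qed
  moreover have "?k / 2 / \<rho>0\<^sup>2 = g * s_star g \<rho>0 p" "?k / 2 / y\<^sup>2 = g * s_star g \<rho>0 p * (\<rho>0\<^sup>2 / y\<^sup>2)"
    using r0_pos g_pos by (simp_all add: s_star_def)
  ultimately show ?thesis by (simp add: h_r0 right_diff_distrib)
qed

lemma h_large:
  assumes "s < s_star g \<rho>0 p"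
  shows "\<exists>y>\<rho>0. h y > g * s"
proof (cases "s \<le> 0")
  case True
  then have "g * s \<le> 0" using g_pos by (intro mult_nonneg_nonpos) auto
  then show ?thesis using h_strict_mono[of \<rho>0 "\<rho>0 + 1"] r0_pos
    by (intro exI[of _ "\<rho>0 + 1"]) (auto simp: h_r0)
next
  case False
  define S where "S = s_star g \<rho>0 p"
  have S: "0 < s" "s < S" using False assms by (auto simp: S_def)
  have "(\<lambda>n. S * (1 - (\<rho>0 / Suc n)\<^sup>2)) \<longlonglongrightarrow> S * (1 - 0\<^sup>2)"
    using tendsto_mult_right_zero[OF LIMSEQ_Suc[OF lim_1_over_n], of \<rho>0]
    by (intro tendsto_intros) simp
  then have "\<forall>\<^sub>F n in sequentially. s < S * (1 - (\<rho>0 / Suc n)\<^sup>2)"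
    using S by (intro order_tendstoD(1)) auto
  moreover have "\<forall>\<^sub>F n in sequentially. \<rho>0 < real (Suc n)"
    using filterlim_real_sequentially[THEN filterlim_compose[OF _ filterlim_Suc], unfolded filterlim_at_top_dense] by blast
  ultimately have "\<forall>\<^sub>F n in sequentially. s < S * (1 - (\<rho>0 / Suc n)\<^sup>2) \<and> \<rho>0 < real (Suc n)"
    by (rule eventually_conj)
  then obtain n where n: "s < S * (1 - (\<rho>0 / Suc n)\<^sup>2)" "\<rho>0 < real (Suc n)"
    by (auto simp: eventually_sequentially)
  have "g * s < g * (S * (1 - (\<rho>0 / Suc n)\<^sup>2))" using n g_pos by simp
  also have "\<dots> \<le> h (Suc n)" using h_lower[of "Suc n"] n by (simp add: S_def power_divide mult.assoc)
  finally show ?thesis using n by blast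
qed

text \<open>For \<open>t = 0\<close> the equation reads \<open>h y = g * s\<close>. A root is
  subsonic automatically, because \<open>Q\<close> exceeds \<open>h\<close> by
  \<open>p' / 2\<close>.\<close>

lemma is_H_zero:
  assumes s: "0 \<le> s" "s < s_star g \<rho>0 p"
  shows "\<exists>y\<ge>\<rho>0. is_H g \<rho>0 p 0 s y"
proof -
  obtain y where y: "y > \<rho>0" "h y > g * s" using h_large[OF s(2)] by blast
  obtain x where x: "\<rho>0 \<le> x" "x \<le> y" "h x = g * s"
    using IVT'[of h \<rho>0 "g * s" y] h_cont[of "{\<rho>0..y}"] y s g_pos r0_pos by (auto simp: h_r0 subset_eq)
  have "Q x > h x" using dp_pos[of x] x r0_pos by (simp add: Q_def)
  then show ?thesis using x r0_pos unfolding is_H_iff[OF s] by (intro exI[of _ x]) (auto simp: T_def)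
qed

text \<open>On the subsonic branch \<open>T\<close> falls continuously from \<open>t\<close> to 0.
  Hence \<open>H\<close> exists on the whole interval from 0 to \<open>t\<close>, over which
  \<open>F\<close> integrates.\<close>

lemma is_H_between:
  assumes s: "0 \<le> s" "s < s_star g \<rho>0 p" and y: "is_H g \<rho>0 p t s y" and \<tau>: "0 \<le> \<tau>" "\<tau> \<le> t"
  shows "\<exists>x\<ge>y. is_H g \<rho>0 p \<tau> s x"
proof -
  obtain z where z: "is_H g \<rho>0 p 0 s z" using is_H_zero[OF s] by blast
  note y' = y[unfolded is_H_iff[OF s]] and z' = z[unfolded is_H_iff[OF s]]
  have yz: "y \<le> z"
  proof (rule ccontr)
    assume "\<not> y \<le> z"
    then have "T y s < T z s" using T_strict_antimono[of z y s] z' by auto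
    then show False using y' z' \<tau> by simp
  qed
  have cont: "continuous_on {y..z} (\<lambda>y. T y s)"
    using y' by (intro continuous_at_imp_continuous_on ballI DERIV_isCont[OF T_deriv1]) auto
  obtain x where x: "y \<le> x" "x \<le> z" "T x s = \<tau>"
    using IVT2'[of "\<lambda>y. T y s" z \<tau> y] cont yz y' z' \<tau> by auto
  have "Q y \<le> Q x" using Q_strict_mono[of y x] x y' by (cases "x = y") auto
  then show ?thesis using x y' unfolding is_H_iff[OF s] by (intro exI[of _ x]) auto
qed

text \<open>\<open>dom\<close> is the open set on which \<open>H\<close> is given by the inverse of \<open>(y, s) \<mapsto> (T y s, s)\<close>; it
  contains arguments with \<open>t < 0\<close>, so that no one-sided derivatives occur at \<open>t = 0\<close>.\<close>

definition dom :: "(real \<times> real) set" where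
  "dom = {(t, s). 0 < s \<and> s < s_star g \<rho>0 p \<and> (\<exists>y. is_H g \<rho>0 p t s y)}"

lemma dom_H:
  assumes "(t, s) \<in> dom"
  shows "is_H g \<rho>0 p t s (H t s)" "H t s > 0" "g * s < Q (H t s)" "T (H t s) s = t"
    "g * \<rho>0\<^sup>2 * t / (H t s)\<^sup>2 + h (H t s) = g * s"
proof -
  obtain y where s: "0 \<le> s" "s < s_star g \<rho>0 p" and y: "is_H g \<rho>0 p t s y" using assms by (auto simp: dom_def)
  have "H t s = y" by (rule H_eqI[OF s y])
  with y show *: "is_H g \<rho>0 p t s (H t s)" by simp
  then show "H t s > 0" "g * s < Q (H t s)" "T (H t s) s = t"  unfolding is_H_iff[OF s] by auto
  from * show "g * \<rho>0\<^sup>2 * t / (H t s)\<^sup>2 + h (H t s) = g * s" by (simp add: is_H_def)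
qed

text \<open>Implicit differentiation of \<open>T (H t s) s = t\<close> yields these partial
  derivatives; the denominators are positive on \<open>dom\<close>.\<close>

definition "Ht t s = - (g * \<rho>0\<^sup>2) / (2 * H t s * (Q (H t s) - g * s))"
definition "Hs t s = g * H t s / (2 * (Q (H t s) - g * s))"

text \<open>The Jacobian of \<open>(y, s) \<mapsto> (T y s, s)\<close> is triangular, with the
  y-derivative of \<open>T\<close> as its only nontrivial diagonal entry, nonzero on the subsonic
  branch. The inverse function theorem gives the derivative, and its open image shows that
  \<open>dom\<close> is a neighbourhood of each of its points.\<close>

lemma H_has_derivative:
  assumes ts: "(t, s) \<in> dom"
  shows "((\<lambda>z. H (fst z) (snd z)) has_derivative (\<lambda>v. Ht t s * fst v + Hs t s * snd v)) (at (t, s))"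
    "eventually (\<lambda>z. z \<in> dom) (nhds (t, s))"
proof -
  define U where "U = {z::real \<times> real. fst z > 0 \<and> 0 < snd z \<and> snd z < s_star g \<rho>0 p \<and> g * snd z < Q (fst z)}"
  define Ty where "Ty = (\<lambda>z::real \<times> real. 2 * fst z * (g * snd z - Q (fst z)) / (g * \<rho>0\<^sup>2))"
  define Ts where "Ts = (\<lambda>z::real \<times> real. (fst z)\<^sup>2 / \<rho>0\<^sup>2)"
  define f where "f = (\<lambda>z::real \<times> real. (T (fst z) (snd z), snd z))"
  define f' where "f' = (\<lambda>z::real \<times> real. Blinfun (\<lambda>v. (Ty z * fst v + Ts z * snd v, snd v)))"
  have bl: "bounded_linear (\<lambda>v::real \<times> real. (a * fst v + c * snd v, snd v))" for a c :: real
    by (intro bounded_linear_Pair bounded_linear_add bounded_linear_mult_right[THEN bounded_linear_compose] bounded_linear_fst bounded_linear_snd)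
  have f'_apply: "blinfun_apply (f' z) = (\<lambda>v. (Ty z * fst v + Ts z * snd v, snd v))" for z
    unfolding f'_def by (rule bounded_linear_Blinfun_apply[OF bl])
  have "open {z::real \<times> real. fst z > 0}" by (intro open_Collect_less continuous_intros)
  have U0: "open {z::real \<times> real. fst z > 0 \<and> 0 < snd z \<and> snd z < s_star g \<rho>0 p}"
    by (intro open_Collect_conj open_Collect_less continuous_intros)
  have openU: "open U"
  proof -
    let ?V = "{z::real \<times> real. fst z > 0 \<and> 0 < snd z \<and> snd z < s_star g \<rho>0 p}"
    have "continuous_on ?V (\<lambda>z. Q (fst z) - g * snd z)"
      by (intro continuous_intros continuous_on_compose2[OF Q_cont[of "{0<..}"]]) auto
    then have "open (?V \<inter> (\<lambda>z. Q (fst z) - g * snd z) -` {0<..})"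
      by (rule continuous_open_preimage[OF _ U0]) simp
    also have "?V \<inter> (\<lambda>z. Q (fst z) - g * snd z) -` {0<..} = U" by (auto simp: U_def)
    finally show ?thesis .
  qed
  have f_eq: "f z = (t', s') \<and> z \<in> U \<Longrightarrow> (t', s') \<in> dom \<and> H t' s' = fst z" for z t' s'
    using H_eqI[of s' t' "fst z"] is_H_iff[of s' t' "fst z"] by (auto simp: f_def U_def dom_def)
  define z0 where "z0 = (H t s, s)"
  have z0: "z0 \<in> U" "f z0 = (t, s)"
    using dom_H[OF ts] ts by (auto simp: z0_def U_def f_def dom_def)
  have derf: "(f has_derivative blinfun_apply (f' z)) (at z)" if "z \<in> U" for z
  proof -
    have "fst z > 0" using that by (simp add: U_def)
    have "((\<lambda>z. T (fst z) (snd z)) has_derivative (\<lambda>v. Ty z * fst v + Ts z * snd v)) (at z)"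
    proof -
      have hd: "((\<lambda>z. h (fst z)) has_derivative (\<lambda>v. deriv p (fst z) / fst z * fst v)) (at z)"
        using has_derivative_compose[OF has_derivative_fst[OF has_derivative_ident] h_deriv[OF \<open>fst z > 0\<close>, unfolded has_field_derivative_def]] by simp
      have "((\<lambda>z. (fst z)\<^sup>2 * (g * snd z - h (fst z)) * k) has_derivative
         (\<lambda>v. ((fst z)\<^sup>2 * (g * snd v - deriv p (fst z) / fst z * fst v) + 2 * fst z * fst v * (g * snd z - h (fst z))) * k)) (at z)" for k
        by (auto intro!: derivative_eq_intros hd simp: power2_eq_square)
      from this[of "1 / (g * \<rho>0\<^sup>2)"]
      have "((\<lambda>z. (fst z)\<^sup>2 * (g * snd z - h (fst z)) / (g * \<rho>0\<^sup>2)) has_derivative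
         (\<lambda>v. ((fst z)\<^sup>2 * (g * snd v - deriv p (fst z) / fst z * fst v) + 2 * fst z * fst v * (g * snd z - h (fst z))) / (g * \<rho>0\<^sup>2))) (at z)"
        by simp
      then show ?thesis
        unfolding T_def Ty_def Ts_def Q_def
        by (rule has_derivative_eq_rhs)
          (simp add: fun_eq_iff \<open>fst z > 0\<close>[THEN less_imp_neq, symmetric] g_pos[THEN less_imp_neq, symmetric] r0_pos[THEN less_imp_neq, symmetric] field_simps power2_eq_square)
    qed
    then show ?thesis
      unfolding f'_apply f_def by (intro has_derivative_Pair) (auto intro!: derivative_eq_intros)
  qed
  have contf: "continuous_on U f'"
  proof (rule continuous_on_blinfun_componentwise)
    fix i :: "real \<times> real"
    show "continuous_on U (\<lambda>x. blinfun_apply (f' x) i)"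
      unfolding f'_apply Ty_def Ts_def using g_pos r0_pos
      by (intro continuous_intros continuous_on_compose2[OF Q_cont[of "{0<..}"]]) (auto simp: U_def)
  qed
  have Ty0: "Ty z0 = - (2 * H t s * (Q (H t s) - g * s)) / (g * \<rho>0\<^sup>2)"
    using g_pos r0_pos by (simp add: Ty_def z0_def field_simps)
  have D0: "H t s * (Q (H t s) - g * s) > 0" using dom_H(2,3)[OF ts] by simp
  have Ty_ne: "Ty z0 \<noteq> 0"
    unfolding Ty0 using dom_H(2,3)[OF ts] g_pos r0_pos by auto
  define invf where "invf = Blinfun (\<lambda>v::real \<times> real. (1 / Ty z0 * fst v + (- Ts z0 / Ty z0) * snd v, snd v))"
  have invf_apply: "blinfun_apply invf = (\<lambda>v. (1 / Ty z0 * fst v + (- Ts z0 / Ty z0) * snd v, snd v))"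
    unfolding invf_def by (rule bounded_linear_Blinfun_apply[OF bl])
  have inv: "invf o\<^sub>L f' z0 = id_blinfun"
    by (rule blinfun_eqI) (use Ty_ne in \<open>auto simp: invf_apply f'_apply field_simps\<close>)
  obtain U' V G G' where UV: "open U'" "U' \<subseteq> U" "z0 \<in> U'" "open V" "f z0 \<in> V" "homeomorphism U' V f G"
      "\<And>y. y \<in> V \<Longrightarrow> (G has_derivative (G' y)) (at y)"
      "\<And>y. y \<in> V \<Longrightarrow> G' y = inv (blinfun_apply (f' (G y)))"
      "\<And>y. y \<in> V \<Longrightarrow> bij (blinfun_apply (f' (G y)))"
    using inverse_function_theorem[OF openU derf contf z0(1) inv] by metis
  have VH: "z \<in> dom \<and> H (fst z) (snd z) = fst (G z)" if "z \<in> V" for z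
  proof -
    have "f (G z) = z" "G z \<in> U'" using UV(6) that by (auto simp: homeomorphism_def)
    then show ?thesis using f_eq[of "G z" "fst z" "snd z"] UV(2) by auto
  qed
  show "eventually (\<lambda>z. z \<in> dom) (nhds (t, s))"
    using UV(4,5) VH unfolding z0(2) eventually_nhds by blast
  have Gz: "G (t, s) = z0" using UV(3,6) z0(2) unfolding homeomorphism_def by (metis z0(2))
  have "G' (t, s) = blinfun_apply invf"
  proof -
    have "inv (blinfun_apply (f' z0)) = blinfun_apply invf"
    proof (rule inv_unique_comp)
      show "blinfun_apply (f' z0) \<circ> blinfun_apply invf = id"
        using Ty_ne by (auto simp: fun_eq_iff invf_apply f'_apply field_simps)
      show "blinfun_apply invf \<circ> blinfun_apply (f' z0) = id"
        using Ty_ne by (auto simp: fun_eq_iff invf_apply f'_apply field_simps)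
    qed
    then show ?thesis using UV(8)[of "(t, s)"] UV(5) Gz z0(2) by simp
  qed
  then have "(G has_derivative blinfun_apply invf) (at (t, s))"
    using UV(7)[of "(t, s)"] UV(5) z0(2) by simp
  from has_derivative_fst[OF this]
  have fG: "((\<lambda>z. fst (G z)) has_derivative (\<lambda>v. 1 / Ty z0 * fst v + (- Ts z0 / Ty z0) * snd v)) (at (t, s))"
    by (simp add: invf_apply)
  have "1 / (- a / k) = - k / a" for a k :: real by simp
  then have e1: "1 / Ty z0 = Ht t s" unfolding Ty0 Ht_def by blast
  have e2: "- Ts z0 / Ty z0 = Hs t s"
    unfolding Ty0 Hs_def using D0 g_pos r0_pos by (simp add: Ts_def z0_def power2_eq_square)
  from fG[unfolded e1 e2] show "((\<lambda>z. H (fst z) (snd z)) has_derivative (\<lambda>v. Ht t s * fst v + Hs t s * snd v)) (at (t, s))"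
    by (rule has_derivative_transform_within_open[OF _ UV(4)]) (use UV(5) z0(2) VH in auto)
qed


text \<open>The left side is the t-derivative of the primitive \<Phi> introduced below. Expressing
  \<open>t\<close> through \<open>y = H t s\<close> by the Bernoulli equation turns the coefficient
  of \<open>Ht\<close> into a multiple of \<open>Q y - g * s\<close>, which cancels the denominator
  of \<open>Ht\<close>. The s-derivative is treated in the same way next.\<close>

lemma Ht_identity:
  assumes "(t, s) \<in> dom"
  shows "2 / H t s - 2 * t * Ht t s / (H t s)\<^sup>2 + deriv p (H t s) * Ht t s / (g * \<rho>0\<^sup>2) = 1 / H t s"
proof -
  define y where "y = H t s"
  define D where "D = Q y - g * s"
  have y: "y > 0" "D > 0" "T y s = t" using dom_H[OF assms] by (auto simp: y_def D_def)
  have Htd: "Ht t s = - (g * \<rho>0\<^sup>2) / (2 * y * D)" by (simp add: Ht_def y_def D_def)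
  have t: "2 * t / y\<^sup>2 = 2 * (g * s - h y) / (g * \<rho>0\<^sup>2)"
    using y(1) by (simp add: T_def flip: y(3))
  have "2 * t * Ht t s / y\<^sup>2 - deriv p y * Ht t s / (g * \<rho>0\<^sup>2) = Ht t s * (2 * t / y\<^sup>2 - deriv p y / (g * \<rho>0\<^sup>2))"
    by (simp add: algebra_simps)
  also have "\<dots> = Ht t s * (- (2 * D) / (g * \<rho>0\<^sup>2))"
    unfolding t by (simp add: D_def Q_def algebra_simps flip: diff_divide_distrib)
  also have "\<dots> = 1 / y" unfolding Htd using y g_pos r0_pos by (simp add: field_simps)
  finally show ?thesis unfolding y_def[symmetric] by (simp add: field_simps)
qed

lemma Hs_identity:
  assumes "(t, s) \<in> dom"
  shows "- 2 * t * Hs t s / (H t s)\<^sup>2 + deriv p (H t s) * Hs t s / (g * \<rho>0\<^sup>2) = H t s / \<rho>0\<^sup>2"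
proof -
  define y where "y = H t s"
  define D where "D = Q y - g * s"
  have y: "y > 0" "D > 0" "T y s = t" using dom_H[OF assms] by (auto simp: y_def D_def)
  have Hsd: "Hs t s = g * y / (2 * D)" by (simp add: Hs_def y_def D_def)
  have t: "2 * t / y\<^sup>2 = 2 * (g * s - h y) / (g * \<rho>0\<^sup>2)"
    using y(1) by (simp add: T_def flip: y(3))
  have "2 * t * Hs t s / y\<^sup>2 - deriv p y * Hs t s / (g * \<rho>0\<^sup>2) = Hs t s * (2 * t / y\<^sup>2 - deriv p y / (g * \<rho>0\<^sup>2))"
    by (simp add: algebra_simps)
  also have "\<dots> = Hs t s * (- (2 * D) / (g * \<rho>0\<^sup>2))"
    unfolding t by (simp add: D_def Q_def algebra_simps flip: diff_divide_distrib)
  also have "\<dots> = - y / \<rho>0\<^sup>2" unfolding Hsd using y g_pos r0_pos by (simp add: field_simps)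
  finally show ?thesis unfolding y_def[symmetric] by (simp add: field_simps)
qed

text \<open>\<open>\<Phi>\<close> is the primitive of \<open>1 / H\<close> in \<open>t\<close> obtained by integrating by parts and substituting
  \<open>y = H t s\<close>.\<close>

definition "\<Phi> t s = 2 * t / H t s + p (H t s) / (g * \<rho>0\<^sup>2)"

lemma \<Phi>_has_derivative:
  assumes ts: "(t, s) \<in> dom"
  shows "((\<lambda>z. \<Phi> (fst z) (snd z)) has_derivative (\<lambda>v. 1 / H t s * fst v + H t s / \<rho>0\<^sup>2 * snd v)) (at (t, s))"
proof -
  note dH = H_has_derivative(1)[OF ts]
  have pos: "H t s > 0" by (rule dom_H(2)[OF ts])
  have dp: "((\<lambda>z. p (H (fst z) (snd z))) has_derivative (\<lambda>v. deriv p (H t s) * (Ht t s * fst v + Hs t s * snd v))) (at (t, s))"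
    using has_derivative_compose[OF dH, of p "(*) (deriv p (H t s))"] p_deriv[OF pos] by (simp add: has_field_derivative_def)
  have di: "((\<lambda>z. inverse (H (fst z) (snd z))) has_derivative (\<lambda>v. - (inverse (H t s) * (Ht t s * fst v + Hs t s * snd v) * inverse (H t s)))) (at (t, s))"
    using has_derivative_compose[OF dH, of inverse] has_derivative_inverse'[of "H t s" UNIV] pos by simp
  have "((\<lambda>z. 2 * fst z * inverse (H (fst z) (snd z)) + p (H (fst z) (snd z)) * k) has_derivative
     (\<lambda>v. 2 * t * - (inverse (H t s) * (Ht t s * fst v + Hs t s * snd v) * inverse (H t s)) + 2 * fst v * inverse (H t s)
       + deriv p (H t s) * (Ht t s * fst v + Hs t s * snd v) * k)) (at (t, s))" for k
    by (rule has_derivative_eq_rhs, (rule derivative_intros di dp)+) auto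
  from this[of "1 / (g * \<rho>0\<^sup>2)"]
  moreover have "(\<lambda>z. \<Phi> (fst z) (snd z)) = (\<lambda>z. 2 * fst z * inverse (H (fst z) (snd z)) + p (H (fst z) (snd z)) * (1 / (g * \<rho>0\<^sup>2)))"
    by (simp add: fun_eq_iff \<Phi>_def divide_inverse)
  ultimately have "((\<lambda>z. \<Phi> (fst z) (snd z)) has_derivative
     (\<lambda>v. (2 / H t s - 2 * t * Ht t s / (H t s)\<^sup>2 + deriv p (H t s) * Ht t s / (g * \<rho>0\<^sup>2)) * fst v
        + (- 2 * t * Hs t s / (H t s)\<^sup>2 + deriv p (H t s) * Hs t s / (g * \<rho>0\<^sup>2)) * snd v)) (at (t, s))"
    by (simp only:) (rule has_derivative_eq_rhs, assumption, simp add: fun_eq_iff divide_inverse algebra_simps power2_eq_square)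
  then show ?thesis unfolding Ht_identity[OF ts] Hs_identity[OF ts] .
qed

lemma \<Phi>_deriv_t:
  assumes ts: "(t, s) \<in> dom"
  shows "((\<lambda>t. \<Phi> t s) has_real_derivative 1 / H t s) (at t)" "((\<lambda>t. H t s) has_real_derivative Ht t s) (at t)"
proof -
  have "((\<lambda>t. (t, s)) has_derivative (\<lambda>v. (v, 0))) (at t)" by (auto intro!: derivative_eq_intros)
  from has_derivative_compose[OF this H_has_derivative(1)[OF ts]]
  show dH: "((\<lambda>t. H t s) has_real_derivative Ht t s) (at t)"
    by (simp add: has_field_derivative_def)
  have pos: "H t s > 0" by (rule dom_H(2)[OF ts])
  have "((\<lambda>t. 2 * t / H t s) has_real_derivative 2 / H t s - 2 * t * Ht t s / (H t s)\<^sup>2) (at t)"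
    using pos by (auto intro!: derivative_eq_intros dH simp: power2_eq_square diff_divide_distrib)
  from DERIV_add[OF this DERIV_cdivide[OF DERIV_chain2[OF p_deriv[OF pos] dH], of "g * \<rho>0\<^sup>2"]]
  show "((\<lambda>t. \<Phi> t s) has_real_derivative 1 / H t s) (at t)"
    unfolding \<Phi>_def Ht_identity[OF ts] .
qed

lemma \<Phi>_deriv_s:
  assumes ts: "(t, s) \<in> dom"
  shows "((\<lambda>s. \<Phi> t s) has_real_derivative H t s / \<rho>0\<^sup>2) (at s)"
proof -
  have "((\<lambda>s. (t, s)) has_derivative (\<lambda>v. (0, v))) (at s)" by (auto intro!: derivative_eq_intros)
  from has_derivative_compose[OF this H_has_derivative(1)[OF ts]]
  have dH: "((\<lambda>s. H t s) has_real_derivative Hs t s) (at s)"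
    by (simp add: has_field_derivative_def)
  have pos: "H t s > 0" by (rule dom_H(2)[OF ts])
  have "((\<lambda>s. 2 * t / H t s) has_real_derivative - 2 * t * Hs t s / (H t s)\<^sup>2) (at s)"
    using pos by (auto intro!: derivative_eq_intros dH simp: power2_eq_square)
  from DERIV_add[OF this DERIV_cdivide[OF DERIV_chain2[OF p_deriv[OF pos] dH], of "g * \<rho>0\<^sup>2"]]
  show ?thesis
    unfolding \<Phi>_def Hs_identity[OF ts] .
qed

lemma dom_between:
  assumes "(t, s) \<in> dom" "0 \<le> \<tau>" "\<tau> \<le> t" shows "(\<tau>, s) \<in> dom"
  using assms is_H_between[of s t _ \<tau>] unfolding dom_def by (auto intro: less_imp_le)

lemma F_eq:
  assumes ts: "(t, s) \<in> dom" and t: "0 \<le> t"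
  shows "F_eos g \<rho>0 p t s = \<Phi> t s - \<Phi> 0 s"
proof -
  have "(LBINT \<tau>=0..t. 1 / H \<tau> s) = \<Phi> t s - \<Phi> 0 s"
    unfolding zero_ereal_def
  proof (rule interval_integral_FTC_finite)
    show "continuous_on {min 0 t..max 0 t} (\<lambda>\<tau>. 1 / H \<tau> s)"
      using t dom_H(2)[OF dom_between[OF ts]]
      by (intro continuous_intros continuous_at_imp_continuous_on ballI DERIV_isCont[OF \<Phi>_deriv_t(2)[OF dom_between[OF ts]]])
        (auto simp: less_imp_neq[symmetric])
    fix \<tau> assume "min 0 t \<le> \<tau>" "\<tau> \<le> max 0 t"
    then show "((\<lambda>t. \<Phi> t s) has_vector_derivative 1 / H \<tau> s) (at \<tau> within {min 0 t..max 0 t})"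
      using t \<Phi>_deriv_t(1)[OF dom_between[OF ts, of \<tau>]]
      by (auto simp: has_real_derivative_iff_has_vector_derivative intro: has_vector_derivative_at_within)
  qed
  then show ?thesis by (simp add: F_eos_def)
qed

lemma dom_nhds_s: "(t, s) \<in> dom \<Longrightarrow> \<forall>\<^sub>F \<sigma> in nhds s. (t, \<sigma>) \<in> dom"
proof -
  assume "(t, s) \<in> dom"
  then obtain S where S: "open S" "(t, s) \<in> S" "S \<subseteq> dom"
    using H_has_derivative(2)[of t s] unfolding eventually_nhds by blast
  have "open (Pair t -` S)" by (intro open_vimage S continuous_intros)
  then show ?thesis using S unfolding eventually_nhds by (intro exI[of _ "Pair t -` S"]) auto
qed

lemma zero_in_dom: "0 < s \<Longrightarrow> s < s_star g \<rho>0 p \<Longrightarrow> (0, s) \<in> dom"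
  using is_H_zero[of s] by (auto simp: dom_def)

lemma diag_in_dom: "0 < s \<Longrightarrow> s < s_star g \<rho>0 p \<Longrightarrow> (s, s) \<in> dom"
  using is_H_r0[of s] by (auto simp: dom_def)

lemma d2F_eq:
  assumes ts: "(t, s) \<in> dom" and t: "0 \<le> t"
  shows "d2F_eos g \<rho>0 p t s = (H t s - H 0 s) / \<rho>0\<^sup>2"
proof -
  have "(0, s) \<in> dom" using ts by (intro zero_in_dom) (auto simp: dom_def)
  from DERIV_diff[OF \<Phi>_deriv_s[OF ts] \<Phi>_deriv_s[OF this]]
  have "((\<lambda>s. \<Phi> t s - \<Phi> 0 s) has_real_derivative (H t s - H 0 s) / \<rho>0\<^sup>2) (at s)" by (simp add: diff_divide_distrib)
  moreover have "\<forall>\<^sub>F \<sigma> in nhds s. F_eos g \<rho>0 p t \<sigma> = \<Phi> t \<sigma> - \<Phi> 0 \<sigma>"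
    using dom_nhds_s[OF ts] by eventually_elim (rule F_eq[OF _ t])
  ultimately have "((\<lambda>\<sigma>. F_eos g \<rho>0 p t \<sigma>) has_real_derivative (H t s - H 0 s) / \<rho>0\<^sup>2) (at s)"
    by (subst DERIV_cong_ev[OF refl _ refl])
  then show ?thesis unfolding d2F_eos_def by (rule DERIV_imp_deriv)
qed

text \<open>Because \<open>H s s = \<rho>0\<close>, the term \<open>2 * s / \<rho>0\<close> of
  \<lambda> cancels the one in \<Phi> at the diagonal. In the sum \<open>F + \<lambda>\<close> the
  remaining values of \<Phi> at \<open>t = 0\<close> cancel as well, so that the sum is \<Phi> minus
  a constant.\<close>

lemma lambda_eq:
  assumes "0 < s" "s < s_star g \<rho>0 p"
  shows "lambda_eos g \<rho>0 p s = \<Phi> 0 s - p \<rho>0 / (g * \<rho>0\<^sup>2)"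
proof -
  have "H s s = \<rho>0" using assms by (intro H_eqI is_H_r0) auto
  then show ?thesis
    using F_eq[OF diag_in_dom[OF assms]] assms by (simp add: lambda_eos_def \<Phi>_def[of s s])
qed

lemma deriv_lambda:
  assumes s: "0 < s" "s < s_star g \<rho>0 p"
  shows "deriv (lambda_eos g \<rho>0 p) s = H 0 s / \<rho>0\<^sup>2"
proof -
  have "((\<lambda>s. \<Phi> 0 s - p \<rho>0 / (g * \<rho>0\<^sup>2)) has_real_derivative H 0 s / \<rho>0\<^sup>2 - 0) (at s)"
    by (rule DERIV_diff[OF \<Phi>_deriv_s[OF zero_in_dom[OF s]] DERIV_const])
  moreover have "\<forall>\<^sub>F \<sigma> in nhds s. lambda_eos g \<rho>0 p \<sigma> = \<Phi> 0 \<sigma> - p \<rho>0 / (g * \<rho>0\<^sup>2)"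
  proof -
    have "\<forall>\<^sub>F \<sigma> in nhds s. \<sigma> \<in> {0<..<s_star g \<rho>0 p}" by (rule eventually_nhds_in_open) (use s in auto)
    then show ?thesis by eventually_elim (rule lambda_eq, auto)
  qed
  ultimately have "(lambda_eos g \<rho>0 p has_real_derivative H 0 s / \<rho>0\<^sup>2 - 0) (at s)"
    by (subst DERIV_cong_ev[OF refl _ refl])
  then show ?thesis by (simp add: DERIV_imp_deriv)
qed

lemma F_zero: "F_eos g \<rho>0 p 0 s = 0" "d2F_eos g \<rho>0 p 0 s = 0"
proof -
  have "F_eos g \<rho>0 p 0 \<sigma> = 0" for \<sigma> by (simp add: F_eos_def zero_ereal_def)
  then show "F_eos g \<rho>0 p 0 s = 0" "d2F_eos g \<rho>0 p 0 s = 0" by (simp_all add: d2F_eos_def)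
qed

text \<open>Below: \<open>Q y > g * s\<close>, while \<open>Q\<close> vanishes at the critical
  density for \<open>s = 0\<close>. Above: \<open>t\<close> being nonnegative forces
  \<open>h y\<close> to be at most \<open>g * S\<close>, which \<open>h\<close> exceeds at
  \<open>y1\<close>. The bound on \<open>t\<close> then comes from the Bernoulli equation. This
  turns subsonicity into a gradient bound.\<close>

lemma H_bounds:
  assumes S: "S < s_star g \<rho>0 p"
  obtains c C where "0 < c" "\<And>t s y. 0 \<le> s \<Longrightarrow> s \<le> S \<Longrightarrow> 0 \<le> t \<Longrightarrow> is_H g \<rho>0 p t s y \<Longrightarrow> c < y \<and> y < C \<and> t \<le> C"
proof (cases "0 \<le> S")
  case True
  have s0: "0 < s_star g \<rho>0 p" using True S by simp
  define c where "c = rcr 0"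
  have c: "c > 0" "Q c = 0" using rcr[of 0] s0 by (auto simp: c_def)
  obtain y1 where y1: "y1 > \<rho>0" "h y1 > g * S" using h_large[OF S] by blast
  define C where "C = max y1 (y1\<^sup>2 * (g * S - h c) / (g * \<rho>0\<^sup>2))"
  show thesis
  proof (rule that[OF c(1), of C])
    fix t s y assume s: "0 \<le> s" "s \<le> S" and t: "0 \<le> t" and y: "is_H g \<rho>0 p t s y"
    have ss: "s < s_star g \<rho>0 p" using s S by simp
    note y' = y[unfolded is_H_iff[OF s(1) ss]]
    have cy: "c < y"
    proof (rule ccontr)
      assume "\<not> c < y"
      then have "Q y \<le> Q c" using Q_strict_mono[of y c] y' by (cases "y = c") auto
      moreover have "0 \<le> g * s" using s g_pos by simp
      ultimately show False using c y' by linarith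
    qed
    have gs: "g * s \<le> g * S" using s g_pos by simp
    have "y\<^sup>2 * (g * s - h y) = t * (g * \<rho>0\<^sup>2)" using y' g_pos r0_pos by (auto simp: T_def)
    then have "0 \<le> y\<^sup>2 * (g * s - h y)" using t g_pos by simp
    then have hy: "h y \<le> g * s" using y' by (auto simp: zero_le_mult_iff)
    have yy1: "y < y1"
    proof (rule ccontr)
      assume "\<not> y < y1"
      then have "h y1 \<le> h y" using h_strict_mono[of y1 y] y1 r0_pos by (cases "y = y1") auto
      then show False using hy y1 gs by linarith
    qed
    have "h c < h y" by (rule h_strict_mono[OF c(1) cy])
    have "t \<le> y1\<^sup>2 * (g * S - h c) / (g * \<rho>0\<^sup>2)"
    proof -
      have "g * s - h y \<le> g * S - h c" using gs \<open>h c < h y\<close> by linarith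
      then have "y\<^sup>2 * (g * s - h y) \<le> y1\<^sup>2 * (g * S - h c)"
        using y' hy yy1 by (intro mult_mono power_mono) auto
      then show ?thesis using y' g_pos by (auto simp: T_def intro!: divide_right_mono)
    qed
    then show "c < y \<and> y < C \<and> t \<le> C" using cy yy1 by (auto simp: C_def)
  qed
next
  case False
  \<comment> \<open>For negative \<open>S\<close> there is no admissible \<open>s\<close>, so the
    constants are arbitrary apart from positivity of the first.\<close>
  then show thesis by (intro that[of 1 0]) auto
qed

text \<open>Uniform subsonicity is preserved in the limit, because it amounts to \<open>g s \<le> Q (y - \<epsilon>)\<close>.\<close>

lemma is_H_closed:
  assumes s: "0 \<le> s" "s < s_star g \<rho>0 p" and t: "\<And>n. 0 \<le> t' n" and e: "e > 0"
    and lim: "t' \<longlonglongrightarrow> t" "s' \<longlonglongrightarrow> s" and s': "\<And>n. 0 \<le> s' n"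
    and y: "\<And>n. is_H g \<rho>0 p (t' n) (s' n) (y n)" "\<And>n. y n - rho_cr g \<rho>0 p (s' n) \<ge> e"
  shows "\<exists>y. is_H g \<rho>0 p t s y"
proof -
  obtain S where S: "s < S" "S < s_star g \<rho>0 p" using s dense by blast
  obtain c C where c: "0 < c" "\<And>t s y. 0 \<le> s \<Longrightarrow> s \<le> S \<Longrightarrow> 0 \<le> t \<Longrightarrow> is_H g \<rho>0 p t s y \<Longrightarrow> c < y \<and> y < C \<and> t \<le> C"
    using H_bounds[OF S(2)] by blast
  obtain N where N: "\<And>n. n \<ge> N \<Longrightarrow> s' n < S"
    using order_tendstoD(2)[OF lim(2) S(1)] by (auto simp: eventually_sequentially)
  \<comment> \<open>A positive lower bound for all critical densities keeps the limit of
    \<open>y - e\<close> inside the domain where \<open>Q\<close> is continuous.\<close>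
  have rc: "rcr 0 \<le> rcr (s' n)" if "n \<ge> N" for n
  proof (rule ccontr)
    assume "\<not> ?thesis"
    then have "Q (rcr (s' n)) < Q (rcr 0)"
      using rcr(1)[of "s' n"] s' N[OF that] S by (intro Q_strict_mono) auto
    moreover have "Q (rcr (s' n)) = g * s' n" "Q (rcr 0) = 0"
      using rcr(3)[of "s' n"] rcr(3)[of 0] s' N[OF that] S s by auto
    ultimately show False using s'[of n] g_pos by (simp add: mult_less_0_iff)
  qed
  have in_cC: "y (n + N) \<in> {c..C}" for n
    using c(2)[OF s' less_imp_le[OF N] t y(1), of "n + N"] by simp
  obtain l r where l: "l \<in> {c..C}" "strict_mono r" "((\<lambda>n. y (n + N)) \<circ> r) \<longlonglongrightarrow> l"
    using compact_Icc[of c C, unfolded compact_def, rule_format, of "\<lambda>n. y (n + N)"] in_cC by blast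
  define k where "k n = r n + N" for n
  have k: "strict_mono k" "\<And>n. k n \<ge> N" using l(2) by (auto simp: k_def strict_mono_def)
  have yl: "(\<lambda>n. y (k n)) \<longlonglongrightarrow> l" using l(3) by (simp add: o_def k_def)
  have sl: "(\<lambda>n. s' (k n)) \<longlonglongrightarrow> s" and tl: "(\<lambda>n. t' (k n)) \<longlonglongrightarrow> t"
    using LIMSEQ_subseq_LIMSEQ[OF lim(2) k(1)] LIMSEQ_subseq_LIMSEQ[OF lim(1) k(1)] by (simp_all add: o_def)
  have l0: "l > 0" using l(1) c(1) by simp
  have ye: "rcr (s' (k n)) \<le> y (k n) - e" for n using y(2)[of "k n"] by (simp add: rcr_def)
  have rpos: "rcr 0 > 0" using rcr(1)[of 0] s by simp
  have le: "rcr 0 \<le> l - e"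
    by (rule LIMSEQ_le_const[OF tendsto_diff[OF yl tendsto_const]]) (use rc[OF k(2)] ye order_trans in blast)
  have Qc: "isCont Q z" if "z > 0" for z using DERIV_isCont[OF Q_deriv[OF that]] .
  have hc: "isCont h z" if "z > 0" for z using DERIV_isCont[OF h_deriv[OF that]] .
  have "(\<lambda>n. Q (y (k n) - e)) \<longlonglongrightarrow> Q (l - e)"
    by (rule isCont_tendsto_compose[OF Qc tendsto_diff[OF yl tendsto_const]]) (use le rpos in simp)
  moreover have "g * s' (k n) \<le> Q (y (k n) - e)" for n
  proof -
    have sk: "0 \<le> s' (k n)" "s' (k n) < s_star g \<rho>0 p" using s' N[OF k(2)[of n]] S by auto
    show ?thesis using rcr[OF sk] ye[of n] Q_strict_mono[of "rcr (s' (k n))" "y (k n) - e"]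
      by (cases "rcr (s' (k n)) = y (k n) - e") auto
  qed
  ultimately have "g * s \<le> Q (l - e)"
    by (intro LIMSEQ_le[OF tendsto_mult[OF tendsto_const sl]]) auto
  also have "\<dots> < Q l" using le rpos e by (intro Q_strict_mono) auto
  finally have Ql: "g * s < Q l" .
  have "(\<lambda>n. T (y (k n)) (s' (k n))) \<longlonglongrightarrow> T l s"
    unfolding T_def using g_pos r0_pos
    by (intro tendsto_intros yl sl isCont_tendsto_compose[OF hc[OF l0]]) auto
  moreover have "T (y (k n)) (s' (k n)) = t' (k n)" for n
    using y(1)[of "k n"] is_H_iff[of "s' (k n)" "t' (k n)" "y (k n)"] s' N[OF k(2)[of n]] S by auto
  ultimately have "T l s = t" using tl LIMSEQ_unique by simp
  with Ql l0 show ?thesis unfolding is_H_iff[OF s] by blast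
qed

end

section \<open>Calculus in the plane\<close>

text \<open>By translation invariance the integral of every difference quotient vanishes.\<close>

lemma integral_directional_derivative_zero:
  fixes f :: "'a::euclidean_space \<Rightarrow> real"
  assumes K: "compact K" "K \<subseteq> W" and W: "open W"
    and out: "\<And>x. x \<notin> K \<Longrightarrow> f x = 0"
    and der: "\<And>x. x \<in> W \<Longrightarrow> ((\<lambda>h. f (x + h *\<^sub>R e)) has_real_derivative D x) (at 0)"
    and contD: "continuous_on W D" and contf: "continuous_on W f"
    and D0: "\<And>x. x \<notin> W \<Longrightarrow> D x = 0"
  shows "integrable lborel D" "(LINT x|lborel. D x) = 0"
proof -
  have openK: "open (- K)" using K compact_imp_closed by auto
  have DK: "D x = 0" if "x \<notin> K" for x
  proof (cases "x \<in> W")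
    case True
    have "open ((\<lambda>h::real. x + h *\<^sub>R e) -` (- K))" by (intro open_vimage openK continuous_intros)
    moreover have "0 \<in> (\<lambda>h::real. x + h *\<^sub>R e) -` (- K)" using that by simp
    ultimately have "((\<lambda>h. f (x + h *\<^sub>R e)) has_real_derivative 0) (at 0)"
      by (intro has_field_derivative_transform_within_open[of "\<lambda>_. 0" 0 0 _ "\<lambda>h. f (x + h *\<^sub>R e)"]) (auto simp: out)
    with der[OF True] show ?thesis by (rule DERIV_unique)
  qed (rule D0)
  have der': "((\<lambda>h. f (x + h *\<^sub>R e)) has_real_derivative D (x + h0 *\<^sub>R e)) (at h0)" for x h0
  proof -
    have "((\<lambda>h. f ((x + h0 *\<^sub>R e) + h *\<^sub>R e)) has_real_derivative D (x + h0 *\<^sub>R e)) (at 0)"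
    proof (cases "x + h0 *\<^sub>R e \<in> W")
      case False
      then have nK: "x + h0 *\<^sub>R e \<notin> K" using K by auto
      have "open ((\<lambda>h::real. (x + h0 *\<^sub>R e) + h *\<^sub>R e) -` (- K))" by (intro open_vimage openK continuous_intros)
      moreover have "0 \<in> (\<lambda>h::real. (x + h0 *\<^sub>R e) + h *\<^sub>R e) -` (- K)" using nK by simp
      ultimately have "((\<lambda>h. f ((x + h0 *\<^sub>R e) + h *\<^sub>R e)) has_real_derivative 0) (at 0)"
        by (intro has_field_derivative_transform_within_open[of "\<lambda>_. 0" 0 0 _ "\<lambda>h. f ((x + h0 *\<^sub>R e) + h *\<^sub>R e)"]) (auto simp: out)
      then show ?thesis using DK[OF nK] by simp
    qed (rule der)
    then have "((\<lambda>h. f (x + (h + h0) *\<^sub>R e)) has_real_derivative D (x + h0 *\<^sub>R e)) (at 0)"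
      by (simp add: scaleR_add_left add.assoc add.commute[of "h0 *\<^sub>R e"])
    then show ?thesis
      using DERIV_shift[of "\<lambda>h. f (x + h *\<^sub>R e)" "D (x + h0 *\<^sub>R e)" 0 h0] by simp
  qed
  have bdd: "\<exists>M. \<forall>x. \<bar>\<psi> x\<bar> \<le> M" if "continuous_on K \<psi>" "\<And>x. x \<notin> K \<Longrightarrow> \<psi> x = 0" for \<psi> :: "'a \<Rightarrow> real"
  proof -
    have "bounded (\<psi> ` K)" using compact_continuous_image[OF that(1) K(1)] by (rule compact_imp_bounded)
    then obtain M where M: "\<And>x. x \<in> K \<Longrightarrow> \<bar>\<psi> x\<bar> \<le> M" by (auto simp: bounded_iff)
    then have "\<bar>\<psi> x\<bar> \<le> max M 0" for x using that(2) by (cases "x \<in> K") (auto simp: le_max_iff_disj)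
    then show ?thesis by blast
  qed
  have contDK: "continuous_on K D" "continuous_on K f" using contD contf K continuous_on_subset by blast+
  obtain M where M: "\<And>x. \<bar>D x\<bar> \<le> M" using bdd[OF contDK(1) DK] by blast
  obtain M' where M': "\<And>x. \<bar>f x\<bar> \<le> M'" using bdd[OF contDK(2) out] by blast
  have M0: "M \<ge> 0" using M[of 0] by linarith
  have meas: "\<psi> \<in> borel_measurable borel" if "continuous_on K \<psi>" "\<And>x. x \<notin> K \<Longrightarrow> \<psi> x = 0" for \<psi> :: "'a \<Rightarrow> real"
  proof -
    have "(\<lambda>x. indicator K x *\<^sub>R \<psi> x) \<in> borel_measurable borel"
      using K(1) that(1) by (intro borel_measurable_continuous_on_indicator) (auto intro: borel_compact)
    also have "(\<lambda>x. indicator K x *\<^sub>R \<psi> x) = \<psi>" using that(2) by (auto simp: indicator_def fun_eq_iff)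
    finally show ?thesis .
  qed
  have fm[measurable]: "f \<in> borel_measurable borel" by (rule meas[OF contDK(2) out])
  have Dm[measurable]: "D \<in> borel_measurable borel" by (rule meas[OF contDK(1) DK])
  obtain R where R: "K \<subseteq> cball 0 R" "R > 0"
    using bounded_subset_ballD[OF compact_imp_bounded[OF K(1)], of 0] ball_subset_cball[of "0::'a"] by fast
  have bint: "integrable lborel \<psi>" if "\<psi> \<in> borel_measurable borel" "\<And>x. \<bar>\<psi> x\<bar> \<le> B * indicator (cball 0 R') x" for \<psi> :: "'a \<Rightarrow> real" and B R'
  proof (rule Bochner_Integration.integrable_bound[where f="\<lambda>x. B * indicator (cball 0 R') x"])
    show "integrable lborel (\<lambda>x. B * indicator (cball (0::'a) R') x)"
      by (intro integrable_mult_right integrable_real_indicator) (auto simp: emeasure_lborel_cball_finite simp flip: infinity_ennreal_def)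
    show "AE x in lborel. norm (\<psi> x) \<le> norm (B * indicator (cball 0 R') x)"
      using order_trans[OF that(2) abs_ge_self] by simp
  qed (use that in simp)
  have bK: "\<bar>\<psi> x\<bar> \<le> B * indicator (cball 0 R) x" if "\<bar>\<psi> x\<bar> \<le> B" "x \<notin> K \<Longrightarrow> \<psi> x = 0" for \<psi> :: "'a \<Rightarrow> real" and B x
    using that R by (cases "x \<in> K") (auto simp: indicator_def)
  show Di: "integrable lborel D" by (rule bint[OF Dm, of M R]) (intro bK M DK)
  have fi: "integrable lborel f" by (rule bint[OF fm, of M' R]) (intro bK M' out)
  define q where "q n x = (f (x + (1 / real (Suc n)) *\<^sub>R e) - f x) * Suc n" for n x
  have "(\<lambda>n. LINT x|lborel. q n x) \<longlonglongrightarrow> (LINT x|lborel. D x)"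
  \<comment> \<open>The mean value theorem bounds the quotients by \<open>M\<close>, and a shift by
    at most \<open>norm e\<close> enlarges the supporting ball by that amount.\<close>
  proof (rule integral_dominated_convergence[where w="\<lambda>x. M * indicator (cball 0 (R + norm e)) x"])
    show "integrable lborel (\<lambda>x. M * indicator (cball (0::'a) (R + norm e)) x)"
      by (intro integrable_mult_right integrable_real_indicator) (auto simp: emeasure_lborel_cball_finite simp flip: infinity_ennreal_def)
    show "q n \<in> borel_measurable lborel" for n unfolding q_def by measurable
    show "AE x in lborel. (\<lambda>n. q n x) \<longlonglongrightarrow> D x"
    proof (intro always_eventually allI)
      fix x
      have "((\<lambda>h. (f (x + h *\<^sub>R e) - f x) / h) \<longlongrightarrow> D x) (at 0)"
        using der'[of x 0] by (simp add: DERIV_def)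
      moreover have "filterlim (\<lambda>n. 1 / real (Suc n)) (at 0) sequentially"
        using LIMSEQ_Suc[OF lim_1_over_n] by (simp add: filterlim_at)
      ultimately have "(\<lambda>n. (f (x + (1 / real (Suc n)) *\<^sub>R e) - f x) / (1 / real (Suc n))) \<longlonglongrightarrow> D x"
        by (rule filterlim_compose)
      then show "(\<lambda>n. q n x) \<longlonglongrightarrow> D x" by (simp add: q_def)
    qed
    show "AE x in lborel. norm (q n x) \<le> M * indicator (cball 0 (R + norm e)) x" for n
    proof (intro always_eventually allI)
      fix x
      let ?h = "1 / real (Suc n)"
      have h: "0 < ?h" "?h \<le> 1" by auto
      show "norm (q n x) \<le> M * indicator (cball 0 (R + norm e)) x"
      proof (cases "x \<in> cball 0 (R + norm e)")
        case True
        obtain z where z: "0 < z" "z < ?h" "f (x + ?h *\<^sub>R e) - f (x + 0 *\<^sub>R e) = (?h - 0) * D (x + z *\<^sub>R e)"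
          using MVT2[OF h(1), of "\<lambda>h. f (x + h *\<^sub>R e)" "\<lambda>z. D (x + z *\<^sub>R e)"] der' by blast
        have "q n x = D (x + z *\<^sub>R e)" using z(3) by (simp add: q_def)
        with True M show ?thesis by simp
      next
        case False
        have nR: "norm x > R + norm e" using False by simp
        have "norm (?h *\<^sub>R e) \<le> norm e" using h mult_right_mono[OF h(2) norm_ge_zero[of e]] by simp
        then have "norm (x + ?h *\<^sub>R e) > R" using nR norm_triangle_ineq4[of "x + ?h *\<^sub>R e" "?h *\<^sub>R e"] by simp
        moreover have "norm x > R" using nR norm_ge_zero[of e] by linarith
        ultimately have "x + ?h *\<^sub>R e \<notin> K" "x \<notin> K" using R by (auto simp: subset_eq)
        then show ?thesis using False by (simp add: q_def out)
      qed
    qed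
  qed simp
  moreover have "(LINT x|lborel. q n x) = 0" for n
  proof -
    have eq: "(LINT x|lborel. f (x + c)) = (LINT x|lborel. f x)" for c
      using integral_distr[of "(+) c" lborel borel f] by (simp add: lborel_distr_plus add.commute)
    have ti: "integrable lborel (\<lambda>x. f (x + c))" for c
      using fi integrable_distr_eq[of "(+) c" lborel borel f] by (simp add: lborel_distr_plus add.commute)
    show ?thesis unfolding q_def using ti fi eq by simp
  qed
  ultimately show "(LINT x|lborel. D x) = 0" by (simp add: LIMSEQ_const_iff)
qed

text \<open>C^1 functions with the partial derivatives as named real functions, so that the product
  and chain rules produce explicit formulas. Off \<open>W\<close> these functions may take any
  values.\<close>

definition grad_on :: "(real \<times> real) set \<Rightarrow> (real \<times> real \<Rightarrow> real) \<Rightarrow> (real \<times> real \<Rightarrow> real) \<Rightarrow> (real \<times> real \<Rightarrow> real) \<Rightarrow> bool" where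
  "grad_on W f f1 f2 \<longleftrightarrow> (\<forall>x\<in>W. (f has_derivative (\<lambda>v. f1 x * fst v + f2 x * snd v)) (at x)) \<and>
     continuous_on W f1 \<and> continuous_on W f2"

lemma grad_onD: "grad_on W f f1 f2 \<Longrightarrow> x \<in> W \<Longrightarrow> (f has_derivative (\<lambda>v. f1 x * fst v + f2 x * snd v)) (at x)"
  and grad_on_cont: "grad_on W f f1 f2 \<Longrightarrow> continuous_on W f1" "grad_on W f f1 f2 \<Longrightarrow> continuous_on W f2"
  by (auto simp: grad_on_def)

lemma grad_on_cont0: "grad_on W f f1 f2 \<Longrightarrow> continuous_on W f"
  by (auto simp: grad_on_def intro!: continuous_at_imp_continuous_on has_derivative_continuous)

lemma grad_on_mult:
  assumes "grad_on W f f1 f2" "grad_on W k k1 k2"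
  shows "grad_on W (\<lambda>x. f x * k x) (\<lambda>x. f1 x * k x + f x * k1 x) (\<lambda>x. f2 x * k x + f x * k2 x)"
  using assms grad_on_cont0[OF assms(1)] grad_on_cont0[OF assms(2)] unfolding grad_on_def
  by (auto intro!: continuous_intros derivative_eq_intros simp: algebra_simps)

lemma grad_on_add:
  assumes "grad_on W f f1 f2" "grad_on W k k1 k2"
  shows "grad_on W (\<lambda>x. f x + k x) (\<lambda>x. f1 x + k1 x) (\<lambda>x. f2 x + k2 x)"
  using assms unfolding grad_on_def
  by (auto intro!: continuous_intros derivative_eq_intros simp: algebra_simps)

lemma grad_on_fst: "grad_on W fst (\<lambda>x. 1) (\<lambda>x. 0)"
  unfolding grad_on_def by (auto intro!: continuous_intros derivative_eq_intros)

lemma grad_on_compose: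
  assumes f: "grad_on W f f1 f2"
    and k: "\<And>x. x \<in> W \<Longrightarrow> (k has_real_derivative k' (f x)) (at (f x))" "continuous_on W (\<lambda>x. k' (f x))"
  shows "grad_on W (\<lambda>x. k (f x)) (\<lambda>x. k' (f x) * f1 x) (\<lambda>x. k' (f x) * f2 x)"
  unfolding grad_on_def
proof (intro conjI ballI)
  fix x assume x: "x \<in> W"
  show "((\<lambda>x. k (f x)) has_derivative (\<lambda>v. k' (f x) * f1 x * fst v + k' (f x) * f2 x * snd v)) (at x)"
    using has_derivative_compose[OF grad_onD[OF f x] k(1)[OF x, unfolded has_field_derivative_def]]
    by (simp add: algebra_simps)
qed (intro continuous_intros k grad_on_cont[OF f])+

lemma grad_on_inverse:
  assumes "grad_on W f f1 f2" "\<And>x. x \<in> W \<Longrightarrow> f x \<noteq> 0"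
  shows "grad_on W (\<lambda>x. inverse (f x)) (\<lambda>x. - (inverse (f x))\<^sup>2 * f1 x) (\<lambda>x. - (inverse (f x))\<^sup>2 * f2 x)"
  using assms(2) by (intro grad_on_compose[OF assms(1), where k'="\<lambda>y. - (inverse y)\<^sup>2"])
    (auto intro!: continuous_intros grad_on_cont0[OF assms(1)] derivative_eq_intros simp: power2_eq_square)

lemma grad_on_subset: "grad_on W f f1 f2 \<Longrightarrow> V \<subseteq> W \<Longrightarrow> grad_on V f f1 f2"
  unfolding grad_on_def by (auto intro: continuous_on_subset)

lemma grad_on_cong:
  "grad_on W f f1 f2 \<Longrightarrow> (\<And>x. x \<in> W \<Longrightarrow> f1 x = k1 x) \<Longrightarrow> (\<And>x. x \<in> W \<Longrightarrow> f2 x = k2 x) \<Longrightarrow> grad_on W f k1 k2"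
  unfolding grad_on_def by (auto cong: continuous_on_cong)

lemma integral_partial_zero:
  assumes K: "compact K" "K \<subseteq> W" and W: "open W"
    and f: "grad_on W f f1 f2" and out: "\<And>x. x \<in> W \<Longrightarrow> x \<notin> K \<Longrightarrow> f x = 0"
  shows "set_integrable lborel W f1" "(LINT x:W|lborel. f1 x) = 0"
    "set_integrable lborel W f2" "(LINT x:W|lborel. f2 x) = 0"
proof -
  define F where "F x = (if x \<in> W then f x else 0)" for x
  have cF: "continuous_on W F"
    using grad_on_cont0[OF f] by (simp add: F_def cong: continuous_on_cong)
  have F0: "F x = 0" if "x \<notin> K" for x using out that by (simp add: F_def)
  have dF: "((\<lambda>h. F (x + h *\<^sub>R e)) has_real_derivative (f1 x * fst e + f2 x * snd e)) (at 0)" if x: "x \<in> W" for x e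
  proof -
    have "(F has_derivative (\<lambda>v. f1 x * fst v + f2 x * snd v)) (at x)"
      by (rule has_derivative_transform_within_open[OF grad_onD[OF f x] W x]) (simp add: F_def)
    then have FD: "(F has_derivative (\<lambda>v. f1 x * fst v + f2 x * snd v)) (at (x + 0 *\<^sub>R e))" by simp
    have "((\<lambda>h::real. x + h *\<^sub>R e) has_derivative (\<lambda>h. h *\<^sub>R e)) (at 0)" by (auto intro!: derivative_eq_intros)
    from has_derivative_compose[OF this FD]
    show ?thesis unfolding has_field_derivative_def
      by (rule has_derivative_eq_rhs) (simp add: fun_eq_iff algebra_simps)
  qed
  have "integrable lborel (\<lambda>x. indicator W x * (f1 x * fst e + f2 x * snd e)) \<and>
      (LINT x|lborel. indicator W x * (f1 x * fst e + f2 x * snd e)) = 0" for e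
  proof (intro conjI)
    have c: "continuous_on W (\<lambda>x. indicator W x * (f1 x * fst e + f2 x * snd e))"
      using grad_on_cont[OF f] by (simp cong: continuous_on_cong) (intro continuous_intros)
    show "integrable lborel (\<lambda>x. indicator W x * (f1 x * fst e + f2 x * snd e))"
      by (rule integral_directional_derivative_zero(1)[OF K W F0 _ c cF, of e]) (use dF in auto)
    show "(LINT x|lborel. indicator W x * (f1 x * fst e + f2 x * snd e)) = 0"
      by (rule integral_directional_derivative_zero(2)[OF K W F0 _ c cF, of e]) (use dF in auto)
  qed
  from this[of "(1, 0)"] this[of "(0, 1)"]
  show "set_integrable lborel W f1" "(LINT x:W|lborel. f1 x) = 0"
    "set_integrable lborel W f2" "(LINT x:W|lborel. f2 x) = 0"
    by (auto simp: set_integrable_def set_lebesgue_integral_def)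
qed

text \<open>Both mixed partial derivatives are limits of the same
  second difference.\<close>

lemma grad_on_symmetric:
  assumes W: "open W" and u: "grad_on W u u1 u2" and u1: "grad_on W u1 u11 u12" and u2: "grad_on W u2 u21 u22"
    and x: "x \<in> W"
  shows "u12 x = u21 x"
proof (rule ccontr)
  assume ne: "u12 x \<noteq> u21 x"
  define e where "e = \<bar>u12 x - u21 x\<bar> / 2"
  have e: "e > 0" using ne by (simp add: e_def)
  obtain d1 where d1: "d1 > 0" "\<And>y. y \<in> W \<Longrightarrow> dist y x < d1 \<Longrightarrow> dist (u12 y) (u12 x) < e"
    using grad_on_cont(2)[OF u1] x e unfolding continuous_on_iff by meson
  obtain d2 where d2: "d2 > 0" "\<And>y. y \<in> W \<Longrightarrow> dist y x < d2 \<Longrightarrow> dist (u21 y) (u21 x) < e"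
    using grad_on_cont(1)[OF u2] x e unfolding continuous_on_iff by meson
  obtain d3 where d3: "d3 > 0" "ball x d3 \<subseteq> W" using W x open_contains_ball by blast
  define h where "h = min d1 (min d2 d3) / 4"
  have h: "h > 0" "2 * h < d1" "2 * h < d2" "2 * h < d3" using d1 d2 d3 by (auto simp: h_def)
  obtain a b where xab: "x = (a, b)" by (cases x)
  have near: "(a + s, b + t) \<in> W \<and> dist (a + s, b + t) x < d1 \<and> dist (a + s, b + t) x < d2"
    if "0 \<le> s" "s \<le> h" "0 \<le> t" "t \<le> h" for s t
  proof -
    have "dist (a + s, b + t) x \<le> \<bar>s\<bar> + \<bar>t\<bar>"
      using sqrt_sum_squares_le_sum_abs[of s t] by (simp add: xab dist_Pair_Pair dist_real_def)
    then have "dist (a + s, b + t) x \<le> 2 * h" using that by simp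
    then show ?thesis using h d3(2) by (auto simp: dist_commute subset_eq)
  qed
  have dx: "((\<lambda>s. k (a + s, b + t)) has_real_derivative k1 (a + s, b + t)) (at s)"
    and dy: "((\<lambda>t. k (a + s, b + t)) has_real_derivative k2 (a + s, b + t)) (at t)"
    if "grad_on W k k1 k2" "0 \<le> s" "s \<le> h" "0 \<le> t" "t \<le> h" for k k1 k2 s t
  proof -
    have "(k has_derivative (\<lambda>v. k1 (a + s, b + t) * fst v + k2 (a + s, b + t) * snd v)) (at (a + s, b + t))"
      using grad_onD[OF that(1)] near[OF that(2-)] by blast
    note D = this
    have "((\<lambda>s. (a + s, b + t)) has_derivative (\<lambda>v. (v, 0))) (at s)" by (auto intro!: derivative_eq_intros)
    from has_derivative_compose[OF this D]
    show "((\<lambda>s. k (a + s, b + t)) has_real_derivative k1 (a + s, b + t)) (at s)"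
      by (simp add: has_field_derivative_def)
    have "((\<lambda>t. (a + s, b + t)) has_derivative (\<lambda>v. (0, v))) (at t)" by (auto intro!: derivative_eq_intros)
    from has_derivative_compose[OF this D]
    show "((\<lambda>t. k (a + s, b + t)) has_real_derivative k2 (a + s, b + t)) (at t)"
      by (simp add: has_field_derivative_def)
  qed
  define \<Delta> where "\<Delta> = u (a + h, b + h) - u (a + h, b + 0) - (u (a + 0, b + h) - u (a + 0, b + 0))"
  obtain s where s: "0 < s" "s < h" "\<Delta> = (h - 0) * (u1 (a + s, b + h) - u1 (a + s, b + 0))"
    using MVT2[OF h(1), of "\<lambda>s. u (a + s, b + h) - u (a + s, b + 0)" "\<lambda>s. u1 (a + s, b + h) - u1 (a + s, b + 0)"]
      dx[OF u] h(1) by (force intro!: DERIV_diff simp: \<Delta>_def)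
  obtain t where t: "0 < t" "t < h" "u1 (a + s, b + h) - u1 (a + s, b + 0) = (h - 0) * u12 (a + s, b + t)"
    using MVT2[OF h(1), of "\<lambda>t. u1 (a + s, b + t)" "\<lambda>t. u12 (a + s, b + t)"] dy[OF u1] s by force
  obtain t' where t': "0 < t'" "t' < h" "\<Delta> = (h - 0) * (u2 (a + h, b + t') - u2 (a + 0, b + t'))"
    using MVT2[OF h(1), of "\<lambda>t. u (a + h, b + t) - u (a + 0, b + t)" "\<lambda>t. u2 (a + h, b + t) - u2 (a + 0, b + t)"]
      dy[OF u] h(1) by (force intro!: DERIV_diff simp: \<Delta>_def)
  obtain s' where s': "0 < s'" "s' < h" "u2 (a + h, b + t') - u2 (a + 0, b + t') = (h - 0) * u21 (a + s', b + t')"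
    using MVT2[OF h(1), of "\<lambda>s. u2 (a + s, b + t')" "\<lambda>s. u21 (a + s, b + t')"] dx[OF u2] t' by force
  have "u12 (a + s, b + t) = u21 (a + s', b + t')"
    using s(3) t(3) t'(3) s'(3) h(1) by simp
  moreover have "dist (u12 (a + s, b + t)) (u12 x) < e" using near[of s t] s t by (intro d1(2)) auto
  moreover have "dist (u21 (a + s', b + t')) (u21 x) < e" using near[of s' t'] s' t' by (intro d2(2)) auto
  ultimately show False unfolding e_def dist_real_def by (simp add: abs_if split: if_splits)
qed


section \<open>Test functions and a one-dimensional Lipschitz bound\<close>

lemma AE_zero_imp_zero:
  fixes f :: "'a::euclidean_space \<Rightarrow> real"
  assumes W: "open W" and f: "continuous_on W f" and ae: "AE x in lebesgue. x \<in> W \<longrightarrow> f x = 0" and x: "x \<in> W"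
  shows "f x = 0"
proof (rule ccontr)
  assume ne: "f x \<noteq> 0"
  have "open (W \<inter> f -` (- {0}))" by (rule continuous_open_preimage[OF f W]) auto
  moreover have "x \<in> W \<inter> f -` (- {0})" using x ne by simp
  ultimately obtain e where e: "e > 0" "ball x e \<subseteq> W \<inter> f -` (- {0})" using open_contains_ball by blast
  have "AE y in lborel. y \<notin> ball x e"
    using ae unfolding AE_completion_iff by eventually_elim (use e in auto)
  then have "ball x e \<in> null_sets lborel" by (simp add: AE_iff_null_sets)
  then show False using e(1) content_ball_pos[of e x] by (simp add: null_sets_def measure_def)
qed

lemma C1_0_has_derivative:
  "C1_0 W \<phi> D \<Longrightarrow> open W \<Longrightarrow> x \<in> W \<Longrightarrow> (\<phi> has_derivative blinfun_apply (D x)) (at x)"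
  using at_within_open[of x W] by (auto simp: C1_0_def)

lemma C1_0_deriv_zero:
  assumes c: "C1_0 W \<phi> D" and W: "open W" and K: "compact K" "\<forall>x\<in>W - K. \<phi> x = 0" and x: "x \<in> W" "x \<notin> K"
  shows "D x = 0"
proof -
  have "(\<phi> has_derivative blinfun_apply (D x)) (at x)"
    by (rule C1_0_has_derivative[OF c W x(1)])
  moreover have "open (W \<inter> - K)" using W compact_imp_closed[OF K(1)] by auto
  then have "(\<phi> has_derivative (\<lambda>_. 0)) (at x)"
    by (rule has_derivative_transform_within_open[OF has_derivative_const[of 0]]) (use x K(2) in auto)
  ultimately have "blinfun_apply (D x) = (\<lambda>_. 0)" by (rule has_derivative_unique)
  then show ?thesis by (intro blinfun_eqI) simp
qed

text \<open>The extension is C^1 because the support is compact inside \<open>W\<close>. Identities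
  postulated for test functions on a large domain thereby become available on its open
  subsets.\<close>

lemma C1_0_extend:
  assumes c: "C1_0 W \<phi> D" and W: "open W" "W \<subseteq> V"
  shows "C1_0 V (\<lambda>x. if x \<in> W then \<phi> x else 0) (\<lambda>x. if x \<in> W then D x else 0)"
proof -
  obtain K where K: "compact K" "K \<subseteq> W" "\<forall>x\<in>W - K. \<phi> x = 0" using c unfolding C1_0_def by blast
  let ?p = "\<lambda>x. if x \<in> W then \<phi> x else 0" and ?D = "\<lambda>x. if x \<in> W then D x else 0"
  have oK: "open (- K)" using compact_imp_closed[OF K(1)] by auto
  have z: "?p x = 0" "?D x = 0" if "x \<notin> K" for x
    using K(3) C1_0_deriv_zero[OF c W(1) K(1,3)] that by auto
  show ?thesis unfolding C1_0_def
  proof (intro conjI ballI)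
    fix x assume x: "x \<in> V"
    have "(?p has_derivative blinfun_apply (?D x)) (at x)"
    proof (cases "x \<in> W")
      case True
      have "(\<phi> has_derivative blinfun_apply (D x)) (at x)"
        by (rule C1_0_has_derivative[OF c W(1) True])
      then have "(?p has_derivative blinfun_apply (D x)) (at x)"
        by (rule has_derivative_transform_within_open[OF _ W(1) True]) simp
      with True show ?thesis by simp
    next
      case False
      then have nK: "x \<in> - K" using K by auto
      have "(?p has_derivative (\<lambda>_. 0)) (at x)"
        by (rule has_derivative_transform_within_open[OF has_derivative_const[of 0] oK nK]) (use z in auto)
      then show ?thesis using False by (simp add: zero_blinfun.rep_eq)
    qed
    then show "(?p has_derivative blinfun_apply (?D x)) (at x within V)" by (rule has_derivative_at_withinI)
  next
    have "isCont ?D x" if "x \<in> V" for x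
    proof (cases "x \<in> W")
      case True
      then have "isCont D x" using c W by (auto simp: C1_0_def continuous_on_eq_continuous_at)
      moreover have "\<forall>\<^sub>F y in nhds x. ?D y = D y"
        using eventually_nhds_in_open[OF W(1) True] by eventually_elim simp
      ultimately show ?thesis by (simp add: isCont_cong)
    next
      case False
      then have nK: "x \<in> - K" using K by auto
      have "\<forall>\<^sub>F y in nhds x. ?D y = 0"
        using eventually_nhds_in_open[OF oK nK] by eventually_elim (use z in auto)
      then show ?thesis using isCont_cong[of ?D "\<lambda>_. 0" x] by simp
    qed
    then show "continuous_on V ?D" by (intro continuous_at_imp_continuous_on) blast
    show "\<exists>K. compact K \<and> K \<subseteq> V \<and> (\<forall>x\<in>V - K. ?p x = 0)"
      using K W z by (intro exI[of _ K]) auto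
  qed
qed

lemma blinfun_real2: "blinfun_apply (D :: (real \<times> real) \<Rightarrow>\<^sub>L 'b::real_normed_vector) v = fst v *\<^sub>R blinfun_apply D (1, 0) + snd v *\<^sub>R blinfun_apply D (0, 1)"
proof -
  have "v = fst v *\<^sub>R (1, 0) + snd v *\<^sub>R (0, 1)" by (cases v) simp
  then show ?thesis by (metis blinfun.add_right blinfun.scaleR_right)
qed

lemma C1_0_grad_on:
  fixes \<phi> :: "real \<times> real \<Rightarrow> real"
  assumes "C1_0 W \<phi> D" "open W"
  shows "grad_on W \<phi> (\<lambda>x. D x (1, 0)) (\<lambda>x. D x (0, 1))"
  unfolding grad_on_def
proof (intro conjI ballI)
  fix x assume x: "x \<in> W"
  have "(\<phi> has_derivative blinfun_apply (D x)) (at x)" by (rule C1_0_has_derivative[OF assms x])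
  moreover have "blinfun_apply (D x) = (\<lambda>v. D x (1, 0) * fst v + D x (0, 1) * snd v)"
    by (rule ext, subst blinfun_real2) (simp add: mult.commute)
  ultimately show "(\<phi> has_derivative (\<lambda>v. D x (1, 0) * fst v + D x (0, 1) * snd v)) (at x)" by simp
qed (use assms(1) in \<open>auto simp: C1_0_def intro!: continuous_intros\<close>)

text \<open>Compare with the last point at which the value of the left end point is attained.\<close>

lemma nonneg_lipschitz_aux:
  fixes v :: "real \<Rightarrow> real"
  assumes ab: "a < b" and c: "continuous_on {a..b} v" and nn: "\<And>x. x \<in> {a..b} \<Longrightarrow> v x \<ge> 0"
    and d: "\<And>x. a < x \<Longrightarrow> x < b \<Longrightarrow> v x > 0 \<Longrightarrow> (v has_real_derivative v' x) (at x) \<and> \<bar>v' x\<bar> \<le> L"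
    and L: "L \<ge> 0"
  shows "v b - v a \<le> L * (b - a)"
proof (cases "v b \<le> v a")
  case True then show ?thesis using ab L by (smt (verit) mult_nonneg_nonneg)
next
  case False
  define S where "S = {x\<in>{a..b}. v x \<le> v a}"
  have clS: "closed S" unfolding S_def
    using continuous_closed_preimage[OF c closed_atLeastAtMost, of "{..v a}"] by (simp add: vimage_def Int_def conj_commute)
  have Sne: "a \<in> S" "bdd_above S" using ab by (auto simp: S_def intro!: bdd_aboveI[of _ b])
  define s where "s = Sup S"
  have sS: "s \<in> S" unfolding s_def using Sne clS by (intro closed_contains_Sup) auto
  have s: "a \<le> s" "s < b" "v s \<le> v a" using sS False by (auto simp: S_def less_le)
  have gt: "v x > v a" if "s < x" "x \<le> b" for x
  proof (rule ccontr)
    assume "\<not> ?thesis"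
    then have "x \<in> S" using that s by (simp add: S_def)
    then have "x \<le> s" unfolding s_def using Sne by (intro cSup_upper)
    with that show False by simp
  qed
  have "continuous_on {s..b} v" using c s by (auto intro: continuous_on_subset)
  moreover have "v differentiable (at x)" if "s < x" "x < b" for x
  proof -
    have "v x > 0" using gt[of x] nn[of a] that ab by simp
    then show ?thesis using d[of x] that s unfolding real_differentiable_def by auto
  qed
  ultimately obtain l z where z: "s < z" "z < b" "(v has_real_derivative l) (at z)" "v b - v s = (b - s) * l"
    using MVT[OF s(2)] by blast
  have "v z > 0" using gt[of z] z nn[of a] ab by auto
  then have "l = v' z" "\<bar>v' z\<bar> \<le> L" using d[of z] z s DERIV_unique by auto
  have "\<not> v s < v a"
  proof
    assume "v s < v a"
    moreover have "v a < v b" using False by simp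
    ultimately obtain x where "s \<le> x" "x \<le> b" "v x = v a"
      using IVT'[of v s "v a" b] s \<open>continuous_on {s..b} v\<close> by auto
    then show False using gt[of x] \<open>v s < v a\<close> by (cases "x = s") auto
  qed
  then have "v b - v a \<le> (b - s) * L" using z(4) \<open>l = v' z\<close> \<open>\<bar>v' z\<bar> \<le> L\<close> s
    by (smt (verit) mult_left_mono)
  also have "\<dots> \<le> (b - a) * L" using s L by (intro mult_right_mono) auto
  finally show ?thesis by (simp add: mult.commute)
qed

text \<open>The derivative is assumed only where \<open>v\<close> is positive, which is the
  situation along a segment crossing the free boundary. Reflecting the interval supplies the second
  inequality.\<close>

lemma nonneg_lipschitz:
  fixes v :: "real \<Rightarrow> real"
  assumes ab: "a < b" and c: "continuous_on {a..b} v" and nn: "\<And>x. x \<in> {a..b} \<Longrightarrow> v x \<ge> 0"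
    and d: "\<And>x. a < x \<Longrightarrow> x < b \<Longrightarrow> v x > 0 \<Longrightarrow> (v has_real_derivative v' x) (at x) \<and> \<bar>v' x\<bar> \<le> L"
    and L: "L \<ge> 0"
  shows "\<bar>v b - v a\<bar> \<le> L * (b - a)"
proof -
  have 1: "v b - v a \<le> L * (b - a)" by (rule nonneg_lipschitz_aux[OF assms])
  have "v (- (- a)) - v (- (- b)) \<le> L * (- a - (- b))"
  proof (rule nonneg_lipschitz_aux[where v="\<lambda>x. v (- x)" and v'="\<lambda>x. - v' (- x)"])
    show "continuous_on {- b..- a} (\<lambda>x. v (- x))"
      by (intro continuous_on_compose2[OF c] continuous_intros) auto
    fix x assume "- b < x" "x < - a" "0 < v (- x)"
    then have D: "(v has_real_derivative v' (- x)) (at (- x))" "\<bar>v' (- x)\<bar> \<le> L" using d[of "- x"] by auto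
    then show "((\<lambda>x. v (- x)) has_real_derivative - v' (- x)) (at x) \<and> \<bar>- v' (- x)\<bar> \<le> L"
      using DERIV_mirror[of v "v' (- x)" x] by simp
  qed (use ab nn L in auto)
  with 1 show ?thesis by simp
qed

section \<open>Weak gradients and integration by parts\<close>

lemma grad_on_sqrt_shift:
  assumes "grad_on W f f1 f2" "\<And>x. x \<in> W \<Longrightarrow> f x \<ge> 0" "c > 0"
  shows "grad_on W (\<lambda>x. sqrt (f x + c)) (\<lambda>x. inverse (2 * sqrt (f x + c)) * f1 x) (\<lambda>x. inverse (2 * sqrt (f x + c)) * f2 x)"
proof (rule grad_on_compose[OF assms(1), where k="\<lambda>y. sqrt (y + c)" and k'="\<lambda>y. inverse (2 * sqrt (y + c))"])
  fix x assume x: "x \<in> W"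
  have "f x + c > 0" using assms(2)[OF x] assms(3) by simp
  then show "((\<lambda>y. sqrt (y + c)) has_real_derivative inverse (2 * sqrt (f x + c))) (at (f x))"
    by (auto intro!: derivative_eq_intros simp: field_simps)
next
  have "f x + c \<noteq> 0" if "x \<in> W" for x using assms(2)[OF that] assms(3) by simp
  then show "continuous_on W (\<lambda>x. inverse (2 * sqrt (f x + c)))"
    by (intro continuous_intros grad_on_cont0[OF assms(1)]) auto
qed

text \<open>Tests on \<open>V\<close>, extended by zero to \<open>U\<close>, show that
  \<open>Dv \<bullet> e - g1\<close> is orthogonal to all test functions on
  \<open>V\<close>.\<close>

lemma weak_gradient_unique:
  fixes v g1 :: "real \<times> real \<Rightarrow> real" and e :: "real \<times> real"
  assumes wg: "has_weak_gradient v Dv U" and e: "e \<in> Basis"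
    and V: "open V" "V \<subseteq> U"
    and g1: "\<And>K. compact K \<Longrightarrow> K \<subseteq> V \<Longrightarrow> set_integrable lebesgue K g1"
    and id: "\<And>\<phi> D. C1_0 V \<phi> D \<Longrightarrow> (LINT x:V|lebesgue. v x * D x e) = - (LINT x:V|lebesgue. g1 x * \<phi> x)"
  shows "AE x in lebesgue. x \<in> V \<longrightarrow> Dv x \<bullet> e = g1 x"
proof -
  have Dvi: "set_integrable lebesgue K (\<lambda>x. Dv x \<bullet> e)" if "compact K" "K \<subseteq> V" for K
  proof -
    have "set_integrable lebesgue K Dv" using wg that V unfolding has_weak_gradient_def by blast
    then have "integrable lebesgue (\<lambda>x. (indicator K x *\<^sub>R Dv x) \<bullet> e)" unfolding set_integrable_def by (rule integrable_inner_left)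
    then show ?thesis by (simp add: set_integrable_def inner_scaleR_left)
  qed
  have "AE x in lebesgue. x \<in> V \<longrightarrow> Dv x \<bullet> e - g1 x = 0"
  proof (rule test_integrals_zero_imp_AE_zero[OF V(1)])
    show "set_integrable lebesgue K (\<lambda>x. Dv x \<bullet> e - g1 x)" if "compact K" "K \<subseteq> V" for K
      by (rule set_integral_diff(1)[OF Dvi[OF that] g1[OF that]])
    fix \<phi> :: "real \<times> real \<Rightarrow> real" and D assume c: "C1_0 V \<phi> D"
    let ?p = "\<lambda>x. if x \<in> V then \<phi> x else 0" and ?D = "\<lambda>x. if x \<in> V then D x else 0"
    obtain K where K: "compact K" "K \<subseteq> V" "\<forall>x\<in>V - K. \<phi> x = 0" using c unfolding C1_0_def by blast
    have "C1_0 U ?p ?D" by (rule C1_0_extend[OF c V])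
    then have "(LINT x:U|lebesgue. v x * ?D x e) = - (LINT x:U|lebesgue. (Dv x \<bullet> e) * ?p x)"
      using wg e unfolding has_weak_gradient_def by blast
    moreover have "(LINT x:U|lebesgue. v x * ?D x e) = (LINT x:V|lebesgue. v x * D x e)"
      unfolding set_lebesgue_integral_def using V
      by (intro Bochner_Integration.integral_cong) (auto simp: indicator_def)
    moreover have "(LINT x:U|lebesgue. (Dv x \<bullet> e) * ?p x) = (LINT x:V|lebesgue. (Dv x \<bullet> e) * \<phi> x)"
      unfolding set_lebesgue_integral_def using V
      by (intro Bochner_Integration.integral_cong) (auto simp: indicator_def)
    ultimately have eq: "(LINT x:V|lebesgue. (Dv x \<bullet> e) * \<phi> x) = (LINT x:V|lebesgue. g1 x * \<phi> x)"
      using id[OF c] by simp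
    have phi_c: "continuous_on K \<phi>"
      using c K unfolding C1_0_def by (meson continuous_on_subset has_derivative_continuous_on)
    obtain M where M: "\<And>x. x \<in> K \<Longrightarrow> \<bar>\<phi> x\<bar> \<le> M"
      using compact_imp_bounded[OF compact_continuous_image[OF phi_c K(1)]] by (auto simp: bounded_iff)
    have pm: "(\<lambda>x. indicator K x *\<^sub>R \<phi> x) \<in> borel_measurable lebesgue"
      using borel_measurable_continuous_on_indicator[OF borel_compact[OF K(1)] phi_c] by (intro measurable_completion) simp
    have ii: "set_integrable lebesgue V (\<lambda>x. k x * \<phi> x)" if k: "set_integrable lebesgue K k" for k :: "real \<times> real \<Rightarrow> real"
    proof -
      have "integrable lebesgue (\<lambda>x. (indicator K x *\<^sub>R k x) * (indicator K x *\<^sub>R \<phi> x))"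
      proof (rule Bochner_Integration.integrable_bound[where f="\<lambda>x. M * (indicator K x *\<^sub>R k x)"])
        show "integrable lebesgue (\<lambda>x. M * (indicator K x *\<^sub>R k x))" using k by (simp add: set_integrable_def)
        show "(\<lambda>x. (indicator K x *\<^sub>R k x) * (indicator K x *\<^sub>R \<phi> x)) \<in> borel_measurable lebesgue"
          using k by (intro borel_measurable_times pm) (simp add: set_integrable_def borel_measurable_integrable)
        show "AE x in lebesgue. norm ((indicator K x *\<^sub>R k x) * (indicator K x *\<^sub>R \<phi> x)) \<le> norm (M * (indicator K x *\<^sub>R k x))"
          using order_trans[OF M abs_ge_self] by (intro always_eventually allI) (auto simp: indicator_def abs_mult mult.commute intro!: mult_right_mono)
      qed
      also have "(\<lambda>x. (indicator K x *\<^sub>R k x) * (indicator K x *\<^sub>R \<phi> x)) = (\<lambda>x. indicator V x *\<^sub>R (k x * \<phi> x))"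
        using K by (auto simp: indicator_def fun_eq_iff)
      finally show ?thesis by (simp add: set_integrable_def)
    qed
    show "(LINT x:V|lebesgue. (Dv x \<bullet> e - g1 x) * \<phi> x) = 0"
      using eq set_integral_diff(2)[OF ii[OF Dvi[OF K(1,2)]] ii[OF g1[OF K(1,2)]]] by (simp add: left_diff_distrib)
  qed
  then show ?thesis by eventually_elim simp
qed

lemma set_integrable_continuous:
  fixes f :: "'a::euclidean_space \<Rightarrow> real"
  assumes "compact K" "continuous_on K f"
  shows "set_integrable lebesgue K f"
  using borel_integrable_compact[OF assms] integrable_completion[of "\<lambda>x. indicator K x *\<^sub>R f x" lborel]
    borel_measurable_integrable[OF borel_integrable_compact[OF assms]]
  by (simp add: set_integrable_def)

lemma grad_on_test:
  fixes \<phi> :: "real \<times> real \<Rightarrow> real"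
  assumes V: "open V" and f: "grad_on V f f1 f2" and c: "C1_0 V \<phi> D"
  shows "(LINT x:V|lebesgue. f x * D x (1, 0)) = - (LINT x:V|lebesgue. f1 x * \<phi> x)"
    "(LINT x:V|lebesgue. f x * D x (0, 1)) = - (LINT x:V|lebesgue. f2 x * \<phi> x)"
proof -
  obtain K where K: "compact K" "K \<subseteq> V" "\<forall>x\<in>V - K. \<phi> x = 0" using c unfolding C1_0_def by blast
  note g = C1_0_grad_on[OF c V]
  have Dz: "D x = 0" if "x \<in> V" "x \<notin> K" for x by (rule C1_0_deriv_zero[OF c V K(1,3) that])
  have ii: "set_integrable lebesgue V k" if k: "continuous_on V k" "\<And>x. x \<in> V \<Longrightarrow> x \<notin> K \<Longrightarrow> k x = 0" for k :: "real \<times> real \<Rightarrow> real"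
  proof -
    have "(\<lambda>x. indicator V x *\<^sub>R k x) = (\<lambda>x. indicator K x *\<^sub>R k x)" using k K by (auto simp: indicator_def fun_eq_iff)
    then show ?thesis using set_integrable_continuous[OF K(1) continuous_on_subset[OF k(1) K(2)]] by (simp add: set_integrable_def)
  qed
  note gi = integral_partial_zero[OF K(1,2) V grad_on_mult[OF f g]]
  have z: "x \<in> V \<Longrightarrow> x \<notin> K \<Longrightarrow> f x * \<phi> x = 0" for x using K by auto
  have m: "(\<lambda>x. indicat_real V x *\<^sub>R k x) \<in> borel_measurable lborel" if "set_integrable lborel V k" for k
    using that by (simp add: set_integrable_def borel_measurable_integrable)
  have 1: "(LINT x:V|lebesgue. f1 x * \<phi> x + f x * D x (1, 0)) = 0" "(LINT x:V|lebesgue. f2 x * \<phi> x + f x * D x (0, 1)) = 0"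
    using gi(2)[OF z] gi(4)[OF z] m[OF gi(1)[OF z]] m[OF gi(3)[OF z]]
    by (simp_all add: set_lebesgue_integral_def integral_completion)
  have c': "continuous_on V (\<lambda>x. f1 x * \<phi> x)" "continuous_on V (\<lambda>x. f2 x * \<phi> x)"
    "continuous_on V (\<lambda>x. f x * D x (1, 0))" "continuous_on V (\<lambda>x. f x * D x (0, 1))"
    by (intro continuous_intros grad_on_cont[OF f] grad_on_cont0[OF f] grad_on_cont[OF g] grad_on_cont0[OF g])+
  have s: "set_integrable lebesgue V (\<lambda>x. f1 x * \<phi> x)" "set_integrable lebesgue V (\<lambda>x. f2 x * \<phi> x)"
    "set_integrable lebesgue V (\<lambda>x. f x * D x (1, 0))" "set_integrable lebesgue V (\<lambda>x. f x * D x (0, 1))"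
    using K(3) Dz by (auto intro!: ii c')
  show "(LINT x:V|lebesgue. f x * D x (1, 0)) = - (LINT x:V|lebesgue. f1 x * \<phi> x)"
    using 1(1) set_integral_add(2)[OF s(1,3)] by simp
  show "(LINT x:V|lebesgue. f x * D x (0, 1)) = - (LINT x:V|lebesgue. f2 x * \<phi> x)"
    using 1(2) set_integral_add(2)[OF s(2,4)] by simp
qed

section \<open>Variational solutions on the set where \<open>u\<close> is positive\<close>

locale flow = eos +
  fixes \<Omega> :: "(real \<times> real) set" and u :: "real \<times> real \<Rightarrow> real" and Du :: "real \<times> real \<Rightarrow> real \<times> real"
  assumes flow_dom: "flow_domain g \<rho>0 p \<Omega>" and sol: "subsonic_variational_solution g \<rho>0 p \<Omega> u Du"
begin

definition "\<Omega>p = \<Omega> \<inter> {x. fst x > 0}"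
definition "W = \<Omega> \<inter> {x. u x > 0}"

lemma openin_\<Omega>: "openin (top_of_set half_plane) \<Omega>" and \<Omega>_half: "\<Omega> \<subseteq> half_plane"
  and \<Omega>_snd: "x \<in> \<Omega> \<Longrightarrow> snd x < s_star g \<rho>0 p"
  using flow_dom openin_imp_subset by (auto simp: flow_domain_def)

lemma open_\<Omega>p: "open \<Omega>p"
proof -
  obtain O' where O': "open O'" "\<Omega> = half_plane \<inter> O'" using openin_\<Omega> by (auto simp: openin_open)
  have "\<Omega>p = O' \<inter> {x. fst x > 0}" 
    unfolding \<Omega>p_def using O'(2) by (auto simp: half_plane_def)
  then show ?thesis using O'(1) by (auto intro!: open_Int open_Collect_less continuous_intros)
qed

lemmas sol_conj = sol[unfolded subsonic_variational_solution_def]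

lemma u_W12: "W12_w_loc \<Omega> u Du" by (rule sol_conj[THEN conjunct1])

lemma u_nonneg: "x \<in> \<Omega> \<Longrightarrow> u x \<ge> 0" using sol_conj[THEN conjunct2, THEN conjunct1] by blast

lemma u_axis: "x \<in> \<Omega> \<Longrightarrow> fst x = 0 \<Longrightarrow> u x = 0"
  using sol_conj[THEN conjunct2, THEN conjunct2, THEN conjunct1] by blast

lemma u_cont: "continuous_on \<Omega> u"
  by (rule sol_conj[THEN conjunct2, THEN conjunct2, THEN conjunct2, THEN conjunct1])

lemma u_C2: "C2_on W u"
  unfolding W_def by (rule sol_conj[THEN conjunct2, THEN conjunct2, THEN conjunct2, THEN conjunct2, THEN conjunct1])

lemmas sol_tail = sol_conj[THEN conjunct2, THEN conjunct2, THEN conjunct2, THEN conjunct2, THEN conjunct2, THEN conjunct2]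

lemma subsonic: "compact K \<Longrightarrow> K \<subseteq> \<Omega> \<inter> {x. snd x \<ge> 0} \<Longrightarrow>
  \<exists>\<epsilon>>0. AE y in lebesgue. y \<in> K \<longrightarrow> (\<exists>h. is_H g \<rho>0 p (tq Du y) (snd y) h) \<and>
     H_eos g \<rho>0 p (tq Du y) (snd y) - rho_cr g \<rho>0 p (snd y) \<ge> \<epsilon>"
  using sol_tail[THEN conjunct1, rule_format, of K] by simp

lemma W_fluid: "W \<subseteq> {x. snd x \<ge> 0}"
  using sol_tail[THEN conjunct2, THEN conjunct1] unfolding W_def by blast

lemma variation: "C1_0 \<Omega> \<phi> D\<phi> \<Longrightarrow> (\<And>x. x \<in> \<Omega> \<Longrightarrow> fst x = 0 \<Longrightarrow> fst (\<phi> x) = 0) \<Longrightarrow> variation_identity g \<rho>0 p \<Omega> u Du \<phi> D\<phi>"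
  using sol_tail[THEN conjunct2, THEN conjunct2] by blast

lemma W_sub: "W \<subseteq> \<Omega>p" "W \<subseteq> \<Omega>"
proof -
  show 2: "W \<subseteq> \<Omega>" by (auto simp: W_def)
  show "W \<subseteq> \<Omega>p"
  proof
    fix x assume x: "x \<in> W"
    then have "x \<in> \<Omega>" "u x > 0" by (auto simp: W_def)
    moreover have "fst x \<ge> 0" using \<open>x \<in> \<Omega>\<close> \<Omega>_half by (auto simp: half_plane_def)
    ultimately show "x \<in> \<Omega>p" using u_axis[of x] by (cases "fst x = 0") (auto simp: \<Omega>p_def)
  qed
qed

lemma open_W: "open W"
proof -
  have "continuous_on \<Omega>p u" using u_cont by (rule continuous_on_subset) (auto simp: \<Omega>p_def)
  then have "open (\<Omega>p \<inter> u -` {0<..})" by (rule continuous_open_preimage[OF _ open_\<Omega>p]) simp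
  also have "\<Omega>p \<inter> u -` {0<..} = W" using W_sub by (auto simp: W_def \<Omega>p_def)
  finally show ?thesis .
qed

lemma W_pos: "x \<in> W \<Longrightarrow> fst x > 0" and W_u: "x \<in> W \<Longrightarrow> u x > 0"
  using W_sub by (auto simp: \<Omega>p_def W_def)

lemma W_ne: "x \<in> W \<Longrightarrow> fst x \<noteq> 0" using W_pos[of x] by auto

text \<open>The inequality at 0 is strict because \<open>W\<close> is open, and \<open>dom\<close>
  asks for positive \<open>s\<close>.\<close>

lemma W_snd: assumes "x \<in> W" shows "0 < snd x" "snd x < s_star g \<rho>0 p"
proof -
  show "snd x < s_star g \<rho>0 p" using assms W_sub \<Omega>_snd by blast
  obtain a c where x: "x = (a, c)" by (cases x)
  obtain e where e: "e > 0" "ball x e \<subseteq> W" using open_W assms open_contains_ball by blast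
  have "(a, c - e/2) \<in> ball x e" using e by (simp add: x dist_Pair_Pair dist_real_def)
  with e W_fluid have "0 \<le> snd (a, c - e/2)" by blast
  then show "0 < snd x" using e by (simp add: x)
qed

lemma ex_second_derivatives:
  "\<exists>u1 u2 u11 u12 u22. grad_on W u u1 u2 \<and> grad_on W u1 u11 u12 \<and> grad_on W u2 u12 u22"
proof -
  obtain Df :: "real \<times> real \<Rightarrow> (real \<times> real) \<Rightarrow>\<^sub>L real" and D2f :: "real \<times> real \<Rightarrow> (real \<times> real) \<Rightarrow>\<^sub>L ((real \<times> real) \<Rightarrow>\<^sub>L real)"
    where d1: "\<And>x. x \<in> W \<Longrightarrow> (u has_derivative blinfun_apply (Df x)) (at x)"
    and d2: "\<And>x. x \<in> W \<Longrightarrow> (Df has_derivative blinfun_apply (D2f x)) (at x)"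
    and c2: "continuous_on W D2f"
    using u_C2 unfolding C2_on_def by blast
  have cD: "continuous_on W Df" using d2 by (auto intro!: continuous_at_imp_continuous_on has_derivative_continuous)
  have lin: "blinfun_apply L = (\<lambda>v. L (1, 0) * fst v + L (0, 1) * snd v)" for L :: "(real \<times> real) \<Rightarrow>\<^sub>L real"
    by (rule ext, subst blinfun_real2) (simp add: mult.commute)
  have g0: "grad_on W u (\<lambda>x. Df x (1, 0)) (\<lambda>x. Df x (0, 1))"
    unfolding grad_on_def using d1 cD by (auto simp flip: lin intro!: continuous_intros)
  have g1: "grad_on W (\<lambda>x. Df x e) (\<lambda>x. D2f x (1, 0) e) (\<lambda>x. D2f x (0, 1) e)" for e
    unfolding grad_on_def
  proof (intro conjI ballI)
    fix x assume x: "x \<in> W"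
    have "((\<lambda>x. Df x e) has_derivative (\<lambda>v. D2f x v e)) (at x)"
      using bounded_linear.has_derivative[OF blinfun.bounded_linear_left[of e] d2[OF x]] .
    moreover have "(\<lambda>v. D2f x v e) = (\<lambda>v. D2f x (1, 0) e * fst v + D2f x (0, 1) e * snd v)"
      by (rule ext, subst blinfun_real2) (simp add: blinfun.add_left blinfun.scaleR_left mult.commute)
    ultimately show "((\<lambda>x. Df x e) has_derivative (\<lambda>v. D2f x (1, 0) e * fst v + D2f x (0, 1) e * snd v)) (at x)" by simp
  qed (intro continuous_intros c2)+
  have "D2f x (0, 1) (1, 0) = D2f x (1, 0) (0, 1)" if "x \<in> W" for x
    using grad_on_symmetric[OF open_W g0 g1[of "(1, 0)"] g1[of "(0, 1)"] that] by simp
  then have "grad_on W (\<lambda>x. Df x (0, 1)) (\<lambda>x. D2f x (0, 1) (1, 0)) (\<lambda>x. D2f x (0, 1) (0, 1))"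
    by (intro grad_on_cong[OF g1[of "(0, 1)"]]) auto
  with g0 g1[of "(1, 0)"] show ?thesis by blast
qed

definition "uders = (SOME (a1, a2, a11, a12, a22). grad_on W u a1 a2 \<and> grad_on W a1 a11 a12 \<and> grad_on W a2 a12 a22)"
definition "u1 = fst uders"
definition "u2 = fst (snd uders)"
definition "u11 = fst (snd (snd uders))"
definition "u12 = fst (snd (snd (snd uders)))"
definition "u22 = snd (snd (snd (snd uders)))"

lemma u_grad: "grad_on W u u1 u2" and u1_grad: "grad_on W u1 u11 u12" and u2_grad: "grad_on W u2 u12 u22"
proof -
  have "\<exists>z. (case z of (a1, a2, a11, a12, a22) \<Rightarrow> grad_on W u a1 a2 \<and> grad_on W a1 a11 a12 \<and> grad_on W a2 a12 a22)"
    using ex_second_derivatives by (metis (mono_tags, lifting) case_prod_conv)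
  then have "(case uders of (a1, a2, a11, a12, a22) \<Rightarrow> grad_on W u a1 a2 \<and> grad_on W a1 a11 a12 \<and> grad_on W a2 a12 a22)"
    unfolding uders_def by (rule someI_ex)
  then show "grad_on W u u1 u2" "grad_on W u1 u11 u12" "grad_on W u2 u12 u22"
    by (auto simp: u1_def u2_def u11_def u12_def u22_def split: prod.splits)
qed

text \<open>The classical gradient extended by zero: the candidate for the weak gradient across the
  free boundary.\<close>

definition "G x = (if x \<in> W then (u1 x, u2 x) else 0)"

lemma has_weak_grad: "has_weak_gradient u Du \<Omega>p"
  using u_W12 by (simp add: W12_w_loc_def \<Omega>p_def)

lemma Basis_real2: "(1, 0) \<in> (Basis :: (real \<times> real) set)" "(0, 1) \<in> (Basis :: (real \<times> real) set)"
  by (auto simp: Basis_prod_def)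

lemma AE_Du_W: "AE x in lebesgue. x \<in> W \<longrightarrow> Du x = G x"
proof -
  note id = grad_on_test[OF open_W u_grad]
  have "AE x in lebesgue. x \<in> W \<longrightarrow> Du x \<bullet> (1, 0) = u1 x"
    by (rule weak_gradient_unique[OF has_weak_grad Basis_real2(1) open_W W_sub(1) _ id(1)])
       (auto intro!: set_integrable_continuous continuous_on_subset[OF grad_on_cont(1)[OF u_grad]])
  moreover have "AE x in lebesgue. x \<in> W \<longrightarrow> Du x \<bullet> (0, 1) = u2 x"
    by (rule weak_gradient_unique[OF has_weak_grad Basis_real2(2) open_W W_sub(1) _ id(2)])
       (auto intro!: set_integrable_continuous continuous_on_subset[OF grad_on_cont(2)[OF u_grad]])
  ultimately show ?thesis
    by eventually_elim (auto simp: G_def inner_prod_def prod_eq_iff)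
qed

definition "t x = tq G x"

lemma t_nonneg: "t x \<ge> 0" by (simp add: t_def tq_def)

lemma t_W: "x \<in> W \<Longrightarrow> t x = ((u1 x)\<^sup>2 + (u2 x)\<^sup>2) / (fst x)\<^sup>2"
  by (simp add: t_def tq_def G_def norm_prod_def)

lemma t_cont: "continuous_on W t"
proof -
  have "continuous_on W (\<lambda>x. ((u1 x)\<^sup>2 + (u2 x)\<^sup>2) / (fst x)\<^sup>2)"
    by (intro continuous_intros grad_on_cont[OF u_grad]) (simp add: W_ne)
  then show ?thesis using t_W by (simp cong: continuous_on_cong)
qed

text \<open>Condition (4) holds almost everywhere; by continuity of the classical gradient \<open>H\<close> exists
  at every point of \<open>W\<close>.\<close>

lemma W_dom:
  assumes x: "x \<in> W" shows "(t x, snd x) \<in> dom"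
proof -
  obtain e where e: "e > 0" "cball x e \<subseteq> W" using open_W x open_contains_cball by blast
  have "compact (cball x e) \<and> cball x e \<subseteq> \<Omega> \<inter> {x. snd x \<ge> 0}" using e W_sub W_fluid by auto
  then obtain \<epsilon> where \<epsilon>: "\<epsilon> > 0" "AE y in lebesgue. y \<in> cball x e \<longrightarrow>
       (\<exists>h. is_H g \<rho>0 p (tq Du y) (snd y) h) \<and> H_eos g \<rho>0 p (tq Du y) (snd y) - rho_cr g \<rho>0 p (snd y) \<ge> \<epsilon>"
    using subsonic[of "cball x e"] by blast
  define P where "P y \<longleftrightarrow> y \<in> W \<and> (\<exists>h. is_H g \<rho>0 p (t y) (snd y) h \<and> h - rho_cr g \<rho>0 p (snd y) \<ge> \<epsilon>)" for y
  have aeP: "AE y in lebesgue. y \<in> cball x e \<longrightarrow> P y"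
    using \<epsilon>(2) AE_Du_W
  proof eventually_elim
    case (elim y)
    show ?case
    proof
      assume y: "y \<in> cball x e"
      then have yW: "y \<in> W" using e by auto
      have teq: "tq Du y = t y" using elim(2) yW by (simp add: t_def tq_def)
      obtain h where h: "is_H g \<rho>0 p (t y) (snd y) h" using elim(1) y unfolding teq by blast
      have "H_eos g \<rho>0 p (t y) (snd y) = h" using W_snd[OF yW] h by (intro H_eqI) auto
      then show "P y" unfolding P_def using h elim(1) y yW unfolding teq by auto
    qed
  qed
  \<comment> \<open>A property valid almost everywhere holds at some point of every small ball,
    which gives a sequence of uniformly subsonic points tending to \<open>x\<close>.\<close>
  have "\<exists>y\<in>ball x (e / Suc n). P y" for n :: nat
  proof (rule ccontr)
    assume "\<not> ?thesis"
    then have np: "\<And>y. y \<in> ball x (e / Suc n) \<Longrightarrow> \<not> P y" by blast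
    have sub: "ball x (e / Suc n) \<subseteq> cball x e"
      using e(1) by (intro order_trans[OF ball_subset_cball] subset_cball) (simp add: divide_le_eq mult_le_cancel_left1)
    have "AE y in lborel. y \<notin> ball x (e / Suc n)"
      using aeP unfolding AE_completion_iff by eventually_elim (use np sub in blast)
    then have "ball x (e / Suc n) \<in> null_sets lborel" by (simp add: AE_iff_null_sets)
    then show False using e(1) content_ball_pos[of "e / Suc n" x] by (simp add: null_sets_def measure_def)
  qed
  then obtain y where y: "\<And>n. y n \<in> ball x (e / Suc n)" "\<And>n. P (y n)" by metis
  then obtain h where h: "\<And>n. is_H g \<rho>0 p (t (y n)) (snd (y n)) (h n)" "\<And>n. h n - rho_cr g \<rho>0 p (snd (y n)) \<ge> \<epsilon>"
    unfolding P_def by metis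
  have yW: "y n \<in> W" for n using y(2) by (simp add: P_def)
  have ylim: "y \<longlonglongrightarrow> x"
  proof (rule tendstoI)
    fix d :: real assume d: "d > 0"
    have "(\<lambda>n. e * (1 / real (Suc n))) \<longlonglongrightarrow> 0" by (rule tendsto_mult_right_zero[OF LIMSEQ_Suc[OF lim_1_over_n]])
    from order_tendstoD(2)[OF this d] show "\<forall>\<^sub>F n in sequentially. dist (y n) x < d"
    proof eventually_elim
      case (elim n)
      then show ?case using y(1)[of n] by (simp add: dist_commute)
    qed
  qed
  have tl: "(\<lambda>n. t (y n)) \<longlonglongrightarrow> t x"
    using t_cont open_W x ylim by (intro isCont_tendsto_compose[of x t]) (auto simp: continuous_on_eq_continuous_at)
  have "\<exists>z. is_H g \<rho>0 p (t x) (snd x) z"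
    using W_snd[OF x] W_snd[OF yW] t_nonneg
    by (intro is_H_closed[OF _ _ _ \<epsilon>(1) tl tendsto_snd[OF ylim] _ h]) (auto intro: less_imp_le)
  then show ?thesis using W_snd[OF x] by (auto simp: dom_def)
qed

definition "R x = H_eos g \<rho>0 p (t x) (snd x)"

lemma R_pos: "x \<in> W \<Longrightarrow> R x > 0" and R_Q: "x \<in> W \<Longrightarrow> g * snd x < Q (R x)"
  using dom_H[OF W_dom] by (auto simp: R_def)

definition "t1 x = 2 * (u1 x * u11 x + u2 x * u12 x) / (fst x)\<^sup>2 - 2 * t x / fst x"
definition "t2 x = 2 * (u1 x * u12 x + u2 x * u22 x) / (fst x)\<^sup>2"

lemma t_grad: "grad_on W t t1 t2"
proof -
  have inv: "grad_on W (\<lambda>x. inverse (fst x)) (\<lambda>x. - (inverse (fst x))\<^sup>2 * 1) (\<lambda>x. - (inverse (fst x))\<^sup>2 * 0)"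
    by (rule grad_on_inverse[OF grad_on_fst]) (use W_pos in force)
  note g = grad_on_mult[OF grad_on_mult[OF inv inv] grad_on_add[OF grad_on_mult[OF u1_grad u1_grad] grad_on_mult[OF u2_grad u2_grad]]]
  have "grad_on W (\<lambda>x. inverse (fst x) * inverse (fst x) * (u1 x * u1 x + u2 x * u2 x)) t1 t2"
  proof (rule grad_on_cong[OF g])
    fix x assume "x \<in> W"
    then show "(- (inverse (fst x))\<^sup>2 * 1 * inverse (fst x) + inverse (fst x) * (- (inverse (fst x))\<^sup>2 * 1)) * (u1 x * u1 x + u2 x * u2 x) +
         inverse (fst x) * inverse (fst x) * (u11 x * u1 x + u1 x * u11 x + (u12 x * u2 x + u2 x * u12 x)) = t1 x"
      "(- (inverse (fst x))\<^sup>2 * 0 * inverse (fst x) + inverse (fst x) * (- (inverse (fst x))\<^sup>2 * 0)) * (u1 x * u1 x + u2 x * u2 x) +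
         inverse (fst x) * inverse (fst x) * (u12 x * u1 x + u1 x * u12 x + (u22 x * u2 x + u2 x * u22 x)) = t2 x"
      unfolding t1_def t2_def using W_ne[OF \<open>x \<in> W\<close>] t_W[OF \<open>x \<in> W\<close>] by (simp_all add: field_simps power2_eq_square)
  qed
  moreover have "(\<lambda>x. inverse (fst x) * inverse (fst x) * (u1 x * u1 x + u2 x * u2 x)) x = t x" if "x \<in> W" for x
    using t_W[OF that] by (simp add: divide_inverse power2_eq_square mult_ac)
  ultimately show ?thesis
    unfolding grad_on_def
    by (auto intro: has_derivative_transform_within_open[OF _ open_W])
qed

definition "R1 x = Ht (t x) (snd x) * t1 x"
definition "R2 x = Ht (t x) (snd x) * t2 x + Hs (t x) (snd x)"

lemma pair_compose_derivative:
  assumes k: "((\<lambda>z. k (fst z) (snd z)) has_derivative (\<lambda>v. kt * fst v + ks * snd v)) (at (t x, snd x))" and x: "x \<in> W"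
  shows "((\<lambda>x. k (t x) (snd x)) has_derivative (\<lambda>v. (kt * t1 x) * fst v + (kt * t2 x + ks) * snd v)) (at x)"
proof -
  have "((\<lambda>x. (t x, snd x)) has_derivative (\<lambda>v. (t1 x * fst v + t2 x * snd v, snd v))) (at x)"
    by (intro has_derivative_Pair grad_onD[OF t_grad x] has_derivative_snd has_derivative_ident)
  from has_derivative_compose[OF this k] show ?thesis by (simp add: algebra_simps)
qed

lemma R_grad: "grad_on W R R1 R2"
proof -
  have d: "(R has_derivative (\<lambda>v. R1 x * fst v + R2 x * snd v)) (at x)" if x: "x \<in> W" for x
    using pair_compose_derivative[OF H_has_derivative(1)[OF W_dom[OF x]] x]
    by (simp add: R_def[abs_def] R1_def R2_def)
  then have cR: "continuous_on W R" by (auto intro!: continuous_at_imp_continuous_on has_derivative_continuous)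
  have cQ: "continuous_on W (\<lambda>x. Q (R x))"
    by (rule continuous_on_compose2[OF Q_cont[of "{0<..}"] cR]) (use R_pos in auto)
  have ne: "R x * (Q (R x) - g * snd x) \<noteq> 0" "Q (R x) - g * snd x \<noteq> 0" if "x \<in> W" for x using R_pos[OF that] R_Q[OF that] by auto
  have cHt: "continuous_on W (\<lambda>x. Ht (t x) (snd x))" "continuous_on W (\<lambda>x. Hs (t x) (snd x))"
    unfolding Ht_def Hs_def R_def[symmetric] using ne by (intro continuous_intros cR cQ; force)+
  show ?thesis unfolding grad_on_def
    using d by (auto simp: R1_def[abs_def] R2_def[abs_def] intro!: continuous_intros cHt grad_on_cont[OF t_grad])
qed

definition "E x = \<Phi> (t x) (snd x) - p \<rho>0 / (g * \<rho>0\<^sup>2)"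

lemma E_grad: "grad_on W E (\<lambda>x. t1 x / R x) (\<lambda>x. t2 x / R x + R x / \<rho>0\<^sup>2)"
proof -
  have d: "(E has_derivative (\<lambda>v. (1 / R x * t1 x) * fst v + (1 / R x * t2 x + R x / \<rho>0\<^sup>2) * snd v)) (at x)" if x: "x \<in> W" for x
    using has_derivative_diff[OF pair_compose_derivative[OF \<Phi>_has_derivative[OF W_dom[OF x]] x] has_derivative_const[of "p \<rho>0 / (g * \<rho>0\<^sup>2)"]]
    by (simp add: E_def[abs_def] R_def)
  have "R x \<noteq> 0" if "x \<in> W" for x using R_pos[OF that] by simp
  then show ?thesis unfolding grad_on_def
    using d r0_pos by (auto intro!: continuous_intros grad_on_cont[OF t_grad] grad_on_cont0[OF R_grad])
qed

lemma E_eq: "x \<in> W \<Longrightarrow> F_eos g \<rho>0 p (t x) (snd x) + lambda_eos g \<rho>0 p (snd x) = E x"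
  using F_eq[OF W_dom t_nonneg] lambda_eq[of "snd x"] W_snd[of x] by (simp add: E_def)

lemma d2_eq: "x \<in> W \<Longrightarrow> d2F_eos g \<rho>0 p (t x) (snd x) + deriv (lambda_eos g \<rho>0 p) (snd x) = R x / \<rho>0\<^sup>2"
  using d2F_eq[OF W_dom t_nonneg] deriv_lambda[of "snd x"] W_snd[of x] by (simp add: R_def flip: add_divide_distrib)

end

section \<open>The Euler-Lagrange equation on the positivity set\<close>

lemma compact_support_integrable:
  fixes k :: "'a::euclidean_space \<Rightarrow> real"
  assumes "compact K" "K \<subseteq> V" "continuous_on V k" "\<And>x. x \<in> V \<Longrightarrow> x \<notin> K \<Longrightarrow> k x = 0"
  shows "set_integrable lebesgue V k"
proof -
  have "(\<lambda>x. indicator V x *\<^sub>R k x) = (\<lambda>x. indicator K x *\<^sub>R k x)" using assms by (auto simp: indicator_def fun_eq_iff)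
  then show ?thesis
    using set_integrable_continuous[OF assms(1) continuous_on_subset[OF assms(3,2)]] by (simp add: set_integrable_def)
qed

lemma C1_0_blinfun_compose:
  assumes "C1_0 V \<zeta> D"
  shows "C1_0 V (\<lambda>x. blinfun_apply L (\<zeta> x)) (\<lambda>x. L o\<^sub>L D x)"
  unfolding C1_0_def
proof (intro conjI ballI)
  fix x assume "x \<in> V"
  then have "(\<zeta> has_derivative blinfun_apply (D x)) (at x within V)" using assms by (simp add: C1_0_def)
  from bounded_linear.has_derivative[OF blinfun.bounded_linear_right[of L] this]
  show "((\<lambda>x. blinfun_apply L (\<zeta> x)) has_derivative blinfun_apply (L o\<^sub>L D x)) (at x within V)"
    by (rule has_derivative_eq_rhs) (simp add: fun_eq_iff)
next
  show "continuous_on V (\<lambda>x. L o\<^sub>L D x)" using assms by (auto simp: C1_0_def intro!: continuous_intros)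
  show "\<exists>K. compact K \<and> K \<subseteq> V \<and> (\<forall>x\<in>V - K. blinfun_apply L (\<zeta> x) = 0)"
    using assms unfolding C1_0_def by (metis blinfun.zero_right)
qed

context flow
begin

definition "a x = inverse (fst x * R x)"
definition "A1 x = a x * u1 x"
definition "A2 x = a x * u2 x"

lemma a_eq: "a x = 1 / (fst x * R x)" by (simp add: a_def divide_inverse)

lemma fR_grad: "grad_on W (\<lambda>x. fst x * R x) (\<lambda>x. R x + fst x * R1 x) (\<lambda>x. fst x * R2 x)"
  using grad_on_mult[OF grad_on_fst R_grad] by simp

lemma fR_ne: "x \<in> W \<Longrightarrow> fst x * R x \<noteq> 0" using W_pos[of x] R_pos[of x] by simp

definition "a1 x = - (a x)\<^sup>2 * (R x + fst x * R1 x)"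
definition "a2 x = - (a x)\<^sup>2 * (fst x * R2 x)"

lemma a_grad: "grad_on W a a1 a2"
  using grad_on_inverse[OF fR_grad fR_ne] unfolding a_def[abs_def] a1_def[abs_def] a2_def[abs_def] by simp

lemma A_grad: "grad_on W A1 (\<lambda>x. a1 x * u1 x + a x * u11 x) (\<lambda>x. a2 x * u1 x + a x * u12 x)"
  "grad_on W A2 (\<lambda>x. a1 x * u2 x + a x * u12 x) (\<lambda>x. a2 x * u2 x + a x * u22 x)"
  unfolding A1_def[abs_def] A2_def[abs_def] by (intro grad_on_mult a_grad u1_grad u2_grad)+

definition "divA x = a1 x * u1 x + a x * u11 x + (a2 x * u2 x + a x * u22 x)"

lemma divA_cont: "continuous_on W divA"
  unfolding divA_def[abs_def]
  by (intro continuous_intros grad_on_cont[OF a_grad] grad_on_cont0[OF a_grad] grad_on_cont[OF u_grad] grad_on_cont[OF u1_grad] grad_on_cont[OF u2_grad])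

lemma complete_lebesgue: "complete_measure (lebesgue :: 'a::euclidean_space measure)"
  by unfold_locales

lemma set_integral_AE_lebesgue:
  fixes f k :: "real \<times> real \<Rightarrow> real"
  assumes "continuous_on W k" "AE x in lebesgue. indicator S x * f x = indicator W x * k x"
  shows "(LINT x:S|lebesgue. f x) = (LINT x:W|lebesgue. k x)"
proof -
  have m: "(\<lambda>x. indicat_real W x *\<^sub>R k x) \<in> borel_measurable lebesgue"
    using borel_measurable_continuous_on_indicator[OF borel_open[OF open_W] assms(1)] by (intro measurable_completion) simp
  show ?thesis unfolding set_lebesgue_integral_def
    by (rule complete_measure.integral_AE_eq[OF complete_lebesgue m]) (use assms(2) in simp)
qed

text \<open>Off \<open>W\<close> all integrands vanish because \<open>F (0; s) = 0\<close>.\<close>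

lemma variation_W:
  assumes c: "C1_0 \<Omega> \<phi> D" and bc: "\<And>x. x \<in> \<Omega> \<Longrightarrow> fst x = 0 \<Longrightarrow> fst (\<phi> x) = 0"
    and ae: "AE x in lebesgue. x \<in> \<Omega> \<longrightarrow> Du x = G x \<or> (\<phi> x = 0 \<and> D x = 0)"
  shows "0 = (LINT x:W|lebesgue. fst x * E x * (fst (D x (1, 0)) + snd (D x (0, 1))))
     - 2 * (LINT x:W|lebesgue. a x * ((u1 x, u2 x) \<bullet> D x (u1 x, u2 x)))
     + (LINT x:W|lebesgue. (E x - 2 * t x / R x) * fst (\<phi> x))
     + (LINT x:W|lebesgue. fst x * (R x / \<rho>0\<^sup>2) * snd (\<phi> x))"
proof -
  let ?f1 = "\<lambda>x. fst x * (F_eos g \<rho>0 p (tq Du x) (snd x) + lambda_eos g \<rho>0 p (snd x) * indicator {y. u y > 0} x) * (\<Sum>b\<in>Basis. D x b \<bullet> b)"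
  let ?f2 = "\<lambda>x. d1F_eos g \<rho>0 p (tq Du x) (snd x) * (1 / fst x) * (Du x \<bullet> D x (Du x))"
  let ?f3 = "\<lambda>x. (F_eos g \<rho>0 p (tq Du x) (snd x) - 2 * d1F_eos g \<rho>0 p (tq Du x) (snd x) * tq Du x + lambda_eos g \<rho>0 p (snd x) * indicator {y. u y > 0} x) * fst (\<phi> x)"
  let ?f4 = "\<lambda>x. fst x * (d2F_eos g \<rho>0 p (tq Du x) (snd x) + deriv (lambda_eos g \<rho>0 p) (snd x) * indicator {y. u y > 0} x) * snd (\<phi> x)"
  let ?S = "\<Omega> \<inter> fluid_side"
  have WS: "W \<subseteq> ?S" using W_sub W_fluid by (auto simp: fluid_side_def)
  have iW: "x \<in> \<Omega> \<Longrightarrow> indicator {y. u y > 0} x = (indicator W x :: real)" for x by (auto simp: W_def indicator_def)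
  have tG: "Du x = G x \<Longrightarrow> tq Du x = t x" for x by (simp add: t_def tq_def)
  have t0: "x \<notin> W \<Longrightarrow> t x = 0" for x by (simp add: t_def tq_def G_def)
  have sumB: "(\<Sum>i\<in>Basis. blinfun_apply L i \<bullet> i) = fst (L (1, 0)) + snd (L (0, 1))" for L :: "(real \<times> real) \<Rightarrow>\<^sub>L (real \<times> real)"
  proof -
    have B: "(Basis :: (real \<times> real) set) = {(1, 0), (0, 1)}" by (auto simp: Basis_prod_def)
    show ?thesis unfolding B by (simp add: inner_prod_def)
  qed
  have cph: "continuous_on W \<phi>" "continuous_on W D"
    using c W_sub(2) unfolding C1_0_def
    by (meson continuous_on_subset has_derivative_continuous_on)+
  have Rne: "x \<in> W \<Longrightarrow> R x \<noteq> 0" for x using R_pos[of x] by simp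
  note cont = cph grad_on_cont0[OF E_grad] grad_on_cont0[OF a_grad] grad_on_cont0[OF R_grad] t_cont grad_on_cont[OF u_grad]
  have 1: "(LINT x:?S|lebesgue. ?f1 x)
     = (LINT x:W|lebesgue. fst x * E x * (fst (D x (1, 0)) + snd (D x (0, 1))))"
  proof (rule set_integral_AE_lebesgue)
    show "continuous_on W (\<lambda>x. fst x * E x * (fst (D x (1, 0)) + snd (D x (0, 1))))"
      by (intro continuous_intros cont)
    show "AE x in lebesgue. indicator ?S x * (?f1 x)
      = indicator W x * (fst x * E x * (fst (D x (1, 0)) + snd (D x (0, 1))))"
      using ae
    proof eventually_elim
      case (elim x)
      show ?case
      proof (cases "x \<in> ?S")
        case True
        then have xO: "x \<in> \<Omega>" by simp
        show ?thesis unfolding sumB iW[OF xO]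
          using elim True xO E_eq[of x] t0[of x] by (cases "x \<in> W") (auto simp: tG F_zero)
      qed (use WS in \<open>auto simp: indicator_def\<close>)
    qed
  qed
  have 2: "(LINT x:?S|lebesgue. ?f2 x)
     = (LINT x:W|lebesgue. a x * ((u1 x, u2 x) \<bullet> D x (u1 x, u2 x)))"
  proof (rule set_integral_AE_lebesgue)
    show "continuous_on W (\<lambda>x. a x * ((u1 x, u2 x) \<bullet> D x (u1 x, u2 x)))"
      by (intro continuous_intros cont)
    show "AE x in lebesgue. indicator ?S x * (?f2 x)
      = indicator W x * (a x * ((u1 x, u2 x) \<bullet> D x (u1 x, u2 x)))"
      using ae
    proof eventually_elim
      case (elim x)
      show ?case
      proof (cases "x \<in> ?S")
        case True
        show ?thesis
          using elim True by (cases "x \<in> W") (auto simp: tG d1F_eos_def G_def a_eq R_def[symmetric])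
      qed (use WS in \<open>auto simp: indicator_def\<close>)
    qed
  qed
  have 3: "(LINT x:?S|lebesgue. ?f3 x)
     = (LINT x:W|lebesgue. (E x - 2 * t x / R x) * fst (\<phi> x))"
  proof (rule set_integral_AE_lebesgue)
    show "continuous_on W (\<lambda>x. (E x - 2 * t x / R x) * fst (\<phi> x))"
      using Rne by (intro continuous_intros cont) auto
    show "AE x in lebesgue. indicator ?S x * (?f3 x)
      = indicator W x * ((E x - 2 * t x / R x) * fst (\<phi> x))"
      using ae
    proof eventually_elim
      case (elim x)
      show ?case
      proof (cases "x \<in> ?S")
        case True
        then have xO: "x \<in> \<Omega>" by simp
        show ?thesis unfolding iW[OF xO]
          using elim True xO t0[of x] by (cases "x \<in> W") (auto simp: tG F_zero E_eq[symmetric] d1F_eos_def R_def[symmetric])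
      qed (use WS in \<open>auto simp: indicator_def\<close>)
    qed
  qed
  have 4: "(LINT x:?S|lebesgue. ?f4 x)
     = (LINT x:W|lebesgue. fst x * (R x / \<rho>0\<^sup>2) * snd (\<phi> x))"
  proof (rule set_integral_AE_lebesgue)
    show "continuous_on W (\<lambda>x. fst x * (R x / \<rho>0\<^sup>2) * snd (\<phi> x))"
      using r0_pos by (intro continuous_intros cont) auto
    show "AE x in lebesgue. indicator ?S x * (?f4 x)
      = indicator W x * (fst x * (R x / \<rho>0\<^sup>2) * snd (\<phi> x))"
      using ae
    proof eventually_elim
      case (elim x)
      show ?case
      proof (cases "x \<in> ?S")
        case True
        then have xO: "x \<in> \<Omega>" by simp
        show ?thesis unfolding iW[OF xO]
          using elim True xO t0[of x] by (cases "x \<in> W") (auto simp: tG F_zero d2_eq)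
      qed (use WS in \<open>auto simp: indicator_def\<close>)
    qed
  qed
  show ?thesis
    using variation[OF c bc] unfolding variation_identity_def 1 2 3 4 .
qed

text \<open>Testing with \<open>\<phi> = \<zeta> e\<close> for \<open>\<zeta>\<close> supported in \<open>W\<close> and integrating by parts gives the product of
  \<open>div A\<close> with the gradient of \<open>u\<close> (Noether's identity).\<close>

lemma divA_grad: assumes x: "x \<in> W" shows "divA x * u1 x = 0" "divA x * u2 x = 0"
proof -
  have cdu: "continuous_on W (\<lambda>x. divA x * u1 x)" "continuous_on W (\<lambda>x. divA x * u2 x)"
    by (intro continuous_intros divA_cont grad_on_cont[OF u_grad])+
  have test: "(LINT x:W|lebesgue. (divA x * u1 x) * \<zeta> x) = 0 \<and> (LINT x:W|lebesgue. (divA x * u2 x) * \<zeta> x) = 0" if c: "C1_0 W \<zeta> D" for \<zeta> D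
  proof -
    obtain K where K: "compact K" "K \<subseteq> W" "\<forall>x\<in>W - K. \<zeta> x = 0" using c unfolding C1_0_def by blast
    note gz = C1_0_grad_on[OF c open_W]
    have Dz: "D x = 0" if "x \<in> W" "x \<notin> K" for x by (rule C1_0_deriv_zero[OF c open_W K(1,3) that])
    let ?z = "\<lambda>x. if x \<in> W then \<zeta> x else 0" and ?D = "\<lambda>x. if x \<in> W then D x else 0"
    have cO: "C1_0 \<Omega> ?z ?D" by (rule C1_0_extend[OF c open_W W_sub(2)])
    have var: "0 = (LINT x:W|lebesgue. fst x * E x * (fst e * D x (1, 0) + snd e * D x (0, 1)))
     - 2 * (LINT x:W|lebesgue. a x * ((u1 x * fst e + u2 x * snd e) * (u1 x * D x (1, 0) + u2 x * D x (0, 1))))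
     + (LINT x:W|lebesgue. (E x - 2 * t x / R x) * (fst e * \<zeta> x))
     + (LINT x:W|lebesgue. fst x * (R x / \<rho>0\<^sup>2) * (snd e * \<zeta> x))" for e :: "real \<times> real"
    proof -
      have ae: "AE x in lebesgue. x \<in> \<Omega> \<longrightarrow> Du x = G x \<or> (blinfun_scaleR_left e (?z x) = 0 \<and> (blinfun_scaleR_left e o\<^sub>L ?D x) = 0)"
        using AE_Du_W by eventually_elim auto
      have bc: "fst (blinfun_scaleR_left e (?z x)) = 0" if "x \<in> \<Omega>" "fst x = 0" for x
        using that W_ne[of x] by auto
      have eq: "(LINT x:W|lebesgue. f x) = (LINT x:W|lebesgue. f' x)" if "\<And>x. x \<in> W \<Longrightarrow> f x = f' x" for f f' :: "real \<times> real \<Rightarrow> real"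
        unfolding set_lebesgue_integral_def by (intro Bochner_Integration.integral_cong) (use that in \<open>auto simp: indicator_def\<close>)
      have DD: "D x (u1 x, u2 x) = u1 x * D x (1, 0) + u2 x * D x (0, 1)" for x
        by (subst blinfun_real2) simp
      have e1: "(LINT x:W|lebesgue. fst x * E x * (fst ((blinfun_scaleR_left e o\<^sub>L ?D x) (1, 0)) + snd ((blinfun_scaleR_left e o\<^sub>L ?D x) (0, 1))))
        = (LINT x:W|lebesgue. fst x * E x * (fst e * D x (1, 0) + snd e * D x (0, 1)))"
        by (rule eq) (simp add: mult.commute)
      have e2: "(LINT x:W|lebesgue. a x * ((u1 x, u2 x) \<bullet> (blinfun_scaleR_left e o\<^sub>L ?D x) (u1 x, u2 x)))
        = (LINT x:W|lebesgue. a x * ((u1 x * fst e + u2 x * snd e) * (u1 x * D x (1, 0) + u2 x * D x (0, 1))))"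
        by (rule eq) (simp add: DD inner_prod_def algebra_simps)
      have e3: "(LINT x:W|lebesgue. (E x - 2 * t x / R x) * fst (blinfun_scaleR_left e (?z x))) = (LINT x:W|lebesgue. (E x - 2 * t x / R x) * (fst e * \<zeta> x))"
        by (rule eq) (simp add: mult.commute)
      have e4: "(LINT x:W|lebesgue. fst x * (R x / \<rho>0\<^sup>2) * snd (blinfun_scaleR_left e (?z x))) = (LINT x:W|lebesgue. fst x * (R x / \<rho>0\<^sup>2) * (snd e * \<zeta> x))"
        by (rule eq) (simp add: mult.commute)
      show ?thesis
        using variation_W[OF C1_0_blinfun_compose[OF cO, of "blinfun_scaleR_left e"] bc ae] unfolding e1 e2 e3 e4 .
    qed
    have ii: "set_integrable lebesgue W k" if "continuous_on W k" "\<And>x. x \<in> W \<Longrightarrow> x \<notin> K \<Longrightarrow> k x = 0" for k :: "real \<times> real \<Rightarrow> real"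
      by (rule compact_support_integrable[OF K(1,2) that])
    have Rne: "x \<in> W \<Longrightarrow> R x \<noteq> 0" for x using R_pos[of x] by simp
    note cont = grad_on_cont0[OF E_grad] grad_on_cont0[OF a_grad] grad_on_cont0[OF R_grad] t_cont grad_on_cont[OF u_grad]
       grad_on_cont[OF gz] grad_on_cont0[OF gz] grad_on_cont[OF a_grad] grad_on_cont[OF u1_grad] grad_on_cont[OF u2_grad] grad_on_cont[OF t_grad] divA_cont
    have fE: "grad_on W (\<lambda>x. fst x * E x) (\<lambda>x. E x + fst x * (t1 x / R x)) (\<lambda>x. fst x * (t2 x / R x + R x / \<rho>0\<^sup>2))"
      using grad_on_mult[OF grad_on_fst E_grad] by simp
    note P = grad_on_test[OF open_W fE c]
    note M1 = grad_on_test[OF open_W grad_on_mult[OF A_grad(1) u_grad[THEN grad_on_subset, OF order_refl]] c]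
    note A11 = grad_on_test(1)[OF open_W grad_on_mult[OF A_grad(1) u1_grad] c] and A12 = grad_on_test(1)[OF open_W grad_on_mult[OF A_grad(1) u2_grad] c]
     and A21 = grad_on_test(2)[OF open_W grad_on_mult[OF A_grad(2) u1_grad] c] and A22 = grad_on_test(2)[OF open_W grad_on_mult[OF A_grad(2) u2_grad] c]
    \<comment> \<open>Up to the axis term, \<open>fst x * ti / R\<close> is twice the product of the
      flux \<open>(A1, A2)\<close> with the gradient of \<open>ui\<close>. These terms cancel those
      coming from the integration by parts, and \<open>divA\<close> times \<open>ui\<close> is what
      remains.\<close>
    have t1': "fst x * (t1 x / R x) = 2 * a x * (u1 x * u11 x + u2 x * u12 x) - 2 * t x / R x"
      and t2': "fst x * (t2 x / R x) = 2 * a x * (u1 x * u12 x + u2 x * u22 x)" if "x \<in> W" for x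
      using W_ne[OF that] Rne[OF that] by (simp_all add: t1_def t2_def a_eq field_simps power2_eq_square)
    have s1: "(LINT x:W|lebesgue. a x * ((u1 x * 1 + u2 x * 0) * (u1 x * D x (1, 0) + u2 x * D x (0, 1)))) =
       (LINT x:W|lebesgue. A1 x * u1 x * D x (1, 0)) + (LINT x:W|lebesgue. A2 x * u1 x * D x (0, 1))"
      by (subst set_integral_add(2)[symmetric])
         (auto simp: A1_def A2_def Dz algebra_simps intro!: ii continuous_intros cont)
    have s2: "(LINT x:W|lebesgue. a x * ((u1 x * 0 + u2 x * 1) * (u1 x * D x (1, 0) + u2 x * D x (0, 1)))) =
       (LINT x:W|lebesgue. A1 x * u2 x * D x (1, 0)) + (LINT x:W|lebesgue. A2 x * u2 x * D x (0, 1))"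
      by (subst set_integral_add(2)[symmetric])
         (auto simp: A1_def A2_def Dz algebra_simps intro!: ii continuous_intros cont)
    let ?I = "\<lambda>f. LINT x:W|lebesgue. f x"
    have "(LINT x:W|lebesgue. (divA x * u1 x) * \<zeta> x) = 0"
    proof -
      have "0 = - ?I (\<lambda>x. (E x + fst x * (t1 x / R x)) * \<zeta> x)
        + 2 * (?I (\<lambda>x. ((a1 x * u1 x + a x * u11 x) * u1 x + A1 x * u11 x) * \<zeta> x) + ?I (\<lambda>x. ((a2 x * u2 x + a x * u22 x) * u1 x + A2 x * u12 x) * \<zeta> x))
        + ?I (\<lambda>x. (E x - 2 * t x / R x) * \<zeta> x)"
        using var[of "(1, 0)"] unfolding fst_conv snd_conv s1 P A11 A21 by (simp add: P A11 A21)
      also have "\<dots> = ?I (\<lambda>x. - ((E x + fst x * (t1 x / R x)) * \<zeta> x)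
          + 2 * (((a1 x * u1 x + a x * u11 x) * u1 x + A1 x * u11 x) * \<zeta> x + ((a2 x * u2 x + a x * u22 x) * u1 x + A2 x * u12 x) * \<zeta> x)
          + (E x - 2 * t x / R x) * \<zeta> x)"
        by (subst set_integral_add(2), (auto intro!: ii continuous_intros cont simp: A1_def A2_def K(3) Rne)[2],
            subst set_integral_add(2), (auto intro!: ii continuous_intros cont simp: A1_def A2_def K(3) Rne)[2],
            subst set_integral_uminus, (auto intro!: ii continuous_intros cont simp: A1_def A2_def K(3) Rne)[1],
            subst set_integral_mult_right, subst set_integral_add(2), (auto intro!: ii continuous_intros cont simp: A1_def A2_def K(3) Rne))
      also have "\<dots> = ?I (\<lambda>x. 2 * ((divA x * u1 x) * \<zeta> x))"
        unfolding set_lebesgue_integral_def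
      proof (intro Bochner_Integration.integral_cong refl)
        fix x
        show "indicat_real W x *\<^sub>R (- ((E x + fst x * (t1 x / R x)) * \<zeta> x)
          + 2 * (((a1 x * u1 x + a x * u11 x) * u1 x + A1 x * u11 x) * \<zeta> x + ((a2 x * u2 x + a x * u22 x) * u1 x + A2 x * u12 x) * \<zeta> x)
          + (E x - 2 * t x / R x) * \<zeta> x) = indicat_real W x *\<^sub>R (2 * ((divA x * u1 x) * \<zeta> x))"
        proof (cases "x \<in> W")
          case True
          show ?thesis unfolding t1'[OF True] A1_def A2_def divA_def by (simp add: algebra_simps)
        qed simp
      qed
      finally show ?thesis by simp
    qed
    moreover have "(LINT x:W|lebesgue. (divA x * u2 x) * \<zeta> x) = 0"
    proof -
      have "0 = - ?I (\<lambda>x. (fst x * (t2 x / R x + R x / \<rho>0\<^sup>2)) * \<zeta> x)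
        + 2 * (?I (\<lambda>x. ((a1 x * u1 x + a x * u11 x) * u2 x + A1 x * u12 x) * \<zeta> x) + ?I (\<lambda>x. ((a2 x * u2 x + a x * u22 x) * u2 x + A2 x * u22 x) * \<zeta> x))
        + ?I (\<lambda>x. fst x * (R x / \<rho>0\<^sup>2) * \<zeta> x)"
        using var[of "(0, 1)"] unfolding fst_conv snd_conv s2 P A12 A22 by (simp add: P A12 A22)
      also have "\<dots> = ?I (\<lambda>x. - ((fst x * (t2 x / R x + R x / \<rho>0\<^sup>2)) * \<zeta> x)
          + 2 * (((a1 x * u1 x + a x * u11 x) * u2 x + A1 x * u12 x) * \<zeta> x + ((a2 x * u2 x + a x * u22 x) * u2 x + A2 x * u22 x) * \<zeta> x)
          + fst x * (R x / \<rho>0\<^sup>2) * \<zeta> x)"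
        using r0_pos
        by (subst set_integral_add(2), (auto intro!: ii continuous_intros cont simp: A1_def A2_def K(3) Rne)[2],
            subst set_integral_add(2), (auto intro!: ii continuous_intros cont simp: A1_def A2_def K(3) Rne)[2],
            subst set_integral_uminus, (auto intro!: ii continuous_intros cont simp: A1_def A2_def K(3) Rne)[1],
            subst set_integral_mult_right, subst set_integral_add(2), (auto intro!: ii continuous_intros cont simp: A1_def A2_def K(3) Rne))
      also have "\<dots> = ?I (\<lambda>x. 2 * ((divA x * u2 x) * \<zeta> x))"
        unfolding set_lebesgue_integral_def distrib_left[of "fst x" "t2 x / R x" for x]
      proof (intro Bochner_Integration.integral_cong refl)
        fix x
        show "indicat_real W x *\<^sub>R (- ((fst x * (t2 x / R x) + fst x * (R x / \<rho>0\<^sup>2)) * \<zeta> x)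
          + 2 * (((a1 x * u1 x + a x * u11 x) * u2 x + A1 x * u12 x) * \<zeta> x + ((a2 x * u2 x + a x * u22 x) * u2 x + A2 x * u22 x) * \<zeta> x)
          + fst x * (R x / \<rho>0\<^sup>2) * \<zeta> x) = indicat_real W x *\<^sub>R (2 * ((divA x * u2 x) * \<zeta> x))"
        proof (cases "x \<in> W")
          case True
          show ?thesis unfolding t2'[OF True] A1_def A2_def divA_def by (simp add: algebra_simps)
        qed simp
      qed
      finally show ?thesis by simp
    qed
    ultimately show ?thesis by blast
  qed
  have ae1: "AE x in lebesgue. x \<in> W \<longrightarrow> divA x * u1 x = 0"
    by (rule test_integrals_zero_imp_AE_zero[OF open_W])
       (use test in \<open>auto intro: set_integrable_continuous continuous_on_subset[OF cdu(1)]\<close>)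
  have ae2: "AE x in lebesgue. x \<in> W \<longrightarrow> divA x * u2 x = 0"
    by (rule test_integrals_zero_imp_AE_zero[OF open_W])
       (use test in \<open>auto intro: set_integrable_continuous continuous_on_subset[OF cdu(2)]\<close>)
  show "divA x * u1 x = 0" "divA x * u2 x = 0"
    using AE_zero_imp_zero[OF open_W cdu(1) ae1 x] AE_zero_imp_zero[OF open_W cdu(2) ae2 x] by auto
qed

text \<open>The product with the gradient says nothing at critical points of \<open>u\<close>. But
  if \<open>divA\<close> were nonzero at \<open>x\<close>, it would be so on a ball; there the
  gradient would vanish identically, hence also the second derivatives at \<open>x\<close>, and
  \<open>divA x\<close> would be 0.\<close>

lemma divA_zero: assumes x: "x \<in> W" shows "divA x = 0"
proof (rule ccontr)
  assume ne: "divA x \<noteq> 0"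
  have "open (W \<inter> divA -` (- {0}))" by (rule continuous_open_preimage[OF divA_cont open_W]) auto
  moreover have "x \<in> W \<inter> divA -` (- {0})" using x ne by simp
  ultimately obtain e where e: "e > 0" "ball x e \<subseteq> W \<inter> divA -` (- {0})" using open_contains_ball by blast
  have z: "u1 y = 0 \<and> u2 y = 0" if "y \<in> ball x e" for y
  proof -
    have "y \<in> W" "divA y \<noteq> 0" using that e(2) by auto
    with divA_grad[of y] show ?thesis by simp
  qed
  have g0: "f1 x = 0 \<and> f2 x = 0" if g: "grad_on W f f1 f2" and f0: "\<And>y. y \<in> ball x e \<Longrightarrow> f y = 0" for f f1 f2
  proof -
    have "(f has_derivative (\<lambda>_. 0)) (at x)"
      by (rule has_derivative_transform_within_open[OF has_derivative_const[of 0] open_ball, of _ _ e]) (use e f0 in auto)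
    from has_derivative_unique[OF grad_onD[OF g x] this]
    have "f1 x * fst v + f2 x * snd v = 0" for v :: "real \<times> real" by (rule fun_cong)
    from this[of "(1, 0)"] this[of "(0, 1)"] show ?thesis by simp
  qed
  have "u11 x = 0" "u22 x = 0" using g0[OF u1_grad] g0[OF u2_grad] z by auto
  moreover have "u1 x = 0" "u2 x = 0" using z[of x] e by auto
  ultimately have "divA x = 0" by (simp add: divA_def)
  with ne show False by simp
qed

end

section \<open>Half discs centred on the axis\<close>

locale flow_at = flow +
  fixes b d :: real
  assumes d_pos: "d > 0" and Kd_sub: "cball (0, b) d \<inter> half_plane \<subseteq> \<Omega>"
begin

abbreviation "c \<equiv> (0::real, b)"

section \<open>Growth near the axis and regularity across the free boundary\<close>

definition "Kd = cball c d \<inter> half_plane"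
definition "B = half_disc c d"

lemma closed_half_plane: "closed half_plane"
  unfolding half_plane_def by (intro closed_Collect_le continuous_intros)

lemma compact_Kd: "compact Kd"
  unfolding Kd_def by (intro compact_Int_closed compact_cball closed_half_plane)

lemma convex_Kd: "convex Kd"
proof -
  have "half_plane = {x. (1, 0) \<bullet> x \<ge> 0}" by (auto simp: half_plane_def inner_prod_def)
  then have "convex half_plane" using convex_halfspace_ge[of 0 "(1, 0) :: real \<times> real"] by simp
  then show ?thesis unfolding Kd_def by (intro convex_Int convex_cball)
qed

lemma Kd_Omega: "Kd \<subseteq> \<Omega>" using Kd_sub by (simp add: Kd_def)

lemma open_B: "open B"
  unfolding B_def half_disc_def by (intro open_Int open_ball open_Collect_less continuous_intros)

lemma B_iff: "x \<in> B \<longleftrightarrow> norm (x - c) < d \<and> fst x > 0"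
  unfolding B_def half_disc_def by (simp add: dist_norm norm_minus_commute)

lemma B_Kd: "B \<subseteq> Kd"
  by (auto simp: B_def half_disc_def Kd_def half_plane_def)

lemma B_Omegap: "B \<subseteq> \<Omega>p"
  using B_Kd Kd_Omega by (auto simp: \<Omega>p_def B_iff)

lemma Kd_fst: "x \<in> Kd \<Longrightarrow> 0 \<le> fst x \<and> fst x \<le> d"
proof -
  assume "x \<in> Kd"
  then have "norm (x - c) \<le> d" "0 \<le> fst x" by (auto simp: Kd_def half_plane_def dist_norm norm_minus_commute)
  moreover have "\<bar>fst x\<bar> \<le> norm (x - c)"
  proof (cases x)
    case (Pair p q) then show ?thesis using norm_fst_le[of p "q - b"] by simp
  qed
  ultimately show ?thesis by simp
qed

text \<open>On the compact closed half disc the height attains a maximum, still below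
  \<open>s_star\<close>, and \<open>H_bounds\<close> applies with this single value.\<close>

lemma ex_bounds: "\<exists>z. 0 < fst z \<and> 0 < snd z \<and> (\<forall>x\<in>W \<inter> Kd. t x \<le> snd z \<and> fst z < R x \<and> R x < snd z)"
proof -
  have "c \<in> Kd" using d_pos by (auto simp: Kd_def half_plane_def)
  then obtain z where z: "z \<in> Kd" "\<And>x. x \<in> Kd \<Longrightarrow> snd x \<le> snd z"
    using continuous_attains_sup[OF compact_Kd _ continuous_on_snd[OF continuous_on_id]] by blast
  have "snd z < s_star g \<rho>0 p" using z(1) Kd_Omega \<Omega>_snd by blast
  then obtain c0 C0 where c: "0 < c0"
    "\<And>t s y. 0 \<le> s \<Longrightarrow> s \<le> snd z \<Longrightarrow> 0 \<le> t \<Longrightarrow> is_H g \<rho>0 p t s y \<Longrightarrow> c0 < y \<and> y < C0 \<and> t \<le> C0"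
    using H_bounds[of "snd z"] by blast
  show ?thesis
  proof (intro exI[of _ "(c0, max C0 1)"] conjI ballI)
    fix x assume x: "x \<in> W \<inter> Kd"
    have "c0 < R x \<and> R x < C0 \<and> t x \<le> C0"
      using x z(2)[of x] W_snd[of x] t_nonneg dom_H(1)[OF W_dom[of x]] by (intro c(2)[of "snd x"]) (auto simp: R_def)
    then show "t x \<le> snd (c0, max C0 1)" "fst (c0, max C0 1) < R x" "R x < snd (c0, max C0 1)" by auto
  qed (use c in auto)
qed

definition "bnds = (SOME z. 0 < fst z \<and> 0 < snd z \<and> (\<forall>x\<in>W \<inter> Kd. t x \<le> snd z \<and> fst z < R x \<and> R x < snd z))"
definition "c0 = fst bnds"
definition "C0 = snd bnds"
definition "L0 = sqrt C0"

lemma c0_pos: "c0 > 0" and C0_pos: "C0 > 0"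
  and bounds: "x \<in> W \<Longrightarrow> x \<in> Kd \<Longrightarrow> t x \<le> C0 \<and> c0 < R x \<and> R x < C0"
  using someI_ex[OF ex_bounds] unfolding bnds_def[symmetric] c0_def C0_def by auto

lemma L0_nonneg: "L0 \<ge> 0" using C0_pos by (simp add: L0_def)

lemma G_bound: assumes "x \<in> Kd" shows "norm (G x) \<le> L0 * fst x"
proof (cases "x \<in> W")
  case True
  have "(norm (G x))\<^sup>2 = t x * (fst x)\<^sup>2" using W_ne[OF True] by (simp add: t_def tq_def)
  also have "\<dots> \<le> C0 * (fst x)\<^sup>2" using bounds[OF True assms] by (intro mult_right_mono) auto
  also have "\<dots> = (L0 * fst x)\<^sup>2" using C0_pos by (simp add: L0_def power_mult_distrib)
  finally have "(norm (G x))\<^sup>2 \<le> (L0 * fst x)\<^sup>2" .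
  then show ?thesis by (rule power2_le_imp_le) (use L0_nonneg Kd_fst[OF assms] in simp)
next
  case False
  then show ?thesis using L0_nonneg Kd_fst[OF assms] by (simp add: G_def)
qed

definition "G1 x = fst (G x)"
definition "G2 x = snd (G x)"

lemma G12_W: "x \<in> W \<Longrightarrow> G1 x = u1 x" "x \<in> W \<Longrightarrow> G2 x = u2 x" "x \<notin> W \<Longrightarrow> G1 x = 0" "x \<notin> W \<Longrightarrow> G2 x = 0"
  by (auto simp: G1_def G2_def G_def)

lemma G12_bound: "x \<in> Kd \<Longrightarrow> \<bar>G1 x\<bar> \<le> L0 * fst x" "x \<in> Kd \<Longrightarrow> \<bar>G2 x\<bar> \<le> L0 * fst x"
  using G_bound[of x] norm_fst_le[of "G1 x" "G2 x"] norm_snd_le[of "G2 x" "G1 x"] by (auto simp: G1_def G2_def)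

lemma G_inner_bound: "x \<in> Kd \<Longrightarrow> \<bar>G x \<bullet> v\<bar> \<le> L0 * fst x * norm v"
  using Cauchy_Schwarz_ineq2[of "G x" v] mult_right_mono[OF G_bound[of x] norm_ge_zero[of v]] by linarith

text \<open>Along a segment in the convex set \<open>Kd\<close> the function \<open>u\<close> is
  differentiable only where it is positive, as \<open>nonneg_lipschitz\<close> requires. The
  constant keeps the bound \<open>m\<close> for the distance to the axis; comparing with the axis
  point at the same height then gives the quadratic growth of \<open>u\<close>.\<close>

lemma u_lip:
  assumes x: "x \<in> Kd" and y: "y \<in> Kd" and m: "fst x \<le> m" "fst y \<le> m"
  shows "\<bar>u y - u x\<bar> \<le> L0 * m * norm (y - x)"
proof -
  define P where "P s = x + s *\<^sub>R (y - x)" for s :: real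
  have PK: "P s \<in> Kd" if "s \<in> {0..1}" for s
  proof -
    have "P s = (1 - s) *\<^sub>R x + s *\<^sub>R y" by (simp add: P_def algebra_simps)
    then show ?thesis using convexD[OF convex_Kd x y, of "1 - s" s] that by simp
  qed
  have Pm: "fst (P s) \<le> m" if "s \<in> {0..1}" for s
  proof -
    have "fst (P s) = (1 - s) * fst x + s * fst y" by (simp add: P_def algebra_simps)
    also have "\<dots> \<le> (1 - s) * m + s * m" using that m by (intro add_mono mult_left_mono) auto
    finally show ?thesis by (simp add: algebra_simps)
  qed
  have m0: "0 \<le> m" using Kd_fst[OF x] m by simp
  have "\<bar>u (P 1) - u (P 0)\<bar> \<le> L0 * m * norm (y - x) * (1 - 0)"
  proof (rule nonneg_lipschitz[where v'="\<lambda>s. G (P s) \<bullet> (y - x)"])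
    show "continuous_on {0..1} (\<lambda>s. u (P s))"
      using PK Kd_Omega by (intro continuous_on_compose2[OF u_cont]) (auto simp: P_def intro!: continuous_intros)
    show "0 \<le> u (P s)" if "s \<in> {0..1}" for s using u_nonneg PK[OF that] Kd_Omega by blast
    show "0 \<le> L0 * m * norm (y - x)" using L0_nonneg m0 by simp
    fix s :: real assume s: "0 < s" "s < 1" "0 < u (P s)"
    then have sI: "s \<in> {0..1}" by simp
    have PW: "P s \<in> W" using s PK[OF sI] Kd_Omega by (auto simp: W_def)
    have "(P has_derivative (\<lambda>h. h *\<^sub>R (y - x))) (at s)" unfolding P_def by (auto intro!: derivative_eq_intros)
    from has_derivative_compose[OF this grad_onD[OF u_grad PW]]
    have "((\<lambda>s. u (P s)) has_real_derivative G (P s) \<bullet> (y - x)) (at s)"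
      unfolding has_field_derivative_def
      by (rule has_derivative_eq_rhs) (use PW in \<open>simp add: fun_eq_iff G_def inner_prod_def algebra_simps\<close>)
    moreover have "\<bar>G (P s) \<bullet> (y - x)\<bar> \<le> L0 * m * norm (y - x)"
      using Pm[OF sI] L0_nonneg
      by (intro order_trans[OF G_inner_bound[OF PK[OF sI]]] mult_right_mono mult_left_mono) auto
    ultimately show "((\<lambda>s. u (P s)) has_real_derivative G (P s) \<bullet> (y - x)) (at s) \<and> \<bar>G (P s) \<bullet> (y - x)\<bar> \<le> L0 * m * norm (y - x)" ..
  qed simp
  then show ?thesis by (simp add: P_def)
qed

lemma u_bound: assumes x: "x \<in> Kd" shows "0 \<le> u x" "u x \<le> L0 * (fst x)\<^sup>2"
proof -
  show "0 \<le> u x" using u_nonneg x Kd_Omega by blast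
  let ?y = "(0, snd x)"
  have "dist c ?y \<le> dist c x" using dist_snd_le[of c x] by (simp add: dist_Pair_Pair)
  then have yK: "?y \<in> Kd" using x by (auto simp: Kd_def half_plane_def)
  have "u ?y = 0" using u_axis[of ?y] yK Kd_Omega by auto
  moreover have "\<bar>u x - u ?y\<bar> \<le> L0 * fst x * norm (x - ?y)"
    using Kd_fst[OF x] by (intro u_lip[OF yK x]) auto
  moreover have "norm (x - ?y) = fst x" using Kd_fst[OF x] by (cases x) simp
  ultimately show "u x \<le> L0 * (fst x)\<^sup>2" by (simp add: power2_eq_square mult.assoc)
qed

lemma u_lip_B: "x \<in> Kd \<Longrightarrow> y \<in> Kd \<Longrightarrow> \<bar>u y - u x\<bar> \<le> L0 * d * norm (y - x)"
  using u_lip[of x y d] Kd_fst by auto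

text \<open>The gradient component may jump at the free boundary, but it stays bounded and is
  multiplied by \<open>u\<close>, which is Lipschitz and vanishes there.\<close>

lemma uG_continuous:
  assumes cW: "continuous_on W Gi" and bd: "\<And>y. y \<in> Kd \<Longrightarrow> \<bar>Gi y\<bar> \<le> L0 * fst y"
  shows "continuous_on B (\<lambda>x. 2 * u x * Gi x)"
proof -
  have "isCont (\<lambda>x. 2 * u x * Gi x) x" if x: "x \<in> B" for x
  proof (cases "x \<in> W")
    case True
    have "continuous_on W (\<lambda>x. 2 * u x * Gi x)" by (intro continuous_intros cW grad_on_cont0[OF u_grad])
    with True open_W show ?thesis by (simp add: continuous_on_eq_continuous_at)
  next
    case False
    have xK: "x \<in> Kd" using x B_Kd by blast
    then have u0: "u x = 0" using False u_bound(1)[OF xK] Kd_Omega by (auto simp: W_def)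
    have "((\<lambda>y. 2 * u y * Gi y) \<longlongrightarrow> 0) (at x)"
    proof (rule Lim_null_comparison)
      have "\<forall>\<^sub>F y in at x. y \<in> B" using eventually_at_in_open'[OF open_B x] .
      then show "\<forall>\<^sub>F y in at x. norm (2 * u y * Gi y) \<le> 2 * (L0 * d * norm (y - x)) * (L0 * d)"
      proof eventually_elim
        case (elim y)
        then have yK: "y \<in> Kd" using B_Kd by blast
        have "\<bar>u y\<bar> \<le> L0 * d * norm (y - x)" using u_lip_B[OF xK yK] u0 by simp
        moreover have "\<bar>Gi y\<bar> \<le> L0 * d" using bd[OF yK] Kd_fst[OF yK] L0_nonneg by (meson mult_left_mono order_trans)
        ultimately show ?case unfolding abs_mult real_norm_def
          using L0_nonneg d_pos by (intro mult_mono) auto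
      qed
      show "((\<lambda>y. 2 * (L0 * d * norm (y - x)) * (L0 * d)) \<longlongrightarrow> 0) (at x)"
        by (rule tendsto_eq_intros refl)+ auto
    qed
    then show ?thesis using u0 by (simp add: isCont_def)
  qed
  then show ?thesis by (intro continuous_at_imp_continuous_on) blast
qed

lemma G12_cont: "continuous_on W G1" "continuous_on W G2"
  using grad_on_cont[OF u_grad] G12_W by (auto cong: continuous_on_cong)

text \<open>At a zero of \<open>u\<close> the Lipschitz bound makes \<open>u^2\<close> quadratically
  small, so its derivative exists and is 0. This C^1 function replaces \<open>u\<close> wherever
  derivatives across the free boundary are taken.\<close>

lemma usq_grad: "grad_on B (\<lambda>x. (u x)\<^sup>2) (\<lambda>x. 2 * u x * G1 x) (\<lambda>x. 2 * u x * G2 x)"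
  unfolding grad_on_def
proof (intro conjI ballI)
  fix x assume x: "x \<in> B"
  show "((\<lambda>x. (u x)\<^sup>2) has_derivative (\<lambda>v. 2 * u x * G1 x * fst v + 2 * u x * G2 x * snd v)) (at x)"
  proof (cases "x \<in> W")
    case True
    show ?thesis using grad_onD[OF grad_on_mult[OF u_grad u_grad] True] G12_W(1,2)[OF True]
      by (simp add: power2_eq_square algebra_simps)
  next
    case False
    have xK: "x \<in> Kd" using x B_Kd by blast
    then have u0: "u x = 0" using False u_bound(1)[OF xK] Kd_Omega by (auto simp: W_def)
    obtain e where e: "e > 0" "ball x e \<subseteq> B" using open_B x open_contains_ball by blast
    have "((\<lambda>x. (u x)\<^sup>2) has_derivative (\<lambda>v. 0)) (at x)"
    proof (rule has_derivativeI_sandwich[OF e(1)])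
      fix y assume y: "y \<noteq> x" "dist y x < e"
      then have yK: "y \<in> Kd" using e(2) B_Kd by (auto simp: dist_commute)
      have "(u y)\<^sup>2 \<le> (L0 * d * norm (y - x))\<^sup>2"
        using u_lip_B[OF xK yK] u0 u_bound(1)[OF yK] by (intro power_mono) auto
      then show "norm ((u y)\<^sup>2 - (u x)\<^sup>2 - 0) / norm (y - x) \<le> (L0 * d)\<^sup>2 * norm (y - x)"
        using y(1) u0 by (simp add: divide_le_eq power2_eq_square mult_ac)
    next
      show "((\<lambda>y. (L0 * d)\<^sup>2 * norm (y - x)) \<longlongrightarrow> 0) (at x)"
        by (rule tendsto_eq_intros refl)+ auto
    qed simp
    then show ?thesis using u0 by simp
  qed
next
  show "continuous_on B (\<lambda>x. 2 * u x * G1 x)" by (rule uG_continuous[OF G12_cont(1) G12_bound(1)])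
  show "continuous_on B (\<lambda>x. 2 * u x * G2 x)" by (rule uG_continuous[OF G12_cont(2) G12_bound(2)])
qed

lemma W_borel [measurable]: "W \<in> sets borel" and B_borel [measurable]: "B \<in> sets borel"
  using open_W open_B by auto

lemma W_fun_borel:
  fixes k :: "real \<times> real \<Rightarrow> real"
  assumes "continuous_on W k" shows "(\<lambda>x. indicator (W \<inter> B) x * k x) \<in> borel_measurable borel"
proof -
  have "continuous_on (W \<inter> B) k" by (rule continuous_on_subset[OF assms]) auto
  from borel_measurable_continuous_on_indicator[OF _ this] show ?thesis by simp
qed

lemma G12_borel [measurable]: "G1 \<in> borel_measurable borel" "G2 \<in> borel_measurable borel"
proof -
  have "(\<lambda>x. indicator W x *\<^sub>R G1 x) \<in> borel_measurable borel" "(\<lambda>x. indicator W x *\<^sub>R G2 x) \<in> borel_measurable borel"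
    by (intro borel_measurable_continuous_on_indicator G12_cont W_borel)+
  moreover have "(\<lambda>x. indicator W x *\<^sub>R G1 x) = G1" "(\<lambda>x. indicator W x *\<^sub>R G2 x) = G2"
    using G12_W(3,4) by (auto simp: indicator_def fun_eq_iff)
  ultimately show "G1 \<in> borel_measurable borel" "G2 \<in> borel_measurable borel" by simp_all
qed

text \<open>\<open>sqrt (u^2 + s)\<close> is a C^1 function on \<open>B\<close>, free boundary
  included, and satisfies the classical integration by parts. As \<open>s\<close> tends to 0 it
  tends to \<open>u\<close>, and its derivatives tend to \<open>Gi\<close> boundedly, so
  \<open>Gi\<close> is the weak derivative.\<close>

lemma AE_Du_component:
  assumes e: "e \<in> Basis" and Gm: "Gi \<in> borel_measurable borel" and Gb: "\<And>y. y \<in> Kd \<Longrightarrow> \<bar>Gi y\<bar> \<le> L0 * fst y"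
    and G0: "\<And>y. y \<notin> W \<Longrightarrow> Gi y = 0"
    and test: "\<And>\<phi> D s. s > 0 \<Longrightarrow> C1_0 B \<phi> D \<Longrightarrow> (LINT x:B|lebesgue. sqrt ((u x)\<^sup>2 + s) * D x e) =
       - (LINT x:B|lebesgue. inverse (2 * sqrt ((u x)\<^sup>2 + s)) * (2 * u x * Gi x) * \<phi> x)"
  shows "AE x in lebesgue. x \<in> B \<longrightarrow> Du x \<bullet> e = Gi x"
proof (rule weak_gradient_unique[OF has_weak_grad e open_B B_Omegap])
  have Gb': "\<bar>Gi y\<bar> \<le> L0 * d" if "y \<in> B" for y
  proof -
    have yK: "y \<in> Kd" using that B_Kd by blast
    show ?thesis using Gb[OF yK] Kd_fst[OF yK] L0_nonneg by (meson mult_left_mono order_trans)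
  qed
  show "set_integrable lebesgue K Gi" if K: "compact K" "K \<subseteq> B" for K
    unfolding set_integrable_def
  proof (rule Bochner_Integration.integrable_bound[where f="\<lambda>x. indicator K x *\<^sub>R (L0 * d)"])
    show "integrable lebesgue (\<lambda>x. indicator K x *\<^sub>R (L0 * d))"
      using set_integrable_continuous[OF K(1), of "\<lambda>_. L0 * d"] by (simp add: set_integrable_def)
    show "(\<lambda>x. indicator K x *\<^sub>R Gi x) \<in> borel_measurable lebesgue"
      using borel_compact[OF K(1)] Gm by (intro measurable_completion borel_measurable_scaleR borel_measurable_indicator) simp_all
    show "AE x in lebesgue. norm (indicator K x *\<^sub>R Gi x) \<le> norm (indicator K x *\<^sub>R (L0 * d))"
      using Gb' K L0_nonneg d_pos by (intro always_eventually allI) (auto simp: indicator_def)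
  qed
  fix \<phi> :: "real \<times> real \<Rightarrow> real" and D assume cB: "C1_0 B \<phi> D"
  obtain K where K: "compact K" "K \<subseteq> B" "\<forall>x\<in>B - K. \<phi> x = 0" using cB unfolding C1_0_def by blast
  note gp = C1_0_grad_on[OF cB open_B]
  have Dz: "D x = 0" if "x \<in> B" "x \<notin> K" for x by (rule C1_0_deriv_zero[OF cB open_B K(1,3) that])
  have cu: "continuous_on B u" by (rule continuous_on_subset[OF u_cont]) (use B_Kd Kd_Omega in blast)
  have cD: "continuous_on B D" using cB by (simp add: C1_0_def)
  have i1: "set_integrable lebesgue B (\<lambda>x. (u x + 1) * \<bar>D x e\<bar>)"
    by (rule compact_support_integrable[OF K(1,2)]) (auto intro!: continuous_intros cu cD simp: Dz)
  have i2: "set_integrable lebesgue B (\<lambda>x. L0 * d * \<bar>\<phi> x\<bar>)"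
    by (rule compact_support_integrable[OF K(1,2)]) (auto intro!: continuous_intros grad_on_cont0[OF gp] simp: K(3))
  have mB: "(\<lambda>x. indicator B x *\<^sub>R k x) \<in> borel_measurable lebesgue" if "continuous_on B k" for k :: "real \<times> real \<Rightarrow> real"
    using borel_measurable_continuous_on_indicator[OF B_borel that] by (intro measurable_completion) simp
  have gm: "Gi \<in> borel_measurable lebesgue" using Gm by (intro measurable_completion) simp
  let ?s = "\<lambda>n. 1 / real (Suc n)"
  let ?h = "\<lambda>n x. inverse (2 * sqrt ((u x)\<^sup>2 + ?s n)) * (2 * u x * Gi x) * \<phi> x"
  have unn: "x \<in> B \<Longrightarrow> u x \<ge> 0" for x using u_bound(1) B_Kd by blast
  have sl: "(\<lambda>n. sqrt ((u x)\<^sup>2 + ?s n)) \<longlonglongrightarrow> sqrt ((u x)\<^sup>2 + 0)" for x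
    by (intro tendsto_intros LIMSEQ_Suc[OF lim_1_over_n])
  have sq: "(u x)\<^sup>2 + ?s n > 0" for x n by (simp add: add_nonneg_pos)
  have "(\<lambda>n. LINT x|lebesgue. indicator B x *\<^sub>R (sqrt ((u x)\<^sup>2 + ?s n) * D x e)) \<longlonglongrightarrow> (LINT x|lebesgue. indicator B x *\<^sub>R (u x * D x e))"
  \<comment> \<open>The values \<open>s = 1 / Suc n\<close> are at most 1, so
    \<open>sqrt (u^2 + s)\<close> is at most \<open>u + 1\<close>.\<close>
  proof (rule integral_dominated_convergence[where w="\<lambda>x. indicator B x *\<^sub>R ((u x + 1) * \<bar>D x e\<bar>)"])
    show "AE x in lebesgue. (\<lambda>n. indicator B x *\<^sub>R (sqrt ((u x)\<^sup>2 + ?s n) * D x e)) \<longlonglongrightarrow> indicator B x *\<^sub>R (u x * D x e)"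
    proof (intro always_eventually allI)
      fix x
      show "(\<lambda>n. indicator B x *\<^sub>R (sqrt ((u x)\<^sup>2 + ?s n) * D x e)) \<longlonglongrightarrow> indicator B x *\<^sub>R (u x * D x e)"
        using tendsto_mult[OF sl[of x] tendsto_const[of "D x e"]] unn[of x] by (cases "x \<in> B") auto
    qed
    show "AE x in lebesgue. norm (indicator B x *\<^sub>R (sqrt ((u x)\<^sup>2 + ?s n) * D x e)) \<le> indicator B x *\<^sub>R ((u x + 1) * \<bar>D x e\<bar>)" for n
    proof (intro always_eventually allI)
      fix x
      show "norm (indicator B x *\<^sub>R (sqrt ((u x)\<^sup>2 + ?s n) * D x e)) \<le> indicator B x *\<^sub>R ((u x + 1) * \<bar>D x e\<bar>)"
      proof (cases "x \<in> B")
        case True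
        have "(u x)\<^sup>2 + ?s n \<le> (u x + 1)\<^sup>2" using unn[OF True] by (simp add: power2_eq_square algebra_simps divide_le_eq)
        then have "sqrt ((u x)\<^sup>2 + ?s n) \<le> u x + 1" using unn[OF True] by (intro real_le_lsqrt) auto
        then show ?thesis using True sq[of x n] by (simp add: abs_mult mult_right_mono)
      qed simp
    qed
    show "(\<lambda>x. indicator B x *\<^sub>R (u x * D x e)) \<in> borel_measurable lebesgue"
      "(\<lambda>x. indicator B x *\<^sub>R (sqrt ((u x)\<^sup>2 + ?s n) * D x e)) \<in> borel_measurable lebesgue" for n
      by (rule mB, intro continuous_intros cu cD)+
    show "integrable lebesgue (\<lambda>x. indicator B x *\<^sub>R ((u x + 1) * \<bar>D x e\<bar>))" using i1 by (simp only: set_integrable_def)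
  qed
  moreover have "(\<lambda>n. LINT x|lebesgue. indicator B x *\<^sub>R (?h n x)) \<longlonglongrightarrow> (LINT x|lebesgue. indicator B x *\<^sub>R (Gi x * \<phi> x))"
  proof (rule integral_dominated_convergence[where w="\<lambda>x. indicator B x *\<^sub>R (L0 * d * \<bar>\<phi> x\<bar>)"])
    show "AE x in lebesgue. (\<lambda>n. indicator B x *\<^sub>R (?h n x)) \<longlonglongrightarrow> indicator B x *\<^sub>R (Gi x * \<phi> x)"
    proof (intro always_eventually allI)
      fix x
      show "(\<lambda>n. indicator B x *\<^sub>R (?h n x)) \<longlonglongrightarrow> indicator B x *\<^sub>R (Gi x * \<phi> x)"
      proof (cases "x \<in> B \<and> x \<in> W")
        case True
        then have up: "u x > 0" by (simp add: W_u)
        have "(\<lambda>n. ?h n x) \<longlonglongrightarrow> inverse (2 * sqrt ((u x)\<^sup>2 + 0)) * (2 * u x * Gi x) * \<phi> x"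
          using up by (intro tendsto_intros LIMSEQ_Suc[OF lim_1_over_n]) auto
        also have "inverse (2 * sqrt ((u x)\<^sup>2 + 0)) * (2 * u x * Gi x) * \<phi> x = Gi x * \<phi> x" using up by simp
        finally show ?thesis using True by simp
      qed (auto simp: G0)
    qed
    show "AE x in lebesgue. norm (indicator B x *\<^sub>R (?h n x)) \<le> indicator B x *\<^sub>R (L0 * d * \<bar>\<phi> x\<bar>)" for n
    proof (intro always_eventually allI)
      fix x
      show "norm (indicator B x *\<^sub>R (?h n x)) \<le> indicator B x *\<^sub>R (L0 * d * \<bar>\<phi> x\<bar>)"
      proof (cases "x \<in> B")
        case True
        have "u x \<le> sqrt ((u x)\<^sup>2 + ?s n)" by (rule real_le_rsqrt) simp
        then have "u x / sqrt ((u x)\<^sup>2 + ?s n) \<le> 1" using sq[of x n] by (simp add: divide_le_eq)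
        then have "u x / sqrt ((u x)\<^sup>2 + ?s n) * \<bar>Gi x\<bar> \<le> 1 * (L0 * d)"
          using unn[OF True] Gb'[OF True] sq[of x n] by (intro mult_mono) auto
        from mult_right_mono[OF this abs_ge_zero[of "\<phi> x"]]
        have le: "u x / sqrt ((u x)\<^sup>2 + ?s n) * \<bar>Gi x\<bar> * \<bar>\<phi> x\<bar> \<le> L0 * d * \<bar>\<phi> x\<bar>"
          by (simp only: mult_1)
        have "inverse (2 * S) * (2 * u x * Gi x) * \<phi> x = u x / S * (Gi x * \<phi> x)" for S
          by (cases "S = 0") (simp_all add: field_simps)
        then have "?h n x = u x / sqrt ((u x)\<^sup>2 + ?s n) * (Gi x * \<phi> x)" .
        also have "\<bar>\<dots>\<bar> = u x / sqrt ((u x)\<^sup>2 + ?s n) * \<bar>Gi x\<bar> * \<bar>\<phi> x\<bar>"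
          unfolding abs_mult using unn[OF True] sq[of x n] by (simp only: abs_divide abs_of_nonneg real_sqrt_ge_zero less_imp_le mult.assoc)
        finally show ?thesis unfolding real_norm_def using True le by (simp only: indicator_simps real_scaleR_def mult_1)
      qed simp
    qed
    show "(\<lambda>x. indicator B x *\<^sub>R (?h n x)) \<in> borel_measurable lebesgue" for n
    proof -
      have "continuous_on B (\<lambda>x. inverse (2 * sqrt ((u x)\<^sup>2 + ?s n)) * (2 * u x) * \<phi> x)"
        using sq less_imp_neq by (intro continuous_intros cu grad_on_cont0[OF gp]) (force dest: less_imp_neq)
      from borel_measurable_times[OF mB[OF this] gm] show ?thesis by (simp add: mult_ac)
    qed
    show "(\<lambda>x. indicator B x *\<^sub>R (Gi x * \<phi> x)) \<in> borel_measurable lebesgue"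
      using borel_measurable_times[OF mB[OF grad_on_cont0[OF gp]] gm] by (simp add: mult_ac)
  qed (use i2 in \<open>auto simp: set_integrable_def\<close>)
  then have "(\<lambda>n. - (LINT x|lebesgue. indicator B x *\<^sub>R (?h n x))) \<longlonglongrightarrow> - (LINT x|lebesgue. indicator B x *\<^sub>R (Gi x * \<phi> x))"
    by (rule tendsto_minus)
  moreover have "(LINT x|lebesgue. indicator B x *\<^sub>R (sqrt ((u x)\<^sup>2 + ?s n) * D x e)) = - (LINT x|lebesgue. indicator B x *\<^sub>R (?h n x))" for n
    using test[OF _ cB, of "?s n"] by (simp add: set_lebesgue_integral_def)
  ultimately show "(LINT x:B|lebesgue. u x * D x e) = - (LINT x:B|lebesgue. Gi x * \<phi> x)"
    unfolding set_lebesgue_integral_def using LIMSEQ_unique by simp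
qed

lemma AE_Du_B: "AE x in lebesgue. x \<in> B \<longrightarrow> Du x = G x"
proof -
  have nn: "x \<in> B \<Longrightarrow> (u x)\<^sup>2 \<ge> 0" for x by simp
  have "AE x in lebesgue. x \<in> B \<longrightarrow> Du x \<bullet> (1, 0) = G1 x"
    by (rule AE_Du_component[OF Basis_real2(1) G12_borel(1)])
       (erule G12_bound(1), erule G12_W(3), rule grad_on_test(1)[OF open_B grad_on_sqrt_shift[OF usq_grad]], simp_all)
  moreover have "AE x in lebesgue. x \<in> B \<longrightarrow> Du x \<bullet> (0, 1) = G2 x"
    by (rule AE_Du_component[OF Basis_real2(2) G12_borel(2)])
       (erule G12_bound(2), erule G12_W(4), rule grad_on_test(2)[OF open_B grad_on_sqrt_shift[OF usq_grad]], simp_all)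
  ultimately show ?thesis
    by eventually_elim (auto simp: G1_def G2_def inner_prod_def prod_eq_iff)
qed


section \<open>Integrands on the half disc and the radial cutoff\<close>

definition "ext k x = indicator (W \<inter> B) x * k x" for k :: "real \<times> real \<Rightarrow> real"

lemma ext_simps [simp]: "x \<in> W \<Longrightarrow> x \<in> B \<Longrightarrow> ext k x = k x" "x \<notin> W \<Longrightarrow> ext k x = 0" "x \<notin> B \<Longrightarrow> ext k x = 0"
  by (auto simp: ext_def)

lemma ext_mult: "f x * ext k x = ext (\<lambda>x. f x * k x) x"
  by (simp add: ext_def)

lemma ext_borel: "continuous_on W k \<Longrightarrow> ext k \<in> borel_measurable borel"
  using W_fun_borel[of k] by (simp add: ext_def[abs_def])

text \<open>Bounded Borel functions supported in the half disc. The half disc is spelled out in the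
  form required by \<open>AE_radial_limits\<close>.\<close>

definition "good C f \<longleftrightarrow> 0 \<le> C \<and> f \<in> borel_measurable borel \<and> (\<forall>x. \<bar>f x\<bar> \<le> C * indicator {x. fst x > 0 \<and> norm (x - c) < d} x)"
  for f :: "real \<times> real \<Rightarrow> real"

lemma B_eq: "B = {x. fst x > 0 \<and> norm (x - c) < d}"
  using B_iff by auto

lemma goodI:
  assumes "0 \<le> C" "f \<in> borel_measurable borel" "\<And>x. x \<in> B \<Longrightarrow> \<bar>f x\<bar> \<le> C" "\<And>x. x \<notin> B \<Longrightarrow> f x = 0"
  shows "good C f"
  unfolding good_def B_eq[symmetric]
proof (intro conjI assms(1,2) allI)
  fix x show "\<bar>f x\<bar> \<le> C * indicator B x" using assms(3,4)[of x] by (cases "x \<in> B") auto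
qed

lemma goodD:
  assumes "good C f"
  shows "0 \<le> C" "f \<in> borel_measurable borel" "\<bar>f x\<bar> \<le> C * indicator {x. fst x > 0 \<and> norm (x - c) < d} x"
    "\<bar>f x\<bar> \<le> C" "x \<notin> B \<Longrightarrow> f x = 0"
proof -
  show *: "0 \<le> C" "f \<in> borel_measurable borel" "\<bar>f x\<bar> \<le> C * indicator {x. fst x > 0 \<and> norm (x - c) < d} x"
    using assms unfolding good_def by blast+
  show "\<bar>f x\<bar> \<le> C" using order_trans[OF *(3), of C] *(1) by (simp add: indicator_def)
  show "x \<notin> B \<Longrightarrow> f x = 0" using *(3) by (simp add: B_eq[symmetric])
qed

lemma good_ext:
  assumes "continuous_on W k" "0 \<le> C" "\<And>x. x \<in> W \<Longrightarrow> x \<in> B \<Longrightarrow> \<bar>k x\<bar> \<le> C"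
  shows "good C (ext k)"
proof (rule goodI[OF assms(2) ext_borel[OF assms(1)]])
  fix x assume "x \<in> B" then show "\<bar>ext k x\<bar> \<le> C" using assms(2) assms(3)[of x] by (cases "x \<in> W") auto
qed simp

lemma good_mult:
  assumes f: "good C f" and k: "k \<in> borel_measurable borel" "\<And>x. x \<in> B \<Longrightarrow> \<bar>k x\<bar> \<le> C'" "0 \<le> C'"
  shows "good (C' * C) (\<lambda>x. k x * f x)"
proof (rule goodI)
  fix x assume "x \<in> B"
  then show "\<bar>k x * f x\<bar> \<le> C' * C" unfolding abs_mult using k goodD(4)[OF f] by (intro mult_mono) auto
qed (use k goodD[OF f] in auto)

lemma finite_B: "emeasure lborel B < \<infinity>"
  using emeasure_mono[of B "ball c d" lborel] emeasure_lborel_ball_finite[of c d]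
  by (auto simp: B_def half_disc_def)

lemma good_integrable: "good C f \<Longrightarrow> integrable lborel f"
proof (rule Bochner_Integration.integrable_bound[where f="\<lambda>x. C * indicator B x"])
  assume f: "good C f"
  show "integrable lborel (\<lambda>x. C * indicator B x)"
    using finite_B by (intro integrable_mult_right integrable_real_indicator) auto
  show "f \<in> borel_measurable lborel" using goodD(2)[OF f] by simp
  show "AE x in lborel. norm (f x) \<le> norm (C * indicat_real B x)"
  proof (intro always_eventually allI)
    fix x show "norm (f x) \<le> norm (C * indicat_real B x)"
      using goodD(3)[OF f, of x] goodD(1)[OF f] by (simp add: B_eq[symmetric])
  qed
qed

definition "q x = (fst x)\<^sup>2 + (snd x - b)\<^sup>2"

lemma norm2_q: "(norm (x - c))\<^sup>2 = q x"
  by (simp add: q_def norm_prod_def)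

definition "eta r n x = cut r n (norm (x - c))"
text \<open>The gradient of \<open>eta\<close> is \<open>- kap\<close> times \<open>x - c\<close>.
  Compared with the kernel the factor \<open>norm (x - c)\<close> is divided out, so that no
  singularity arises at the centre.\<close>

definition "kap r n x = smooth_step' ((q x - r\<^sup>2) / cut_width r n) * (2 / cut_width r n)"

lemma eta_q: "eta r n x = 1 - smooth_step ((q x - r\<^sup>2) / cut_width r n)"
  unfolding eta_def cut_def norm2_q ..

lemma kap_kernel: "cut_kernel r n (norm (x - c)) = kap r n x * norm (x - c)"
  unfolding cut_kernel_def kap_def norm2_q by simp

lemma kap_cont: "r > 0 \<Longrightarrow> continuous_on S (kap r n)"
  unfolding kap_def[abs_def] q_def using cut_width_pos[of r n]
  by (intro continuous_intros continuous_on_compose2[OF continuous_smooth_step']) auto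

lemma eta_grad: assumes r: "r > 0" shows "grad_on S (eta r n) (\<lambda>x. - kap r n x * fst x) (\<lambda>x. - kap r n x * (snd x - b))"
  unfolding grad_on_def
proof (intro conjI ballI)
  fix x :: "real \<times> real"
  have "(q has_derivative (\<lambda>v. 2 * fst x * fst v + 2 * (snd x - b) * snd v)) (at x)"
    unfolding q_def[abs_def] by (auto intro!: derivative_eq_intros)
  then have "((\<lambda>x. (q x - r\<^sup>2) / cut_width r n) has_derivative (\<lambda>v. (2 * fst x * fst v + 2 * (snd x - b) * snd v) / cut_width r n)) (at x)"
    by (intro bounded_linear.has_derivative[OF bounded_linear_divide]) (auto intro!: derivative_eq_intros)
  from has_derivative_compose[OF this smooth_step_deriv[unfolded has_field_derivative_def]]
  have "((\<lambda>x. smooth_step ((q x - r\<^sup>2) / cut_width r n)) has_derivative (\<lambda>v. kap r n x * fst x * fst v + kap r n x * (snd x - b) * snd v)) (at x)"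
    by (rule has_derivative_eq_rhs) (simp add: kap_def fun_eq_iff algebra_simps add_divide_distrib diff_divide_distrib)
  from has_derivative_diff[OF has_derivative_const[of 1] this]
  show "(eta r n has_derivative (\<lambda>v. - kap r n x * fst x * fst v + - kap r n x * (snd x - b) * snd v)) (at x)"
    unfolding eta_q[abs_def] by (rule has_derivative_eq_rhs) (simp add: fun_eq_iff)
qed (intro continuous_intros kap_cont r)+

lemma eta_bounds: "0 \<le> eta r n x" "eta r n x \<le> 1"
  unfolding eta_def by (rule cut_bounds)+

lemma eta_out: "r > 0 \<Longrightarrow> r + 1 / Suc n \<le> norm (x - c) \<Longrightarrow> eta r n x = 0"
  unfolding eta_def by (rule cut_eq_0)

lemma kap_out: assumes "r > 0" "r + 1 / Suc n < norm (x - c)" shows "kap r n x = 0"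
proof -
  have "0 < r + 1 / Suc n" using assms(1) by (simp add: add_pos_nonneg)
  then have "0 < norm (x - c)" using assms(2) by linarith
  then show ?thesis using cut_kernel_eq_0[OF assms(1), of "norm (x - c)" n] assms(2) kap_kernel[of r n x] by simp
qed

lemma eta_borel [measurable]: "r > 0 \<Longrightarrow> eta r n \<in> borel_measurable borel"
  by (intro borel_measurable_continuous_onI grad_on_cont0[OF eta_grad])

lemma kernel_borel [measurable]: "r > 0 \<Longrightarrow> (\<lambda>x. cut_kernel r n (norm (x - c))) \<in> borel_measurable borel"
  unfolding kap_kernel by (intro borel_measurable_continuous_onI continuous_intros kap_cont)

lemma good_eta: "r > 0 \<Longrightarrow> good C f \<Longrightarrow> good (1 * C) (\<lambda>x. eta r n x * f x)"
  by (rule good_mult) (auto simp: eta_bounds abs_le_iff intro: order_trans[OF _ eta_bounds(1)])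

lemma good_kernel: assumes r: "r > 0" and f: "good C f" shows "good (8 / (2 / Suc n) * C) (\<lambda>x. cut_kernel r n (norm (x - c)) * f x)"
proof (rule good_mult[OF f kernel_borel[OF r]])
  fix x assume "x \<in> B"
  then have "norm (x - c) > 0" by (auto simp: B_iff)
  from cut_kernel_bound[OF r this, of n]
  show "\<bar>cut_kernel r n (norm (x - c))\<bar> \<le> 8 / (2 / Suc n)"
    by (rule order_trans) (simp add: indicator_def)
qed simp

definition "Gn x = (u1 x * fst x + u2 x * (snd x - b)) / norm (x - c)"

lemma W_norm: "x \<in> W \<Longrightarrow> norm (x - c) \<noteq> 0"
  using W_pos[of x] by auto

lemma Gn_norm: "x \<in> W \<Longrightarrow> Gn x * norm (x - c) = u1 x * fst x + u2 x * (snd x - b)"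
  unfolding Gn_def by (rule nonzero_eq_divide_eq[THEN iffD1, OF W_norm refl])

lemma Gn_cont: "continuous_on W Gn"
  unfolding Gn_def[abs_def] by (intro continuous_intros grad_on_cont[OF u_grad]) (use W_norm in auto)

lemma Gn_inner: "x \<in> W \<Longrightarrow> Gn x = G x \<bullet> ((x - c) /\<^sub>R norm (x - c))"
  by (simp add: Gn_def G_def inner_prod_def divide_inverse algebra_simps)

lemma Gn_bound: assumes "x \<in> W" "x \<in> B" shows "\<bar>Gn x\<bar> \<le> L0 * fst x"
  using G_inner_bound[of x "(x - c) /\<^sub>R norm (x - c)"] W_norm[OF assms(1)] B_Kd assms(2)
  unfolding Gn_inner[OF assms(1)] by (auto simp: subset_eq)

lemma B_fst: "x \<in> B \<Longrightarrow> 0 < fst x" "x \<in> B \<Longrightarrow> fst x \<le> d"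
  using B_iff[of x] Kd_fst[of x] B_Kd by blast+

lemma a_bound: assumes "x \<in> W" "x \<in> B" shows "0 < a x" "a x \<le> 1 / (c0 * fst x)"
proof -
  have b: "0 < fst x" "c0 < R x" using bounds[of x] B_Kd assms W_pos by auto
  then show "0 < a x" using c0_pos by (simp add: a_eq)
  show "a x \<le> 1 / (c0 * fst x)" unfolding a_eq
    using b c0_pos mult_strict_right_mono[OF b(2,1)] by (intro divide_left_mono) (auto simp: mult.commute)
qed

text \<open>\<open>mL\<close>, \<open>mT\<close> and \<open>mK\<close> are the densities of I, of
  the energy T and of K_1 on half discs. On circles, \<open>mN\<close> gives N, \<open>me\<close>
  the boundary term of the energy identity, \<open>mv\<close> gives \<rho>0 J, and \<open>mj\<close>
  half of \<rho>0 J'. \<open>mu\<close> appears when the square in the final formula is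
  expanded.\<close>

definition "mL = ext (\<lambda>x. fst x * E x)"
definition "mT = ext (\<lambda>x. fst x * t x / R x)"
definition "mK = ext (\<lambda>x. fst x * (snd x - b) * (R x / \<rho>0\<^sup>2))"
definition "mN = ext (\<lambda>x. a x * (Gn x)\<^sup>2)"
definition "me = ext (\<lambda>x. u x * a x * Gn x)"
definition "mj = ext (\<lambda>x. u x * Gn x / fst x)"
definition "mu = ext (\<lambda>x. (u x)\<^sup>2 * a x)"
definition "mv = ext (\<lambda>x. (u x)\<^sup>2 / fst x)"

lemma W_R_ne: "x \<in> W \<Longrightarrow> R x \<noteq> 0" using R_pos[of x] by simp

lemmas W_conts = grad_on_cont0[OF E_grad] grad_on_cont0[OF a_grad] grad_on_cont0[OF R_grad] t_cont grad_on_cont[OF u_grad]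
  grad_on_cont0[OF u_grad] Gn_cont

lemma u_bound_B: "x \<in> B \<Longrightarrow> 0 \<le> u x" "x \<in> B \<Longrightarrow> u x \<le> L0 * (fst x)\<^sup>2"
  using u_bound[of x] B_Kd by auto

text \<open>The weight \<open>a\<close> is of order \<open>1 / fst x\<close> at the axis, the
  gradient of order \<open>fst x\<close> and \<open>u\<close> of order \<open>(fst x)^2\<close>, so
  the products stay bounded up to the axis.\<close>

lemma au_bound: assumes x: "x \<in> W" "x \<in> B" shows "0 \<le> a x * u x" "a x * u x \<le> L0 * d / c0" "a x * \<bar>Gn x\<bar> \<le> L0 / c0"
proof -
  note ab = a_bound[OF x] and f = B_fst[OF x(2)] and ub = u_bound_B[OF x(2)]
  show "0 \<le> a x * u x" using ab ub by simp
  have "a x * u x \<le> 1 / (c0 * fst x) * (L0 * (fst x)\<^sup>2)" using ab ub c0_pos f by (intro mult_mono) auto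
  also have "\<dots> = L0 * fst x / c0" using f c0_pos by (simp add: field_simps power2_eq_square)
  also have "\<dots> \<le> L0 * d / c0" using f c0_pos L0_nonneg by (intro divide_right_mono mult_left_mono) auto
  finally show "a x * u x \<le> L0 * d / c0" .
  have "a x * \<bar>Gn x\<bar> \<le> 1 / (c0 * fst x) * (L0 * fst x)" using ab Gn_bound[OF x] c0_pos f by (intro mult_mono) auto
  also have "\<dots> = L0 / c0" using f c0_pos by (simp add: field_simps)
  finally show "a x * \<bar>Gn x\<bar> \<le> L0 / c0" .
qed

lemma ux_bound: assumes x: "x \<in> B" shows "0 \<le> u x / fst x" "u x / fst x \<le> L0 * d" "u x \<le> L0 * d\<^sup>2"
proof -
  note f = B_fst[OF x] and ub = u_bound_B[OF x]
  show "0 \<le> u x / fst x" using ub f by simp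
  have "u x / fst x \<le> L0 * (fst x)\<^sup>2 / fst x" using ub f by (intro divide_right_mono) auto
  also have "\<dots> = L0 * fst x" using f by (simp add: power2_eq_square)
  also have "\<dots> \<le> L0 * d" using f L0_nonneg by (intro mult_left_mono) auto
  finally show "u x / fst x \<le> L0 * d" .
  show "u x \<le> L0 * d\<^sup>2" using ub f L0_nonneg by (intro order_trans[OF ub(2)] mult_left_mono power_mono) auto
qed

lemma Gn_bound': "x \<in> W \<Longrightarrow> x \<in> B \<Longrightarrow> \<bar>Gn x\<bar> \<le> L0 * d"
  using order_trans[OF Gn_bound mult_left_mono[OF B_fst(2) L0_nonneg]] .

lemma good_me: "good (L0 * d / c0 * (L0 * d)) me" unfolding me_def
proof (rule good_ext)
  fix x assume x: "x \<in> W" "x \<in> B"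
  have "\<bar>u x * a x * Gn x\<bar> = a x * u x * \<bar>Gn x\<bar>" using a_bound[OF x] u_bound_B[OF x(2)] by (simp add: abs_mult)
  also have "\<dots> \<le> L0 * d / c0 * (L0 * d)" using au_bound[OF x] Gn_bound'[OF x] by (intro mult_mono) (auto intro: order_trans)
  finally show "\<bar>u x * a x * Gn x\<bar> \<le> L0 * d / c0 * (L0 * d)" .
qed (use L0_nonneg d_pos c0_pos in \<open>auto intro!: continuous_intros W_conts\<close>)

lemma good_mN: "good (L0 / c0 * (L0 * d)) mN" unfolding mN_def
proof (rule good_ext)
  fix x assume x: "x \<in> W" "x \<in> B"
  have "\<bar>a x * (Gn x)\<^sup>2\<bar> = a x * \<bar>Gn x\<bar> * \<bar>Gn x\<bar>" using a_bound[OF x] by (simp add: abs_mult power2_eq_square)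
  also have "\<dots> \<le> L0 / c0 * (L0 * d)" using au_bound[OF x] Gn_bound'[OF x] L0_nonneg c0_pos by (intro mult_mono) auto
  finally show "\<bar>a x * (Gn x)\<^sup>2\<bar> \<le> L0 / c0 * (L0 * d)" .
qed (use L0_nonneg d_pos c0_pos in \<open>auto intro!: continuous_intros W_conts\<close>)

lemma good_mj: "good (L0 * d * (L0 * d)) mj" unfolding mj_def
proof (rule good_ext)
  fix x assume x: "x \<in> W" "x \<in> B"
  have "\<bar>u x * Gn x / fst x\<bar> = u x / fst x * \<bar>Gn x\<bar>" using B_fst[OF x(2)] u_bound_B[OF x(2)] by (simp add: abs_mult)
  also have "\<dots> \<le> L0 * d * (L0 * d)" using ux_bound[OF x(2)] Gn_bound'[OF x] L0_nonneg d_pos by (intro mult_mono) auto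
  finally show "\<bar>u x * Gn x / fst x\<bar> \<le> L0 * d * (L0 * d)" .
qed (use L0_nonneg d_pos W_ne in \<open>auto intro!: continuous_intros W_conts\<close>)

lemma good_mu: "good (L0 * d / c0 * (L0 * d\<^sup>2)) mu" unfolding mu_def
proof (rule good_ext)
  fix x assume x: "x \<in> W" "x \<in> B"
  have "\<bar>(u x)\<^sup>2 * a x\<bar> = a x * u x * u x" using a_bound[OF x] by (simp add: power2_eq_square)
  also have "\<dots> \<le> L0 * d / c0 * (L0 * d\<^sup>2)"
    using au_bound[OF x] ux_bound[OF x(2)] u_bound_B[OF x(2)] L0_nonneg d_pos c0_pos by (intro mult_mono) auto
  finally show "\<bar>(u x)\<^sup>2 * a x\<bar> \<le> L0 * d / c0 * (L0 * d\<^sup>2)" .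
qed (use L0_nonneg d_pos c0_pos in \<open>auto intro!: continuous_intros W_conts\<close>)

lemma good_mv: "good (L0 * d * (L0 * d\<^sup>2)) mv" unfolding mv_def
proof (rule good_ext)
  fix x assume x: "x \<in> W" "x \<in> B"
  have "\<bar>(u x)\<^sup>2 / fst x\<bar> = u x / fst x * u x" using B_fst[OF x(2)] by (simp add: power2_eq_square)
  also have "\<dots> \<le> L0 * d * (L0 * d\<^sup>2)"
    using ux_bound[OF x(2)] u_bound_B[OF x(2)] L0_nonneg d_pos by (intro mult_mono) auto
  finally show "\<bar>(u x)\<^sup>2 / fst x\<bar> \<le> L0 * d * (L0 * d\<^sup>2)" .
qed (use L0_nonneg d_pos W_ne in \<open>auto intro!: continuous_intros W_conts\<close>)

lemma good_mT: "good (d * (C0 / c0)) mT" unfolding mT_def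
proof (rule good_ext)
  fix x assume x: "x \<in> W" "x \<in> B"
  have bb: "t x \<le> C0" "c0 < R x" using bounds[of x] x B_Kd by auto
  have "\<bar>fst x * t x / R x\<bar> = fst x * (t x / R x)" using B_fst[OF x(2)] t_nonneg[of x] bb c0_pos by (simp add: abs_mult)
  also have "\<dots> \<le> d * (C0 / c0)"
    using B_fst[OF x(2)] bb t_nonneg[of x] c0_pos C0_pos by (intro mult_mono frac_le) auto
  finally show "\<bar>fst x * t x / R x\<bar> \<le> d * (C0 / c0)" .
qed (use C0_pos d_pos c0_pos W_R_ne in \<open>auto intro!: continuous_intros W_conts\<close>)

lemma good_mK: "good (d * d * (C0 / \<rho>0\<^sup>2)) mK" unfolding mK_def
proof (rule good_ext)
  fix x assume x: "x \<in> W" "x \<in> B"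
  have bb: "0 < R x" "R x < C0" using bounds[of x] x B_Kd c0_pos by auto
  have "\<bar>snd x - b\<bar> \<le> norm (x - c)" using norm_snd_le[of "snd x - b" "fst x"] by (cases x) simp
  then have sb: "\<bar>snd x - b\<bar> \<le> d" using x(2) B_iff by auto
  have "\<bar>fst x * (snd x - b) * (R x / \<rho>0\<^sup>2)\<bar> = fst x * \<bar>snd x - b\<bar> * (R x / \<rho>0\<^sup>2)"
    using B_fst[OF x(2)] bb by (simp add: abs_mult)
  also have "\<dots> \<le> d * d * (C0 / \<rho>0\<^sup>2)"
    using B_fst[OF x(2)] bb sb d_pos by (intro mult_mono divide_right_mono) auto
  finally show "\<bar>fst x * (snd x - b) * (R x / \<rho>0\<^sup>2)\<bar> \<le> d * d * (C0 / \<rho>0\<^sup>2)" .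
qed (use C0_pos d_pos r0_pos in \<open>auto intro!: continuous_intros W_conts\<close>)

lemma ex_good_mL: "\<exists>C. good C mL"
proof -
  have cp: "continuous_on {c0..C0} p"
  proof (intro continuous_at_imp_continuous_on ballI)
    fix y assume "y \<in> {c0..C0}"
    then show "isCont p y" using c0_pos by (intro DERIV_isCont[OF p_deriv]) auto
  qed
  obtain P where P: "\<forall>y\<in>{c0..C0}. \<bar>p y\<bar> \<le> P"
    using compact_imp_bounded[OF compact_continuous_image[OF cp compact_Icc]] by (auto simp: bounded_iff)
  define C where "C = 2 * C0 / c0 + \<bar>P\<bar> / (g * \<rho>0\<^sup>2) + \<bar>p \<rho>0 / (g * \<rho>0\<^sup>2)\<bar>"
  have "good (d * C) mL" unfolding mL_def
  proof (rule good_ext)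
    have "0 \<le> C" using C0_pos c0_pos g_pos r0_pos by (simp add: C_def)
    then show "0 \<le> d * C" using d_pos by simp
    fix x assume x: "x \<in> W" "x \<in> B"
    have bb: "t x \<le> C0" "c0 < R x" "R x < C0" using bounds[of x] x B_Kd by auto
    have 1: "0 \<le> 2 * t x / R x" using t_nonneg[of x] bb c0_pos by simp
    have 2: "2 * t x / R x \<le> 2 * C0 / c0"
      using bb t_nonneg[of x] c0_pos C0_pos by (intro frac_le) auto
    have 3: "\<bar>p (R x) / (g * \<rho>0\<^sup>2)\<bar> \<le> \<bar>P\<bar> / (g * \<rho>0\<^sup>2)"
      using bspec[OF P, of "R x"] bb g_pos by (auto simp: abs_mult intro!: divide_right_mono)
    have "E x = 2 * t x / R x + p (R x) / (g * \<rho>0\<^sup>2) - p \<rho>0 / (g * \<rho>0\<^sup>2)" by (simp add: E_def \<Phi>_def R_def)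
    then have "\<bar>E x\<bar> \<le> C" using 1 2 3 unfolding C_def by linarith
    then show "\<bar>fst x * E x\<bar> \<le> d * C"
      unfolding abs_mult using B_fst[OF x(2)] by (intro mult_mono) auto
  qed (auto intro!: continuous_intros W_conts)
  then show ?thesis ..
qed


subsection \<open>The integrated identities\<close>

lemma eta_kap_out:
  assumes r: "0 < r" "r + 1 / Suc n < d" and x: "0 < fst x" "x \<notin> B"
  shows "eta r n x = 0" "kap r n x = 0"
proof -
  have "r + 1 / Suc n < norm (x - c)" using x r(2) by (auto simp: B_iff)
  then show "eta r n x = 0" "kap r n x = 0" using eta_out[OF r(1), of n x] kap_out[OF r(1), of n x] by auto
qed

lemma half_ball_sub_Kd: "s \<le> d \<Longrightarrow> cball c s \<inter> half_plane \<subseteq> Kd"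
  unfolding Kd_def using subset_cball[of s d c] by blast

text \<open>The equation \<open>div A = 0\<close> is tested with \<open>k (u) \<eta>\<close>, where \<open>k y = (max 0 (y - \<epsilon>))\<^sup>2 / y\<close> keeps the
  support inside \<open>W\<close> and \<open>k (u)\<close> tends to \<open>u\<close> as \<open>\<epsilon>\<close> tends to 0.\<close>

lemma energy_identity:
  assumes r: "0 < r" "r + 1 / Suc n < d"
  shows "(LINT x|lborel. eta r n x * mT x) = (LINT x|lborel. cut_kernel r n (norm (x - c)) * me x)"
proof -
  let ?ck = "\<lambda>x. cut_kernel r n (norm (x - c))"
  \<comment> \<open>With this \<open>z\<close> the truncation is \<open>k u = z^2 * u\<close> and
    its derivative \<open>2 * z - z^2\<close>. On \<open>W\<close> both factors lie between 0 and 1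
    and tend to 1 as \<open>e\<close> tends to 0, which gives dominated convergence.\<close>
  define z where "z e x = max 0 (u x - e) / u x" for e x
  have z01: "0 \<le> z e x" "z e x \<le> 1" if "e > 0" "x \<in> W" for e x
    using that W_u[of x] by (auto simp: z_def max_def divide_le_eq)
  have zc: "continuous_on W (z e)" for e unfolding z_def[abs_def]
    by (intro continuous_intros W_conts) (use W_u in force)
  have int0: "(LINT x|lborel. (2 * z e x - (z e x)\<^sup>2) * (eta r n x * mT x) - (z e x)\<^sup>2 * (?ck x * me x)) = 0" if e: "e > 0" for e
  proof -
    let ?k = "\<lambda>y. (max 0 (y - e))\<^sup>2 / y" and ?k' = "\<lambda>y. 2 * (max 0 (y - e) / y) - (max 0 (y - e) / y)\<^sup>2"
    have gk: "grad_on W (\<lambda>x. ?k (u x)) (\<lambda>x. ?k' (u x) * u1 x) (\<lambda>x. ?k' (u x) * u2 x)"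
    proof (rule grad_on_compose[OF u_grad])
      fix x assume x: "x \<in> W"
      have "((\<lambda>y. (max 0 (y - e))\<^sup>2) has_real_derivative 2 * max 0 (u x - e)) (at (u x))"
        using DERIV_chain2[OF has_real_derivative_pos_part_square DERIV_diff[OF DERIV_ident DERIV_const[of e]], of "u x"] by simp
      from DERIV_divide[OF this DERIV_ident] W_u[OF x]
      have "(?k has_real_derivative (2 * max 0 (u x - e) * u x - (max 0 (u x - e))\<^sup>2 * 1) / (u x * u x)) (at (u x))" by simp
      moreover have "(2 * max 0 (u x - e) * u x - (max 0 (u x - e))\<^sup>2 * 1) / (u x * u x) = ?k' (u x)"
        using W_u[OF x] by (simp add: diff_divide_distrib power_divide power2_eq_square)
      ultimately show "(?k has_real_derivative ?k' (u x)) (at (u x))" by (simp only:)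
    next
      show "continuous_on W (\<lambda>x. ?k' (u x))" by (intro continuous_intros W_conts) (use W_u in force)+
    qed
    note gz = grad_on_mult[OF gk eta_grad[OF r(1), of W n]]
    note g1 = grad_on_mult[OF A_grad(1) gz] and g2 = grad_on_mult[OF A_grad(2) gz]
    let ?Kr = "cball c (r + 1 / Suc n) \<inter> half_plane"
    \<comment> \<open>The bound \<open>e \<le> u\<close> keeps this compact set away from the axis
      and from the free boundary, on both of which \<open>u\<close> is 0.\<close>
    let ?K = "?Kr \<inter> u -` {e..}"
    have Kr: "?Kr \<subseteq> \<Omega>" using half_ball_sub_Kd[of "r + 1 / Suc n"] Kd_Omega r(2) by auto
    have "closed ?K"
      by (intro continuous_closed_preimage[OF continuous_on_subset[OF u_cont Kr]] closed_Int closed_cball closed_half_plane) simp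
    moreover have "bounded ?K" using bounded_subset[OF bounded_cball, of ?K c "r + 1 / Suc n"] by blast
    ultimately have cK: "compact ?K" by (simp add: compact_eq_bounded_closed)
    have KW: "?K \<subseteq> W" using Kr e by (auto simp: W_def)
    have out: "A1 x * (?k (u x) * eta r n x) = 0" "A2 x * (?k (u x) * eta r n x) = 0" if x: "x \<in> W" "x \<notin> ?K" for x
    proof -
      have "x \<in> half_plane" using W_pos[OF x(1)] by (simp add: half_plane_def)
      then have "r + 1 / Suc n < norm (x - c) \<or> u x < e" using x(2) by (auto simp: dist_norm norm_minus_commute)
      then have "?k (u x) * eta r n x = 0" using eta_out[OF r(1), of n x] by (auto simp: max_def)
      then show "A1 x * (?k (u x) * eta r n x) = 0" "A2 x * (?k (u x) * eta r n x) = 0" by simp_all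
    qed
    note I1 = integral_partial_zero(1,2)[OF cK KW open_W g1 out(1)] and I2 = integral_partial_zero(3,4)[OF cK KW open_W g2 out(2)]
    have "0 = (LINT x:W|lborel. ((a1 x * u1 x + a x * u11 x) * (?k (u x) * eta r n x) + A1 x * (?k' (u x) * u1 x * eta r n x + ?k (u x) * (- kap r n x * fst x)))
        + ((a2 x * u2 x + a x * u22 x) * (?k (u x) * eta r n x) + A2 x * (?k' (u x) * u2 x * eta r n x + ?k (u x) * (- kap r n x * (snd x - b)))))"
      using set_integral_add(2)[OF I1(1) I2(1)] I1(2) I2(2) by simp
    also have "\<dots> = (LINT x|lborel. (2 * z e x - (z e x)\<^sup>2) * (eta r n x * mT x) - (z e x)\<^sup>2 * (?ck x * me x))"
      unfolding set_lebesgue_integral_def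
    proof (intro Bochner_Integration.integral_cong refl)
      fix x
      let ?L = "((a1 x * u1 x + a x * u11 x) * (?k (u x) * eta r n x) + A1 x * (?k' (u x) * u1 x * eta r n x + ?k (u x) * (- kap r n x * fst x)))
        + ((a2 x * u2 x + a x * u22 x) * (?k (u x) * eta r n x) + A2 x * (?k' (u x) * u2 x * eta r n x + ?k (u x) * (- kap r n x * (snd x - b))))"
      let ?R = "(2 * z e x - (z e x)\<^sup>2) * (eta r n x * mT x) - (z e x)\<^sup>2 * (?ck x * me x)"
      show "indicator W x *\<^sub>R ?L = ?R"
      proof (cases "x \<in> W")
        case False then show ?thesis by (simp add: mT_def me_def)
      next
        case W: True
        show ?thesis
        proof (cases "x \<in> B")
          case False
          then show ?thesis using eta_kap_out[OF r W_pos[OF W]] by (simp add: mT_def me_def)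
        next
          case True
          have k: "?k (u x) = (z e x)\<^sup>2 * u x" "?k' (u x) = 2 * z e x - (z e x)\<^sup>2"
            using W_u[OF W] by (simp_all add: z_def power2_eq_square)
          have AT: "A1 x * u1 x + A2 x * u2 x = mT x"
            using W True W_ne[OF W] W_R_ne[OF W] by (simp add: A1_def A2_def a_eq mT_def t_W power2_eq_square field_simps)
          have AG: "kap r n x * (A1 x * fst x + A2 x * (snd x - b)) * u x = ?ck x * me x"
          proof -
            have "A1 x * fst x + A2 x * (snd x - b) = a x * (Gn x * norm (x - c))"
              unfolding Gn_norm[OF W] A1_def A2_def by (simp add: algebra_simps)
            then show ?thesis using W True by (simp add: kap_kernel me_def)
          qed
          have "?L = divA x * ?k (u x) * eta r n x + ?k' (u x) * (eta r n x * (A1 x * u1 x + A2 x * u2 x))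
              - ?k (u x) * (kap r n x * (A1 x * fst x + A2 x * (snd x - b)))"
            unfolding divA_def by (simp only: ring_distribs mult_ac minus_mult_left[symmetric] minus_mult_right[symmetric])
          also have "\<dots> = (2 * z e x - (z e x)\<^sup>2) * (eta r n x * mT x) - (z e x)\<^sup>2 * (kap r n x * (A1 x * fst x + A2 x * (snd x - b)) * u x)"
            unfolding k AT divA_zero[OF W] by simp
          finally show ?thesis unfolding AG using W by simp
        qed
      qed
    qed
    finally show ?thesis by simp
  qed
  have zl: "(\<lambda>m. z (1 / real (Suc m)) x) \<longlonglongrightarrow> 1" if x: "x \<in> W" for x
  proof -
    have "(\<lambda>m. max 0 (u x - 1 / real (Suc m)) / u x) \<longlonglongrightarrow> max 0 (u x - 0) / u x"
      using W_u[OF x] by (intro tendsto_intros LIMSEQ_Suc[OF lim_1_over_n]) auto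
    then show ?thesis using W_u[OF x] by (simp add: z_def)
  qed
  note gT = good_eta[OF r(1) good_mT, of n] and gE = good_kernel[OF r(1) good_me, of n]
  let ?f = "\<lambda>m x. (2 * z (1 / real (Suc m)) x - (z (1 / real (Suc m)) x)\<^sup>2) * (eta r n x * mT x) - (z (1 / real (Suc m)) x)\<^sup>2 * (?ck x * me x)"
  have "(\<lambda>m. LINT x|lborel. ?f m x)
      \<longlonglongrightarrow> (LINT x|lborel. eta r n x * mT x - ?ck x * me x)"
  proof (rule integral_dominated_convergence[where w="\<lambda>x. \<bar>eta r n x * mT x\<bar> + \<bar>?ck x * me x\<bar>"])
    show "(\<lambda>x. eta r n x * mT x - ?ck x * me x) \<in> borel_measurable lborel"
      using goodD(2)[OF gT] goodD(2)[OF gE] by simp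
    show "integrable lborel (\<lambda>x. \<bar>eta r n x * mT x\<bar> + \<bar>?ck x * me x\<bar>)"
      using good_integrable[OF gT] good_integrable[OF gE] by simp
    show "(\<lambda>x. ?f m x) \<in> borel_measurable lborel" for m
    proof -
      have "(\<lambda>x. eta r n x * ext (\<lambda>x. (2 * z (1 / real (Suc m)) x - (z (1 / real (Suc m)) x)\<^sup>2) * (fst x * t x / R x)) x
          - ?ck x * ext (\<lambda>x. (z (1 / real (Suc m)) x)\<^sup>2 * (u x * a x * Gn x)) x) \<in> borel_measurable borel"
        using r(1) W_R_ne by (intro borel_measurable_diff borel_measurable_times eta_borel kernel_borel ext_borel continuous_intros zc W_conts) auto
      moreover have "eta r n x * ext (\<lambda>x. (2 * z (1 / real (Suc m)) x - (z (1 / real (Suc m)) x)\<^sup>2) * (fst x * t x / R x)) x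
          - ?ck x * ext (\<lambda>x. (z (1 / real (Suc m)) x)\<^sup>2 * (u x * a x * Gn x)) x
        = ?f m x" for x
        by (simp only: ext_mult[symmetric] mT_def me_def mult.left_commute)
      ultimately show ?thesis by simp
    qed
    show "AE x in lborel. (\<lambda>m. ?f m x)
      \<longlonglongrightarrow> eta r n x * mT x - ?ck x * me x"
    proof (intro always_eventually allI)
      fix x
      show "(\<lambda>m. ?f m x)
        \<longlonglongrightarrow> eta r n x * mT x - ?ck x * me x"
      proof (cases "x \<in> W")
        case True
        have "(\<lambda>m. ?f m x)
           \<longlonglongrightarrow> (2 * 1 - 1\<^sup>2) * (eta r n x * mT x) - 1\<^sup>2 * (?ck x * me x)"
          by (intro tendsto_intros zl True)
        then show ?thesis by (simp only: power_one mult_1 mult_1_right) simp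
      next
        case False
        then show ?thesis by (simp add: mT_def me_def)
      qed
    qed
    show "AE x in lborel. norm (?f m x)
      \<le> \<bar>eta r n x * mT x\<bar> + \<bar>?ck x * me x\<bar>" for m
    proof (intro always_eventually allI)
      fix x
      show "norm (?f m x)
      \<le> \<bar>eta r n x * mT x\<bar> + \<bar>?ck x * me x\<bar>"
      proof (cases "x \<in> W")
        case False
        then show ?thesis by (simp add: mT_def me_def)
      next
        case True
        define w where "w = z (1 / real (Suc m)) x"
        have w: "0 \<le> w" "w \<le> 1" using z01[OF _ True, of "1 / real (Suc m)"] by (auto simp: w_def)
        then have "w\<^sup>2 \<le> 1" by (simp add: power_le_one)
        moreover have "(1 - w)\<^sup>2 \<ge> 0" by simp
        then have "2 * w - w\<^sup>2 \<le> 1" by (simp add: power2_eq_square algebra_simps)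
        moreover have "w\<^sup>2 \<le> w" using w by (simp add: power2_eq_square mult_left_le)
        then have "0 \<le> 2 * w - w\<^sup>2" using w by simp
        ultimately have *: "\<bar>2 * w - w\<^sup>2\<bar> \<le> 1" "\<bar>w\<^sup>2\<bar> \<le> 1" by auto
        have le: "\<bar>A * X - B * Y\<bar> \<le> \<bar>X\<bar> + \<bar>Y\<bar>" if "\<bar>A\<bar> \<le> 1" "\<bar>B\<bar> \<le> 1" for A B X Y :: real
        proof -
          have "\<bar>A * X - B * Y\<bar> \<le> \<bar>A * X\<bar> + \<bar>B * Y\<bar>" by (rule abs_triangle_ineq4)
          also have "\<dots> \<le> 1 * \<bar>X\<bar> + 1 * \<bar>Y\<bar>" unfolding abs_mult using that by (intro add_mono mult_right_mono) auto
          finally show ?thesis by simp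
        qed
        show ?thesis unfolding real_norm_def w_def[symmetric] by (rule le[OF *])
      qed
    qed
  qed
  moreover have "(\<lambda>m. LINT x|lborel. ?f m x)
      = (\<lambda>m. 0)" by (rule ext, rule int0) simp
  ultimately have "(LINT x|lborel. eta r n x * mT x - ?ck x * me x) = 0"
    by (simp only: LIMSEQ_const_iff)
  then show ?thesis using good_integrable[OF gT] good_integrable[OF gE] by simp
qed


lemma AE_fst_ne: "AE x in lebesgue. fst (x :: real \<times> real) \<noteq> 0"
proof -
  have "negligible {x :: real \<times> real. x \<bullet> (1, 0) = 0}"
    by (rule negligible_standard_hyperplane[OF Basis_real2(1)])
  moreover have "{x :: real \<times> real. x \<bullet> (1, 0) = 0} = {x. fst x = 0}" by (auto simp: inner_prod_def)
  ultimately have "{x :: real \<times> real. fst x = 0} \<in> null_sets lebesgue" by (simp add: negligible_iff_null_sets)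
  then show ?thesis by (rule AE_I') auto
qed

lemma lebesgue_W_integral:
  fixes f F :: "real \<times> real \<Rightarrow> real"
  assumes "F \<in> borel_measurable borel" "\<And>x. x \<in> W \<Longrightarrow> f x = F x" "\<And>x. x \<notin> W \<Longrightarrow> F x = 0"
  shows "(LINT x:W|lebesgue. f x) = (LINT x|lborel. F x)"
proof -
  have "(LINT x:W|lebesgue. f x) = (LINT x|lebesgue. F x)"
    unfolding set_lebesgue_integral_def
    by (intro Bochner_Integration.integral_cong) (use assms(2,3) in \<open>auto simp: indicator_def\<close>)
  also have "\<dots> = (LINT x|lborel. F x)" by (rule integral_completion) (use assms(1) in simp)
  finally show ?thesis .
qed

text \<open>The variational identity is tested with \<open>\<phi> x = \<eta> x (x - c)\<close>.\<close>

lemma variation_cut: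
  assumes r: "0 < r" "r + 1 / Suc n < d"
  shows "0 = 3 * (LINT x|lborel. eta r n x * mL x) - 4 * (LINT x|lborel. eta r n x * mT x) + (LINT x|lborel. eta r n x * mK x)
     - (LINT x|lborel. cut_kernel r n (norm (x - c)) * (norm (x - c) * mL x))
     + 2 * (LINT x|lborel. cut_kernel r n (norm (x - c)) * (norm (x - c) * mN x))"
proof -
  let ?ck = "\<lambda>x. cut_kernel r n (norm (x - c))"
  define \<phi> where "\<phi> x = eta r n x *\<^sub>R (x - c)" for x
  define D where "D x = (blinfun_scaleR_left (x - c) o\<^sub>L (- kap r n x *\<^sub>R blinfun_inner_left (x - c))) + eta r n x *\<^sub>R id_blinfun" for x
  have D: "blinfun_apply (D x) v = (- kap r n x * (v \<bullet> (x - c))) *\<^sub>R (x - c) + eta r n x *\<^sub>R v" for x v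
    by (simp add: D_def blinfun.add_left blinfun.minus_left blinfun.scaleR_left)
  have der: "(\<phi> has_derivative blinfun_apply (D x)) (at x within S)" for x S
  proof -
    have "(eta r n has_derivative (\<lambda>v. - kap r n x * fst x * fst v + - kap r n x * (snd x - b) * snd v)) (at x within S)"
      by (rule has_derivative_at_withinI[OF grad_onD[OF eta_grad[OF r(1)] UNIV_I]])
    moreover have "((\<lambda>x. x - c) has_derivative (\<lambda>v. v)) (at x within S)" by (auto intro!: derivative_eq_intros)
    ultimately have "(\<phi> has_derivative (\<lambda>v. eta r n x *\<^sub>R v + (- kap r n x * fst x * fst v + - kap r n x * (snd x - b) * snd v) *\<^sub>R (x - c))) (at x within S)"
      unfolding \<phi>_def[abs_def] by (rule has_derivative_scaleR)
    then show ?thesis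
      by (rule has_derivative_eq_rhs) (simp add: fun_eq_iff D inner_prod_def algebra_simps)
  qed
  have cD: "continuous_on S D" for S
    unfolding D_def[abs_def]
    by (intro continuous_intros bounded_linear.continuous_on[OF bounded_linear_blinfun_scaleR_left]
        bounded_linear.continuous_on[OF bounded_linear_blinfun_inner_left] kap_cont grad_on_cont0[OF eta_grad] r(1))
  let ?K = "cball c (r + 1 / Suc n) \<inter> half_plane"
  have cphi: "C1_0 \<Omega> \<phi> D"
    unfolding C1_0_def
  proof (intro conjI ballI der cD exI[of _ ?K])
    show "compact ?K" by (intro compact_Int_closed compact_cball closed_half_plane)
    show "?K \<subseteq> \<Omega>" using half_ball_sub_Kd[of "r + 1 / Suc n"] Kd_Omega r(2) by auto
    fix x assume x: "x \<in> \<Omega> - ?K"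
    then have "r + 1 / Suc n < norm (x - c)" using \<Omega>_half by (auto simp: dist_norm norm_minus_commute)
    then show "\<phi> x = 0" using eta_out[OF r(1), of n x] by (simp add: \<phi>_def)
  qed
  have ae: "AE x in lebesgue. x \<in> \<Omega> \<longrightarrow> Du x = G x \<or> (\<phi> x = 0 \<and> D x = 0)"
    using AE_Du_B AE_fst_ne
  proof eventually_elim
    case (elim x)
    show ?case
    proof (intro impI)
      assume "x \<in> \<Omega>"
      then have f: "0 < fst x" using \<Omega>_half elim(2) by (auto simp: half_plane_def)
      show "Du x = G x \<or> (\<phi> x = 0 \<and> D x = 0)"
        using elim(1) eta_kap_out[OF r f] by (cases "x \<in> B") (auto simp: \<phi>_def D_def)
    qed
  qed
  \<comment> \<open>The centre lies on the axis, so the first component of \<open>x - c\<close> is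
    \<open>fst x\<close>.\<close>
  have bc: "fst (\<phi> x) = 0" if "fst x = 0" for x using that by (simp add: \<phi>_def)
  obtain CL where gL: "good CL mL" using ex_good_mL by blast
  have nb: "(\<lambda>x. norm (x - c)) \<in> borel_measurable borel"
    by (intro borel_measurable_continuous_onI continuous_intros)
  have good_norm: "good (d * C) (\<lambda>x. norm (x - c) * f x)" if "good C f" for C f
    by (rule good_mult[OF that nb _ less_imp_le[OF d_pos]]) (simp add: B_iff)
  note nL = good_norm[OF gL] and nN = good_norm[OF good_mN]
  note eL = good_eta[OF r(1) gL, of n] and eT = good_eta[OF r(1) good_mT, of n] and eK = good_eta[OF r(1) good_mK, of n]
    and kL = good_kernel[OF r(1) nL, of n] and kN = good_kernel[OF r(1) nN, of n]
  note ms = goodD(2)[OF eL] goodD(2)[OF eT] goodD(2)[OF eK] goodD(2)[OF kL] goodD(2)[OF kN]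
  note ints = good_integrable[OF eL] good_integrable[OF eT] good_integrable[OF eK] good_integrable[OF kL] good_integrable[OF kN]
  have kq: "kap r n x * q x = ?ck x * norm (x - c)" for x
    by (simp add: kap_kernel norm2_q[symmetric] power2_eq_square)
  \<comment> \<open>The divergence of \<open>x - c\<close> in the plane is 2; the other term is the
    derivative of the cutoff in direction \<open>x - c\<close>.\<close>
  have v: "fst (D x (1, 0)) + snd (D x (0, 1)) = 2 * eta r n x - ?ck x * norm (x - c)" for x
    unfolding kq[symmetric] by (simp add: D inner_prod_def q_def power2_eq_square algebra_simps)
  have e1: "(LINT x:W|lebesgue. fst x * E x * (fst (D x (1, 0)) + snd (D x (0, 1)))) = (LINT x|lborel. 2 * (eta r n x * mL x) - ?ck x * (norm (x - c) * mL x))"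
  proof (rule lebesgue_W_integral)
    fix x assume x: "x \<in> W"
    show "fst x * E x * (fst (D x (1, 0)) + snd (D x (0, 1))) = 2 * (eta r n x * mL x) - ?ck x * (norm (x - c) * mL x)"
    proof (cases "x \<in> B")
      case True then show ?thesis unfolding v using x by (simp add: mL_def algebra_simps)
    next
      case False then show ?thesis unfolding v using eta_kap_out[OF r W_pos[OF x]] by (simp add: mL_def kap_kernel)
    qed
  qed (use ms in \<open>auto simp: mL_def\<close>)
  have e2: "(LINT x:W|lebesgue. a x * ((u1 x, u2 x) \<bullet> D x (u1 x, u2 x))) = (LINT x|lborel. eta r n x * mT x - ?ck x * (norm (x - c) * mN x))"
  proof (rule lebesgue_W_integral)
    fix x assume x: "x \<in> W"
    have "(u1 x, u2 x) \<bullet> D x (u1 x, u2 x) = eta r n x * ((u1 x)\<^sup>2 + (u2 x)\<^sup>2) - kap r n x * (u1 x * fst x + u2 x * (snd x - b))\<^sup>2"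
      by (simp add: D inner_prod_def power2_eq_square algebra_simps)
    also have "(u1 x * fst x + u2 x * (snd x - b))\<^sup>2 = (Gn x)\<^sup>2 * (norm (x - c))\<^sup>2"
      unfolding Gn_norm[OF x, symmetric] by (rule power_mult_distrib)
    finally have dd: "(u1 x, u2 x) \<bullet> D x (u1 x, u2 x) = eta r n x * ((u1 x)\<^sup>2 + (u2 x)\<^sup>2) - kap r n x * ((Gn x)\<^sup>2 * (norm (x - c))\<^sup>2)" .
    have *: "a x * ((u1 x, u2 x) \<bullet> D x (u1 x, u2 x)) = eta r n x * (a x * ((u1 x)\<^sup>2 + (u2 x)\<^sup>2)) - kap r n x * norm (x - c) * (norm (x - c) * (a x * (Gn x)\<^sup>2))"
      unfolding dd by (simp add: algebra_simps power2_eq_square)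
    have "a x * ((u1 x)\<^sup>2 + (u2 x)\<^sup>2) = fst x * t x / R x"
      using W_ne[OF x] W_R_ne[OF x] by (simp add: a_eq t_W[OF x] power2_eq_square)
    note * = *[unfolded this]
    show "a x * ((u1 x, u2 x) \<bullet> D x (u1 x, u2 x)) = eta r n x * mT x - ?ck x * (norm (x - c) * mN x)"
    proof (cases "x \<in> B")
      case True then show ?thesis unfolding * kap_kernel using x by (simp add: mT_def mN_def)
    next
      case False then show ?thesis unfolding * using eta_kap_out[OF r W_pos[OF x]] by (simp add: mT_def mN_def)
    qed
  qed (use ms in \<open>auto simp: mT_def mN_def\<close>)
  have e3: "(LINT x:W|lebesgue. (E x - 2 * t x / R x) * fst (\<phi> x)) = (LINT x|lborel. eta r n x * mL x - 2 * (eta r n x * mT x))"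
  proof (rule lebesgue_W_integral)
    fix x assume x: "x \<in> W"
    show "(E x - 2 * t x / R x) * fst (\<phi> x) = eta r n x * mL x - 2 * (eta r n x * mT x)"
    proof (cases "x \<in> B")
      case True then show ?thesis using x by (simp add: mL_def mT_def \<phi>_def algebra_simps)
    next
      case False then show ?thesis using eta_kap_out[OF r W_pos[OF x]] by (simp add: \<phi>_def)
    qed
  qed (use ms in \<open>auto simp: mL_def mT_def\<close>)
  have e4: "(LINT x:W|lebesgue. fst x * (R x / \<rho>0\<^sup>2) * snd (\<phi> x)) = (LINT x|lborel. eta r n x * mK x)"
  proof (rule lebesgue_W_integral)
    fix x assume x: "x \<in> W"
    show "fst x * (R x / \<rho>0\<^sup>2) * snd (\<phi> x) = eta r n x * mK x"
    proof (cases "x \<in> B")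
      case True then show ?thesis using x by (simp add: mK_def \<phi>_def)
    next
      case False then show ?thesis using eta_kap_out[OF r W_pos[OF x]] by (simp add: \<phi>_def)
    qed
  qed (use ms in \<open>auto simp: mK_def\<close>)
  \<comment> \<open>The coefficient 3 is 2 from the divergence plus 1 from the term with
    \<open>fst (\<phi> x)\<close>; the coefficient 4 is 2 from the quadratic term in
    \<open>D\<close> plus 2 from \<open>2 * t / R\<close> in the axis term.\<close>
  show ?thesis
    using variation_W[OF cphi bc ae] unfolding e1 e2 e3 e4 using ints by simp
qed

section \<open>Passage to sharp cutoffs\<close>

abbreviation "dint f r \<equiv> LINT x:half_disc c r|lborel. f x" for f :: "real \<times> real \<Rightarrow> real"

lemma eta_limit:
  assumes f: "good C f" and r: "r > 0"
  shows "(\<lambda>n. LINT x|lborel. eta r n x * f x) \<longlonglongrightarrow> dint f r"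
proof -
  \<comment> \<open>The cutoffs converge to the indicator of the closed disc, which agrees with that
    of the open disc off this null sphere.\<close>
  have sp: "AE x in lborel. norm (x - c) \<noteq> r"
  proof -
    have "sphere c r \<in> null_sets lebesgue" using negligible_sphere negligible_iff_null_sets by blast
    then have "sphere c r \<in> null_sets lborel" by (simp add: null_sets_completion_iff)
    moreover have "x \<in> sphere c r \<longleftrightarrow> norm (x - c) = r" for x by (simp add: dist_norm norm_minus_commute)
    then have "{x \<in> space lborel. \<not> norm (x - c) \<noteq> r} \<subseteq> sphere c r" by blast
    ultimately show ?thesis by (rule AE_I')
  qed
  have hdb: "half_disc c r \<in> sets borel"
    unfolding half_disc_def by (intro borel_open open_Int open_ball open_Collect_less continuous_intros)
  have nb: "(\<lambda>x. norm (x - c)) \<in> borel_measurable borel"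
    by (intro borel_measurable_continuous_onI continuous_intros)
  have "(\<lambda>n. LINT x|lborel. eta r n x * f x) \<longlonglongrightarrow> (LINT x|lborel. indicator (half_disc c r) x *\<^sub>R f x)"
  proof (rule integral_dominated_convergence[where w="\<lambda>x. \<bar>f x\<bar>"])
    show "(\<lambda>x. indicator (half_disc c r) x *\<^sub>R f x) \<in> borel_measurable lborel"
      using goodD(2)[OF f] hdb by simp
    show "(\<lambda>x. eta r n x * f x) \<in> borel_measurable lborel" for n
      using goodD(2)[OF good_eta[OF r f]] by simp
    show "integrable lborel (\<lambda>x. \<bar>f x\<bar>)" using good_integrable[OF f] by simp
    show "AE x in lborel. (\<lambda>n. eta r n x * f x) \<longlonglongrightarrow> indicator (half_disc c r) x *\<^sub>R f x"
      using sp
    proof eventually_elim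
      case (elim x)
      show ?case
      proof (cases "x \<in> B")
        case False then show ?thesis using goodD(5)[OF f] by simp
      next
        case True
        have "(\<lambda>n. eta r n x * f x) \<longlonglongrightarrow> indicator {..r} (norm (x - c)) * f x"
          unfolding eta_def by (intro tendsto_intros cut_tendsto r) simp
        moreover have "x \<in> half_disc c r \<longleftrightarrow> norm (x - c) \<in> {..r}"
          using True elim by (auto simp: half_disc_def B_iff dist_norm norm_minus_commute)
        then have "indicator {..r} (norm (x - c)) * f x = indicator (half_disc c r) x *\<^sub>R f x"
          by (simp add: indicator_def)
        ultimately show ?thesis by simp
      qed
    qed
    show "AE x in lborel. norm (eta r n x * f x) \<le> \<bar>f x\<bar>" for n
      using eta_bounds[of r n] by (intro always_eventually allI) (simp add: abs_mult mult_left_le_one_le)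
  qed
  then show ?thesis by (simp add: set_lebesgue_integral_def)
qed

lemma AE_good_limits:
  assumes f: "good C f"
  shows "AE r in lborel. r \<in> {0<..<d} \<longrightarrow> ((\<lambda>r. dint f r) has_real_derivative circ_int c f r) (at r) \<and>
    (\<lambda>n. LINT x|lborel. cut_kernel r n (norm (x - c)) * f x) \<longlonglongrightarrow> circ_int c f r"
proof -
  have "(LINT x:{x. fst x > 0}|lborel. k x * f x) = (LINT x|lborel. k x * f x)" for k
    unfolding set_lebesgue_integral_def
  proof (intro Bochner_Integration.integral_cong refl)
    fix x show "indicator {x. fst x > 0} x *\<^sub>R (k x * f x) = k x * f x"
      using goodD(5)[OF f, of x] by (cases "x \<in> B") (auto simp: B_iff)
  qed
  then show ?thesis using AE_radial_limits[OF goodD(2,3)[OF f]] by simp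
qed

text \<open>The admissible radii are those at which four instances of \<open>AE_good_limits\<close>
  hold together. The functions multiplied by \<open>norm (x - c)\<close> account for the factor
  \<open>r\<close> on the right, since this norm is constant on the circle. For large
  \<open>n\<close> the cutoff fits into the half disc of radius \<open>d\<close>, so both cutoff
  identities pass to the limit.\<close>

lemma AE_identities:
  "AE r in lborel. r \<in> {0<..<d} \<longrightarrow>
     3 * dint mL r - 4 * dint mT r + dint mK r = r * (circ_int c mL r - 2 * circ_int c mN r) \<and>
     dint mT r = circ_int c me r \<and> (dint mL has_real_derivative circ_int c mL r) (at r)"
proof -
  obtain CL where gL: "good CL mL" using ex_good_mL by blast
  have nb: "(\<lambda>x. norm (x - c)) \<in> borel_measurable borel"
    by (intro borel_measurable_continuous_onI continuous_intros)
  have good_norm: "good (d * C) (\<lambda>x. norm (x - c) * f x)" if "good C f" for C f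
    by (rule good_mult[OF that nb _ less_imp_le[OF d_pos]]) (simp add: B_iff)
  note nL = good_norm[OF gL] and nN = good_norm[OF good_mN]
  show ?thesis
    using AE_good_limits[OF gL] AE_good_limits[OF nL] AE_good_limits[OF nN] AE_good_limits[OF good_me]
  proof eventually_elim
    case (elim r)
    show ?case
    proof (intro impI)
      assume rd: "r \<in> {0<..<d}"
      then have r: "r > 0" by simp
      have ev: "\<forall>\<^sub>F n in sequentially. r + 1 / real (Suc n) < d"
        using order_tendstoD(2)[OF tendsto_add[OF tendsto_const LIMSEQ_Suc[OF lim_1_over_n]], of r d] rd by simp
      have cr: "circ_int c (\<lambda>x. norm (x - c) * f x) r = r * circ_int c f r" for f
        using circ_int_radial[of r c "\<lambda>y. y" f] r by simp
      have T: "dint mT r = circ_int c me r"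
      proof (rule LIMSEQ_unique[OF eta_limit[OF good_mT r]])
        have "\<forall>\<^sub>F n in sequentially. (LINT x|lborel. cut_kernel r n (norm (x - c)) * me x) = (LINT x|lborel. eta r n x * mT x)"
          using ev by eventually_elim (simp add: energy_identity[OF r])
        then show "(\<lambda>n. LINT x|lborel. eta r n x * mT x) \<longlonglongrightarrow> circ_int c me r"
          using elim(4) rd by (auto intro: Lim_transform_eventually)
      qed
      have "(\<lambda>n. 3 * (LINT x|lborel. eta r n x * mL x) - 4 * (LINT x|lborel. eta r n x * mT x) + (LINT x|lborel. eta r n x * mK x)
         - (LINT x|lborel. cut_kernel r n (norm (x - c)) * (norm (x - c) * mL x))
         + 2 * (LINT x|lborel. cut_kernel r n (norm (x - c)) * (norm (x - c) * mN x)))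
         \<longlonglongrightarrow> 3 * dint mL r - 4 * dint mT r + dint mK r - r * circ_int c mL r + 2 * (r * circ_int c mN r)"
        using elim rd
        by (intro tendsto_add tendsto_diff tendsto_mult tendsto_const eta_limit[OF gL r] eta_limit[OF good_mT r] eta_limit[OF good_mK r])
          (simp_all add: cr)
      moreover have "\<forall>\<^sub>F n in sequentially. 3 * (LINT x|lborel. eta r n x * mL x) - 4 * (LINT x|lborel. eta r n x * mT x) + (LINT x|lborel. eta r n x * mK x)
         - (LINT x|lborel. cut_kernel r n (norm (x - c)) * (norm (x - c) * mL x))
         + 2 * (LINT x|lborel. cut_kernel r n (norm (x - c)) * (norm (x - c) * mN x)) = 0"
        using ev by eventually_elim (rule variation_cut[OF r, symmetric])
      ultimately have "(\<lambda>n. 0) \<longlonglongrightarrow> 3 * dint mL r - 4 * dint mT r + dint mK r - r * circ_int c mL r + 2 * (r * circ_int c mN r)"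
        by (rule Lim_transform_eventually)
      then have "3 * dint mL r - 4 * dint mT r + dint mK r - r * circ_int c mL r + 2 * (r * circ_int c mN r) = 0"
        by (simp add: LIMSEQ_const_iff)
      then show "3 * dint mL r - 4 * dint mT r + dint mK r = r * (circ_int c mL r - 2 * circ_int c mN r) \<and>
         dint mT r = circ_int c me r \<and> (dint mL has_real_derivative circ_int c mL r) (at r)"
        using T elim(1) rd by (simp add: algebra_simps)
    qed
  qed
qed


section \<open>Differentiation of the boundary integral J\<close>

lemma polar_B: assumes "\<rho> \<in> {0<..<d}" "\<theta> \<in> semi" shows "polar c \<rho> \<theta> \<in> B"
  using assms cos_pos_semi[OF assms(2)] by (simp add: B_iff norm_polar fst_polar)

lemma good_circ_integrable: assumes "good C f" shows "integrable lborel (\<lambda>\<theta>. indicator semi \<theta> * (r * f (polar c r \<theta>)))"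
proof (rule Bochner_Integration.integrable_bound[where f="\<lambda>\<theta>. \<bar>r\<bar> * C * indicator semi \<theta>"])
  show "integrable lborel (\<lambda>\<theta>. \<bar>r\<bar> * C * indicat_real semi \<theta>)"
    using emeasure_semi by (intro integrable_mult_right integrable_real_indicator) auto
  show "(\<lambda>\<theta>. indicat_real semi \<theta> * (r * f (polar c r \<theta>))) \<in> borel_measurable lborel"
    using goodD(2)[OF assms] measurable_compose[OF polar_borel, of f borel] by (intro borel_measurable_times) auto
  show "AE \<theta> in lborel. norm (indicat_real semi \<theta> * (r * f (polar c r \<theta>))) \<le> norm (\<bar>r\<bar> * C * indicat_real semi \<theta>)"
  proof (intro always_eventually allI)
    fix \<theta> show "norm (indicat_real semi \<theta> * (r * f (polar c r \<theta>))) \<le> norm (\<bar>r\<bar> * C * indicat_real semi \<theta>)"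
      using goodD(4)[OF assms, of "polar c r \<theta>"] goodD(1)[OF assms]
      by (cases "\<theta> \<in> semi") (auto simp: abs_mult intro!: mult_left_mono)
  qed
qed

lemma circ_int_alt: "circ_int c f r = (LINT \<theta>|lborel. indicator semi \<theta> * (r * f (polar c r \<theta>)))"
  by (simp only: circ_int_def set_lebesgue_integral_def real_scaleR_def)

lemma circ_int_lin:
  assumes "good C f" "good C' k"
  shows "circ_int c (\<lambda>x. y * f x + z * k x) r = y * circ_int c f r + z * circ_int c k r"
proof -
  have "circ_int c (\<lambda>x. y * f x + z * k x) r =
    (LINT \<theta>|lborel. y * (indicator semi \<theta> * (r * f (polar c r \<theta>))) + z * (indicator semi \<theta> * (r * k (polar c r \<theta>))))"
    unfolding circ_int_alt by (intro Bochner_Integration.integral_cong refl) (simp add: algebra_simps)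
  also have "\<dots> = y * circ_int c f r + z * circ_int c k r"
    using good_circ_integrable[OF assms(1), of r] good_circ_integrable[OF assms(2), of r]
    unfolding circ_int_alt
    by (simp only: Bochner_Integration.integral_add integrable_mult_right integral_mult_right_zero)
  finally show ?thesis .
qed

text \<open>On a ray \<open>fst x = \<rho> * cos \<theta>\<close>, so the arc length factor \<rho>
  cancels and \<open>\<rho> * mv\<close> equals \<open>u^2 / cos \<theta>\<close>. Only the C^1
  function \<open>u^2\<close> has to be differentiated, even where the ray crosses the free
  boundary.\<close>

lemma mv_ray_derivative:
  assumes \<rho>: "\<rho> \<in> {0<..<d}" and \<theta>: "\<theta> \<in> semi"
  shows "((\<lambda>\<rho>. \<rho> * mv (polar c \<rho> \<theta>)) has_real_derivative 2 * (\<rho> * mj (polar c \<rho> \<theta>))) (at \<rho>)"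
proof -
  have co: "cos \<theta> \<noteq> 0" using cos_pos_semi[OF \<theta>] by simp
  let ?x = "polar c \<rho> \<theta>"
  have xB: "?x \<in> B" by (rule polar_B[OF \<rho> \<theta>])
  have "((\<lambda>\<rho>. polar c \<rho> \<theta>) has_derivative (\<lambda>h. (h * cos \<theta>, h * sin \<theta>))) (at \<rho>)"
    unfolding polar_def by (auto intro!: derivative_eq_intros)
  from has_derivative_compose[OF this grad_onD[OF usq_grad xB]]
  have "((\<lambda>\<rho>. (u (polar c \<rho> \<theta>))\<^sup>2) has_real_derivative 2 * u ?x * (G1 ?x * cos \<theta> + G2 ?x * sin \<theta>)) (at \<rho>)"
    unfolding has_field_derivative_def by (rule has_derivative_eq_rhs) (simp add: fun_eq_iff algebra_simps)
  from DERIV_cdivide[OF this, of "cos \<theta>"]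
  have "((\<lambda>\<rho>. (u (polar c \<rho> \<theta>))\<^sup>2 / cos \<theta>) has_real_derivative 2 * u ?x * (G1 ?x * cos \<theta> + G2 ?x * sin \<theta>) / cos \<theta>) (at \<rho>)" .
  moreover have "2 * u ?x * (G1 ?x * cos \<theta> + G2 ?x * sin \<theta>) / cos \<theta> = 2 * (\<rho> * mj ?x)"
  proof (cases "?x \<in> W")
    case True
    have "Gn ?x * \<rho> = (u1 ?x * cos \<theta> + u2 ?x * sin \<theta>) * \<rho>"
      using Gn_norm[OF True] \<rho> by (simp add: norm_polar fst_polar snd_polar algebra_simps)
    then have "Gn ?x = u1 ?x * cos \<theta> + u2 ?x * sin \<theta>" using \<rho> by simp
    then show ?thesis using True xB co \<rho> G12_W[of ?x] by (simp add: mj_def fst_polar)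
  next
    case False then show ?thesis by (simp add: mj_def G12_W)
  qed
  moreover have "(u (polar c \<sigma> \<theta>))\<^sup>2 / cos \<theta> = \<sigma> * mv (polar c \<sigma> \<theta>)" if "\<sigma> \<in> {0<..<d}" for \<sigma>
  proof (cases "polar c \<sigma> \<theta> \<in> W")
    case True then show ?thesis using polar_B[OF that \<theta>] that co by (simp add: mv_def fst_polar)
  next
    case False
    have "polar c \<sigma> \<theta> \<in> \<Omega>" using polar_B[OF that \<theta>] B_Kd Kd_Omega by blast
    then have "u (polar c \<sigma> \<theta>) = 0" using False u_nonneg[of "polar c \<sigma> \<theta>"] by (auto simp: W_def)
    then show ?thesis using False by (simp add: mv_def)
  qed
  ultimately show ?thesis
    using \<rho> by (auto intro: has_field_derivative_transform_within_open[OF _ open_greaterThanLessThan[of 0 d]])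
qed

text \<open>The mean value theorem on each ray and the bound for \<open>mj\<close> dominate the
  difference quotients uniformly in the angle. The derivative exists at every \<open>r\<close>, with
  no exceptional radii.\<close>

lemma circ_mv_derivative:
  assumes r: "r \<in> {0<..<d}"
  shows "(circ_int c mv has_real_derivative 2 * circ_int c mj r) (at r)"
  unfolding has_field_derivative_iff tendsto_at_iff_sequentially comp_def
proof (intro allI impI)
  fix Y :: "nat \<Rightarrow> real" assume Y: "\<forall>i. Y i \<in> UNIV - {r}" "Y \<longlonglongrightarrow> r"
  have "\<forall>\<^sub>F n in sequentially. Y n \<in> {0<..<d}"
    using topological_tendstoD[OF Y(2) open_greaterThanLessThan r] .
  then obtain N where N: "\<And>n. n \<ge> N \<Longrightarrow> Y n \<in> {0<..<d}" by (auto simp: eventually_sequentially)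
  \<comment> \<open>Dropping the first terms puts all radii into the interval where the rays stay in
    \<open>B\<close>, as the bound for every index requires.\<close>
  define X where "X n = Y (n + N)" for n
  have X: "X n \<in> {0<..<d}" "X n \<noteq> r" for n using N Y(1) by (auto simp: X_def)
  have Xl: "X \<longlonglongrightarrow> r" unfolding X_def by (rule LIMSEQ_ignore_initial_segment[OF Y(2)])
  let ?P = "\<lambda>\<rho> \<theta>. \<rho> * mv (polar c \<rho> \<theta>)"
  have meas: "(\<lambda>\<theta>. \<rho> * f (polar c \<rho> \<theta>)) \<in> borel_measurable borel" if "f \<in> borel_measurable borel" for f :: "real \<times> real \<Rightarrow> real" and \<rho>
    using measurable_compose[OF polar_borel that] by simp
  let ?C = "L0 * d * (L0 * d)"
  have C: "?C \<ge> 0" using L0_nonneg d_pos by simp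
  have "(\<lambda>n. LINT \<theta>|lborel. indicator semi \<theta> * ((?P (X n) \<theta> - ?P r \<theta>) / (X n - r))) \<longlonglongrightarrow> (LINT \<theta>|lborel. indicator semi \<theta> * (2 * (r * mj (polar c r \<theta>))))"
  proof (rule integral_dominated_convergence[where w="\<lambda>\<theta>. 2 * d * ?C * indicator semi \<theta>"])
    show "(\<lambda>\<theta>. indicator semi \<theta> * (2 * (r * mj (polar c r \<theta>)))) \<in> borel_measurable lborel"
      using meas[OF goodD(2)[OF good_mj]] by simp
    show "(\<lambda>\<theta>. indicator semi \<theta> * ((?P (X n) \<theta> - ?P r \<theta>) / (X n - r))) \<in> borel_measurable lborel" for n
      using meas[OF goodD(2)[OF good_mv]] by simp
    show "integrable lborel (\<lambda>\<theta>. 2 * d * ?C * indicator semi \<theta>)"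
      using emeasure_semi by (intro integrable_mult_right integrable_real_indicator) auto
    show "AE \<theta> in lborel. (\<lambda>n. indicator semi \<theta> * ((?P (X n) \<theta> - ?P r \<theta>) / (X n - r))) \<longlonglongrightarrow> indicator semi \<theta> * (2 * (r * mj (polar c r \<theta>)))"
    proof (intro always_eventually allI)
      fix \<theta>
      show "(\<lambda>n. indicator semi \<theta> * ((?P (X n) \<theta> - ?P r \<theta>) / (X n - r))) \<longlonglongrightarrow> indicator semi \<theta> * (2 * (r * mj (polar c r \<theta>)))"
      proof (cases "\<theta> \<in> semi")
        case True
        have "(\<lambda>n. (?P (X n) \<theta> - ?P r \<theta>) / (X n - r)) \<longlonglongrightarrow> 2 * (r * mj (polar c r \<theta>))"
          using mv_ray_derivative[OF r True] X(2) Xl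
          unfolding has_field_derivative_iff tendsto_at_iff_sequentially comp_def by auto
        then show ?thesis using True by simp
      qed simp
    qed
    show "AE \<theta> in lborel. norm (indicator semi \<theta> * ((?P (X n) \<theta> - ?P r \<theta>) / (X n - r))) \<le> 2 * d * ?C * indicator semi \<theta>" for n
    proof (intro always_eventually allI)
      fix \<theta>
      show "norm (indicator semi \<theta> * ((?P (X n) \<theta> - ?P r \<theta>) / (X n - r))) \<le> 2 * d * ?C * indicator semi \<theta>"
      proof (cases "\<theta> \<in> semi")
        case True
        have "norm (?P (X n) \<theta> - ?P r \<theta>) \<le> 2 * d * ?C * norm (X n - r)"
        proof (rule field_differentiable_bound[where S="{0<..<d}" and f'="\<lambda>\<rho>. 2 * (\<rho> * mj (polar c \<rho> \<theta>))"])
          fix \<rho> assume \<rho>: "\<rho> \<in> {0<..<d}"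
          show "(((\<lambda>\<rho>. ?P \<rho> \<theta>)) has_field_derivative 2 * (\<rho> * mj (polar c \<rho> \<theta>))) (at \<rho> within {0<..<d})"
            by (rule has_field_derivative_at_within[OF mv_ray_derivative[OF \<rho> True]])
          have "\<bar>\<rho>\<bar> * \<bar>mj (polar c \<rho> \<theta>)\<bar> \<le> d * ?C"
            using \<rho> goodD(4)[OF good_mj] by (intro mult_mono) auto
          then show "norm (2 * (\<rho> * mj (polar c \<rho> \<theta>))) \<le> 2 * d * ?C" by (simp add: abs_mult)
        qed (use X r in auto)
        then show ?thesis using True X(2)[of n] by (simp add: divide_le_eq)
      next
        case False then show ?thesis by simp
      qed
    qed
  qed
  moreover have "(LINT \<theta>|lborel. indicator semi \<theta> * (2 * (r * mj (polar c r \<theta>)))) = 2 * circ_int c mj r"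
    unfolding circ_int_alt by (subst integral_mult_right_zero[symmetric]) (simp add: mult_ac)
  moreover have "(LINT \<theta>|lborel. indicator semi \<theta> * ((?P (X n) \<theta> - ?P r \<theta>) / (X n - r))) = (circ_int c mv (X n) - circ_int c mv r) / (X n - r)" for n
  proof -
    have "(circ_int c mv (X n) - circ_int c mv r) / (X n - r) =
      (LINT \<theta>|lborel. (indicator semi \<theta> * ?P (X n) \<theta> - indicator semi \<theta> * ?P r \<theta>) / (X n - r))"
      unfolding circ_int_alt integral_divide_zero
      by (simp only: Bochner_Integration.integral_diff[OF good_circ_integrable[OF good_mv] good_circ_integrable[OF good_mv]])
    also have "\<dots> = (LINT \<theta>|lborel. indicator semi \<theta> * ((?P (X n) \<theta> - ?P r \<theta>) / (X n - r)))"
      by (intro Bochner_Integration.integral_cong refl) (simp add: right_diff_distrib)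
    finally show ?thesis by (rule sym)
  qed
  ultimately have "(\<lambda>n. (circ_int c mv (X n) - circ_int c mv r) / (X n - r)) \<longlonglongrightarrow> 2 * circ_int c mj r" by (simp only:)
  then show "(\<lambda>n. (circ_int c mv (Y n) - circ_int c mv r) / (Y n - r)) \<longlonglongrightarrow> 2 * circ_int c mj r"
    unfolding X_def by (rule LIMSEQ_offset)
qed

section \<open>Return to the integrals of the statement\<close>

lemma half_disc_B: "r \<le> d \<Longrightarrow> half_disc c r \<subseteq> B"
  by (auto simp: B_def half_disc_def)

text \<open>Equality is needed only where \<open>Du\<close> is the classical gradient and
  \<open>x\<close> lies in \<open>fluid_side\<close>; off \<open>fluid_side\<close> both sides
  vanish, because \<open>W\<close> is contained in it.\<close>

lemma lebesgue_half_disc_integral: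
  assumes F: "F \<in> borel_measurable borel" and r: "r \<le> d"
    and eq: "\<And>x. x \<in> B \<Longrightarrow> Du x = G x \<Longrightarrow> x \<in> fluid_side \<Longrightarrow> f x = F x" "\<And>x. x \<notin> W \<Longrightarrow> F x = 0"
  shows "(LINT x:(half_disc c r \<inter> fluid_side)|lebesgue. f x) = dint F r"
proof -
  have hdb: "half_disc c r \<in> sets borel"
    unfolding half_disc_def by (intro borel_open open_Int open_ball open_Collect_less continuous_intros)
  have m: "(\<lambda>x. indicator (half_disc c r) x *\<^sub>R F x) \<in> borel_measurable lborel" using F hdb by simp
  have "(LINT x:(half_disc c r \<inter> fluid_side)|lebesgue. f x) = (LINT x|lebesgue. indicator (half_disc c r) x *\<^sub>R F x)"
    unfolding set_lebesgue_integral_def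
  proof (rule complete_measure.integral_AE_eq[OF complete_lebesgue measurable_completion[OF m]])
    show "AE x in lebesgue. indicator (half_disc c r \<inter> fluid_side) x *\<^sub>R f x = indicator (half_disc c r) x *\<^sub>R F x"
      using AE_Du_B
    proof eventually_elim
      case (elim x)
      show ?case
      proof (cases "x \<in> half_disc c r")
        case True
        then have xB: "x \<in> B" using half_disc_B[OF r] by blast
        show ?thesis
        proof (cases "x \<in> fluid_side")
          case True then show ?thesis using eq(1)[OF xB] elim xB by (simp add: indicator_def)
        next
          case False
          then have "x \<notin> W" using W_fluid by (auto simp: fluid_side_def)
          then show ?thesis using False eq(2) by simp
        qed
      qed simp
    qed
  qed
  also have "\<dots> = dint F r" unfolding set_lebesgue_integral_def by (rule integral_completion[OF m])
  finally show ?thesis .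
qed

text \<open>The counterpart on circles of the preceding lemma, for radii at which \<open>Du\<close>
  agrees with \<open>G\<close> almost everywhere in arc length.\<close>

lemma lebesgue_half_circle_integral:
  assumes ae: "AE x in hausdorff1. x \<in> half_circle c r \<longrightarrow> x \<in> B \<longrightarrow> Du x = G x"
    and F: "F \<in> borel_measurable borel" and r: "r \<in> {0<..<d}"
    and eq: "\<And>x. x \<in> W \<Longrightarrow> x \<in> B \<Longrightarrow> norm (x - c) = r \<Longrightarrow> Du x = G x \<Longrightarrow> f x = F x"
       "\<And>x. x \<notin> W \<Longrightarrow> u x = 0 \<Longrightarrow> Du x = 0 \<Longrightarrow> f x = 0" "\<And>x. x \<notin> W \<Longrightarrow> F x = 0"
    and S: "fluid_side \<subseteq> S"
  shows "(LINT x:(half_circle c r \<inter> S)|hausdorff1. f x) = circ_int c F r"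
proof (rule integral_half_circle_AE[OF _ F])
  show "AE x in hausdorff1. x \<in> half_circle c r \<longrightarrow> indicator S x * f x = F x"
    using ae
  proof eventually_elim
    case (elim x)
    show ?case
    proof
      assume x: "x \<in> half_circle c r"
      then have n: "norm (x - c) = r" by (simp add: half_circle_def)
      with x r have xB: "x \<in> B" by (auto simp: B_iff half_circle_def)
      then have DG: "Du x = G x" using elim x by simp
      show "indicator S x * f x = F x"
      proof (cases "x \<in> W")
        case True
        then have "x \<in> S" using W_fluid S by (auto simp: fluid_side_def)
        then show ?thesis using eq(1)[OF True xB n DG] by simp
      next
        case False
        have "x \<in> \<Omega>" using xB B_Kd Kd_Omega by blast
        then have "u x = 0" using False u_nonneg[of x] by (auto simp: W_def)
        then show ?thesis using eq(2,3)[OF False] DG False by (simp add: G_def)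
      qed
    qed
  qed
qed (use r in simp)

text \<open>Multiplied by \<open>r^4\<close>, the derivative is
  \<open>r I' - 3 I - 2 J' + 8 J / r\<close>. By the Pohozaev identity the first two terms equal
  \<open>2 r N - 4 T + K_1\<close>, and T is the circle integral of \<open>me\<close>. Writing
  \<open>-4 T\<close> as \<open>-8 T + 4 T\<close> and inserting \<open>8 / r\<close> times the
  integral of \<open>mu\<close> completes the square; the rest pairs up with J' and J to form K_2
  and K_3.\<close>

lemma monotonicity:
  "AE r in lborel. r \<in> {0<..<d} \<longrightarrow>
    ((\<lambda>r. (LINT x:(half_disc c r \<inter> fluid_side)|lebesgue.
         fst x * (F_eos g \<rho>0 p (tq Du x) (snd x) + lambda_eos g \<rho>0 p (snd x) * indicator {y. u y > 0} x)) / r ^ 3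
       - 2 * (LINT x:half_circle c r|hausdorff1. (u x)\<^sup>2 / (fst x * \<rho>0)) / r ^ 4) has_real_derivative
     2 / r ^ 3 * (LINT x:(half_circle c r \<inter> fluid_side)|hausdorff1.
          1 / (fst x * H (tq Du x) (snd x)) * (Du x \<bullet> ((x - c) /\<^sub>R r) - 2 * u x / r)\<^sup>2)
     + ((LINT x:(half_disc c r \<inter> fluid_side)|lebesgue. fst x * (snd x - snd c) *
             (d2F_eos g \<rho>0 p (tq Du x) (snd x) + deriv (lambda_eos g \<rho>0 p) (snd x) * indicator {y. u y > 0} x))
        + 4 * (LINT x:(half_circle c r \<inter> fluid_side)|hausdorff1.
           (1 / (fst x * H (tq Du x) (snd x)) - 1 / (fst x * \<rho>0)) * u x * (Du x \<bullet> ((x - c) /\<^sub>R r)))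
        + 8 / r * (LINT x:(half_circle c r \<inter> fluid_side)|hausdorff1.
           (1 / (fst x * \<rho>0) - 1 / (fst x * H (tq Du x) (snd x))) * (u x)\<^sup>2)) / r ^ 4) (at r)"
    (is "AE r in lborel. _ \<longrightarrow> ((\<lambda>r. ?I r / r ^ 3 - 2 * ?J r / r ^ 4) has_real_derivative
       2 / r ^ 3 * ?S r + (?K1 r + 4 * ?K2 r + 8 / r * ?K3 r) / r ^ 4) (at r)")
proof -
  obtain CL where gL: "good CL mL" using ex_good_mL by blast
  have iW: "x \<in> B \<Longrightarrow> indicator {y. u y > 0} x = (indicator W x :: real)" for x
    using B_Kd Kd_Omega by (auto simp: W_def indicator_def)
  have tG: "tq Du x = t x" if "Du x = G x" for x using that by (simp add: t_def tq_def)
  have t0: "t x = 0" if "x \<notin> W" for x using that by (simp add: t_def tq_def G_def)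
  have I: "?I r = dint mL r" if "r \<le> d" for r
  proof (rule lebesgue_half_disc_integral[OF goodD(2)[OF gL] that])
    fix x assume x: "x \<in> B" "Du x = G x"
    show "fst x * (F_eos g \<rho>0 p (tq Du x) (snd x) + lambda_eos g \<rho>0 p (snd x) * indicator {y. u y > 0} x) = mL x"
      unfolding tG[OF x(2)] iW[OF x(1)]
      using x(1) E_eq[of x] t0[of x] by (cases "x \<in> W") (simp_all add: mL_def F_zero)
  qed (simp add: mL_def)
  have K1: "?K1 r = dint mK r" if "r \<le> d" for r
  proof (rule lebesgue_half_disc_integral[OF goodD(2)[OF good_mK] that])
    fix x assume x: "x \<in> B" "Du x = G x"
    show "fst x * (snd x - snd c) * (d2F_eos g \<rho>0 p (tq Du x) (snd x) + deriv (lambda_eos g \<rho>0 p) (snd x) * indicator {y. u y > 0} x) = mK x"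
      unfolding tG[OF x(2)] iW[OF x(1)]
      using x(1) d2_eq[of x] t0[of x] by (cases "x \<in> W") (simp_all add: mK_def F_zero)
  qed (simp add: mK_def)
  have aeC: "AE r in lborel. r > 0 \<longrightarrow> (AE x in hausdorff1. x \<in> half_circle c r \<longrightarrow> x \<in> B \<longrightarrow> Du x = G x)"
    by (rule AE_half_circle[OF AE_Du_B])
  have nu: "Du x \<bullet> ((x - c) /\<^sub>R r) = Gn x" if "x \<in> W" "norm (x - c) = r" "Du x = G x" for x r
    using Gn_inner[OF that(1)] that(2,3) by simp
  have aH: "1 / (fst x * H (tq Du x) (snd x)) = a x" if "Du x = G x" for x
    unfolding tG[OF that] a_eq R_def ..
  have J: "?J r = (1 / \<rho>0) * circ_int c mv r" if r: "r \<in> {0<..<d}" for r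
  proof -
    \<comment> \<open>The summand with factor 0 brings a scalar multiple into the form of
      \<open>circ_int_lin\<close>.\<close>
    have e: "(u x)\<^sup>2 / (fst x * \<rho>0) = (1 / \<rho>0) * mv x + 0 * mv x" if x: "x \<in> half_circle c r" for x
    proof -
      have xB: "x \<in> B" using x r by (auto simp: B_iff half_circle_def)
      then have "x \<notin> W \<Longrightarrow> u x = 0" using B_Kd Kd_Omega u_nonneg[of x] by (force simp: W_def)
      then show ?thesis using xB by (cases "x \<in> W") (simp_all add: mv_def)
    qed
    have "(LINT x:(half_circle c r \<inter> UNIV)|hausdorff1. (u x)\<^sup>2 / (fst x * \<rho>0)) = circ_int c (\<lambda>x. (1 / \<rho>0) * mv x + 0 * mv x) r"
    proof (rule integral_half_circle_AE)
      show "AE x in hausdorff1. x \<in> half_circle c r \<longrightarrow> indicator UNIV x * ((u x)\<^sup>2 / (fst x * \<rho>0)) = (1 / \<rho>0) * mv x + 0 * mv x"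
        using e by (intro always_eventually allI impI) simp
    qed (use r goodD(2)[OF good_mv] in auto)
    then show ?thesis unfolding circ_int_lin[OF good_mv good_mv] Int_UNIV_right by (simp only: mult_zero_left add_0_right)
  qed
  show ?thesis
    using AE_identities aeC
  proof eventually_elim
    case (elim r)
    show ?case
    proof
      assume r: "r \<in> {0<..<d}"
      then have r0: "r > 0" by simp
      have ae: "AE x in hausdorff1. x \<in> half_circle c r \<longrightarrow> x \<in> B \<longrightarrow> Du x = G x" using elim(2) r0 by blast
      note C = lebesgue_half_circle_integral[OF ae _ r _ _ _ order_refl]
      have K2: "?K2 r = circ_int c me r - circ_int c mj r / \<rho>0"
      proof -
        have "?K2 r = circ_int c (\<lambda>x. 1 * me x + (- 1 / \<rho>0) * mj x) r"
        proof (rule C)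
          fix x assume x: "x \<in> W" "x \<in> B" "norm (x - c) = r" "Du x = G x"
          show "(1 / (fst x * H (tq Du x) (snd x)) - 1 / (fst x * \<rho>0)) * u x * (Du x \<bullet> ((x - c) /\<^sub>R r)) = 1 * me x + (- 1 / \<rho>0) * mj x"
            unfolding aH[OF x(4)] nu[OF x(1,3,4)] using x(1,2) by (simp add: me_def mj_def algebra_simps)
        qed (use goodD(2)[OF good_me] goodD(2)[OF good_mj] in \<open>auto simp: me_def mj_def\<close>)
        also have "\<dots> = 1 * circ_int c me r + (- 1 / \<rho>0) * circ_int c mj r" by (rule circ_int_lin[OF good_me good_mj])
        finally show ?thesis by simp
      qed
      have K3: "?K3 r = circ_int c mv r / \<rho>0 - circ_int c mu r"
      proof -
        have "?K3 r = circ_int c (\<lambda>x. (1 / \<rho>0) * mv x + (- 1) * mu x) r"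
        proof (rule C)
          fix x assume x: "x \<in> W" "x \<in> B" "norm (x - c) = r" "Du x = G x"
          show "(1 / (fst x * \<rho>0) - 1 / (fst x * H (tq Du x) (snd x))) * (u x)\<^sup>2 = (1 / \<rho>0) * mv x + (- 1) * mu x"
            unfolding aH[OF x(4)] using x(1,2) by (simp add: mv_def mu_def algebra_simps)
        qed (use goodD(2)[OF good_mv] goodD(2)[OF good_mu] in \<open>auto simp: mv_def mu_def\<close>)
        also have "\<dots> = (1 / \<rho>0) * circ_int c mv r + (- 1) * circ_int c mu r" by (rule circ_int_lin[OF good_mv good_mu])
        finally show ?thesis by simp
      qed
      have S: "?S r = circ_int c mN r - 4 / r * circ_int c me r + 4 / r\<^sup>2 * circ_int c mu r"
      proof -
        define C1 where "C1 = 1 * (L0 / c0 * (L0 * d)) + \<bar>- 4 / r\<bar> * (L0 * d / c0 * (L0 * d))"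
        have g1: "good C1 (\<lambda>x. 1 * mN x + (- 4 / r) * me x)"
        proof (rule goodI)
          show "0 \<le> C1" unfolding C1_def using goodD(1)[OF good_mN] goodD(1)[OF good_me]
            by (intro add_nonneg_nonneg mult_nonneg_nonneg[OF abs_ge_zero]) simp_all
          fix x :: "real \<times> real"
          have "\<bar>1 * mN x + (- 4 / r) * me x\<bar> \<le> \<bar>1 * mN x\<bar> + \<bar>(- 4 / r) * me x\<bar>" by (rule abs_triangle_ineq)
          also have "\<dots> \<le> C1" unfolding C1_def abs_mult
            using goodD(4)[OF good_mN, of x] goodD(4)[OF good_me, of x] by (intro add_mono mult_mono) auto
          finally show "\<bar>1 * mN x + (- 4 / r) * me x\<bar> \<le> C1" .
        qed (use goodD(2,5)[OF good_mN] goodD(2,5)[OF good_me] in auto)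
        have "?S r = circ_int c (\<lambda>x. 1 * (1 * mN x + (- 4 / r) * me x) + (4 / r\<^sup>2) * mu x) r"
        proof (rule C)
          fix x assume x: "x \<in> W" "x \<in> B" "norm (x - c) = r" "Du x = G x"
          show "1 / (fst x * H (tq Du x) (snd x)) * (Du x \<bullet> ((x - c) /\<^sub>R r) - 2 * u x / r)\<^sup>2
             = 1 * (1 * mN x + (- 4 / r) * me x) + (4 / r\<^sup>2) * mu x"
            unfolding aH[OF x(4)] nu[OF x(1,3,4)] using x(1,2) r0 by (simp add: mN_def me_def mu_def field_simps power2_eq_square)
        qed (use goodD(2)[OF g1] goodD(2)[OF good_mu] in \<open>auto simp: mN_def me_def mu_def\<close>)
        also have "\<dots> = 1 * circ_int c (\<lambda>x. 1 * mN x + (- 4 / r) * me x) r + (4 / r\<^sup>2) * circ_int c mu r"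
          by (rule circ_int_lin[OF g1 good_mu])
        also have "circ_int c (\<lambda>x. 1 * mN x + (- 4 / r) * me x) r = 1 * circ_int c mN r + (- 4 / r) * circ_int c me r"
          by (rule circ_int_lin[OF good_mN good_me])
        finally show ?thesis by simp
      qed
      from elim(1) r have id: "3 * dint mL r - 4 * circ_int c me r + dint mK r = r * (circ_int c mL r - 2 * circ_int c mN r)"
        and dL: "(dint mL has_real_derivative circ_int c mL r) (at r)" by auto
      have "((\<lambda>r. dint mL r / r ^ 3 - 2 * ((1 / \<rho>0) * circ_int c mv r) / r ^ 4) has_real_derivative
         (circ_int c mL r * r ^ 3 - dint mL r * (3 * r ^ 2)) / (r ^ 3 * r ^ 3)
          - (2 * ((1 / \<rho>0) * (2 * circ_int c mj r)) * r ^ 4 - 2 * ((1 / \<rho>0) * circ_int c mv r) * (4 * r ^ 3)) / (r ^ 4 * r ^ 4)) (at r)"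
        using r0
        by (intro DERIV_diff DERIV_divide DERIV_cmult dL circ_mv_derivative[OF r]) (auto intro!: derivative_eq_intros)
      moreover have "(circ_int c mL r * r ^ 3 - dint mL r * (3 * r ^ 2)) / (r ^ 3 * r ^ 3)
          - (2 * ((1 / \<rho>0) * (2 * circ_int c mj r)) * r ^ 4 - 2 * ((1 / \<rho>0) * circ_int c mv r) * (4 * r ^ 3)) / (r ^ 4 * r ^ 4)
          = 2 / r ^ 3 * ?S r + (?K1 r + 4 * ?K2 r + 8 / r * ?K3 r) / r ^ 4"
      proof -
        have K: "dint mK r = r * (circ_int c mL r - 2 * circ_int c mN r) - 3 * dint mL r + 4 * circ_int c me r" using id by simp
        have "r \<le> d" using r by simp
        show ?thesis unfolding S K1[OF \<open>r \<le> d\<close>] K2 K3 K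
          using r0 r0_pos by (simp add: field_simps eval_nat_numeral)
      qed
      ultimately have der: "((\<lambda>r. dint mL r / r ^ 3 - 2 * ((1 / \<rho>0) * circ_int c mv r) / r ^ 4) has_real_derivative
         2 / r ^ 3 * ?S r + (?K1 r + 4 * ?K2 r + 8 / r * ?K3 r) / r ^ 4) (at r)" by (simp only:)
      show "((\<lambda>r. ?I r / r ^ 3 - 2 * ?J r / r ^ 4) has_real_derivative
         2 / r ^ 3 * ?S r + (?K1 r + 4 * ?K2 r + 8 / r * ?K3 r) / r ^ 4) (at r)"
      \<comment> \<open>The representations of I and J hold at every radius of the interval, not
        just almost everywhere, so they may be substituted under the derivative.\<close>
      proof (rule has_field_derivative_transform_within_open[OF der open_greaterThanLessThan r])
        fix s assume s: "s \<in> {0<..<d}"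
        then have "s \<le> d" by simp
        show "dint mL s / s ^ 3 - 2 * ((1 / \<rho>0) * circ_int c mv s) / s ^ 4 = ?I s / s ^ 3 - 2 * ?J s / s ^ 4"
          unfolding I[OF \<open>s \<le> d\<close>] J[OF s] ..
      qed
    qed
  qed
qed

end

theorem proposition4p5:
  fixes g \<rho>0 \<alpha> b \<delta> :: real and p :: "real \<Rightarrow> real" and x0 :: "real \<times> real"
    and \<Omega> :: "(real \<times> real) set"
    and u :: "real \<times> real \<Rightarrow> real" and Du :: "real \<times> real \<Rightarrow> real \<times> real"
    and t H :: "real \<times> real \<Rightarrow> real" and I J M K1 K2 K3 :: "real \<Rightarrow> real"
  assumes eos: "equation_of_state g \<rho>0 p \<alpha>"
    and dom: "flow_domain g \<rho>0 p \<Omega>"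
    and sol: "subsonic_variational_solution g \<rho>0 p \<Omega> u Du"
    and x0: "x0 = (0, b)" "x0 \<in> \<Omega>" "b \<noteq> 0"
  defines "\<delta> \<equiv> infdist x0 (top_of_set half_plane frontier_of \<Omega>) / 2"
    and "t \<equiv> (\<lambda>x. (norm (Du x))\<^sup>2 / (fst x)\<^sup>2)"
    and "H \<equiv> (\<lambda>x. H_eos g \<rho>0 p (t x) (snd x))"
    and "I \<equiv> (\<lambda>r. LINT x:(half_disc x0 r \<inter> fluid_side)|lebesgue.
           fst x * (F_eos g \<rho>0 p (t x) (snd x) + lambda_eos g \<rho>0 p (snd x) * indicator {y. u y > 0} x))"
    and "J \<equiv> (\<lambda>r. LINT x:half_circle x0 r|hausdorff1. (u x)\<^sup>2 / (fst x * \<rho>0))"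
    and "M \<equiv> (\<lambda>r. I r / r ^ 3 - 2 * J r / r ^ 4)"
    and "K1 \<equiv> (\<lambda>r. LINT x:(half_disc x0 r \<inter> fluid_side)|lebesgue.
           fst x * (snd x - snd x0) *
             (d2F_eos g \<rho>0 p (t x) (snd x) + deriv (lambda_eos g \<rho>0 p) (snd x) * indicator {y. u y > 0} x))"
    and "K2 \<equiv> (\<lambda>r. 4 * (LINT x:(half_circle x0 r \<inter> fluid_side)|hausdorff1.
           (1 / (fst x * H x) - 1 / (fst x * \<rho>0)) * u x * (Du x \<bullet> ((x - x0) /\<^sub>R r))))"
    and "K3 \<equiv> (\<lambda>r. 8 / r * (LINT x:(half_circle x0 r \<inter> fluid_side)|hausdorff1.
           (1 / (fst x * \<rho>0) - 1 / (fst x * H x)) * (u x)\<^sup>2))"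
  shows "AE r in lborel. r \<in> {0<..<\<delta>} \<longrightarrow>
    (M has_real_derivative
       2 / r ^ 3 * (LINT x:(half_circle x0 r \<inter> fluid_side)|hausdorff1.
          1 / (fst x * H x) * (Du x \<bullet> ((x - x0) /\<^sub>R r) - 2 * u x / r)\<^sup>2)
       + (K1 r + K2 r + K3 r) / r ^ 4) (at r)"
proof (cases "\<delta> > 0")
  \<comment> \<open>If \<delta> is not positive, for instance by the value 0 of
    \<open>infdist\<close> to an empty set, there is no radius to consider.\<close>
  case False then show ?thesis by simp
next
  case True
  note defs = M_def I_def J_def K1_def K2_def K3_def H_def t_def tq_def x0(1)
  have "cball x0 \<delta> \<inter> half_plane \<subseteq> \<Omega>"
  proof
    fix y assume y: "y \<in> cball x0 \<delta> \<inter> half_plane"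
    show "y \<in> \<Omega>"
    proof (rule ccontr)
      assume "y \<notin> \<Omega>"
      \<comment> \<open>A connected subset of the half plane that meets both \<Omega> and its
        complement meets the relative frontier. The open half disc of radius
        \<open>2 * \<delta>\<close> does not, by the choice of \<delta>, and it contains the closed
        one of radius \<delta>.\<close>
      let ?C = "ball x0 (2 * \<delta>) \<inter> half_plane"
      have "half_plane = {x. (1, 0) \<bullet> x \<ge> 0}" by (auto simp: half_plane_def inner_prod_def)
      then have "convex half_plane" using convex_halfspace_ge[of 0 "(1, 0) :: real \<times> real"] by simp
      then have "connected ?C" by (intro convex_connected convex_Int convex_ball)
      then have "connectedin (top_of_set half_plane) ?C" by (simp add: connectedin_subtopology)
      moreover have "x0 \<in> ?C \<inter> \<Omega>" using x0 True by (simp add: half_plane_def)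
      moreover have "y \<in> ?C - \<Omega>" using y \<open>y \<notin> \<Omega>\<close> True by auto
      ultimately have "?C \<inter> top_of_set half_plane frontier_of \<Omega> \<noteq> {}"
        by (intro connectedin_Int_frontier_of) blast+
      then obtain z where z: "z \<in> ?C" "z \<in> top_of_set half_plane frontier_of \<Omega>" by blast
      then have "2 * \<delta> \<le> dist x0 z" using infdist_le[OF z(2), of x0] by (simp add: \<delta>_def)
      with z(1) show False by simp
    qed
  qed
  then interpret flow_at g \<rho>0 p \<alpha> \<Omega> u Du b \<delta>
    using eos dom sol True x0(1) by unfold_locales auto
  show ?thesis
    using monotonicity unfolding defs .
qed

end
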